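(* Let $\mathbf{V}$ be a positive-dimensional dagger compact category that has algebraic square roots. Then there is a functor $F\colon\mathrm{CP}^*[\mathbf{V}]\to\mathrm{Split}^\dagger[\mathrm{CPM}[\mathbf{V}]]$ that sends an object $(A,m)$ with normaliser $z_A$ to the object $A$ of $\mathrm{CPM}[\mathbf{V}]$ equipped with the dagger idempotent $$\mathrm{act}_A\circ\mathrm{coact}_A\circ(z_A^*\otimes z_A)\colon A^*\otimes A\to A^*\otimes A,$$ and sends a morphism $f\colon(A,m)\to(B,n)$ to $$F(f)=\mathrm{act}_B\circ z_B\circ f\circ z_A\circ\mathrm{coact}_A,$$ where $z_B$ is the normaliser of $(B,n)$. This functor $F$ is full, faithful, and strongly dagger symmetric monoidal.
   Context: Conventions. In a dagger compact category $\mathbf{V}$, every object $A$ has a dual $A^*$ with maps $\eta_A\colon I\to A^*\otimes A$ and $\varepsilon_A\colon A\otimes A^*\to I$ satisfying the snake equations and $\varepsilon_A=\eta_A^\dagger\circ\sigma_{A,A^*}$, where $\sigma$ is the symmetry. For $f\colon A\to B$, $f^*\colon B^*\to A^*$ is its dual and $f_*:=(f^\dagger)^*\colon A^*\to B^*$. Coherence isomorphisms are suppressed, and $(A\otimes B)^*$ is identified with $B^*\otimes A^*$. A morphism $g\colon A\to A$ is positive if $g=h^\dagger\circ h$ for some $h$, and positive definite if it is positive and an isomorphism. $\mathbf{V}$ is positive-dimensional if for each object $X$ there is a positive definite scalar $z\colon I\to I$ with $(z\circ z\circ \mathrm{Tr}_X(1_X))\otimes 1_X=1_X$, where $\mathrm{Tr}_X(1_X)=\eta_X^\dagger\circ\eta_X$.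 A Frobenius algebra is an object $A$ with a monoid structure $(m\colon A\otimes A\to A,\ u\colon I\to A)$ and a comonoid structure $(\delta\colon A\to A\otimes A,\ e\colon A\to I)$ with $(1_A\otimes m)\circ(\delta\otimes 1_A)=\delta\circ m=(m\otimes 1_A)\circ(1_A\otimes\delta)$. It is a dagger Frobenius algebra if $\delta=m^\dagger$ and $e=u^\dagger$; it is then denoted $(A,m)$. A map $z\colon A\to A$ is central if $m\circ(z\otimes 1_A)=z\circ m=m\circ(1_A\otimes z)$. A dagger Frobenius algebra is normalisable if there is a central positive definite $z\colon A\to A$ (a normaliser) with $\mathrm{Tr}_A(m)\circ z\circ z=e$, where $\mathrm{Tr}_A(m)=\varepsilon_A\circ(m\otimes 1_{A^*})\circ(1_A\otimes(\sigma_{A^*,A}\circ\eta_A))\colon A\to I$. Each object of $\mathrm{CP}^*[\mathbf{V}]$ is taken with a chosen normaliser. $\mathbf{V}$ has algebraic square roots when, for any normalisable dagger Frobenius algebra on an object $A$ and any central positive definite $f\colon A\to A$, there exists a central morphism $g\colon A\to A$ with $f=g\circ g$. The action map of $(A,m)$ is $\mathrm{act}_A=(1_{A^*}\otimes m)\circ(\eta_A\otimes 1_A)\colon A\to A^*\otimes A$, and the coaction map is $\mathrm{coact}_A=(\eta_A^\dagger\otimes 1_A)\circ(1_{A^*}\otimes\delta)\colon A^*\otimes A\to A$. The category $\mathrm{CP}^*[\mathbf{V}]$: objects are normalisable dagger Frobenius algebras in $\mathbf{V}$; morphisms $(A,m)\to(B,n)$ are morphisms $f\colon A\to B$ of $\mathbf{V}$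 for which there exist an object $X$ and $g\colon A\to X\otimes B$ in $\mathbf{V}$ with $$\mathrm{act}_B\circ f\circ\mathrm{coact}_A=(1_{B^*}\otimes\eta_X^\dagger\otimes 1_B)\circ(g_*\otimes g).$$ Composition, identities and dagger are those of $\mathbf{V}$. The tensor is $(A,m)\otimes(B,n):=(A\otimes B,\ (m\otimes n)\circ(1_A\otimes\sigma_{B,A}\otimes 1_B))$, with unit $I$ and with tensor of morphisms, coherence maps and symmetry as in $\mathbf{V}$. The category $\mathrm{CPM}[\mathbf{V}]$ (Selinger): objects are those of $\mathbf{V}$; morphisms $A\to B$ are $\mathbf{V}$-morphisms $f\colon A^*\otimes A\to B^*\otimes B$ for which there exist an object $X$ and $g\colon A\to X\otimes B$ with $f=(1_{B^*}\otimes\eta_X^\dagger\otimes 1_B)\circ(g_*\otimes g)$. Composition, identities, dagger and the tensor on objects are as in $\mathbf{V}$. The tensor of morphisms $f\colon A\to B$ and $g\colon C\to D$ is $f\otimes g$ conjugated by the evident symmetry isomorphisms $C^*\otimes A^*\otimes A\otimes C\cong A^*\otimes A\otimes C^*\otimes C$ and $D^*\otimes B^*\otimes B\otimes D\cong B^*\otimes B\otimes D^*\otimes D$. For a dagger category $\mathbf{W}$, $\mathrm{Split}^\dagger[\mathbf{W}]$ has as objects pairs $(A,p)$ with $p\colon A\to A$ in $\mathbf{W}$ satisfying $p\circ p=p=p^\dagger$; morphisms $(A,p)\to(B,q)$ are morphisms $f\colon A\to B$ of $\mathbf{W}$ with $f=q\circ f\circ p$; the identity on $(A,p)$ is $p$.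 If $\mathbf{W}$ is dagger compact, so is $\mathrm{Split}^\dagger[\mathbf{W}]$, with $(A,p)\otimes(B,q)=(A\otimes B,p\otimes q)$. A strongly dagger symmetric monoidal functor is a dagger-preserving functor $F$ that is strong symmetric monoidal with unitary structure isomorphisms, in particular with a unitary natural isomorphism $\varphi_{A,B}\colon F(A\otimes B)\to F(A)\otimes F(B)$. *)

theory Defs
  imports Main
begin

section \<open>Dagger symmetric monoidal categories\<close>

text \<open>Monoidal categories are not assumed to be strict: wherever the usual notation suppresses
  coherence isomorphisms, they are written out. The tensor product is written \<open>\<odot>\<close> on objects and
  \<open>\<otimes>\<close> on arrows. The left unitor is \<open>\<Lambda>\<close>, the right unitor is \<open>\<rho>\<close>, and the symmetry is \<open>\<sigma>\<close>.\<close>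

record ('o, 'a) cat =
  Obj :: "'o set"
  Arr :: "'a set"
  Dom :: "'a \<Rightarrow> 'o"
  Cod :: "'a \<Rightarrow> 'o"
  Ident :: "'o \<Rightarrow> 'a"  (\<open>\<one>\<index>\<close>)
  Comp :: "'a \<Rightarrow> 'a \<Rightarrow> 'a"  (infixr \<open>\<cdot>\<index>\<close> 55)

record ('o, 'a) dagger_cat = "('o, 'a) cat" +
  Dagger :: "'a \<Rightarrow> 'a"  (\<open>_\<dagger>\<index>\<close> [1000] 999)

record ('o, 'a) dsm_cat = "('o, 'a) dagger_cat" +
  Unit :: "'o"  (\<open>\<I>\<index>\<close>)
  TensorO :: "'o \<Rightarrow> 'o \<Rightarrow> 'o"  (infixr \<open>\<odot>\<index>\<close> 70)
  TensorA :: "'a \<Rightarrow> 'a \<Rightarrow> 'a"  (infixr \<open>\<otimes>\<index>\<close> 70)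
  Assoc :: "'o \<Rightarrow> 'o \<Rightarrow> 'o \<Rightarrow> 'a"  (\<open>\<alpha>\<index>\<close>)
  LUnit :: "'o \<Rightarrow> 'a"  (\<open>\<Lambda>\<index>\<close>)
  RUnit :: "'o \<Rightarrow> 'a"  (\<open>\<rho>\<index>\<close>)
  Sym :: "'o \<Rightarrow> 'o \<Rightarrow> 'a"  (\<open>\<sigma>\<index>\<close>)

record ('o, 'a) dc_cat = "('o, 'a) dsm_cat" +
  Dual :: "'o \<Rightarrow> 'o"  (\<open>_\<star>\<index>\<close> [1000] 999)
  Eta :: "'o \<Rightarrow> 'a"  (\<open>\<eta>\<index>\<close>)

definition hom :: "('o, 'a, 'z) cat_scheme \<Rightarrow> 'o \<Rightarrow> 'o \<Rightarrow> 'a set" where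
  "hom C A B = {f \<in> Arr C. Dom C f = A \<and> Cod C f = B}"

locale category =
  fixes C :: "('o, 'a, 'z) cat_scheme" (structure)
  assumes dom_obj: "f \<in> Arr C \<Longrightarrow> Dom C f \<in> Obj C"
    and cod_obj: "f \<in> Arr C \<Longrightarrow> Cod C f \<in> Obj C"
    and ident_hom: "A \<in> Obj C \<Longrightarrow> \<one> A \<in> hom C A A"
    and comp_hom: "\<lbrakk>f \<in> hom C A B; g \<in> hom C B D\<rbrakk> \<Longrightarrow> g \<cdot> f \<in> hom C A D"
    and comp_ident_right: "f \<in> hom C A B \<Longrightarrow> f \<cdot> \<one> A = f"
    and comp_ident_left: "f \<in> hom C A B \<Longrightarrow> \<one> B \<cdot> f = f"
    and comp_assoc: "\<lbrakk>f \<in> hom C A B; g \<in> hom C B D; h \<in> hom C D E\<rbrakk>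
      \<Longrightarrow> (h \<cdot> g) \<cdot> f = h \<cdot> (g \<cdot> f)"

definition is_iso :: "('o, 'a, 'z) cat_scheme \<Rightarrow> 'a \<Rightarrow> bool" where
  "is_iso C f \<longleftrightarrow> f \<in> Arr C \<and>
    (\<exists>g \<in> hom C (Cod C f) (Dom C f).
      g \<cdot>\<^bsub>C\<^esub> f = \<one>\<^bsub>C\<^esub> (Dom C f) \<and> f \<cdot>\<^bsub>C\<^esub> g = \<one>\<^bsub>C\<^esub> (Cod C f))"

locale dagger_category = category C
  for C :: "('o, 'a, 'z) dagger_cat_scheme" (structure) +
  assumes dagger_hom: "f \<in> hom C A B \<Longrightarrow> f\<dagger> \<in> hom C B A"
    and dagger_dagger: "f \<in> Arr C \<Longrightarrow> (f\<dagger>)\<dagger> = f"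
    and dagger_ident: "A \<in> Obj C \<Longrightarrow> (\<one> A)\<dagger> = \<one> A"
    and dagger_comp: "\<lbrakk>f \<in> hom C A B; g \<in> hom C B D\<rbrakk> \<Longrightarrow> (g \<cdot> f)\<dagger> = f\<dagger> \<cdot> g\<dagger>"

definition unitary :: "('o, 'a, 'z) dagger_cat_scheme \<Rightarrow> 'o \<Rightarrow> 'o \<Rightarrow> 'a \<Rightarrow> bool" where
  "unitary C A B f \<longleftrightarrow> f \<in> hom C A B \<and>
    f\<dagger>\<^bsub>C\<^esub> \<cdot>\<^bsub>C\<^esub> f = \<one>\<^bsub>C\<^esub> A \<and> f \<cdot>\<^bsub>C\<^esub> f\<dagger>\<^bsub>C\<^esub> = \<one>\<^bsub>C\<^esub> B"

definition positive :: "('o, 'a, 'z) dagger_cat_scheme \<Rightarrow> 'a \<Rightarrow> bool" where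
  "positive C g \<longleftrightarrow> (\<exists>h \<in> Arr C. g = h\<dagger>\<^bsub>C\<^esub> \<cdot>\<^bsub>C\<^esub> h)"

definition positive_definite :: "('o, 'a, 'z) dagger_cat_scheme \<Rightarrow> 'a \<Rightarrow> bool" where
  "positive_definite C g \<longleftrightarrow> positive C g \<and> is_iso C g"

locale dagger_symmetric_monoidal_category = dagger_category C
  for C :: "('o, 'a, 'z) dsm_cat_scheme" (structure) +
  assumes unit_obj: "\<I> \<in> Obj C"
    and tensor_obj: "\<lbrakk>A \<in> Obj C; B \<in> Obj C\<rbrakk> \<Longrightarrow> A \<odot> B \<in> Obj C"
    and tensor_hom: "\<lbrakk>f \<in> hom C A B; g \<in> hom C A' B'\<rbrakk> \<Longrightarrow> f \<otimes> g \<in> hom C (A \<odot> A') (B \<odot> B')"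
    and tensor_ident: "\<lbrakk>A \<in> Obj C; B \<in> Obj C\<rbrakk> \<Longrightarrow> \<one> A \<otimes> \<one> B = \<one> (A \<odot> B)"
    and tensor_comp: "\<lbrakk>f \<in> hom C A B; g \<in> hom C B D; f' \<in> hom C A' B'; g' \<in> hom C B' D'\<rbrakk>
      \<Longrightarrow> (g \<cdot> f) \<otimes> (g' \<cdot> f') = (g \<otimes> g') \<cdot> (f \<otimes> f')"
    and tensor_dagger: "\<lbrakk>f \<in> Arr C; g \<in> Arr C\<rbrakk> \<Longrightarrow> (f \<otimes> g)\<dagger> = f\<dagger> \<otimes> g\<dagger>"
    and assoc_unitary: "\<lbrakk>A \<in> Obj C; B \<in> Obj C; D \<in> Obj C\<rbrakk>
      \<Longrightarrow> unitary C ((A \<odot> B) \<odot> D) (A \<odot> (B \<odot> D)) (\<alpha> A B D)"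
    and lunit_unitary: "A \<in> Obj C \<Longrightarrow> unitary C (\<I> \<odot> A) A (\<Lambda> A)"
    and runit_unitary: "A \<in> Obj C \<Longrightarrow> unitary C (A \<odot> \<I>) A (\<rho> A)"
    and sym_unitary: "\<lbrakk>A \<in> Obj C; B \<in> Obj C\<rbrakk> \<Longrightarrow> unitary C (A \<odot> B) (B \<odot> A) (\<sigma> A B)"
    and assoc_natural: "\<lbrakk>f \<in> hom C A A'; g \<in> hom C B B'; h \<in> hom C D D'\<rbrakk>
      \<Longrightarrow> \<alpha> A' B' D' \<cdot> ((f \<otimes> g) \<otimes> h) = (f \<otimes> (g \<otimes> h)) \<cdot> \<alpha> A B D"
    and lunit_natural: "f \<in> hom C A B \<Longrightarrow> \<Lambda> B \<cdot> (\<one> \<I> \<otimes> f) = f \<cdot> \<Lambda> A"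
    and runit_natural: "f \<in> hom C A B \<Longrightarrow> \<rho> B \<cdot> (f \<otimes> \<one> \<I>) = f \<cdot> \<rho> A"
    and sym_natural: "\<lbrakk>f \<in> hom C A A'; g \<in> hom C B B'\<rbrakk>
      \<Longrightarrow> \<sigma> A' B' \<cdot> (f \<otimes> g) = (g \<otimes> f) \<cdot> \<sigma> A B"
    and pentagon: "\<lbrakk>A \<in> Obj C; B \<in> Obj C; D \<in> Obj C; E \<in> Obj C\<rbrakk>
      \<Longrightarrow> (\<one> A \<otimes> \<alpha> B D E) \<cdot> \<alpha> A (B \<odot> D) E \<cdot> (\<alpha> A B D \<otimes> \<one> E)
          = \<alpha> A B (D \<odot> E) \<cdot> \<alpha> (A \<odot> B) D E"
    and triangle: "\<lbrakk>A \<in> Obj C; B \<in> Obj C\<rbrakk>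
      \<Longrightarrow> (\<one> A \<otimes> \<Lambda> B) \<cdot> \<alpha> A \<I> B = \<rho> A \<otimes> \<one> B"
    and hexagon: "\<lbrakk>A \<in> Obj C; B \<in> Obj C; D \<in> Obj C\<rbrakk>
      \<Longrightarrow> \<alpha> B D A \<cdot> \<sigma> A (B \<odot> D) \<cdot> \<alpha> A B D
          = (\<one> B \<otimes> \<sigma> A D) \<cdot> \<alpha> B A D \<cdot> (\<sigma> A B \<otimes> \<one> D)"
    and sym_sym: "\<lbrakk>A \<in> Obj C; B \<in> Obj C\<rbrakk> \<Longrightarrow> \<sigma> B A \<cdot> \<sigma> A B = \<one> (A \<odot> B)"


section \<open>Functors\<close>

record ('o, 'a, 'p, 'b) cat_map =
  on_obj :: "'o \<Rightarrow> 'p"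
  on_arr :: "'a \<Rightarrow> 'b"

definition is_functor ::
  "('o, 'a, 'y) cat_scheme \<Rightarrow> ('p, 'b, 'z) cat_scheme \<Rightarrow> ('o, 'a, 'p, 'b) cat_map \<Rightarrow> bool" where
  "is_functor C D F \<longleftrightarrow> category C \<and> category D \<and>
    (\<forall>A \<in> Obj C. on_obj F A \<in> Obj D) \<and>
    (\<forall>f \<in> Arr C. on_arr F f \<in> hom D (on_obj F (Dom C f)) (on_obj F (Cod C f))) \<and>
    (\<forall>A \<in> Obj C. on_arr F (\<one>\<^bsub>C\<^esub> A) = \<one>\<^bsub>D\<^esub> (on_obj F A)) \<and>
    (\<forall>f \<in> Arr C. \<forall>g \<in> Arr C. Cod C f = Dom C g \<longrightarrow>
      on_arr F (g \<cdot>\<^bsub>C\<^esub> f) = on_arr F g \<cdot>\<^bsub>D\<^esub> on_arr F f)"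

definition full ::
  "('o, 'a, 'y) cat_scheme \<Rightarrow> ('p, 'b, 'z) cat_scheme \<Rightarrow> ('o, 'a, 'p, 'b) cat_map \<Rightarrow> bool" where
  "full C D F \<longleftrightarrow> (\<forall>A \<in> Obj C. \<forall>B \<in> Obj C. \<forall>g \<in> hom D (on_obj F A) (on_obj F B).
    \<exists>f \<in> hom C A B. on_arr F f = g)"

definition faithful ::
  "('o, 'a, 'y) cat_scheme \<Rightarrow> ('p, 'b, 'z) cat_scheme \<Rightarrow> ('o, 'a, 'p, 'b) cat_map \<Rightarrow> bool" where
  "faithful C D F \<longleftrightarrow> (\<forall>A \<in> Obj C. \<forall>B \<in> Obj C. inj_on (on_arr F) (hom C A B))"

definition dagger_functor ::
  "('o, 'a, 'y) dagger_cat_scheme \<Rightarrow> ('p, 'b, 'z) dagger_cat_scheme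
    \<Rightarrow> ('o, 'a, 'p, 'b) cat_map \<Rightarrow> bool" where
  "dagger_functor C D F \<longleftrightarrow> dagger_category C \<and> dagger_category D \<and> is_functor C D F \<and>
    (\<forall>f \<in> Arr C. on_arr F (f\<dagger>\<^bsub>C\<^esub>) = (on_arr F f)\<dagger>\<^bsub>D\<^esub>)"

text \<open>The structure maps point in the direction
  \<open>\<phi> A B : F (A \<odot> B) \<rightarrow> F A \<odot> F B\<close> and \<open>\<phi>0 : F \<I> \<rightarrow> \<I>\<close>.\<close>

definition strongly_dagger_symmetric_monoidal ::
  "('o, 'a, 'y) dsm_cat_scheme \<Rightarrow> ('p, 'b, 'z) dsm_cat_scheme
    \<Rightarrow> ('o, 'a, 'p, 'b) cat_map \<Rightarrow> bool" where
  "strongly_dagger_symmetric_monoidal C D F \<longleftrightarrow>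
    dagger_symmetric_monoidal_category C \<and> dagger_symmetric_monoidal_category D \<and>
    dagger_functor C D F \<and>
    (\<exists>\<phi> \<phi>0.
      unitary D (on_obj F \<I>\<^bsub>C\<^esub>) \<I>\<^bsub>D\<^esub> \<phi>0 \<and>
      (\<forall>A \<in> Obj C. \<forall>B \<in> Obj C.
        unitary D (on_obj F (A \<odot>\<^bsub>C\<^esub> B)) (on_obj F A \<odot>\<^bsub>D\<^esub> on_obj F B) (\<phi> A B)) \<and>
      (\<forall>f \<in> Arr C. \<forall>g \<in> Arr C.
        \<phi> (Cod C f) (Cod C g) \<cdot>\<^bsub>D\<^esub> on_arr F (f \<otimes>\<^bsub>C\<^esub> g)
          = (on_arr F f \<otimes>\<^bsub>D\<^esub> on_arr F g) \<cdot>\<^bsub>D\<^esub> \<phi> (Dom C f) (Dom C g)) \<and>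
      (\<forall>A \<in> Obj C. \<forall>B \<in> Obj C. \<forall>E \<in> Obj C.
        (\<one>\<^bsub>D\<^esub> (on_obj F A) \<otimes>\<^bsub>D\<^esub> \<phi> B E) \<cdot>\<^bsub>D\<^esub> \<phi> A (B \<odot>\<^bsub>C\<^esub> E) \<cdot>\<^bsub>D\<^esub> on_arr F (\<alpha>\<^bsub>C\<^esub> A B E)
          = \<alpha>\<^bsub>D\<^esub> (on_obj F A) (on_obj F B) (on_obj F E) \<cdot>\<^bsub>D\<^esub>
            (\<phi> A B \<otimes>\<^bsub>D\<^esub> \<one>\<^bsub>D\<^esub> (on_obj F E)) \<cdot>\<^bsub>D\<^esub> \<phi> (A \<odot>\<^bsub>C\<^esub> B) E) \<and>
      (\<forall>A \<in> Obj C.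
        on_arr F (\<Lambda>\<^bsub>C\<^esub> A)
          = \<Lambda>\<^bsub>D\<^esub> (on_obj F A) \<cdot>\<^bsub>D\<^esub> (\<phi>0 \<otimes>\<^bsub>D\<^esub> \<one>\<^bsub>D\<^esub> (on_obj F A)) \<cdot>\<^bsub>D\<^esub> \<phi> \<I>\<^bsub>C\<^esub> A) \<and>
      (\<forall>A \<in> Obj C.
        on_arr F (\<rho>\<^bsub>C\<^esub> A)
          = \<rho>\<^bsub>D\<^esub> (on_obj F A) \<cdot>\<^bsub>D\<^esub> (\<one>\<^bsub>D\<^esub> (on_obj F A) \<otimes>\<^bsub>D\<^esub> \<phi>0) \<cdot>\<^bsub>D\<^esub> \<phi> A \<I>\<^bsub>C\<^esub>) \<and>
      (\<forall>A \<in> Obj C. \<forall>B \<in> Obj C.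
        \<phi> B A \<cdot>\<^bsub>D\<^esub> on_arr F (\<sigma>\<^bsub>C\<^esub> A B)
          = \<sigma>\<^bsub>D\<^esub> (on_obj F A) (on_obj F B) \<cdot>\<^bsub>D\<^esub> \<phi> A B))"


section \<open>Dagger compact categories\<close>

text \<open>The counit is determined by the unit, since \<open>\<epsilon> = \<eta>\<dagger> \<cdot> \<sigma>\<close> is part of the definition of a
  dagger compact category; so it is defined rather than carried in the record.\<close>

definition eps :: "('o, 'a, 'z) dc_cat_scheme \<Rightarrow> 'o \<Rightarrow> 'a"  (\<open>\<epsilon>\<index>\<close>) where
  "\<epsilon>\<^bsub>V\<^esub> A = (\<eta>\<^bsub>V\<^esub> A)\<dagger>\<^bsub>V\<^esub> \<cdot>\<^bsub>V\<^esub> \<sigma>\<^bsub>V\<^esub> A (A\<star>\<^bsub>V\<^esub>)"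

locale dagger_compact_category = dagger_symmetric_monoidal_category V
  for V :: "('o, 'a, 'z) dc_cat_scheme" (structure) +
  assumes dual_obj: "A \<in> Obj V \<Longrightarrow> A\<star> \<in> Obj V"
    and eta_hom: "A \<in> Obj V \<Longrightarrow> \<eta> A \<in> hom V \<I> (A\<star> \<odot> A)"
    and snake: "A \<in> Obj V \<Longrightarrow>
      \<Lambda> A \<cdot> (\<epsilon> A \<otimes> \<one> A) \<cdot> (\<alpha> A (A\<star>) A)\<dagger> \<cdot> (\<one> A \<otimes> \<eta> A) \<cdot> (\<rho> A)\<dagger> = \<one> A"
    and snake_dual: "A \<in> Obj V \<Longrightarrow>
      \<rho> (A\<star>) \<cdot> (\<one> (A\<star>) \<otimes> \<epsilon> A) \<cdot> \<alpha> (A\<star>) A (A\<star>) \<cdot> (\<eta> A \<otimes> \<one> (A\<star>)) \<cdot> (\<Lambda> (A\<star>))\<dagger> = \<one> (A\<star>)"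

text \<open>Arrows of the categories constructed below carry their source and target, because the
  underlying arrow of \<open>V\<close> does not determine them.\<close>

datatype ('o, 'a) arrow = Arrow (source: 'o) (und: 'a) (target: 'o)

text \<open>An algebra is a carrier with multiplication and unit; \<open>(A, m)\<close> in the usual notation, where the
  unit is left implicit because \<open>m\<close> determines it.\<close>

record ('o, 'a) algebra =
  carrier :: "'o"
  mult :: "'a"
  unt :: "'a"

context
  fixes V :: "('o, 'a, 'z) dc_cat_scheme" (structure)
begin

definition dual_map :: "'a \<Rightarrow> 'a" where
  "dual_map f = (let A = Dom V f; B = Cod V f in
    \<rho> (A\<star>) \<cdot> (\<one> (A\<star>) \<otimes> \<epsilon> B) \<cdot> (\<one> (A\<star>) \<otimes> (f \<otimes> \<one> (B\<star>))) \<cdot>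
    \<alpha> (A\<star>) A (B\<star>) \<cdot> (\<eta> A \<otimes> \<one> (B\<star>)) \<cdot> (\<Lambda> (B\<star>))\<dagger>)"

definition conj_map :: "'a \<Rightarrow> 'a" where
  "conj_map f = dual_map (f\<dagger>)"

text \<open>The unit \<open>\<I> \<rightarrow> (B\<star> \<odot> A\<star>) \<odot> (A \<odot> B)\<close> obtained by nesting, and the canonical isomorphism
  \<open>(A \<odot> B)\<star> \<rightarrow> B\<star> \<odot> A\<star>\<close> it induces. This isomorphism is usually treated as an identification.\<close>

definition nested_eta :: "'o \<Rightarrow> 'o \<Rightarrow> 'a" where
  "nested_eta A B =
    (\<alpha> (B\<star>) (A\<star>) (A \<odot> B))\<dagger> \<cdot> (\<one> (B\<star>) \<otimes> \<alpha> (A\<star>) A B) \<cdot>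
    (\<one> (B\<star>) \<otimes> (\<eta> A \<otimes> \<one> B)) \<cdot> (\<one> (B\<star>) \<otimes> (\<Lambda> B)\<dagger>) \<cdot> \<eta> B"

definition dual_tensor :: "'o \<Rightarrow> 'o \<Rightarrow> 'a" where
  "dual_tensor A B =
    \<rho> (B\<star> \<odot> A\<star>) \<cdot> (\<one> (B\<star> \<odot> A\<star>) \<otimes> \<epsilon> (A \<odot> B)) \<cdot>
    \<alpha> (B\<star> \<odot> A\<star>) (A \<odot> B) ((A \<odot> B)\<star>) \<cdot>
    (nested_eta A B \<otimes> \<one> ((A \<odot> B)\<star>)) \<cdot> (\<Lambda> ((A \<odot> B)\<star>))\<dagger>"

text \<open>\<open>(A \<odot> B) \<odot> (D \<odot> E) \<rightarrow> (A \<odot> D) \<odot> (B \<odot> E)\<close>\<close>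

definition interchange :: "'o \<Rightarrow> 'o \<Rightarrow> 'o \<Rightarrow> 'o \<Rightarrow> 'a" where
  "interchange A B D E =
    (\<alpha> A D (B \<odot> E))\<dagger> \<cdot> (\<one> A \<otimes> \<alpha> D B E) \<cdot> (\<one> A \<otimes> (\<sigma> B D \<otimes> \<one> E)) \<cdot>
    (\<one> A \<otimes> (\<alpha> B D E)\<dagger>) \<cdot> \<alpha> A B (D \<odot> E)"

definition positive_dimensional :: bool where
  "positive_dimensional \<longleftrightarrow> (\<forall>X \<in> Obj V. \<exists>z \<in> hom V \<I> \<I>. positive_definite V z \<and>
    \<Lambda> X \<cdot> ((z \<cdot> z \<cdot> (\<eta> X)\<dagger> \<cdot> \<eta> X) \<otimes> \<one> X) \<cdot> (\<Lambda> X)\<dagger> = \<one> X)"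


section \<open>Frobenius algebras\<close>

definition frobenius_algebra :: "'o \<Rightarrow> 'a \<Rightarrow> 'a \<Rightarrow> 'a \<Rightarrow> 'a \<Rightarrow> bool" where
  "frobenius_algebra A m u \<delta> e \<longleftrightarrow>
    A \<in> Obj V \<and> m \<in> hom V (A \<odot> A) A \<and> u \<in> hom V \<I> A \<and>
    \<delta> \<in> hom V A (A \<odot> A) \<and> e \<in> hom V A \<I> \<and>
    m \<cdot> (m \<otimes> \<one> A) = m \<cdot> (\<one> A \<otimes> m) \<cdot> \<alpha> A A A \<and>
    m \<cdot> (u \<otimes> \<one> A) = \<Lambda> A \<and> m \<cdot> (\<one> A \<otimes> u) = \<rho> A \<and>
    \<alpha> A A A \<cdot> (\<delta> \<otimes> \<one> A) \<cdot> \<delta> = (\<one> A \<otimes> \<delta>) \<cdot> \<delta> \<and>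
    \<Lambda> A \<cdot> (e \<otimes> \<one> A) \<cdot> \<delta> = \<one> A \<and> \<rho> A \<cdot> (\<one> A \<otimes> e) \<cdot> \<delta> = \<one> A \<and>
    (\<one> A \<otimes> m) \<cdot> \<alpha> A A A \<cdot> (\<delta> \<otimes> \<one> A) = \<delta> \<cdot> m \<and>
    \<delta> \<cdot> m = (m \<otimes> \<one> A) \<cdot> (\<alpha> A A A)\<dagger> \<cdot> (\<one> A \<otimes> \<delta>)"

definition dagger_frobenius_algebra :: "('o, 'a) algebra \<Rightarrow> bool" where
  "dagger_frobenius_algebra M \<longleftrightarrow>
    frobenius_algebra (carrier M) (mult M) (unt M) ((mult M)\<dagger>) ((unt M)\<dagger>)"

definition central :: "('o, 'a) algebra \<Rightarrow> 'a \<Rightarrow> bool" where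
  "central M z \<longleftrightarrow> (let A = carrier M; m = mult M in
    z \<in> hom V A A \<and> m \<cdot> (z \<otimes> \<one> A) = z \<cdot> m \<and> z \<cdot> m = m \<cdot> (\<one> A \<otimes> z))"

definition trace_mult :: "('o, 'a) algebra \<Rightarrow> 'a" where
  "trace_mult M = (let A = carrier M in
    \<epsilon> A \<cdot> (mult M \<otimes> \<one> (A\<star>)) \<cdot> (\<alpha> A A (A\<star>))\<dagger> \<cdot> (\<one> A \<otimes> (\<sigma> (A\<star>) A \<cdot> \<eta> A)) \<cdot> (\<rho> A)\<dagger>)"

definition normaliser :: "('o, 'a) algebra \<Rightarrow> 'a \<Rightarrow> bool" where
  "normaliser M z \<longleftrightarrow>
    central M z \<and> positive_definite V z \<and> trace_mult M \<cdot> z \<cdot> z = (unt M)\<dagger>"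

definition normalisable :: "('o, 'a) algebra \<Rightarrow> bool" where
  "normalisable M \<longleftrightarrow> dagger_frobenius_algebra M \<and> (\<exists>z. normaliser M z)"

definition algebraic_square_roots :: bool where
  "algebraic_square_roots \<longleftrightarrow> (\<forall>M f.
    normalisable M \<and> central M f \<and> positive_definite V f \<longrightarrow> (\<exists>g. central M g \<and> f = g \<cdot> g))"

definition act :: "('o, 'a) algebra \<Rightarrow> 'a" where
  "act M = (let A = carrier M in
    (\<one> (A\<star>) \<otimes> mult M) \<cdot> \<alpha> (A\<star>) A A \<cdot> (\<eta> A \<otimes> \<one> A) \<cdot> (\<Lambda> A)\<dagger>)"

definition coact :: "('o, 'a) algebra \<Rightarrow> 'a" where
  "coact M = (let A = carrier M in
    \<Lambda> A \<cdot> ((\<eta> A)\<dagger> \<otimes> \<one> A) \<cdot> (\<alpha> (A\<star>) A A)\<dagger> \<cdot> (\<one> (A\<star>) \<otimes> (mult M)\<dagger>))"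

definition tensor_algebra :: "('o, 'a) algebra \<Rightarrow> ('o, 'a) algebra \<Rightarrow> ('o, 'a) algebra" where
  "tensor_algebra M N = (let A = carrier M; B = carrier N in
    \<lparr>carrier = A \<odot> B,
     mult = (mult M \<otimes> mult N) \<cdot> interchange A B A B,
     unt = (unt M \<otimes> unt N) \<cdot> (\<Lambda> \<I>)\<dagger>\<rparr>)"

definition unit_algebra :: "('o, 'a) algebra" where
  "unit_algebra = \<lparr>carrier = \<I>, mult = \<Lambda> \<I>, unt = \<one> \<I>\<rparr>"


section \<open>Completely positive maps\<close>

text \<open>\<open>(1 \<otimes> \<eta>\<dagger> \<otimes> 1) \<cdot> (g\<^sub>* \<otimes> g) : A\<star> \<odot> A \<rightarrow> B\<star> \<odot> B\<close>, for \<open>g : A \<rightarrow> X \<odot> B\<close>\<close>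

definition kraus :: "'o \<Rightarrow> 'o \<Rightarrow> 'a \<Rightarrow> 'a" where
  "kraus X B g =
    (\<one> (B\<star>) \<otimes> \<Lambda> B) \<cdot> (\<one> (B\<star>) \<otimes> ((\<eta> X)\<dagger> \<otimes> \<one> B)) \<cdot> (\<one> (B\<star>) \<otimes> (\<alpha> (X\<star>) X B)\<dagger>) \<cdot>
    \<alpha> (B\<star>) (X\<star>) (X \<odot> B) \<cdot> (dual_tensor X B \<otimes> \<one> (X \<odot> B)) \<cdot> (conj_map g \<otimes> g)"

definition completely_positive :: "'o \<Rightarrow> 'o \<Rightarrow> 'a \<Rightarrow> bool" where
  "completely_positive A B f \<longleftrightarrow> (\<exists>X \<in> Obj V. \<exists>g \<in> hom V A (X \<odot> B). f = kraus X B g)"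

definition CPstar :: "(('o, 'a) algebra, (('o, 'a) algebra, 'a) arrow) dsm_cat" where
  "CPstar = \<lparr>
    Obj = {M. normalisable M},
    Arr = {Arrow M f N | M f N. normalisable M \<and> normalisable N \<and>
      f \<in> hom V (carrier M) (carrier N) \<and>
      completely_positive (carrier M) (carrier N) (act N \<cdot> f \<cdot> coact M)},
    Dom = source,
    Cod = target,
    Ident = (\<lambda>M. Arrow M (\<one> (carrier M)) M),
    Comp = (\<lambda>g f. Arrow (source f) (und g \<cdot> und f) (target g)),
    Dagger = (\<lambda>f. Arrow (target f) ((und f)\<dagger>) (source f)),
    Unit = unit_algebra,
    TensorO = tensor_algebra,
    TensorA = (\<lambda>f g. Arrow (tensor_algebra (source f) (source g)) (und f \<otimes> und g)
      (tensor_algebra (target f) (target g))),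
    Assoc = (\<lambda>L M N. Arrow (tensor_algebra (tensor_algebra L M) N)
      (\<alpha> (carrier L) (carrier M) (carrier N)) (tensor_algebra L (tensor_algebra M N))),
    LUnit = (\<lambda>M. Arrow (tensor_algebra unit_algebra M) (\<Lambda> (carrier M)) M),
    RUnit = (\<lambda>M. Arrow (tensor_algebra M unit_algebra) (\<rho> (carrier M)) M),
    Sym = (\<lambda>M N. Arrow (tensor_algebra M N) (\<sigma> (carrier M) (carrier N)) (tensor_algebra N M))\<rparr>"

text \<open>\<open>(A \<odot> B)\<star> \<odot> (A \<odot> B) \<cong> (B\<star> \<odot> A\<star>) \<odot> (A \<odot> B) \<cong> (A\<star> \<odot> A) \<odot> (B\<star> \<odot> B)\<close>. It is
  unitary, so its inverse is its dagger.\<close>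

definition cpm_shuffle :: "'o \<Rightarrow> 'o \<Rightarrow> 'a" where
  "cpm_shuffle A B =
    interchange (A\<star>) (B\<star>) A B \<cdot> (\<sigma> (B\<star>) (A\<star>) \<otimes> \<one> (A \<odot> B)) \<cdot> (dual_tensor A B \<otimes> \<one> (A \<odot> B))"

text \<open>The coherence isomorphisms and the symmetry of \<open>CPM[V]\<close> are the images of those of \<open>V\<close> under
  \<open>f \<mapsto> f\<^sub>* \<otimes> f\<close>.\<close>

definition cpm_pure :: "'a \<Rightarrow> ('o, 'a) arrow" where
  "cpm_pure f = Arrow (Dom V f) (conj_map f \<otimes> f) (Cod V f)"

definition CPM :: "('o, ('o, 'a) arrow) dsm_cat" where
  "CPM = \<lparr>
    Obj = Obj V,
    Arr = {Arrow A f B | A f B. A \<in> Obj V \<and> B \<in> Obj V \<and> completely_positive A B f},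
    Dom = source,
    Cod = target,
    Ident = (\<lambda>A. Arrow A (\<one> (A\<star> \<odot> A)) A),
    Comp = (\<lambda>g f. Arrow (source f) (und g \<cdot> und f) (target g)),
    Dagger = (\<lambda>f. Arrow (target f) ((und f)\<dagger>) (source f)),
    Unit = \<I>,
    TensorO = (\<lambda>A B. A \<odot> B),
    TensorA = (\<lambda>f g. Arrow (source f \<odot> source g)
      ((cpm_shuffle (target f) (target g))\<dagger> \<cdot> (und f \<otimes> und g) \<cdot> cpm_shuffle (source f) (source g))
      (target f \<odot> target g)),
    Assoc = (\<lambda>A B D. cpm_pure (\<alpha> A B D)),
    LUnit = (\<lambda>A. cpm_pure (\<Lambda> A)),
    RUnit = (\<lambda>A. cpm_pure (\<rho> A)),
    Sym = (\<lambda>A B. cpm_pure (\<sigma> A B))\<rparr>"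

end


section \<open>Splitting dagger idempotents\<close>

definition Split_dagger ::
  "('o, 'a, 'z) dsm_cat_scheme \<Rightarrow> ('o \<times> 'a, ('o \<times> 'a, 'a) arrow) dsm_cat" where
  "Split_dagger W =
    (let tensor = (\<lambda>(A, p) (B, q). (A \<odot>\<^bsub>W\<^esub> B, p \<otimes>\<^bsub>W\<^esub> q));
         unit = (\<I>\<^bsub>W\<^esub>, \<one>\<^bsub>W\<^esub> \<I>\<^bsub>W\<^esub>);
         Ob = {(A, p). A \<in> Obj W \<and> p \<in> hom W A A \<and> p \<cdot>\<^bsub>W\<^esub> p = p \<and> p = p\<dagger>\<^bsub>W\<^esub>}
     in \<lparr>
      Obj = Ob,
      Arr = {Arrow (A, p) f (B, q) | A p f B q. (A, p) \<in> Ob \<and> (B, q) \<in> Ob \<and>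
        f \<in> hom W A B \<and> f = q \<cdot>\<^bsub>W\<^esub> f \<cdot>\<^bsub>W\<^esub> p},
      Dom = source,
      Cod = target,
      Ident = (\<lambda>(A, p). Arrow (A, p) p (A, p)),
      Comp = (\<lambda>g f. Arrow (source f) (und g \<cdot>\<^bsub>W\<^esub> und f) (target g)),
      Dagger = (\<lambda>f. Arrow (target f) ((und f)\<dagger>\<^bsub>W\<^esub>) (source f)),
      Unit = unit,
      TensorO = tensor,
      TensorA = (\<lambda>f g. Arrow (tensor (source f) (source g)) (und f \<otimes>\<^bsub>W\<^esub> und g)
        (tensor (target f) (target g))),
      Assoc = (\<lambda>(A, p) (B, q) (D, r).
        Arrow (tensor (tensor (A, p) (B, q)) (D, r))
          (\<alpha>\<^bsub>W\<^esub> A B D \<cdot>\<^bsub>W\<^esub> ((p \<otimes>\<^bsub>W\<^esub> q) \<otimes>\<^bsub>W\<^esub> r))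
          (tensor (A, p) (tensor (B, q) (D, r)))),
      LUnit = (\<lambda>(A, p).
        Arrow (tensor unit (A, p)) (\<Lambda>\<^bsub>W\<^esub> A \<cdot>\<^bsub>W\<^esub> (\<one>\<^bsub>W\<^esub> \<I>\<^bsub>W\<^esub> \<otimes>\<^bsub>W\<^esub> p)) (A, p)),
      RUnit = (\<lambda>(A, p).
        Arrow (tensor (A, p) unit) (\<rho>\<^bsub>W\<^esub> A \<cdot>\<^bsub>W\<^esub> (p \<otimes>\<^bsub>W\<^esub> \<one>\<^bsub>W\<^esub> \<I>\<^bsub>W\<^esub>)) (A, p)),
      Sym = (\<lambda>(A, p) (B, q).
        Arrow (tensor (A, p) (B, q)) (\<sigma>\<^bsub>W\<^esub> A B \<cdot>\<^bsub>W\<^esub> (p \<otimes>\<^bsub>W\<^esub> q)) (tensor (B, q) (A, p)))\<rparr>)"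

end

theory Submission
  imports Defs
begin

text \<open>Let \<open>a\<close> be the action map of a dagger Frobenius algebra on \<open>A\<close> with normaliser \<open>z\<close>. The normaliser
  condition makes the form \<open>u\<dagger> \<cdot> m\<close> symmetric, because the trace of left multiplication is, and with
  the symmetry it becomes \<open>a\<dagger> \<cdot> a \<cdot> z \<cdot> z = \<one>\<close>. Hence \<open>a \<cdot> z\<close> is an isometry. Since \<open>z\<^sub>*\<close> slides through
  the cup, \<open>(z\<^sub>* \<otimes> z) \<cdot> a = a \<cdot> z \<cdot> z\<close>, so the idempotent \<open>a \<cdot> a\<dagger> \<cdot> (z\<^sup>* \<otimes> z)\<close> is the range projection
  of \<open>a \<cdot> z\<close>, and \<open>F\<close> is conjugation by these isometries, which is inverted by conjugating back.

  For \<open>y = h\<dagger> \<cdot> h\<close> central, \<open>a \<cdot> y \<cdot> a\<dagger>\<close> is completely positive with Kraus map \<open>(h \<otimes> \<one>) \<cdot> m\<dagger>\<close>.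
  Composing with \<open>a \<cdot> z \<cdot> a\<dagger>\<close> and with \<open>(z\<^sub>* \<otimes> z) \<cdot> a \<cdot> z \<cdot> a\<dagger> = a \<cdot> z \<cdot> z \<cdot> z \<cdot> a\<dagger>\<close> moves complete
  positivity between \<open>a \<cdot> f \<cdot> a\<dagger>\<close> and \<open>a \<cdot> z \<cdot> f \<cdot> z \<cdot> a\<dagger>\<close>. The structure map \<open>\<phi>\<close> is the tensor product
  of the isometries of two algebras composed with the adjoint of the isometry of their tensor
  product; its coherence reduces to naturality and coherence of the shuffle that defines
  tensor products in \<open>CPM[V]\<close>.\<close>

section \<open>Typing rules and Kelly's coherence lemmas\<close>

text \<open>Arrows are untyped and bracketing is explicit, so every graphical step would carry
  typing and coherence arguments. After \<open>expand\<close>, a structural arrow becomes a word of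
  splits, merges, crossings and generators, and \<open>ap_faithful\<close> turns an equality of
  words on a split epi test state back into an equality of arrows. Duality is handled through names:
  facts about conjugates are proved after composing with a cup, where uniqueness holds. Complete
  positivity is recast as \<open>disc X B \<cdot> pm g\<close>, a doubled arrow followed by tracing
  out an environment; its closure properties then become coherence of the shuffle. The isometry
  \<open>a \<cdot> z\<close> starts at \<open>A\<close> and not at
  \<open>A\<star> \<odot> A\<close>, so it is no arrow of \<open>CPM[V]\<close> and cannot be
  composed there. This is why cubes of \<open>z\<close> occur: in
  \<open>a \<cdot> z \<cdot> z \<cdot> z \<cdot> a\<dagger>\<close> followed by \<open>a\<close>,
  the middle \<open>a\<dagger> \<cdot> a\<close> cancels two factors and leaves the wanted one. The
  chosen normaliser of a tensor algebra may differ from the tensor of the chosen normalisers. So two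
  isometries exist on it, and \<open>\<phi>\<close> compares them.\<close>

context category
begin

lemma arr_comp [simp]: "\<lbrakk>f \<in> Arr C; g \<in> Arr C; Cod C f = Dom C g\<rbrakk> \<Longrightarrow> g \<cdot> f \<in> Arr C"
  and dom_comp [simp]: "\<lbrakk>f \<in> Arr C; g \<in> Arr C; Cod C f = Dom C g\<rbrakk> \<Longrightarrow> Dom C (g \<cdot> f) = Dom C f"
  and cod_comp [simp]: "\<lbrakk>f \<in> Arr C; g \<in> Arr C; Cod C f = Dom C g\<rbrakk> \<Longrightarrow> Cod C (g \<cdot> f) = Cod C g"
  using comp_hom [of f "Dom C f" "Cod C f" g "Cod C g"] by (auto simp: hom_def)

lemma arr_ident [simp]: "A \<in> Obj C \<Longrightarrow> \<one> A \<in> Arr C"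
  and dom_ident [simp]: "A \<in> Obj C \<Longrightarrow> Dom C (\<one> A) = A"
  and cod_ident [simp]: "A \<in> Obj C \<Longrightarrow> Cod C (\<one> A) = A"
  using ident_hom by (auto simp: hom_def)

lemma comp_id_right [simp]: "\<lbrakk>f \<in> Arr C; Dom C f = A\<rbrakk> \<Longrightarrow> f \<cdot> \<one> A = f"
  using comp_ident_right by (auto simp: hom_def)

lemma comp_id_left [simp]: "\<lbrakk>f \<in> Arr C; Cod C f = A\<rbrakk> \<Longrightarrow> \<one> A \<cdot> f = f"
  using comp_ident_left by (auto simp: hom_def)

lemma cassoc: "\<lbrakk>f \<in> Arr C; g \<in> Arr C; h \<in> Arr C; Cod C f = Dom C g; Cod C g = Dom C h\<rbrakk>
    \<Longrightarrow> (h \<cdot> g) \<cdot> f = h \<cdot> (g \<cdot> f)"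
  using comp_assoc by (auto simp: hom_def)

text \<open>Composites are kept nested to the right, so an equation between two-fold composites must
  be usable in front of a tail \<open>x\<close>.\<close>

lemma comp_reduce:
  assumes "b \<cdot> a = d \<cdot> c"
    and "a \<in> Arr C" "b \<in> Arr C" "c \<in> Arr C" "d \<in> Arr C" "Cod C a = Dom C b" "Cod C c = Dom C d"
    and "x \<in> Arr C" "Cod C x = Dom C a" "Dom C c = Dom C a"
  shows "b \<cdot> (a \<cdot> x) = d \<cdot> (c \<cdot> x)"
  using assms by (simp flip: cassoc)

lemma comp_reduce1:
  assumes "b \<cdot> a = c"
    and "a \<in> Arr C" "b \<in> Arr C" "Cod C a = Dom C b"
    and "x \<in> Arr C" "Cod C x = Dom C a"
  shows "b \<cdot> (a \<cdot> x) = c \<cdot> x"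
  using assms by (simp flip: cassoc)

end

context dagger_category
begin

lemma arr_dagger [simp]: "f \<in> Arr C \<Longrightarrow> f\<dagger> \<in> Arr C"
  and dom_dagger [simp]: "f \<in> Arr C \<Longrightarrow> Dom C (f\<dagger>) = Cod C f"
  and cod_dagger [simp]: "f \<in> Arr C \<Longrightarrow> Cod C (f\<dagger>) = Dom C f"
  using dagger_hom [of f] by (auto simp: hom_def)

lemma dagger_dagger' [simp]: "f \<in> Arr C \<Longrightarrow> (f\<dagger>)\<dagger> = f"
  by (rule dagger_dagger)

lemma dagger_ident' [simp]: "A \<in> Obj C \<Longrightarrow> (\<one> A)\<dagger> = \<one> A"
  by (rule dagger_ident)

lemma dagger_comp': "\<lbrakk>f \<in> Arr C; g \<in> Arr C; Cod C f = Dom C g\<rbrakk> \<Longrightarrow> (g \<cdot> f)\<dagger> = f\<dagger> \<cdot> g\<dagger>"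
  using dagger_comp by (auto simp: hom_def)

text \<open>The last two clauses are the cancellation laws in front of a tail, as right-nested
  composites require.\<close>

lemma unitary_cancel:
  assumes "unitary C A B f"
  shows "f \<in> Arr C" "Dom C f = A" "Cod C f = B" "f\<dagger> \<cdot> f = \<one> A" "f \<cdot> f\<dagger> = \<one> B"
    and "\<lbrakk>x \<in> Arr C; Cod C x = A\<rbrakk> \<Longrightarrow> f\<dagger> \<cdot> (f \<cdot> x) = x"
    and "\<lbrakk>x \<in> Arr C; Cod C x = B\<rbrakk> \<Longrightarrow> f \<cdot> (f\<dagger> \<cdot> x) = x"
  using assms by (auto simp: unitary_def hom_def simp flip: cassoc)

lemma unitary_comp:
  "\<lbrakk>unitary C A B f; unitary C B D g\<rbrakk> \<Longrightarrow> unitary C A D (g \<cdot> f)"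
  by (auto simp: unitary_def hom_def dagger_comp' cassoc unitary_cancel(6,7) unitary_def)

lemma unitary_dagger: "unitary C A B f \<Longrightarrow> unitary C B A (f\<dagger>)"
  by (auto simp: unitary_def hom_def)

lemma unitary_ident: "A \<in> Obj C \<Longrightarrow> unitary C A A (\<one> A)"
  by (auto simp: unitary_def hom_def)

end

context dagger_symmetric_monoidal_category
begin

lemma obj_unit [simp]: "\<I> \<in> Obj C"
  by (rule unit_obj)

lemma obj_tensor [simp]: "\<lbrakk>A \<in> Obj C; B \<in> Obj C\<rbrakk> \<Longrightarrow> A \<odot> B \<in> Obj C"
  by (rule tensor_obj)

lemma arr_tensor [simp]: "\<lbrakk>f \<in> Arr C; g \<in> Arr C\<rbrakk> \<Longrightarrow> f \<otimes> g \<in> Arr C"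
  and dom_tensor [simp]: "\<lbrakk>f \<in> Arr C; g \<in> Arr C\<rbrakk> \<Longrightarrow> Dom C (f \<otimes> g) = Dom C f \<odot> Dom C g"
  and cod_tensor [simp]: "\<lbrakk>f \<in> Arr C; g \<in> Arr C\<rbrakk> \<Longrightarrow> Cod C (f \<otimes> g) = Cod C f \<odot> Cod C g"
  using tensor_hom [of f "Dom C f" "Cod C f" g "Dom C g" "Cod C g"] by (auto simp: hom_def)

lemma tensor_id [simp]: "\<lbrakk>A \<in> Obj C; B \<in> Obj C\<rbrakk> \<Longrightarrow> \<one> A \<otimes> \<one> B = \<one> (A \<odot> B)"
  by (rule tensor_ident)

lemma tensor_comp':
  "\<lbrakk>f \<in> Arr C; g \<in> Arr C; f' \<in> Arr C; g' \<in> Arr C; Cod C f = Dom C g; Cod C f' = Dom C g'\<rbrakk>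
    \<Longrightarrow> (g \<otimes> g') \<cdot> (f \<otimes> f') = (g \<cdot> f) \<otimes> (g' \<cdot> f')"
  using tensor_comp [of f "Dom C f" "Cod C f" g "Cod C g" f' "Dom C f'" "Cod C f'" g' "Cod C g'"]
  by (simp add: hom_def)

lemma tensor_comp_reduce:
  "\<lbrakk>f \<in> Arr C; g \<in> Arr C; f' \<in> Arr C; g' \<in> Arr C; Cod C f = Dom C g; Cod C f' = Dom C g';
      x \<in> Arr C; Cod C x = Dom C f \<odot> Dom C f'\<rbrakk>
    \<Longrightarrow> (g \<otimes> g') \<cdot> ((f \<otimes> f') \<cdot> x) = ((g \<cdot> f) \<otimes> (g' \<cdot> f')) \<cdot> x"
  by (simp add: tensor_comp' flip: cassoc)

lemma tensor_dagger' [simp]: "\<lbrakk>f \<in> Arr C; g \<in> Arr C\<rbrakk> \<Longrightarrow> (f \<otimes> g)\<dagger> = f\<dagger> \<otimes> g\<dagger>"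
  by (rule tensor_dagger)

lemma unitary_tensor:
  "\<lbrakk>unitary C A B f; unitary C A' B' g; A \<in> Obj C; A' \<in> Obj C; B \<in> Obj C; B' \<in> Obj C\<rbrakk>
    \<Longrightarrow> unitary C (A \<odot> A') (B \<odot> B') (f \<otimes> g)"
  by (auto simp: unitary_def hom_def tensor_comp')

lemmas assoc_simps [simp] = unitary_cancel [OF assoc_unitary]
lemmas lunit_simps [simp] = unitary_cancel [OF lunit_unitary]
lemmas runit_simps [simp] = unitary_cancel [OF runit_unitary]
lemmas sym_simps [simp] = unitary_cancel [OF sym_unitary]

lemma sym_dagger [simp]:
  assumes "A \<in> Obj C" "B \<in> Obj C"
  shows "(\<sigma> A B)\<dagger> = \<sigma> B A"
proof -
  have "(\<sigma> A B)\<dagger> = (\<sigma> B A \<cdot> \<sigma> A B) \<cdot> (\<sigma> A B)\<dagger>"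
    using assms by (simp only: sym_sym) simp
  then show ?thesis using assms by (simp add: cassoc)
qed

lemma sym_sym' [simp]:
  "\<lbrakk>A \<in> Obj C; B \<in> Obj C; x \<in> Arr C; Cod C x = A \<odot> B\<rbrakk> \<Longrightarrow> \<sigma> B A \<cdot> (\<sigma> A B \<cdot> x) = x"
  by (simp add: sym_sym flip: cassoc)

lemma assoc_nat:
  "\<lbrakk>f \<in> Arr C; g \<in> Arr C; h \<in> Arr C; Dom C f = A; Dom C g = B; Dom C h = D\<rbrakk>
    \<Longrightarrow> (f \<otimes> (g \<otimes> h)) \<cdot> \<alpha> A B D = \<alpha> (Cod C f) (Cod C g) (Cod C h) \<cdot> ((f \<otimes> g) \<otimes> h)"
  using assoc_natural [of f A _ g B _ h D] by (simp add: hom_def)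

lemma lunit_nat: "\<lbrakk>f \<in> Arr C; Dom C f = A\<rbrakk> \<Longrightarrow> f \<cdot> \<Lambda> A = \<Lambda> (Cod C f) \<cdot> (\<one> \<I> \<otimes> f)"
  using lunit_natural by (simp add: hom_def)

lemma runit_nat: "\<lbrakk>f \<in> Arr C; Dom C f = A\<rbrakk> \<Longrightarrow> f \<cdot> \<rho> A = \<rho> (Cod C f) \<cdot> (f \<otimes> \<one> \<I>)"
  using runit_natural by (simp add: hom_def)

lemma sym_nat:
  "\<lbrakk>f \<in> Arr C; g \<in> Arr C; Dom C f = A; Dom C g = B\<rbrakk>
    \<Longrightarrow> (g \<otimes> f) \<cdot> \<sigma> A B = \<sigma> (Cod C f) (Cod C g) \<cdot> (f \<otimes> g)"
  using sym_natural by (simp add: hom_def)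

lemma epi_cancel:
  assumes "f \<cdot> x = g \<cdot> x" "unitary C A B x" "f \<in> Arr C" "g \<in> Arr C" "Dom C f = B" "Dom C g = B"
  shows "f = g"
proof -
  have "(f \<cdot> x) \<cdot> x\<dagger> = (g \<cdot> x) \<cdot> x\<dagger>"
    using assms(1) by simp
  then show ?thesis
    using assms(3-) unitary_cancel [OF assms(2)] by (simp add: cassoc)
qed

lemma mono_cancel:
  assumes "x \<cdot> f = x \<cdot> g" "unitary C A B x" "f \<in> Arr C" "g \<in> Arr C" "Cod C f = A" "Cod C g = A"
  shows "f = g"
proof -
  have "x\<dagger> \<cdot> (x \<cdot> f) = x\<dagger> \<cdot> (x \<cdot> g)"
    using assms(1) by simp
  then show ?thesis
    using assms(3-) unitary_cancel(6) [OF assms(2)] by simp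
qed

text \<open>Naturality of the left unitor makes tensoring with the unit faithful.\<close>

lemma unit_tensor_cancel:
  assumes "\<one> \<I> \<otimes> f = \<one> \<I> \<otimes> g" "f \<in> Arr C" "g \<in> Arr C" "Dom C f = Dom C g" "Cod C f = Cod C g"
  shows "f = g"
proof (rule epi_cancel)
  show "unitary C (\<I> \<odot> Dom C f) (Dom C f) (\<Lambda> (Dom C f))"
    using assms by (simp add: lunit_unitary dom_obj)
  show "f \<cdot> \<Lambda> (Dom C f) = g \<cdot> \<Lambda> (Dom C f)"
    using assms by (simp add: lunit_nat)
qed (use assms in auto)

text \<open>Kelly's argument: after tensoring with the unit, both sides become edges of a pentagon
  whose other regions commute by two triangles and naturality of the associator.\<close>

lemma lunit_tensor:
  assumes "A \<in> Obj C" "X \<in> Obj C"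
  shows "\<Lambda> (A \<odot> X) \<cdot> \<alpha> \<I> A X = \<Lambda> A \<otimes> \<one> X"
proof (rule unit_tensor_cancel)
  \<comment> \<open>The two unitary edges of the pentagon that are cancelled at the end.\<close>
  let ?t = "\<alpha> \<I> (\<I> \<odot> A) X \<cdot> (\<alpha> \<I> \<I> A \<otimes> \<one> X)"
  have "(\<one> \<I> \<otimes> (\<Lambda> (A \<odot> X) \<cdot> \<alpha> \<I> A X)) \<cdot> ?t
      = (\<one> \<I> \<otimes> \<Lambda> (A \<odot> X)) \<cdot> ((\<one> \<I> \<otimes> \<alpha> \<I> A X) \<cdot> ?t)"
    using assms by (simp add: tensor_comp_reduce)
  also have "\<dots> = ((\<one> \<I> \<otimes> \<Lambda> (A \<odot> X)) \<cdot> \<alpha> \<I> \<I> (A \<odot> X)) \<cdot> \<alpha> (\<I> \<odot> \<I>) A X"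
    using assms by (simp add: pentagon cassoc)
  also have "\<dots> = (\<rho> \<I> \<otimes> (\<one> A \<otimes> \<one> X)) \<cdot> \<alpha> (\<I> \<odot> \<I>) A X"
    using assms by (simp add: triangle del: assoc_simps)
  also have "\<dots> = \<alpha> \<I> A X \<cdot> ((\<rho> \<I> \<otimes> \<one> A) \<otimes> \<one> X)"
    using assms by (simp add: assoc_nat del: tensor_id)
  also have "\<dots> = \<alpha> \<I> A X \<cdot> ((\<one> \<I> \<otimes> \<Lambda> A) \<otimes> \<one> X) \<cdot> (\<alpha> \<I> \<I> A \<otimes> \<one> X)"
    using assms by (simp add: triangle tensor_comp')
  also have "\<dots> = (\<one> \<I> \<otimes> (\<Lambda> A \<otimes> \<one> X)) \<cdot> ?t"
    using assms by (subst comp_reduce [OF assoc_nat]) auto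
  finally have *: "(\<one> \<I> \<otimes> (\<Lambda> (A \<odot> X) \<cdot> \<alpha> \<I> A X)) \<cdot> ?t = (\<one> \<I> \<otimes> (\<Lambda> A \<otimes> \<one> X)) \<cdot> ?t" .
  have "unitary C (((\<I> \<odot> \<I>) \<odot> A) \<odot> X) (\<I> \<odot> ((\<I> \<odot> A) \<odot> X)) ?t"
    using assms by (intro unitary_comp [OF unitary_tensor [OF assoc_unitary unitary_ident] assoc_unitary]) auto
  with * show "\<one> \<I> \<otimes> (\<Lambda> (A \<odot> X) \<cdot> \<alpha> \<I> A X) = \<one> \<I> \<otimes> (\<Lambda> A \<otimes> \<one> X)"
    by (rule epi_cancel) (use assms in auto)
qed (use assms in auto)

end

section \<open>A calculus of string diagrams\<close>

text \<open>A state is an arrow into a right-nested tensor product \<open>A\<^sub>1 \<odot> (\<dots> \<odot> (A\<^sub>n \<odot> \<I>))\<close>, recorded with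
  the list \<open>[A\<^sub>1, \<dots>, A\<^sub>n]\<close>; \<open>None\<close> stands for an ill-typed diagram. The state transformer
  \<open>ap i ds f cs\<close> applies \<open>f\<close> to the wires \<open>ds\<close> at offset \<open>i\<close> and replaces them by \<open>cs\<close>. Being partial
  functions on states, diagrams compose strictly associatively and the interchange law holds without
  typing assumptions. Bracketing survives only as identities regarded as maps \<open>[A \<odot> B] \<rightarrow> [A, B]\<close>
  and back, which cancel.\<close>

context dagger_symmetric_monoidal_category
begin

text \<open>The separate singleton clause avoids a trailing unit, so that generators keep their
  usual types such as \<open>A \<odot> A\<close>; only states end in \<open>\<I>\<close>, through
  \<open>lift\<close>.\<close>

fun tob :: "'o list \<Rightarrow> 'o" where
  "tob [] = \<I>"
| "tob [A] = A"
| "tob (A # B # r) = A \<odot> tob (B # r)"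

text \<open>The canonical rebracketing \<open>tob ds \<odot> X \<rightarrow> lift ds X\<close>; for
  no wires it deletes the unit.\<close>

fun strict :: "'o list \<Rightarrow> 'o \<Rightarrow> 'a" where
  "strict [] X = \<Lambda> X"
| "strict [A] X = \<one> (A \<odot> X)"
| "strict (A # B # r) X = (\<one> A \<otimes> strict (B # r) X) \<cdot> \<alpha> A (tob (B # r)) X"

primrec lift :: "'o list \<Rightarrow> 'o \<Rightarrow> 'o" where
  "lift [] X = X"
| "lift (A # r) X = A \<odot> lift r X"

primrec lft :: "'o list \<Rightarrow> 'a \<Rightarrow> 'a" where
  "lft [] x = x"
| "lft (A # r) x = \<one> A \<otimes> lft r x"

text \<open>The action of \<open>f\<close> on the leading wires of a stack whose remainder is
  \<open>X\<close>.\<close>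

definition hat :: "'o list \<Rightarrow> 'a \<Rightarrow> 'o list \<Rightarrow> 'o \<Rightarrow> 'a" where
  "hat ds f cs X = strict cs X \<cdot> (f \<otimes> \<one> X) \<cdot> (strict ds X)\<dagger>"

lemma lift_append: "lift (xs @ ys) X = lift xs (lift ys X)"
  by (induction xs) auto

lemma lft_append: "lft (xs @ ys) x = lft xs (lft ys x)"
  by (induction xs) auto

lemma obj_tob [simp]: "set ds \<subseteq> Obj C \<Longrightarrow> tob ds \<in> Obj C"
  by (induction ds rule: tob.induct) auto

lemma obj_lift [simp]: "\<lbrakk>set ds \<subseteq> Obj C; X \<in> Obj C\<rbrakk> \<Longrightarrow> lift ds X \<in> Obj C"
  by (induction ds) auto

lemma lft_typed [simp]:
  "\<lbrakk>set ds \<subseteq> Obj C; x \<in> Arr C\<rbrakk> \<Longrightarrow> lft ds x \<in> Arr C"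
  "\<lbrakk>set ds \<subseteq> Obj C; x \<in> Arr C\<rbrakk> \<Longrightarrow> Dom C (lft ds x) = lift ds (Dom C x)"
  "\<lbrakk>set ds \<subseteq> Obj C; x \<in> Arr C\<rbrakk> \<Longrightarrow> Cod C (lft ds x) = lift ds (Cod C x)"
  by (induction ds) auto

lemma lft_comp:
  "\<lbrakk>set ds \<subseteq> Obj C; x \<in> Arr C; y \<in> Arr C; Cod C x = Dom C y\<rbrakk>
    \<Longrightarrow> lft ds y \<cdot> lft ds x = lft ds (y \<cdot> x)"
  by (induction ds) (auto simp: tensor_comp')

lemma lft_ident: "\<lbrakk>set ds \<subseteq> Obj C; X \<in> Obj C\<rbrakk> \<Longrightarrow> lft ds (\<one> X) = \<one> (lift ds X)"
  by (induction ds) auto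

lemma strict_unitary:
  "\<lbrakk>set ds \<subseteq> Obj C; X \<in> Obj C\<rbrakk> \<Longrightarrow> unitary C (tob ds \<odot> X) (lift ds X) (strict ds X)"
proof (induction ds X rule: strict.induct)
  case (3 A B r X)
  then have "unitary C (A \<odot> (tob (B # r) \<odot> X)) (A \<odot> lift (B # r) X) (\<one> A \<otimes> strict (B # r) X)"
    by (intro unitary_tensor unitary_ident 3) (auto simp del: lift.simps)
  with 3 show ?case
    by (auto intro!: unitary_comp [OF assoc_unitary])
qed (auto intro: lunit_unitary unitary_ident)

lemmas strict_simps [simp] = unitary_cancel [OF strict_unitary]

lemma strict_nat:
  "\<lbrakk>set ds \<subseteq> Obj C; x \<in> Arr C; Dom C x = X; X \<in> Obj C; Cod C x \<in> Obj C\<rbrakk>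
    \<Longrightarrow> lft ds x \<cdot> strict ds X = strict ds (Cod C x) \<cdot> (\<one> (tob ds) \<otimes> x)"
proof (induction ds X rule: strict.induct)
  case (3 A B r X)
  let ?r = "B # r"
  have ob: "A \<in> Obj C" "set ?r \<subseteq> Obj C" "tob ?r \<in> Obj C"
    using 3 by (auto intro!: obj_tob)
  have "lft (A # ?r) x \<cdot> strict (A # ?r) X
      = (\<one> A \<otimes> (lft ?r x \<cdot> strict ?r X)) \<cdot> \<alpha> A (tob ?r) X"
    using 3 ob by (simp add: tensor_comp_reduce del: lft.simps(2) flip: lft.simps(2) [of A])
      (simp add: tensor_comp_reduce)
  also have "\<dots> = (\<one> A \<otimes> strict ?r (Cod C x)) \<cdot> (\<one> A \<otimes> (\<one> (tob ?r) \<otimes> x)) \<cdot> \<alpha> A (tob ?r) X"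
    using 3 ob by (simp add: tensor_comp_reduce)
  also have "\<dots> = (\<one> A \<otimes> strict ?r (Cod C x)) \<cdot> \<alpha> A (tob ?r) (Cod C x) \<cdot> (\<one> (A \<odot> tob ?r) \<otimes> x)"
    using 3 ob by (simp add: assoc_nat)
  finally show ?case
    using 3 ob by (simp add: cassoc)
qed (auto simp: lunit_nat)

definition vgen :: "'o list \<Rightarrow> 'a \<Rightarrow> 'o list \<Rightarrow> bool" where
  "vgen ds f cs \<longleftrightarrow> set ds \<subseteq> Obj C \<and> set cs \<subseteq> Obj C \<and> f \<in> Arr C \<and>
    Dom C f = tob ds \<and> Cod C f = tob cs"

lemma hat_typed [simp]:
  assumes "vgen ds f cs" "X \<in> Obj C"
  shows "hat ds f cs X \<in> Arr C" "Dom C (hat ds f cs X) = lift ds X" "Cod C (hat ds f cs X) = lift cs X"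
  using assms by (auto simp: hat_def vgen_def)

text \<open>Bifunctoriality of the tensor, transported along \<open>strict\<close>. It is the source
  of the interchange law for words.\<close>

lemma hat_nat:
  assumes "vgen ds f cs" "x \<in> Arr C" "Dom C x = X" "Cod C x = Y" "X \<in> Obj C" "Y \<in> Obj C"
  shows "hat ds f cs Y \<cdot> lft ds x = lft cs x \<cdot> hat ds f cs X"
proof -
  have "hat ds f cs Y \<cdot> lft ds x
      = strict cs Y \<cdot> (f \<otimes> \<one> Y) \<cdot> (strict ds Y)\<dagger> \<cdot> (lft ds x \<cdot> strict ds X) \<cdot> (strict ds X)\<dagger>"
    using assms by (simp add: hat_def cassoc vgen_def)
  also have "\<dots> = strict cs Y \<cdot> (f \<otimes> x) \<cdot> (strict ds X)\<dagger>"
    using assms by (simp add: strict_nat cassoc vgen_def tensor_comp_reduce)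
  also have "\<dots> = (strict cs Y \<cdot> (\<one> (tob cs) \<otimes> x)) \<cdot> (f \<otimes> \<one> X) \<cdot> (strict ds X)\<dagger>"
    using assms by (simp add: cassoc vgen_def tensor_comp_reduce)
  also have "\<dots> = (lft cs x \<cdot> strict cs X) \<cdot> (f \<otimes> \<one> X) \<cdot> (strict ds X)\<dagger>"
    using assms by (simp add: vgen_def strict_nat)
  also have "\<dots> = lft cs x \<cdot> hat ds f cs X"
    using assms by (simp add: hat_def cassoc vgen_def)
  finally show ?thesis .
qed

text \<open>A pair whose arrow does not end in its recorded list also counts as ill-typed; the check
  is repeated here because states carry no typing invariant.\<close>

definition ty :: "('a \<times> 'o list) option \<Rightarrow> 'o list option" where
  "ty s = (case s of None \<Rightarrow> None | Some (x, xs) \<Rightarrow>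
    if x \<in> Arr C \<and> Cod C x = lift xs \<I> \<and> set xs \<subseteq> Obj C then Some xs else None)"

definition has :: "nat \<Rightarrow> 'o list \<Rightarrow> ('a \<times> 'o list) option \<Rightarrow> bool" where
  "has i ds s \<longleftrightarrow> (case ty s of None \<Rightarrow> False | Some xs \<Rightarrow>
    i + length ds \<le> length xs \<and> take (length ds) (drop i xs) = ds)"

definition ap ::
  "nat \<Rightarrow> 'o list \<Rightarrow> 'a \<Rightarrow> 'o list \<Rightarrow> ('a \<times> 'o list) option \<Rightarrow> ('a \<times> 'o list) option" where
  "ap i ds f cs s = (if vgen ds f cs \<and> has i ds s then
    (case s of None \<Rightarrow> None | Some (x, xs) \<Rightarrow>
      Some (lft (take i xs) (hat ds f cs (lift (drop (i + length ds) xs) \<I>)) \<cdot> x,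
        take i xs @ cs @ drop (i + length ds) xs)) else None)"

lemma hasE:
  assumes "has i ds s"
  obtains x us vs where "s = Some (x, us @ ds @ vs)" "i = length us" "x \<in> Arr C"
    "Cod C x = lift us (lift ds (lift vs \<I>))"
    "set us \<subseteq> Obj C" "set ds \<subseteq> Obj C" "set vs \<subseteq> Obj C"
proof -
  from assms obtain x xs where s: "s = Some (x, xs)" "x \<in> Arr C" "Cod C x = lift xs \<I>" "set xs \<subseteq> Obj C"
    and i: "i + length ds \<le> length xs" "take (length ds) (drop i xs) = ds"
    by (auto simp: has_def ty_def split: option.splits prod.splits if_splits)
  have "xs = take i xs @ ds @ drop (i + length ds) xs"
    using i by (metis append_take_drop_id drop_drop add.commute)
  moreover from this i have "length (take i xs) = i" by simp
  ultimately show thesis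
    using s that [of x "take i xs" "drop (i + length ds) xs"]
    by (metis le_sup_iff lift_append set_append)
qed

lemma has_Some:
  "\<lbrakk>x \<in> Arr C; Cod C x = lift us (lift ds (lift vs \<I>)); set us \<subseteq> Obj C; set ds \<subseteq> Obj C; set vs \<subseteq> Obj C\<rbrakk>
    \<Longrightarrow> has (length us) ds (Some (x, us @ ds @ vs))"
  by (simp add: has_def ty_def lift_append)

lemma ap_Some:
  "\<lbrakk>x \<in> Arr C; Cod C x = lift us (lift ds (lift vs \<I>)); set us \<subseteq> Obj C; set vs \<subseteq> Obj C; vgen ds f cs\<rbrakk>
    \<Longrightarrow> ap (length us) ds f cs (Some (x, us @ ds @ vs))
        = Some (lft us (hat ds f cs (lift vs \<I>)) \<cdot> x, us @ cs @ vs)"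
  by (simp add: ap_def has_Some vgen_def)

lemma ap_None:
  "\<not> has i ds s \<Longrightarrow> ap i ds f cs s = None" "\<not> vgen ds f cs \<Longrightarrow> ap i ds f cs s = None"
  by (auto simp: ap_def)

lemma has_None [simp]: "\<not> has i ds None"
  by (simp add: has_def ty_def)

lemma ap_of_None [simp]: "ap i ds f cs None = None"
  by (simp add: ap_def)

lemma ty_ap:
  "ty (ap i ds f cs s) = (if vgen ds f cs \<and> has i ds s then
     (case ty s of None \<Rightarrow> None | Some xs \<Rightarrow> Some (take i xs @ cs @ drop (i + length ds) xs)) else None)"
proof (cases "vgen ds f cs \<and> has i ds s")
  case True
  then obtain x us vs where *: "s = Some (x, us @ ds @ vs)" "i = length us" "x \<in> Arr C"
    "Cod C x = lift us (lift ds (lift vs \<I>))"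
    "set us \<subseteq> Obj C" "set ds \<subseteq> Obj C" "set vs \<subseteq> Obj C"
    by (blast elim: hasE)
  with True show ?thesis
    by (simp add: ap_Some ty_def lift_append vgen_def [of ds f cs])
qed (auto simp: ap_def ty_def [of None])

text \<open>The generator at \<open>j\<close> replaces \<open>es\<close> by \<open>hs\<close>, so
  everything to its right shifts by the difference of lengths; the subtraction is harmless since
  \<open>i\<close> lies beyond \<open>hs\<close>. If one of the generators does not fit, both sides
  are \<open>None\<close>, which is why no typing hypothesis appears.\<close>

lemma ap_interchange:
  assumes "j + length hs \<le> i"
  shows "ap i ds f cs (ap j es g hs s) = ap j es g hs (ap (i - length hs + length es) ds f cs s)"
proof (cases "vgen ds f cs \<and> vgen es g hs")
  case v: True
  let ?l = "ap i ds f cs (ap j es g hs s)" and ?r = "ap j es g hs (ap (i - length hs + length es) ds f cs s)"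
  have main: "?l = ?r" if s: "s = Some (x, us @ es @ ws @ ds @ vs)" "j = length us" "i = length (us @ hs @ ws)"
      "x \<in> Arr C" "Cod C x = lift (us @ es @ ws @ ds @ vs) \<I>" "set (us @ es @ ws @ ds @ vs) \<subseteq> Obj C"
    for x us ws vs
  proof -
    have o: "set us \<subseteq> Obj C" "set ws \<subseteq> Obj C" "set vs \<subseteq> Obj C" "set es \<subseteq> Obj C" "set ds \<subseteq> Obj C"
        "set cs \<subseteq> Obj C" "set hs \<subseteq> Obj C"
      using s v by (auto simp: vgen_def)
    let ?k = "hat ds f cs (lift vs \<I>)"
    have l1: "ap j es g hs s = Some (lft us (hat es g hs (lift (ws @ ds @ vs) \<I>)) \<cdot> x, us @ hs @ ws @ ds @ vs)"
      using s v o by (simp only:) (rule ap_Some, auto simp: lift_append)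
    have l2: "?l = Some (lft (us @ hs @ ws) ?k \<cdot> (lft us (hat es g hs (lift (ws @ ds @ vs) \<I>)) \<cdot> x), (us @ hs @ ws) @ cs @ vs)"
      using ap_Some [of "lft us (hat es g hs (lift (ws @ ds @ vs) \<I>)) \<cdot> x" "us @ hs @ ws" ds vs f cs] s(3-) v o
      unfolding l1 by (simp add: lift_append)
    have i': "i - length hs + length es = length (us @ es @ ws)"
      using s by simp
    have r1: "ap (i - length hs + length es) ds f cs s = Some (lft (us @ es @ ws) ?k \<cdot> x, (us @ es @ ws) @ cs @ vs)"
      using ap_Some [of x "us @ es @ ws" ds vs f cs] s v o by (simp add: i' lift_append add_ac)
    have r2: "?r = Some (lft us (hat es g hs (lift (ws @ cs @ vs) \<I>)) \<cdot> (lft (us @ es @ ws) ?k \<cdot> x), us @ hs @ ws @ cs @ vs)"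
      using ap_Some [of "lft (us @ es @ ws) ?k \<cdot> x" us es "ws @ cs @ vs" g hs] s(2-) v o
      unfolding r1 by (simp add: lift_append)
    have "lft (us @ hs @ ws) ?k \<cdot> (lft us (hat es g hs (lift (ws @ ds @ vs) \<I>)) \<cdot> x)
        = lft us (lft hs (lft ws ?k) \<cdot> hat es g hs (lift (ws @ ds @ vs) \<I>)) \<cdot> x"
      using s v o by (simp add: lft_append lift_append lft_comp flip: cassoc)
    \<comment> \<open>The generator on the left commutes with everything below its own wires by
      naturality of \<open>hat\<close>.\<close>
    also have "lft hs (lft ws ?k) \<cdot> hat es g hs (lift (ws @ ds @ vs) \<I>)
        = hat es g hs (lift (ws @ cs @ vs) \<I>) \<cdot> lft es (lft ws ?k)"
      using v o by (intro hat_nat [symmetric]) (auto simp: lift_append)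
    also have "lft us \<dots> \<cdot> x = lft us (hat es g hs (lift (ws @ cs @ vs) \<I>)) \<cdot> (lft (us @ es @ ws) ?k \<cdot> x)"
      using s v o by (simp add: lft_append lift_append flip: lft_comp cassoc)
    finally show ?thesis
      by (simp add: l2 r2)
  qed
  show ?thesis
  proof (cases "has j es s \<and> has (i - length hs + length es) ds s")
    case True
    then obtain x us zs where s: "s = Some (x, us @ es @ zs)" "j = length us" "x \<in> Arr C"
        "Cod C x = lift us (lift es (lift zs \<I>))" "set us \<subseteq> Obj C" "set es \<subseteq> Obj C" "set zs \<subseteq> Obj C"
      by (blast elim: hasE)
    obtain x' us' vs where s': "s = Some (x', us' @ ds @ vs)" "i - length hs + length es = length us'"
      using True by (blast elim: hasE)
    obtain ws where "us' = us @ es @ ws"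
    proof -
      have "us @ es @ zs = us' @ ds @ vs" using s s' by simp
      moreover have "length (us @ es) \<le> length us'" using s s' assms by simp
      ultimately have "\<exists>ws. us' = (us @ es) @ ws"
        by (metis append_assoc append_eq_append_conv_if append_take_drop_id)
      then show ?thesis using that by auto
    qed
    with s s' assms show ?thesis
      by (intro main [of x us ws vs]) (auto simp: lift_append)
  next
    case False
    have l: "?l = None"
    proof (cases "has j es s")
      case True
      then obtain us zs where s: "ty s = Some (us @ es @ zs)" "j = length us"
        by (auto elim!: hasE simp: ty_def lift_append)
      have "\<not> has i ds (ap j es g hs s)"
        using True False s v assms by (auto simp: has_def ty_ap drop_append add_ac)
      then show ?thesis by (simp add: ap_None)
    qed (simp add: ap_None)
    have r: "?r = None"
    proof (cases "has (i - length hs + length es) ds s")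
      case True
      then obtain us zs where s: "ty s = Some (us @ ds @ zs)" "i - length hs + length es = length us"
        by (auto elim!: hasE simp: ty_def lift_append)
      have le: "j + length es \<le> length us"
        using s assms by linarith
      have "\<not> has j es (ap (i - length hs + length es) ds f cs s)"
        using True False s v le by (auto simp: has_def ty_ap drop_append take_append)
      then show ?thesis by (simp add: ap_None)
    qed (simp add: ap_None)
    from l r show ?thesis by simp
  qed
qed (auto simp: ap_None)

lemma ap_comp:
  assumes "vgen ds f es" "vgen es g cs"
  shows "ap i es g cs (ap i ds f es s) = ap i ds (g \<cdot> f) cs s"
proof (cases "has i ds s")
  case True
  then obtain x us vs where s: "s = Some (x, us @ ds @ vs)" "i = length us" "x \<in> Arr C"
      "Cod C x = lift us (lift ds (lift vs \<I>))" "set us \<subseteq> Obj C" "set ds \<subseteq> Obj C" "set vs \<subseteq> Obj C"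
    by (blast elim: hasE)
  have v: "vgen ds (g \<cdot> f) cs"
    using assms by (simp add: vgen_def)
  have "hat es g cs X \<cdot> hat ds f es X = hat ds (g \<cdot> f) cs X" if "X \<in> Obj C" for X
    using assms that by (simp add: hat_def vgen_def cassoc tensor_comp_reduce)
  then show ?thesis
    using s assms v by (simp add: ap_Some lft_comp flip: cassoc)
qed (simp add: ap_None)

lemma ap_id: "has i ds s \<Longrightarrow> ap i ds (\<one> (tob ds)) ds s = s"
proof (erule hasE)
  fix x us vs
  assume s: "s = Some (x, us @ ds @ vs)" "i = length us" "x \<in> Arr C"
      "Cod C x = lift us (lift ds (lift vs \<I>))" "set us \<subseteq> Obj C" "set ds \<subseteq> Obj C" "set vs \<subseteq> Obj C"
  have "hat ds (\<one> (tob ds)) ds X = \<one> (lift ds X)" if "X \<in> Obj C" for X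
    using s that by (simp add: hat_def)
  then show "ap i ds (\<one> (tob ds)) ds s = s"
    using s by (simp add: ap_Some lft_ident vgen_def)
qed

text \<open>Naturality of the associator separates the two factors. When the wires do not match,
  both sides are undefined.\<close>

lemma ap_tensor:
  assumes "f \<in> Arr C" "g \<in> Arr C"
    and "Dom C f = A" "Dom C g = B" "Cod C f = A'" "Cod C g = B'"
  shows "ap i [A, B] (f \<otimes> g) [A', B'] s = ap i [A] f [A'] (ap (Suc i) [B] g [B'] s)"
proof (cases "has i [A, B] s")
  case True
  then obtain x us vs where s: "s = Some (x, us @ [A, B] @ vs)" "i = length us" "x \<in> Arr C"
      "Cod C x = lift us (lift [A, B] (lift vs \<I>))" "set us \<subseteq> Obj C" "set [A, B] \<subseteq> Obj C" "set vs \<subseteq> Obj C"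
    by (blast elim: hasE)
  have o: "A' \<in> Obj C" "B' \<in> Obj C"
    using assms cod_obj by auto
  let ?X = "lift vs \<I>"
  have h: "hat [A, B] (f \<otimes> g) [A', B'] ?X = hat [A] f [A'] (B' \<odot> ?X) \<cdot> (\<one> A \<otimes> hat [B] g [B'] ?X)"
  proof -
    have "hat [A, B] (f \<otimes> g) [A', B'] ?X = (\<alpha> A' B' ?X \<cdot> ((f \<otimes> g) \<otimes> \<one> ?X)) \<cdot> (\<alpha> A B ?X)\<dagger>"
      using s assms o by (simp add: hat_def cassoc)
    also have "\<dots> = ((f \<otimes> (g \<otimes> \<one> ?X)) \<cdot> \<alpha> A B ?X) \<cdot> (\<alpha> A B ?X)\<dagger>"
      using s assms o by (simp add: assoc_nat)
    finally show ?thesis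
      using s assms o by (simp add: hat_def cassoc tensor_comp')
  qed
  have 1: "ap (Suc i) [B] g [B'] s = Some (lft (us @ [A]) (hat [B] g [B'] ?X) \<cdot> x, (us @ [A]) @ [B'] @ vs)"
    using ap_Some [of x "us @ [A]" "[B]" vs g "[B']"] s assms o by (simp add: vgen_def lift_append)
  have 2: "ap i [A] f [A'] (ap (Suc i) [B] g [B'] s)
      = Some (lft us (hat [A] f [A'] (B' \<odot> ?X)) \<cdot> (lft (us @ [A]) (hat [B] g [B'] ?X) \<cdot> x), us @ [A'] @ B' # vs)"
    using ap_Some [of "lft (us @ [A]) (hat [B] g [B'] ?X) \<cdot> x" us "[A]" "B' # vs" f "[A']"] s(2-) assms o
    unfolding 1 by (simp add: vgen_def lift_append)
  have 3: "ap i [A, B] (f \<otimes> g) [A', B'] s = Some (lft us (hat [A, B] (f \<otimes> g) [A', B'] ?X) \<cdot> x, us @ [A', B'] @ vs)"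
    unfolding s(1,2) using s assms o by (intro ap_Some) (auto simp: vgen_def)
  show ?thesis
    unfolding 2 3 h using s assms o
    by (simp add: lft_append vgen_def flip: cassoc) (simp add: lft_comp vgen_def)
next
  case False
  have "ap (Suc i) [B] g [B'] s = None \<or> \<not> has i [A] (ap (Suc i) [B] g [B'] s)"
  proof (cases "has (Suc i) [B] s")
    case True
    then obtain us vs where t: "ty s = Some (us @ [B] @ vs)" "Suc i = length us"
      by (auto elim!: hasE simp: ty_def lift_append)
    obtain us' A'' where us: "us = us' @ [A'']" "length us' = i"
      using t(2) by (metis append_butlast_last_id diff_Suc_1 length_0_conv length_butlast nat.distinct(1))
    show ?thesis
      using t us False by (auto simp: has_def ty_ap)
  qed (simp add: ap_None)
  with False show ?thesis
    by (auto simp: ap_None)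
qed

text \<open>By the pentagon an associator does nothing to the wires: it splits one pair and merges
  the next one.\<close>

lemma ap_assoc:
  assumes "A \<in> Obj C" "B \<in> Obj C" "D \<in> Obj C"
  shows "ap i [A \<odot> B, D] (\<alpha> A B D) [A, B \<odot> D] s
    = ap (Suc i) [B, D] (\<one> (B \<odot> D)) [B \<odot> D] (ap i [A \<odot> B] (\<one> (A \<odot> B)) [A, B] s)"
proof (cases "has i [A \<odot> B, D] s")
  case True
  then obtain x us vs where s: "s = Some (x, us @ [A \<odot> B, D] @ vs)" "i = length us" "x \<in> Arr C"
      "Cod C x = lift us (lift [A \<odot> B, D] (lift vs \<I>))" "set us \<subseteq> Obj C" "set vs \<subseteq> Obj C"
    by (blast elim: hasE)
  let ?X = "lift vs \<I>"
  have h: "hat [A \<odot> B, D] (\<alpha> A B D) [A, B \<odot> D] ?X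
      = (\<one> A \<otimes> hat [B, D] (\<one> (B \<odot> D)) [B \<odot> D] ?X) \<cdot> hat [A \<odot> B] (\<one> (A \<odot> B)) [A, B] (D \<odot> ?X)"
  proof -
    have "(\<one> A \<otimes> (\<alpha> B D ?X)\<dagger>) \<cdot> ((\<one> A \<otimes> \<alpha> B D ?X) \<cdot> \<alpha> A (B \<odot> D) ?X \<cdot> (\<alpha> A B D \<otimes> \<one> ?X)) \<cdot> (\<alpha> (A \<odot> B) D ?X)\<dagger>
        = (\<one> A \<otimes> (\<alpha> B D ?X)\<dagger>) \<cdot> \<alpha> A B (D \<odot> ?X)"
      using s assms by (simp only: pentagon obj_lift unit_obj) (simp add: cassoc)
    then show ?thesis
      using s assms by (simp add: hat_def cassoc tensor_comp_reduce)
  qed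
  have 1: "ap i [A \<odot> B] (\<one> (A \<odot> B)) [A, B] s
      = Some (lft us (hat [A \<odot> B] (\<one> (A \<odot> B)) [A, B] (D \<odot> ?X)) \<cdot> x, us @ [A, B] @ D # vs)"
    using ap_Some [of x us "[A \<odot> B]" "D # vs" "\<one> (A \<odot> B)" "[A, B]"] s assms by (simp add: vgen_def)
  show ?thesis
    unfolding 1 using ap_Some [of "lft us (hat [A \<odot> B] (\<one> (A \<odot> B)) [A, B] (D \<odot> ?X)) \<cdot> x" "us @ [A]" "[B, D]" vs "\<one> (B \<odot> D)" "[B \<odot> D]"]
      ap_Some [of x us "[A \<odot> B, D]" vs "\<alpha> A B D" "[A, B \<odot> D]"] s assms
    by (simp add: vgen_def lift_append lft_append h lft_comp flip: cassoc)
next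
  case False
  have "\<not> has (Suc i) [B, D] (ap i [A \<odot> B] (\<one> (A \<odot> B)) [A, B] s)"
  proof (cases "has i [A \<odot> B] s")
    case True
    then obtain us vs where "ty s = Some (us @ [A \<odot> B] @ vs)" "i = length us"
      by (auto elim!: hasE simp: ty_def lift_append)
    then show ?thesis
      using False by (cases vs) (auto simp: has_def ty_ap)
  qed (simp add: ap_None)
  with False show ?thesis
    by (auto simp: ap_None)
qed

text \<open>Both unitors become deletion of a unit wire. The left case rests on
  \<open>lunit_tensor\<close>, the right one on the triangle axiom.\<close>

lemma ap_lunit:
  assumes "A \<in> Obj C"
  shows "has i [\<I>, A] s \<Longrightarrow> ap i [\<I>, A] (\<Lambda> A) [A] s = ap i [\<I>] (\<one> \<I>) [] s"
    and "has i [A, \<I>] s \<Longrightarrow> ap i [A, \<I>] (\<rho> A) [A] s = ap (Suc i) [\<I>] (\<one> \<I>) [] s"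
proof -
  assume "has i [\<I>, A] s"
  then obtain x us vs where s: "s = Some (x, us @ [\<I>, A] @ vs)" "i = length us" "x \<in> Arr C"
      "Cod C x = lift us (lift [\<I>, A] (lift vs \<I>))" "set us \<subseteq> Obj C" "set vs \<subseteq> Obj C"
    by (blast elim: hasE)
  let ?X = "lift vs \<I>"
  have "hat [\<I>, A] (\<Lambda> A) [A] ?X = hat [\<I>] (\<one> \<I>) [] (A \<odot> ?X)"
    using s assms by (simp add: hat_def cassoc lunit_tensor [symmetric])
  then show "ap i [\<I>, A] (\<Lambda> A) [A] s = ap i [\<I>] (\<one> \<I>) [] s"
    using ap_Some [of x us "[\<I>]" "A # vs" "\<one> \<I>" "[]"]
      ap_Some [of x us "[\<I>, A]" vs "\<Lambda> A" "[A]"] s assms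
    by (simp add: vgen_def)
next
  assume "has i [A, \<I>] s"
  then obtain x us vs where s: "s = Some (x, us @ [A, \<I>] @ vs)" "i = length us" "x \<in> Arr C"
      "Cod C x = lift us (lift [A, \<I>] (lift vs \<I>))" "set us \<subseteq> Obj C" "set vs \<subseteq> Obj C"
    by (blast elim: hasE)
  let ?X = "lift vs \<I>"
  have "hat [A, \<I>] (\<rho> A) [A] ?X = \<one> A \<otimes> hat [\<I>] (\<one> \<I>) [] ?X"
    using s assms by (simp add: hat_def triangle [symmetric] cassoc)
  then show "ap i [A, \<I>] (\<rho> A) [A] s = ap (Suc i) [\<I>] (\<one> \<I>) [] s"
    using ap_Some [of x "us @ [A]" "[\<I>]" vs "\<one> \<I>" "[]"]
      ap_Some [of x us "[A, \<I>]" vs "\<rho> A" "[A]"] s assms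
    by (simp add: vgen_def lift_append lft_append)
qed

definition init :: "'o list \<Rightarrow> ('a \<times> 'o list) option" where
  "init xs = Some (\<one> (lift xs \<I>), xs)"

lemma ty_init [simp]: "set xs \<subseteq> Obj C \<Longrightarrow> ty (init xs) = Some xs"
  by (simp add: init_def ty_def)

text \<open>The arrow of the state has a right inverse, so an equation tested on the state can be
  cancelled.\<close>

definition epi :: "('a \<times> 'o list) option \<Rightarrow> bool" where
  "epi s \<longleftrightarrow> (\<exists>x xs y. s = Some (x, xs) \<and> x \<in> Arr C \<and> y \<in> Arr C \<and> Dom C y = Cod C x \<and>
     Cod C y = Dom C x \<and> x \<cdot> y = \<one> (Cod C x))"

lemma epi_init [simp]: "set xs \<subseteq> Obj C \<Longrightarrow> epi (init xs)"
  unfolding epi_def init_def by (auto intro!: exI [of _ "\<one> (lift xs \<I>)"])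

lemma epi_ap:
  assumes "epi s" "has i ds s" "vgen ds f cs" "g \<in> Arr C" "Dom C g = tob cs" "Cod C g = tob ds"
    "f \<cdot> g = \<one> (tob cs)"
  shows "epi (ap i ds f cs s)"
proof -
  from assms obtain x us vs where s: "s = Some (x, us @ ds @ vs)" "i = length us" "x \<in> Arr C"
      "Cod C x = lift us (lift ds (lift vs \<I>))" "set us \<subseteq> Obj C" "set ds \<subseteq> Obj C" "set vs \<subseteq> Obj C"
    by (blast elim: hasE)
  from assms(1) s(1) obtain y where y: "y \<in> Arr C" "Dom C y = Cod C x" "Cod C y = Dom C x" "x \<cdot> y = \<one> (Cod C x)"
    by (auto simp: epi_def)
  let ?X = "lift vs \<I>"
  have v: "vgen cs g ds"
    using assms by (simp add: vgen_def)
  have h: "hat ds f cs ?X \<cdot> hat cs g ds ?X = \<one> (lift cs ?X)"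
    using assms s by (simp add: hat_def vgen_def cassoc tensor_comp_reduce)
  let ?f = "lft us (hat ds f cs ?X)" and ?g = "lft us (hat cs g ds ?X)"
  have fg: "?f \<cdot> ?g = \<one> (lift us (lift cs ?X))"
    using h s assms v by (simp add: lft_comp lft_ident vgen_def)
  have "(?f \<cdot> x) \<cdot> (y \<cdot> ?g) = ?f \<cdot> (x \<cdot> y) \<cdot> ?g"
    using s assms v y(1-3) by (simp add: cassoc)
  also have "\<dots> = \<one> (lift us (lift cs ?X))"
    using s assms v y fg by simp
  finally have "(?f \<cdot> x) \<cdot> (y \<cdot> ?g) = \<one> (lift us (lift cs ?X))" .
  then show ?thesis
    unfolding epi_def using s assms v y
    by (intro exI [of _ "?f \<cdot> x"] exI [of _ "us @ cs @ vs"] exI [of _ "y \<cdot> ?g"]) (simp add: ap_Some)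
qed

text \<open>The way back from words to arrows: the right inverse removes the test state, and
  naturality of the right unitor removes the trailing unit.\<close>

lemma ap_faithful:
  assumes "ap 0 [A] f [B] s = ap 0 [A] g [B] s" "epi s" "ty s = Some [A]"
    and "f \<in> Arr C" "g \<in> Arr C" "Dom C f = A" "Dom C g = A" "Cod C f = B" "Cod C g = B"
  shows "f = g"
proof -
  obtain x y where s: "s = Some (x, [A])" "x \<in> Arr C" "y \<in> Arr C" "Dom C y = Cod C x"
      "Cod C y = Dom C x" "x \<cdot> y = \<one> (Cod C x)" "Cod C x = A \<odot> \<I>" "A \<in> Obj C"
    using assms(2,3) by (auto simp: epi_def ty_def split: if_splits)
  have B: "B \<in> Obj C"
    using assms cod_obj by auto
  have "(f \<otimes> \<one> \<I>) \<cdot> x = (g \<otimes> \<one> \<I>) \<cdot> x"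
    using assms s B ap_Some [of x "[]" "[A]" "[]"] by (simp add: vgen_def hat_def)
  then have "((f \<otimes> \<one> \<I>) \<cdot> x) \<cdot> y = ((g \<otimes> \<one> \<I>) \<cdot> x) \<cdot> y"
    by simp
  then have "f \<otimes> \<one> \<I> = g \<otimes> \<one> \<I>"
    using s assms by (simp add: cassoc)
  then have "f \<cdot> \<rho> A = g \<cdot> \<rho> A"
    using s assms by (simp add: runit_nat)
  then show ?thesis
    by (rule epi_cancel [OF _ runit_unitary]) (use s assms in auto)
qed

end

section \<open>Splitting and merging wires, and words for structural arrows\<close>

context dagger_symmetric_monoidal_category
begin

text \<open>The first four operations are identities of \<open>C\<close> read with different source
  and target lists; only \<open>sw\<close> moves anything.\<close>

abbreviation "mg i A B \<equiv> ap i [A, B] (\<one> (A \<odot> B)) [A \<odot> B]"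
abbreviation "sp i A B \<equiv> ap i [A \<odot> B] (\<one> (A \<odot> B)) [A, B]"
abbreviation "dI i \<equiv> ap i [\<I>] (\<one> \<I>) []"
abbreviation "nI i \<equiv> ap i [] (\<one> \<I>) [\<I>]"
abbreviation "sw i A B \<equiv> ap i [A, B] (\<sigma> A B) [B, A]"

lemma has_ty:
  assumes "has i ds s"
  obtains us vs where "ty s = Some (us @ ds @ vs)" "i = length us" "set ds \<subseteq> Obj C"
  using assms by (auto elim!: hasE simp: ty_def lift_append)

lemma ty_ap_eval: "ty (ap i ds f cs s) = (case ty s of None \<Rightarrow> None | Some xs \<Rightarrow>
    if vgen ds f cs \<and> i + length ds \<le> length xs \<and> take (length ds) (drop i xs) = ds
    then Some (take i xs @ cs @ drop (i + length ds) xs) else None)"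
  by (auto simp: ty_ap has_def split: option.splits)

lemma ap_interchange':
  assumes "i + length ds \<le> j"
  shows "ap i ds f cs (ap j es g hs s) = ap (j - length ds + length cs) es g hs (ap i ds f cs s)"
  using ap_interchange [of i cs "j - length ds + length cs" es g hs ds f s] assms by simp

text \<open>Unfolding these computes the wire list of a word, which discharges the
  \<open>has\<close> conditions of the rewrite rules.\<close>

lemmas calc = has_def ty_ap_eval vgen_def

lemma ap_cancel:
  assumes "has i ds s" "vgen ds f cs" "vgen cs g ds" "g \<cdot> f = \<one> (tob ds)"
  shows "ap i cs g ds (ap i ds f cs s) = s"
  using assms by (simp add: ap_comp ap_id)

lemma sp_mg [simp]: "has i [A, B] s \<Longrightarrow> sp i A B (mg i A B s) = s"
  by (erule has_ty) (simp add: ap_cancel calc)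

lemma mg_sp [simp]: "has i [A \<odot> B] s \<Longrightarrow> A \<in> Obj C \<Longrightarrow> B \<in> Obj C \<Longrightarrow> mg i A B (sp i A B s) = s"
  by (erule has_ty) (simp add: ap_cancel calc)

lemma nI_dI [simp]: "has i [\<I>] s \<Longrightarrow> nI i (dI i s) = s"
  by (erule has_ty) (simp add: ap_cancel calc)

lemma dI_nI [simp]: "has i [] s \<Longrightarrow> dI i (nI i s) = s"
  by (erule has_ty) (simp add: ap_cancel calc)

lemma sw_sw [simp]: "has i [A, B] s \<Longrightarrow> sw i B A (sw i A B s) = s"
  by (erule has_ty) (simp add: ap_cancel calc sym_sym)

lemma ap_expand_comp:
  assumes "f \<in> Arr C" "g \<in> Arr C" "Cod C f = Dom C g"
  shows "ap i ds (g \<cdot> f) cs s = ap i [Dom C g] g cs (ap i ds f [Dom C g] s)"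
  using assms ap_comp [of ds f "[Dom C g]" g cs i s] dom_obj [of g]
  by (cases "vgen ds f [Dom C g]"; cases "vgen [Dom C g] g cs") (auto simp: vgen_def [of _ "g \<cdot> f"] ap_None vgen_def)

lemma ap_in_split:
  assumes "A \<in> Obj C" "B \<in> Obj C"
  shows "ap i [A \<odot> B] f cs s = ap i [A, B] f cs (sp i A B s)"
  using assms ap_comp [of "[A \<odot> B]" "\<one> (A \<odot> B)" "[A, B]" f cs i s]
  by (cases "vgen [A \<odot> B] f cs") (auto simp: vgen_def ap_None)

lemma ap_out_split:
  assumes "A \<in> Obj C" "B \<in> Obj C"
  shows "ap i ds f [A \<odot> B] s = mg i A B (ap i ds f [A, B] s)"
  using assms ap_comp [of ds f "[A, B]" "\<one> (A \<odot> B)" "[A \<odot> B]" i s]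
  by (cases "vgen ds f [A \<odot> B]") (auto simp: vgen_def ap_None)

lemma ap_in_unit: "ap i [\<I>] f cs s = ap i [] f cs (dI i s)"
  using ap_comp [of "[\<I>]" "\<one> \<I>" "[]" f cs i s]
  by (cases "vgen [\<I>] f cs") (auto simp: vgen_def ap_None)

lemma ap_out_unit: "ap i ds f [\<I>] s = nI i (ap i ds f [] s)"
  using ap_comp [of ds f "[]" "\<one> \<I>" "[\<I>]" i s]
  by (cases "vgen ds f [\<I>]") (auto simp: vgen_def ap_None)

lemma ap_id_single [simp]: "has i [A] s \<Longrightarrow> ap i [A] (\<one> A) [A] s = s"
  using ap_id [of i "[A]" s] by simp

lemma ap_tensor_id:
  assumes "f \<in> Arr C" "Dom C f = A" "Cod C f = A'" "B \<in> Obj C"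
  shows "has i [A, B] s \<Longrightarrow> ap i [A, B] (f \<otimes> \<one> B) [A', B] s = ap i [A] f [A'] s"
    and "has i [B, A] s \<Longrightarrow> ap i [B, A] (\<one> B \<otimes> f) [B, A'] s = ap (Suc i) [A] f [A'] s"
  using assms dom_obj [of f] cod_obj [of f]
  by (elim has_ty, simp add: ap_tensor calc)+

lemma ap_expand_tensor:
  assumes "f \<in> Arr C" "g \<in> Arr C" "X = Dom C f \<odot> Dom C g" "Y = Cod C f \<odot> Cod C g"
  shows "ap i [X] (f \<otimes> g) [Y] s
    = mg i (Cod C f) (Cod C g) (ap i [Dom C f] f [Cod C f] (ap (Suc i) [Dom C g] g [Cod C g]
        (sp i (Dom C f) (Dom C g) s)))"
  using assms dom_obj [of f] cod_obj [of f] dom_obj [of g] cod_obj [of g]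
  by (subst assms, subst assms, subst ap_in_split, simp, simp, subst ap_out_split, simp, simp)
    (simp add: ap_tensor)

lemma ap_expand_tensor_id:
  assumes "f \<in> Arr C" "B \<in> Obj C"
  shows "X = Dom C f \<odot> B \<Longrightarrow> Y = Cod C f \<odot> B \<Longrightarrow> ap i [X] (f \<otimes> \<one> B) [Y] s
      = mg i (Cod C f) B (ap i [Dom C f] f [Cod C f] (sp i (Dom C f) B s))"
    and "X = B \<odot> Dom C f \<Longrightarrow> Y = B \<odot> Cod C f \<Longrightarrow> ap i [X] (\<one> B \<otimes> f) [Y] s
      = mg i B (Cod C f) (ap (Suc i) [Dom C f] f [Cod C f] (sp i B (Dom C f) s))"
proof -
  assume X: "X = Dom C f \<odot> B" "Y = Cod C f \<odot> B"
  show "ap i [X] (f \<otimes> \<one> B) [Y] s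
      = mg i (Cod C f) B (ap i [Dom C f] f [Cod C f] (sp i (Dom C f) B s))"
  proof (cases "has i [X] s")
    case True
    with assms X dom_obj [of f] cod_obj [of f] show ?thesis
      by (elim has_ty) (auto simp: ap_expand_tensor calc)
  qed (simp add: ap_None X)
next
  assume X: "X = B \<odot> Dom C f" "Y = B \<odot> Cod C f"
  show "ap i [X] (\<one> B \<otimes> f) [Y] s
      = mg i B (Cod C f) (ap (Suc i) [Dom C f] f [Cod C f] (sp i B (Dom C f) s))"
  proof (cases "has i [X] s")
    case True
    with assms X dom_obj [of f] cod_obj [of f] show ?thesis
      by (elim has_ty) (auto simp: ap_expand_tensor calc)
  qed (simp add: ap_None X)
qed

lemma ap_expand_sym:
  assumes "A \<in> Obj C" "B \<in> Obj C"
  shows "ap i [A \<odot> B] (\<sigma> A B) [B \<odot> A] s = mg i B A (sw i A B (sp i A B s))"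
  using assms by (subst ap_in_split, simp, simp, subst ap_out_split, simp, simp) (rule refl)

lemma ap_expand_assoc:
  assumes "A \<in> Obj C" "B \<in> Obj C" "D \<in> Obj C"
  shows "ap i [(A \<odot> B) \<odot> D] (\<alpha> A B D) [A \<odot> (B \<odot> D)] s
      = mg i A (B \<odot> D) (mg (Suc i) B D (sp i A B (sp i (A \<odot> B) D s)))"
  using assms
  by (subst ap_in_split, simp, simp, subst ap_out_split, simp, simp, simp add: ap_assoc)

text \<open>Obtained by inverting the expansion of the associator: applying the associator
  afterwards gives back \<open>s\<close>, and the splits and merges then cancel.\<close>

lemma ap_expand_assoc_dagger:
  assumes "A \<in> Obj C" "B \<in> Obj C" "D \<in> Obj C"
  shows "ap i [A \<odot> (B \<odot> D)] ((\<alpha> A B D)\<dagger>) [(A \<odot> B) \<odot> D] s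
      = mg i (A \<odot> B) D (mg i A B (sp (Suc i) B D (sp i A (B \<odot> D) s)))"
proof (cases "has i [A \<odot> (B \<odot> D)] s")
  case True
  let ?t = "ap i [A \<odot> (B \<odot> D)] ((\<alpha> A B D)\<dagger>) [(A \<odot> B) \<odot> D] s"
  have t: "has i [(A \<odot> B) \<odot> D] ?t"
    using True assms by (elim has_ty) (auto simp: calc)
  have "ap i [(A \<odot> B) \<odot> D] (\<alpha> A B D) [A \<odot> (B \<odot> D)] ?t = s"
    using True assms by (intro ap_cancel) (auto simp: vgen_def)
  then have "s = mg i A (B \<odot> D) (mg (Suc i) B D (sp i A B (sp i (A \<odot> B) D ?t)))"
    using assms by (simp add: ap_expand_assoc)
  moreover from t have "mg i (A \<odot> B) D (mg i A B (sp (Suc i) B D (sp i A (B \<odot> D)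
      (mg i A (B \<odot> D) (mg (Suc i) B D (sp i A B (sp i (A \<odot> B) D ?t))))))) = ?t"
    using assms by (elim has_ty) (simp add: calc)
  ultimately show ?thesis
    by simp
qed (simp add: ap_None)

lemma ap_expand_lunit:
  assumes "A \<in> Obj C"
  shows "ap i [\<I> \<odot> A] (\<Lambda> A) [A] s = dI i (sp i \<I> A s)"
proof (cases "has i [\<I> \<odot> A] s")
  case True
  with assms show ?thesis
    by (subst ap_in_split, simp, simp, subst ap_lunit) (simp, elim has_ty, auto simp: calc)
qed (simp add: ap_None)

lemma ap_expand_runit:
  assumes "A \<in> Obj C"
  shows "ap i [A \<odot> \<I>] (\<rho> A) [A] s = dI (Suc i) (sp i A \<I> s)"
proof (cases "has i [A \<odot> \<I>] s")
  case True
  with assms show ?thesis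
    by (subst ap_in_split, simp, simp, subst ap_lunit) (simp, elim has_ty, auto simp: calc)
qed (simp add: ap_None)

lemma ap_expand_lunit_dagger:
  assumes "A \<in> Obj C" "has i [A] s"
  shows "ap i [A] ((\<Lambda> A)\<dagger>) [\<I> \<odot> A] s = mg i \<I> A (nI i s)"
proof -
  let ?t = "ap i [A] ((\<Lambda> A)\<dagger>) [\<I> \<odot> A] s"
  have t: "has i [\<I> \<odot> A] ?t"
    using assms by (elim has_ty) (auto simp: calc)
  have "ap i [\<I> \<odot> A] (\<Lambda> A) [A] ?t = s"
    using assms by (intro ap_cancel) (auto simp: vgen_def)
  then have "s = dI i (sp i \<I> A ?t)"
    using assms by (simp add: ap_expand_lunit)
  moreover from t have "mg i \<I> A (nI i (dI i (sp i \<I> A ?t))) = ?t"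
    using assms by (elim has_ty) (simp add: calc)
  ultimately show ?thesis
    by simp
qed

lemma ap_expand_runit_dagger:
  assumes "A \<in> Obj C" "has i [A] s"
  shows "ap i [A] ((\<rho> A)\<dagger>) [A \<odot> \<I>] s = mg i A \<I> (nI (Suc i) s)"
proof -
  let ?t = "ap i [A] ((\<rho> A)\<dagger>) [A \<odot> \<I>] s"
  have t: "has i [A \<odot> \<I>] ?t"
    using assms by (elim has_ty) (auto simp: calc)
  have "ap i [A \<odot> \<I>] (\<rho> A) [A] ?t = s"
    using assms by (intro ap_cancel) (auto simp: vgen_def)
  then have "s = dI (Suc i) (sp i A \<I> ?t)"
    using assms by (simp add: ap_expand_runit)
  moreover from t have "mg i A \<I> (nI (Suc i) (dI (Suc i) (sp i A \<I> ?t))) = ?t"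
    using assms by (elim has_ty) (simp add: calc)
  ultimately show ?thesis
    by simp
qed

end

section \<open>The symmetry as crossing of wires\<close>

context dagger_symmetric_monoidal_category
begin

text \<open>The hexagon read on wires: crossing a merged pair is crossing its members in
  turn.\<close>

lemma sw_merge_right:
  assumes "has i [A, B, D] s"
  shows "sw i A (B \<odot> D) (mg (Suc i) B D s) = mg i B D (sw (Suc i) A D (sw i A B s))"
proof -
  from assms obtain us vs where s [simp]: "ty s = Some (us @ [A, B, D] @ vs)" "i = length us"
      and o [simp]: "A \<in> Obj C" "B \<in> Obj C" "D \<in> Obj C"
    by (auto elim: has_ty)
  let ?s = "mg i (A \<odot> B) D (mg i A B s)"
  have "ap i [(A \<odot> B) \<odot> D] (\<alpha> B D A \<cdot> \<sigma> A (B \<odot> D) \<cdot> \<alpha> A B D) [B \<odot> (D \<odot> A)] ?s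
      = ap i [(A \<odot> B) \<odot> D] ((\<one> B \<otimes> \<sigma> A D) \<cdot> \<alpha> B A D \<cdot> (\<sigma> A B \<otimes> \<one> D)) [B \<odot> (D \<odot> A)] ?s"
    by (simp add: hexagon)
  then have "mg i B (D \<odot> A) (mg (Suc i) D A (sp i B D (sw i A (B \<odot> D) (mg (Suc i) B D s))))
      = mg i B (D \<odot> A) (mg (Suc i) D A (sw (Suc i) A D (sw i A B s)))"
    by (simp add: ap_expand_comp ap_expand_assoc ap_expand_sym ap_expand_tensor_id calc)
  then have "mg i B D (sp (Suc i) D A (sp i B (D \<odot> A) (mg i B (D \<odot> A) (mg (Suc i) D A
        (sp i B D (sw i A (B \<odot> D) (mg (Suc i) B D s)))))))
      = mg i B D (sp (Suc i) D A (sp i B (D \<odot> A) (mg i B (D \<odot> A) (mg (Suc i) D A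
        (sw (Suc i) A D (sw i A B s))))))"
    by simp
  then show ?thesis
    by (simp add: calc)
qed

text \<open>The previous law for the inverse crossing, since \<open>\<sigma>\<close> is its own
  inverse.\<close>

lemma sw_merge_left:
  assumes "has i [A, B, D] s"
  shows "sw i (A \<odot> B) D (mg i A B s) = mg (Suc i) A B (sw i A D (sw (Suc i) B D s))"
proof -
  from assms obtain us vs where s [simp]: "ty s = Some (us @ [A, B, D] @ vs)" "i = length us"
      and o [simp]: "A \<in> Obj C" "B \<in> Obj C" "D \<in> Obj C"
    by (auto elim: has_ty)
  let ?t = "sw i A D (sw (Suc i) B D s)"
  have "sw i D (A \<odot> B) (mg (Suc i) A B ?t) = mg i A B (sw (Suc i) D B (sw i D A ?t))"
    by (rule sw_merge_right) (simp add: calc)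
  also have "\<dots> = mg i A B s"
    by (simp add: calc)
  finally have "sw i (A \<odot> B) D (mg i A B s) = sw i (A \<odot> B) D (sw i D (A \<odot> B) (mg (Suc i) A B ?t))"
    by simp
  then show ?thesis
    by (simp add: calc)
qed

lemma sw_nat:
  assumes "f \<in> Arr C" "Dom C f = A" "Cod C f = A'" "B \<in> Obj C"
  shows "has i [A, B] s \<Longrightarrow> sw i A' B (ap i [A] f [A'] s) = ap (Suc i) [A] f [A'] (sw i A B s)"
    and "has i [B, A] s \<Longrightarrow> sw i B A' (ap (Suc i) [A] f [A'] s) = ap i [A] f [A'] (sw i B A s)"
proof -
  have o: "A \<in> Obj C" "A' \<in> Obj C"
    using assms dom_obj cod_obj by auto
  {
    assume "has i [A, B] s"
    then obtain us vs where s [simp]: "ty s = Some (us @ [A, B] @ vs)" "i = length us"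
      by (rule has_ty)
    have "sw i A' B (ap i [A, B] (f \<otimes> \<one> B) [A', B] s) = ap i [B, A] (\<one> B \<otimes> f) [B, A'] (sw i A B s)"
      using assms o sym_nat [of f "\<one> B"] by (simp add: ap_comp vgen_def)
    then show "sw i A' B (ap i [A] f [A'] s) = ap (Suc i) [A] f [A'] (sw i A B s)"
      using assms o by (simp add: ap_tensor_id calc)
  next
    assume "has i [B, A] s"
    then obtain us vs where s [simp]: "ty s = Some (us @ [B, A] @ vs)" "i = length us"
      by (rule has_ty)
    have "sw i B A' (ap i [B, A] (\<one> B \<otimes> f) [B, A'] s) = ap i [A, B] (f \<otimes> \<one> B) [A', B] (sw i B A s)"
      using assms o sym_nat [of "\<one> B" f] by (simp add: ap_comp vgen_def)
    then show "sw i B A' (ap (Suc i) [A] f [A'] s) = ap i [A] f [A'] (sw i B A s)"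
      using assms o by (simp add: ap_tensor_id calc)
  }
qed

text \<open>Naturality gives \<open>\<Lambda> (\<I> \<odot> \<I>) = \<one> \<I> \<otimes> \<Lambda>
  \<I>\<close>. Together with \<open>lunit_tensor\<close> and the triangle this identifies
  \<open>\<Lambda> \<I> \<otimes> \<one> \<I>\<close> with
  \<open>\<rho> \<I> \<otimes> \<one> \<I>\<close>, and tensoring with the unit is faithful.\<close>

lemma lunit_unit: "\<Lambda> \<I> = \<rho> \<I>"
proof -
  have "\<Lambda> \<I> \<cdot> \<Lambda> (\<I> \<odot> \<I>) = \<Lambda> \<I> \<cdot> (\<one> \<I> \<otimes> \<Lambda> \<I>)"
    by (simp add: lunit_nat)
  then have "\<Lambda> (\<I> \<odot> \<I>) = \<one> \<I> \<otimes> \<Lambda> \<I>"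
    by (rule mono_cancel [OF _ lunit_unitary]) auto
  then have "\<Lambda> \<I> \<otimes> \<one> \<I> = \<rho> \<I> \<otimes> \<one> \<I>"
    using lunit_tensor [of \<I> \<I>] triangle [of \<I> \<I>] by simp
  then have "\<Lambda> \<I> \<cdot> \<rho> (\<I> \<odot> \<I>) = \<rho> \<I> \<cdot> \<rho> (\<I> \<odot> \<I>)"
    by (simp add: runit_nat)
  then show ?thesis
    by (rule epi_cancel [OF _ runit_unitary]) auto
qed

lemma dI_dI: "has i [\<I>, \<I>] s \<Longrightarrow> dI (Suc i) s = dI i s"
  using ap_lunit [of \<I> i s] by (simp add: lunit_unit)

text \<open>Compatibility of the symmetry with the unit is derived from the hexagon: a wire crosses
  a doubled unit, one copy of which is deleted before or after the crossing.\<close>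

lemma sw_dI:
  assumes "has i [A, \<I>] s"
  shows "dI i (sw i A \<I> s) = dI (Suc i) s"
proof -
  from assms obtain us vs where s [simp]: "ty s = Some (us @ [A, \<I>] @ vs)" "i = length us"
      and o [simp]: "A \<in> Obj C"
    by (auto elim: has_ty)
  \<comment> \<open>The wires are now \<open>A\<close>, \<open>\<I>\<close>, \<open>\<I>\<close>:
    the first unit is inserted, the second is the given one.\<close>
  let ?s = "sw i \<I> A (nI i s)"
  have "sw i A \<I> (ap (Suc i) [\<I> \<odot> \<I>] (\<Lambda> \<I>) [\<I>] (mg (Suc i) \<I> \<I> ?s))
      = ap i [\<I> \<odot> \<I>] (\<Lambda> \<I>) [\<I>] (sw i A (\<I> \<odot> \<I>) (mg (Suc i) \<I> \<I> ?s))"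
    by (rule sw_nat) (auto simp: calc)
  also have "sw i A (\<I> \<odot> \<I>) (mg (Suc i) \<I> \<I> ?s) = mg i \<I> \<I> (sw (Suc i) A \<I> (sw i A \<I> ?s))"
    by (rule sw_merge_right) (simp add: calc)
  finally have "sw i A \<I> (dI (Suc i) ?s) = dI i (sw (Suc i) A \<I> (sw i A \<I> ?s))"
    by (simp add: ap_expand_lunit calc)
  also have "dI (Suc i) ?s = dI (Suc (Suc i)) ?s"
    by (rule dI_dI [symmetric]) (simp add: calc)
  also have "sw i A \<I> (dI (Suc (Suc i)) ?s) = dI (Suc (Suc i)) (sw i A \<I> ?s)"
    by (simp add: ap_interchange')
  finally have "dI i (dI (Suc (Suc i)) (nI i s)) = dI i (dI i (sw (Suc i) A \<I> (nI i s)))"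
    by (simp add: calc)
  moreover have "dI (Suc (Suc i)) (nI i s) = nI i (dI (Suc i) s)"
    by (simp add: ap_interchange)
  moreover have "sw (Suc i) A \<I> (nI i s) = nI i (sw i A \<I> s)"
    by (simp add: ap_interchange)
  ultimately show ?thesis
    by (simp add: calc)
qed

lemma sw_unit:
  assumes "has i [A] s"
  shows "sw i A \<I> (nI (Suc i) s) = nI i s" and "sw i \<I> A (nI i s) = nI (Suc i) s"
proof -
  from assms obtain us vs where s [simp]: "ty s = Some (us @ [A] @ vs)" "i = length us"
      and o [simp]: "A \<in> Obj C"
    by (auto elim: has_ty)
  have "dI i (sw i A \<I> (nI (Suc i) s)) = dI (Suc i) (nI (Suc i) s)"
    by (rule sw_dI) (simp add: calc)
  then have "nI i (dI i (sw i A \<I> (nI (Suc i) s))) = nI i s"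
    by (simp add: calc)
  then show "sw i A \<I> (nI (Suc i) s) = nI i s"
    by (simp add: calc)
  then have "sw i \<I> A (sw i A \<I> (nI (Suc i) s)) = sw i \<I> A (nI i s)"
    by simp
  then show "sw i \<I> A (nI i s) = nI (Suc i) s"
    by (simp add: calc)
qed


lemma sw_expand_right:
  assumes "B \<in> Obj C" "D \<in> Obj C"
  shows "sw i A (B \<odot> D) s = mg i B D (sw (Suc i) A D (sw i A B (sp (Suc i) B D s)))"
proof (cases "has i [A, B \<odot> D] s")
  case True
  then obtain us vs where s [simp]: "ty s = Some (us @ [A, B \<odot> D] @ vs)" "i = length us"
      and o [simp]: "A \<in> Obj C" by (auto elim: has_ty)
  have "sw i A (B \<odot> D) (mg (Suc i) B D (sp (Suc i) B D s)) = mg i B D (sw (Suc i) A D (sw i A B (sp (Suc i) B D s)))"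
    using assms by (intro sw_merge_right) (simp add: calc)
  then show ?thesis
    using assms by (simp add: calc)
next
  case False
  have "\<not> has i [A, B] (sp (Suc i) B D s)"
  proof (cases "has (Suc i) [B \<odot> D] s")
    case True
    then obtain us vs where t: "ty s = Some (us @ [B \<odot> D] @ vs)" "Suc i = length us"
      by (rule has_ty)
    moreover from t(2) obtain us' A' where "us = us' @ [A']" "length us' = i"
      by (metis append_butlast_last_id diff_Suc_1 length_0_conv length_butlast nat.distinct(1))
    ultimately show ?thesis
      using False by (auto simp: has_def ty_ap_eval)
  qed (simp add: ap_None)
  with False show ?thesis
    by (auto simp: ap_None)
qed

lemma sw_expand_left:
  assumes "A \<in> Obj C" "B \<in> Obj C"
  shows "sw i (A \<odot> B) D s = mg (Suc i) A B (sw i A D (sw (Suc i) B D (sp i A B s)))"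
proof (cases "has i [A \<odot> B, D] s")
  case True
  then obtain us vs where s [simp]: "ty s = Some (us @ [A \<odot> B, D] @ vs)" "i = length us"
      and o [simp]: "D \<in> Obj C" by (auto elim: has_ty)
  have "sw i (A \<odot> B) D (mg i A B (sp i A B s)) = mg (Suc i) A B (sw i A D (sw (Suc i) B D (sp i A B s)))"
    using assms by (intro sw_merge_left) (simp add: calc)
  then show ?thesis
    using assms by (simp add: calc)
next
  case False
  have "\<not> has (Suc i) [B, D] (sp i A B s)"
  proof (cases "has i [A \<odot> B] s")
    case True
    then obtain us vs where "ty s = Some (us @ [A \<odot> B] @ vs)" "i = length us"
      by (rule has_ty)
    then show ?thesis
      using False by (cases vs) (auto simp: has_def ty_ap_eval)
  qed (simp add: ap_None)
  with False show ?thesis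
    by (auto simp: ap_None)
qed

text \<open>Naturality of the crossing of \<open>A\<close> with \<open>B \<odot> D\<close>, applied
  to the arrow \<open>\<sigma> B D\<close>.\<close>

lemma sw_YB:
  assumes "has i [A, B, D] s"
  shows "sw i B D (sw (Suc i) A D (sw i A B s)) = sw (Suc i) A B (sw i A D (sw (Suc i) B D s))"
proof -
  from assms obtain us vs where s [simp]: "ty s = Some (us @ [A, B, D] @ vs)" "i = length us"
      and o [simp]: "A \<in> Obj C" "B \<in> Obj C" "D \<in> Obj C"
    by (auto elim: has_ty)
  have "sw i A (D \<odot> B) (ap (Suc i) [B \<odot> D] (\<sigma> B D) [D \<odot> B] (mg (Suc i) B D s))
      = ap i [B \<odot> D] (\<sigma> B D) [D \<odot> B] (sw i A (B \<odot> D) (mg (Suc i) B D s))"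
    by (intro sw_nat) (simp_all add: calc)
  then have "mg i D B (sw (Suc i) A B (sw i A D (sw (Suc i) B D s)))
      = mg i D B (sw i B D (sw (Suc i) A D (sw i A B s)))"
    by (simp add: ap_expand_sym sw_expand_right calc)
  then have "sp i D B (mg i D B (sw (Suc i) A B (sw i A D (sw (Suc i) B D s))))
      = sp i D B (mg i D B (sw i B D (sw (Suc i) A D (sw i A B s))))"
    by simp
  then show ?thesis
    by (simp add: calc)
qed

text \<open>Crossing a single wire with a whole block; this is what lets generators with several
  inputs or outputs slide past a wire.\<close>

primrec swl :: "nat \<Rightarrow> 'o list \<Rightarrow> 'o \<Rightarrow> ('a \<times> 'o list) option \<Rightarrow> ('a \<times> 'o list) option" where
  "swl i [] E s = s"
| "swl i (A # r) E s = sw i A E (swl (Suc i) r E s)"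

primrec swr :: "nat \<Rightarrow> 'o \<Rightarrow> 'o list \<Rightarrow> ('a \<times> 'o list) option \<Rightarrow> ('a \<times> 'o list) option" where
  "swr i E [] s = s"
| "swr i E (A # r) s = swr (Suc i) E r (sw i E A s)"

lemma ty_swl:
  "\<lbrakk>ty s = Some (us @ ds @ E # vs); length us = i; set ds \<subseteq> Obj C; E \<in> Obj C\<rbrakk>
    \<Longrightarrow> ty (swl i ds E s) = Some (us @ E # ds @ vs)"
proof (induction ds arbitrary: us i)
  case (Cons A r)
  then have "ty (swl (Suc i) r E s) = Some ((us @ [A]) @ E # r @ vs)"
    by (intro Cons.IH) auto
  with Cons show ?case
    by (simp add: calc)
qed simp

lemma ap_merge_Cons:
  assumes "has i (A # B # r) s"
  shows "ap i (A # B # r) (\<one> (tob (A # B # r))) [tob (A # B # r)] s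
    = mg i A (tob (B # r)) (ap (Suc i) (B # r) (\<one> (tob (B # r))) [tob (B # r)] s)"
proof -
  obtain x us vs where s: "s = Some (x, us @ (A # B # r) @ vs)" "i = length us" "x \<in> Arr C"
      "Cod C x = lift us (lift (A # B # r) (lift vs \<I>))" "set us \<subseteq> Obj C" "set (A # B # r) \<subseteq> Obj C" "set vs \<subseteq> Obj C"
    using assms by (blast elim: hasE)
  let ?X = "lift vs \<I>" and ?T = "tob (B # r)"
  have o: "?T \<in> Obj C" "?X \<in> Obj C" "A \<in> Obj C" "set (B # r) \<subseteq> Obj C"
    using s by (auto simp del: tob.simps intro!: obj_tob)
  have h: "hat (A # B # r) (\<one> (A \<odot> ?T)) [A \<odot> ?T] ?X
      = hat [A, ?T] (\<one> (A \<odot> ?T)) [A \<odot> ?T] ?X \<cdot> (\<one> A \<otimes> hat (B # r) (\<one> ?T) [?T] ?X)"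
    using o unfolding hat_def by (simp add: dagger_comp' cassoc del: lift.simps(2))
  have v: "vgen (B # r) (\<one> ?T) [?T]" "vgen (A # B # r) (\<one> (A \<odot> ?T)) [A \<odot> ?T]" "vgen [A, ?T] (\<one> (A \<odot> ?T)) [A \<odot> ?T]"
    using o by (auto simp: vgen_def)
  have 1: "ap (Suc i) (B # r) (\<one> ?T) [?T] s
      = Some (lft (us @ [A]) (hat (B # r) (\<one> ?T) [?T] ?X) \<cdot> x, (us @ [A]) @ [?T] @ vs)"
    using ap_Some [of x "us @ [A]" "B # r" vs "\<one> ?T" "[?T]"] s o v by (simp add: lift_append)
  have 2: "mg i A ?T (ap (Suc i) (B # r) (\<one> ?T) [?T] s)
      = Some (lft us (hat [A, ?T] (\<one> (A \<odot> ?T)) [A \<odot> ?T] ?X) \<cdot> (lft (us @ [A]) (hat (B # r) (\<one> ?T) [?T] ?X) \<cdot> x), us @ [A \<odot> ?T] @ vs)"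
    using ap_Some [of "lft (us @ [A]) (hat (B # r) (\<one> ?T) [?T] ?X) \<cdot> x" us "[A, ?T]" vs "\<one> (A \<odot> ?T)" "[A \<odot> ?T]"] s(2-) o v
    unfolding 1 by (simp add: lift_append)
  have 3: "ap i (A # B # r) (\<one> (A \<odot> ?T)) [A \<odot> ?T] s
      = Some (lft us (hat (A # B # r) (\<one> (A \<odot> ?T)) [A \<odot> ?T] ?X) \<cdot> x, us @ [A \<odot> ?T] @ vs)"
    using ap_Some [of x us "A # B # r" vs "\<one> (A \<odot> ?T)" "[A \<odot> ?T]"] s o v by simp
  show ?thesis
    unfolding tob.simps(3) 2 3 h using s o v
    by (simp add: lft_append flip: cassoc) (simp add: lft_comp)
qed

text \<open>Induction along the block with the hexagon; the empty block is the unit law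
  \<open>sw_unit\<close>.\<close>

lemma sw_merge_list:
  "\<lbrakk>has i (ds @ [E]) s\<rbrakk> \<Longrightarrow> sw i (tob ds) E (ap i ds (\<one> (tob ds)) [tob ds] s)
    = ap (Suc i) ds (\<one> (tob ds)) [tob ds] (swl i ds E s)"
proof (induction ds arbitrary: i rule: tob.induct)
  case 1
  then show ?case
    by (auto intro: sw_unit)
next
  case (2 A)
  then show ?case
    by (elim has_ty) (simp add: calc)
next
  case (3 A B r)
  let ?r = "B # r" and ?T = "tob (B # r)"
  from 3(2) obtain us vs where s [simp]: "ty s = Some (us @ (A # ?r) @ E # vs)" "i = length us"
      and o [simp]: "A \<in> Obj C" "set ?r \<subseteq> Obj C" "E \<in> Obj C"
    by (elim has_ty) auto
  have T [simp]: "?T \<in> Obj C"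
    using o(2) by (rule obj_tob)
  have "has (Suc i) ?r s"
    by (simp add: calc)
  then have v: "ty (ap (Suc i) ?r (\<one> ?T) [?T] s) = Some (us @ A # ?T # E # vs)"
    using T o by (simp add: ty_ap vgen_def)
  have w: "ty (swl (Suc i) ?r E s) = Some ((us @ [A]) @ E # ?r @ vs)"
    using o by (intro ty_swl) auto
  have h: "has i (A # ?r) s"
    by (simp add: calc)
  have "sw i (tob (A # ?r)) E (ap i (A # ?r) (\<one> (tob (A # ?r))) [tob (A # ?r)] s)
      = sw i (A \<odot> ?T) E (mg i A ?T (ap (Suc i) ?r (\<one> ?T) [?T] s))"
    using ap_merge_Cons [OF h] by (simp only: tob.simps(3))
  also have "\<dots> = mg (Suc i) A ?T (sw i A E (sw (Suc i) ?T E (ap (Suc i) ?r (\<one> ?T) [?T] s)))"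
    using v by (intro sw_merge_left) (simp add: has_def)
  also have "sw (Suc i) ?T E (ap (Suc i) ?r (\<one> ?T) [?T] s) = ap (Suc (Suc i)) ?r (\<one> ?T) [?T] (swl (Suc i) ?r E s)"
    by (rule 3(1)) (simp add: has_def)
  also have "sw i A E \<dots> = ap (Suc (Suc i)) ?r (\<one> ?T) [?T] (sw i A E (swl (Suc i) ?r E s))"
    by (subst ap_interchange') auto
  also have "mg (Suc i) A ?T \<dots> = ap (Suc i) (A # ?r) (\<one> (tob (A # ?r))) [tob (A # ?r)] (swl i (A # ?r) E s)"
    using w o by (subst ap_merge_Cons) (simp_all add: calc)
  finally show ?case .
qed

text \<open>\<open>f\<close> is factored through a single merged wire on each side, where naturality
  of one crossing applies; \<open>sw_merge_list\<close> translates between the block and the merged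
  wire.\<close>

lemma swl_nat:
  assumes h: "has i (ds @ [E]) s" and v: "vgen ds f cs"
  shows "swl i cs E (ap i ds f cs s) = ap (Suc i) ds f cs (swl i ds E s)"
proof -
  from h obtain us vs where s [simp]: "ty s = Some (us @ ds @ E # vs)" "i = length us"
      and o [simp]: "set ds \<subseteq> Obj C" "E \<in> Obj C"
    by (elim has_ty) auto
  have o' [simp]: "set cs \<subseteq> Obj C" and f [simp]: "f \<in> Arr C" "Dom C f = tob ds" "Cod C f = tob cs"
    using v by (auto simp: vgen_def)
  let ?D = "tob ds" and ?C = "tob cs"
  have split: "ap j ds f cs t = ap j [?C] (\<one> ?C) cs (ap j [?D] f [?C] (ap j ds (\<one> ?D) [?D] t))" for j t
    by (simp add: ap_comp vgen_def)
  let ?t = "ap i [?D] f [?C] (ap i ds (\<one> ?D) [?D] s)"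
  let ?u = "ap i [?C] (\<one> ?C) cs ?t"
  have t: "ty ?t = Some (us @ ?C # E # vs)"
    by (simp add: calc)
  have u: "ty ?u = Some (us @ cs @ E # vs)"
    using t by (simp add: calc)
  have w: "ty (swl i cs E ?u) = Some (us @ E # cs @ vs)"
    by (rule ty_swl [OF u]) auto
  have "swl i cs E (ap i ds f cs s) = swl i cs E ?u"
    by (simp only: split [of i s])
  also have "\<dots> = ap (Suc i) [?C] (\<one> ?C) cs (ap (Suc i) cs (\<one> ?C) [?C] (swl i cs E ?u))"
    by (rule ap_cancel [symmetric]) (use w in \<open>auto simp: has_def vgen_def\<close>)
  also have "ap (Suc i) cs (\<one> ?C) [?C] (swl i cs E ?u) = sw i ?C E (ap i cs (\<one> ?C) [?C] ?u)"
    by (rule sw_merge_list [symmetric]) (use u in \<open>auto simp: has_def\<close>)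
  also have "ap i cs (\<one> ?C) [?C] ?u = ?t"
    by (rule ap_cancel) (use t in \<open>auto simp: has_def vgen_def\<close>)
  also have "sw i ?C E ?t = ap (Suc i) [?D] f [?C] (sw i ?D E (ap i ds (\<one> ?D) [?D] s))"
    by (intro sw_nat) (auto simp: calc)
  also have "sw i ?D E (ap i ds (\<one> ?D) [?D] s) = ap (Suc i) ds (\<one> ?D) [?D] (swl i ds E s)"
    by (rule sw_merge_list [OF h])
  finally show ?thesis
    by (simp only: split [of "Suc i"])
qed

lemma swr_swl:
  "has i (E # ds) s \<Longrightarrow> swl i ds E (swr i E ds s) = s"
proof (induction ds arbitrary: i s)
  case (Cons A r)
  then obtain us vs where s [simp]: "ty s = Some (us @ [E, A] @ r @ vs)" "i = length us"
      and o [simp]: "E \<in> Obj C" "A \<in> Obj C" "set r \<subseteq> Obj C"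
    by (elim has_ty) auto
  have "swl (Suc i) r E (swr (Suc i) E r (sw i E A s)) = sw i E A s"
    by (rule Cons.IH) (simp add: calc)
  then show ?case
    by (simp add: calc)
qed simp

lemma swl_swr:
  "has i (ds @ [E]) s \<Longrightarrow> swr i E ds (swl i ds E s) = s"
proof (induction ds arbitrary: i s)
  case (Cons A r)
  then obtain us vs where s [simp]: "ty s = Some (us @ A # r @ E # vs)" "i = length us"
      and o [simp]: "E \<in> Obj C" "A \<in> Obj C" "set r \<subseteq> Obj C"
    by (elim has_ty) auto
  have t: "ty (swl (Suc i) r E s) = Some ((us @ [A]) @ E # r @ vs)"
    by (rule ty_swl) auto
  have "swr (Suc i) E r (swl (Suc i) r E s) = s"
    by (rule Cons.IH) (simp add: calc)
  then show ?case
    using t by (simp add: has_def)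
qed simp

lemma ty_swr:
  "\<lbrakk>ty s = Some (us @ E # ds @ vs); length us = i; set ds \<subseteq> Obj C; E \<in> Obj C\<rbrakk>
    \<Longrightarrow> ty (swr i E ds s) = Some (us @ ds @ E # vs)"
proof (induction ds arbitrary: us i s)
  case (Cons A r)
  have "ty (swr (Suc i) E r (sw i E A s)) = Some ((us @ [A]) @ r @ E # vs)"
    using Cons.prems by (intro Cons.IH) (auto simp: calc)
  then show ?case
    by simp
qed simp

text \<open>Follows from \<open>swl_nat\<close> because \<open>swr\<close> and \<open>swl\<close>
  are mutually inverse.\<close>

lemma swr_nat:
  assumes h: "has i (E # ds) s" and v: "vgen ds f cs"
  shows "swr i E cs (ap (Suc i) ds f cs s) = ap i ds f cs (swr i E ds s)"
proof -
  from h obtain us vs where s [simp]: "ty s = Some (us @ E # ds @ vs)" "i = length us"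
      and o [simp]: "set ds \<subseteq> Obj C" "E \<in> Obj C"
    by (elim has_ty) auto
  have t: "ty (swr i E ds s) = Some (us @ ds @ E # vs)"
    by (rule ty_swr) auto
  have "swl i cs E (ap i ds f cs (swr i E ds s)) = ap (Suc i) ds f cs (swl i ds E (swr i E ds s))"
    using t v by (intro swl_nat) (auto simp: has_def)
  also have "\<dots> = ap (Suc i) ds f cs s"
    by (simp only: swr_swl [OF h])
  finally have "swr i E cs (ap (Suc i) ds f cs s) = swr i E cs (swl i cs E (ap i ds f cs (swr i E ds s)))"
    by simp
  also have "\<dots> = ap i ds f cs (swr i E ds s)"
    using t v by (intro swl_swr) (auto simp: calc)
  finally show ?thesis .
qed

lemma epi_mg [simp]: "epi s \<Longrightarrow> has i [A, B] s \<Longrightarrow> epi (mg i A B s)"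
  by (rule epi_ap [where g = "\<one> (A \<odot> B)"]) (auto elim!: has_ty simp: vgen_def)

lemma epi_nI [simp]: "epi s \<Longrightarrow> has i [] s \<Longrightarrow> epi (nI i s)"
  by (rule epi_ap [where g = "\<one> \<I>"]) (auto simp: vgen_def)

lemmas expand = ap_expand_comp ap_expand_assoc ap_expand_assoc_dagger ap_expand_tensor_id
  ap_expand_tensor ap_expand_sym ap_expand_lunit ap_expand_runit ap_expand_lunit_dagger
  ap_expand_runit_dagger

end

section \<open>The middle-four interchange\<close>

context dagger_compact_category
begin

lemma obj_dual [simp]: "A \<in> Obj V \<Longrightarrow> A\<star> \<in> Obj V"
  by (rule dual_obj)

lemma eta_typed [simp]:
  assumes "A \<in> Obj V"
  shows "\<eta> A \<in> Arr V" "Dom V (\<eta> A) = \<I>" "Cod V (\<eta> A) = A\<star> \<odot> A"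
  using eta_hom [OF assms] by (auto simp: hom_def)

lemma inter_typed [simp]:
  assumes "A \<in> Obj V" "B \<in> Obj V" "D \<in> Obj V" "E \<in> Obj V"
  shows "interchange V A B D E \<in> Arr V"
    "Dom V (interchange V A B D E) = (A \<odot> B) \<odot> (D \<odot> E)"
    "Cod V (interchange V A B D E) = (A \<odot> D) \<odot> (B \<odot> E)"
  using assms by (auto simp: interchange_def)

lemma inter_dagger [simp]:
  assumes "A \<in> Obj V" "B \<in> Obj V" "D \<in> Obj V" "E \<in> Obj V"
  shows "(interchange V A B D E)\<dagger> = interchange V A D B E"
  using assms by (simp add: interchange_def dagger_comp' cassoc)

text \<open>On wires, the middle-four interchange is one crossing of the two inner wires.\<close>

lemma ap_expand_inter:
  assumes "A \<in> Obj V" "B \<in> Obj V" "D \<in> Obj V" "E \<in> Obj V"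
    and "has i [(A \<odot> B) \<odot> (D \<odot> E)] s"
  shows "ap i [(A \<odot> B) \<odot> (D \<odot> E)] (interchange V A B D E) [(A \<odot> D) \<odot> (B \<odot> E)] s
    = mg i (A \<odot> D) (B \<odot> E) (mg (Suc i) B E (mg i A D (sw (Suc i) B D (sp (Suc (Suc i)) D E
        (sp i A B (sp i (A \<odot> B) (D \<odot> E) s))))))"
proof -
  from assms(5) obtain us vs where [simp]: "ty s = Some (us @ [(A \<odot> B) \<odot> (D \<odot> E)] @ vs)" "i = length us"
    by (auto elim: has_ty)
  show ?thesis
    using assms(1-4) by (simp add: interchange_def expand ap_interchange calc)
qed

text \<open>The normal form used by \<open>coh\<close> performs generators further to the left last,
  since \<open>ap_interchange\<close> moves them outwards.\<close>

lemmas coh = expand ap_expand_inter sw_expand_left sw_expand_right ap_interchange calc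

text \<open>Exchanging the middle two objects in the arguments gives both the dagger and the
  inverse.\<close>

lemma inter_unitary:
  assumes "A \<in> Obj V" "B \<in> Obj V" "D \<in> Obj V" "E \<in> Obj V"
  shows "unitary V ((A \<odot> B) \<odot> (D \<odot> E)) ((A \<odot> D) \<odot> (B \<odot> E)) (interchange V A B D E)"
proof -
  have *: "interchange V A D B E \<cdot> interchange V A B D E = \<one> ((A \<odot> B) \<odot> (D \<odot> E))"
    if "A \<in> Obj V" "B \<in> Obj V" "D \<in> Obj V" "E \<in> Obj V" for A B D E
    using that by (intro ap_faithful [where s = "mg 0 (A \<odot> B) (D \<odot> E) (mg 0 A B (mg 2 D E (init [A, B, D, E])))"])
      (simp_all add: coh)
  show ?thesis
    using assms * [OF assms] * [of A D B E] by (simp add: unitary_def hom_def)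
qed

lemmas inter_simps [simp] = unitary_cancel(4-) [OF inter_unitary]

lemma inter_nat:
  assumes "f \<in> Arr V" "g \<in> Arr V" "h \<in> Arr V" "k \<in> Arr V"
    and "Dom V f = A" "Dom V g = B" "Dom V h = D" "Dom V k = E"
  shows "interchange V (Cod V f) (Cod V g) (Cod V h) (Cod V k) \<cdot> ((f \<otimes> g) \<otimes> (h \<otimes> k))
    = ((f \<otimes> h) \<otimes> (g \<otimes> k)) \<cdot> interchange V A B D E"
proof -
  have o: "A \<in> Obj V" "B \<in> Obj V" "D \<in> Obj V" "E \<in> Obj V"
     "Cod V f \<in> Obj V" "Cod V g \<in> Obj V" "Cod V h \<in> Obj V" "Cod V k \<in> Obj V"
    using assms dom_obj cod_obj by auto
  have sw: "sw (Suc 0) (Cod V g) (Cod V h) (ap (Suc 0) [B] g [Cod V g] (ap (Suc (Suc 0)) [D] h [Cod V h] t))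
      = ap (Suc 0) [D] h [Cod V h] (ap (Suc (Suc 0)) [B] g [Cod V g] (sw (Suc 0) B D t))"
    if "ty t = Some [A, B, D, E']" "E' \<in> Obj V" for t E'
    using that assms o sw_nat(1) [of g B "Cod V g" "Cod V h" "Suc 0" "ap (Suc (Suc 0)) [D] h [Cod V h] t"]
      sw_nat(2) [of h D "Cod V h" B "Suc 0" t]
    by (simp add: calc ap_interchange)
  show ?thesis
    using assms o sw by (intro ap_faithful [where s = "mg 0 (A \<odot> B) (D \<odot> E) (mg 0 A B (mg 2 D E (init [A, B, D, E])))"])
      (simp_all add: coh)
qed

text \<open>Both sides are the same permutation of six wires and reach the same normal word. This
  and its companion are the structural parts of associativity for shuffles and for tensor
  algebras.\<close>

lemma inter_assoc:
  assumes "A \<in> Obj V" "B \<in> Obj V" "D \<in> Obj V" "E \<in> Obj V" "F \<in> Obj V" "G \<in> Obj V"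
  shows "\<alpha> (A \<odot> E) (B \<odot> F) (D \<odot> G) \<cdot> (interchange V A B E F \<otimes> \<one> (D \<odot> G)) \<cdot>
      interchange V (A \<odot> B) D (E \<odot> F) G
    = (\<one> (A \<odot> E) \<otimes> interchange V B D F G) \<cdot> interchange V A (B \<odot> D) E (F \<odot> G) \<cdot>
      (\<alpha> A B D \<otimes> \<alpha> E F G)"
  using assms by (intro ap_faithful [where s = "mg 0 ((A \<odot> B) \<odot> D) ((E \<odot> F) \<odot> G) (mg 0 (A \<odot> B) D
      (mg 0 A B (mg 3 (E \<odot> F) G (mg 3 E F (init [A, B, D, E, F, G])))))"])
    (simp_all add: coh)

lemma inter_assoc':
  assumes "A \<in> Obj V" "B \<in> Obj V" "D \<in> Obj V" "E \<in> Obj V" "F \<in> Obj V" "G \<in> Obj V"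
  shows "(\<alpha> A B D \<otimes> \<alpha> E F G) \<cdot> interchange V (A \<odot> B) (E \<odot> F) D G \<cdot> (interchange V A E B F \<otimes> \<one> (D \<odot> G))
    = interchange V A E (B \<odot> D) (F \<odot> G) \<cdot> (\<one> (A \<odot> E) \<otimes> interchange V B F D G) \<cdot>
      \<alpha> (A \<odot> E) (B \<odot> F) (D \<odot> G)"
  using assms by (intro ap_faithful [where s = "mg 0 ((A \<odot> E) \<odot> (B \<odot> F)) (D \<odot> G) (mg 0 (A \<odot> E) (B \<odot> F)
      (mg 0 A E (mg 2 B F (mg 4 D G (init [A, E, B, F, D, G])))))"])
    (simp_all add: coh)

lemma inter_lunit:
  assumes "A \<in> Obj V" "B \<in> Obj V"
  shows "(\<Lambda> A \<otimes> \<Lambda> B) \<cdot> interchange V \<I> \<I> A B \<cdot> ((\<Lambda> \<I>)\<dagger> \<otimes> \<one> (A \<odot> B)) = \<Lambda> (A \<odot> B)"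
  using assms by (intro ap_faithful [where s = "mg 0 \<I> (A \<odot> B) (nI 0 (mg 0 A B (init [A, B])))"])
    (simp_all add: coh sw_unit)

lemma inter_runit:
  assumes "A \<in> Obj V" "B \<in> Obj V"
  shows "(\<rho> A \<otimes> \<rho> B) \<cdot> interchange V A B \<I> \<I> \<cdot> (\<one> (A \<odot> B) \<otimes> (\<Lambda> \<I>)\<dagger>) = \<rho> (A \<odot> B)"
  using assms by (intro ap_faithful [where s = "mg 0 (A \<odot> B) \<I> (nI 1 (mg 0 A B (init [A, B])))"])
    (simp_all add: coh sw_unit)

lemma inter_sym:
  assumes "A \<in> Obj V" "B \<in> Obj V" "D \<in> Obj V" "E \<in> Obj V"
  shows "interchange V B A E D \<cdot> (\<sigma> A B \<otimes> \<sigma> D E) = \<sigma> (A \<odot> D) (B \<odot> E) \<cdot> interchange V A B D E"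
  using assms by (intro ap_faithful [where s = "mg 0 (A \<odot> B) (D \<odot> E) (mg 0 A B (mg 2 D E (init [A, B, D, E])))"])
    (simp_all add: coh)

lemma inter_sym':
  assumes "A \<in> Obj V" "B \<in> Obj V" "D \<in> Obj V" "E \<in> Obj V"
  shows "(\<sigma> A D \<otimes> \<sigma> B E) \<cdot> interchange V A B D E = interchange V D E A B \<cdot> \<sigma> (A \<odot> B) (D \<odot> E)"
  using assms by (intro ap_faithful [where s = "mg 0 (A \<odot> B) (D \<odot> E) (mg 0 A B (mg 2 D E (init [A, B, D, E])))"])
    (simp_all add: coh)

end

section \<open>Dual pairs\<close>

context dagger_compact_category
begin

abbreviation "cup i h L R \<equiv> ap i [] h [L, R]"
abbreviation "cap i h L R \<equiv> ap i [L, R] (h\<dagger>) []"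

text \<open>The snake equations, stated on all states, with the dagger of the cup after a crossing
  as the counit. Abstracting from \<open>\<eta>\<close> makes room for other cups, such as those on
  tensor products and on the unit.\<close>

definition dual_pair :: "'o \<Rightarrow> 'o \<Rightarrow> 'a \<Rightarrow> bool" where
  "dual_pair L R h \<longleftrightarrow> L \<in> Obj V \<and> R \<in> Obj V \<and> h \<in> hom V \<I> (L \<odot> R) \<and>
    (\<forall>i s. has i [R] s \<longrightarrow> cap i h L R (sw i R L (cup (Suc i) h L R s)) = s) \<and>
    (\<forall>i s. has i [L] s \<longrightarrow> cap (Suc i) h L R (sw (Suc i) R L (cup i h L R s)) = s)"

lemma dual_pairD:
  assumes "dual_pair L R h"
  shows "L \<in> Obj V" "R \<in> Obj V" "h \<in> Arr V" "Dom V h = \<I>" "Cod V h = L \<odot> R"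
    and "has i [R] s \<Longrightarrow> cap i h L R (sw i R L (cup (Suc i) h L R s)) = s"
    and "has i [L] s \<Longrightarrow> cap (Suc i) h L R (sw (Suc i) R L (cup i h L R s)) = s"
  using assms by (auto simp: dual_pair_def hom_def)

lemma ap_expand_state:
  assumes "L \<in> Obj V" "R \<in> Obj V"
  shows "ap i [\<I>] h [L \<odot> R] s = mg i L R (cup i h L R (dI i s))"
    and "ap i [L \<odot> R] (h\<dagger>) [\<I>] s = nI i (cap i h L R (sp i L R s))"
  using assms by (subst ap_in_unit, subst ap_out_split, simp_all)
    (subst ap_out_unit, subst ap_in_split, simp_all)

lemmas ap_expand_eta = ap_expand_state [of "A\<star>" A i "\<eta> A" for A i]

lemma dual_pair_eta:
  assumes "A \<in> Obj V"
  shows "dual_pair (A\<star>) A (\<eta> A)"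
  unfolding dual_pair_def
proof (intro conjI allI impI)
  fix i s
  assume "has i [A] s"
  then obtain us vs where s [simp]: "ty s = Some (us @ [A] @ vs)" "i = length us"
    by (rule has_ty)
  have "ap i [A] (\<Lambda> A \<cdot> (\<epsilon> A \<otimes> \<one> A) \<cdot> (\<alpha> A (A\<star>) A)\<dagger> \<cdot> (\<one> A \<otimes> \<eta> A) \<cdot> (\<rho> A)\<dagger>) [A] s = s"
    using assms by (simp add: snake calc)
  then show "cap i (\<eta> A) (A\<star>) A (sw i A (A\<star>) (cup (Suc i) (\<eta> A) (A\<star>) A s)) = s"
    using assms by (simp add: eps_def expand ap_expand_eta ap_interchange' calc)
next
  fix i s
  assume "has i [A\<star>] s"
  then obtain us vs where s [simp]: "ty s = Some (us @ [A\<star>] @ vs)" "i = length us"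
    by (rule has_ty)
  have "ap i [A\<star>] (\<rho> (A\<star>) \<cdot> (\<one> (A\<star>) \<otimes> \<epsilon> A) \<cdot> \<alpha> (A\<star>) A (A\<star>) \<cdot> (\<eta> A \<otimes> \<one> (A\<star>)) \<cdot> (\<Lambda> (A\<star>))\<dagger>) [A\<star>] s = s"
    using assms by (simp add: snake_dual calc)
  then show "cap (Suc i) (\<eta> A) (A\<star>) A (sw (Suc i) A (A\<star>) (cup i (\<eta> A) (A\<star>) A s)) = s"
    using assms by (simp add: eps_def expand ap_expand_eta ap_interchange' calc)
qed (use assms eta_hom in auto)

text \<open>A cup is a generator without inputs, so sliding a wire past it needs no crossing on the
  input side; these are the three ways to use that.\<close>

lemma cup_sw:
  assumes "h \<in> Arr V" "Dom V h = \<I>" "Cod V h = L \<odot> R" "L \<in> Obj V" "R \<in> Obj V" "has i [E] s"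
  shows "sw i E L (cup (Suc i) h L R s) = sw (Suc i) R E (cup i h L R s)"
    and "sw (Suc i) E R (sw i E L (cup (Suc i) h L R s)) = cup i h L R s"
    and "sw i L E (sw (Suc i) R E (cup i h L R s)) = cup (Suc i) h L R s"
proof -
  from assms(6) obtain us vs where s [simp]: "ty s = Some (us @ [E] @ vs)" "i = length us" "E \<in> Obj V"
    by (auto elim: has_ty)
  have "swr i E [L, R] (cup (Suc i) h L R s) = cup i h L R (swr i E [] s)"
    using assms by (intro swr_nat) (auto simp: vgen_def)
  then show 1: "sw (Suc i) E R (sw i E L (cup (Suc i) h L R s)) = cup i h L R s"
    by simp
  have "sw (Suc i) R E (sw (Suc i) E R (sw i E L (cup (Suc i) h L R s))) = sw i E L (cup (Suc i) h L R s)"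
    using assms by (simp add: calc)
  with 1 show "sw i E L (cup (Suc i) h L R s) = sw (Suc i) R E (cup i h L R s)"
    by simp
  have "swl i [L, R] E (cup i h L R s) = cup (Suc i) h L R (swl i [] E s)"
    using assms by (intro swl_nat) (auto simp: vgen_def)
  then show "sw i L E (sw (Suc i) R E (cup i h L R s)) = cup (Suc i) h L R s"
    by simp
qed

text \<open>The dual of \<open>f\<close> relative to arbitrary cups. With \<open>\<eta>\<close> on
  both sides it is \<open>dual_map\<close>; other cups yield \<open>dual_tensor\<close>,
  \<open>dunit\<close> and the self-duality \<open>j\<close> of a Frobenius algebra.\<close>

definition transpose :: "'o \<Rightarrow> 'o \<Rightarrow> 'a \<Rightarrow> 'o \<Rightarrow> 'o \<Rightarrow> 'a \<Rightarrow> 'a \<Rightarrow> 'a" where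
  "transpose L R h L' R' h' f =
    \<rho> L \<cdot> (\<one> L \<otimes> (h'\<dagger> \<cdot> \<sigma> R' L')) \<cdot> (\<one> L \<otimes> (f \<otimes> \<one> (L'))) \<cdot>
    \<alpha> L R L' \<cdot> (h \<otimes> \<one> L') \<cdot> (\<Lambda> L')\<dagger>"

text \<open>An equation between names lets an arrow slide from one leg of a cup to the other inside
  any word.\<close>

lemma ap_name:
  assumes "(k \<otimes> \<one> R') \<cdot> h' = (\<one> L \<otimes> f) \<cdot> h"
    and "k \<in> Arr V" "Dom V k = L'" "Cod V k = L" "f \<in> Arr V" "Dom V f = R" "Cod V f = R'"
    and "h \<in> Arr V" "Dom V h = \<I>" "Cod V h = L \<odot> R" "h' \<in> Arr V" "Dom V h' = \<I>" "Cod V h' = L' \<odot> R'"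
    and "has i [] s"
  shows "ap i [L'] k [L] (cup i h' L' R' s) = ap (Suc i) [R] f [R'] (cup i h L R s)"
proof -
  have o: "L \<in> Obj V" "R \<in> Obj V" "L' \<in> Obj V" "R' \<in> Obj V"
    using assms dom_obj cod_obj by auto
  from assms(14) obtain us vs where s [simp]: "ty s = Some (us @ vs)" "i = length us"
    by (auto elim: has_ty)
  have "ap i [L'] k [L] (cup i h' L' R' s) = ap i [L', R'] (k \<otimes> \<one> R') [L, R'] (cup i h' L' R' s)"
    using assms o by (simp add: ap_tensor_id calc)
  also have "\<dots> = ap i [] ((k \<otimes> \<one> R') \<cdot> h') [L, R'] s"
    using assms o by (simp add: ap_comp vgen_def)
  also have "\<dots> = ap i [] ((\<one> L \<otimes> f) \<cdot> h) [L, R'] s"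
    by (simp add: assms(1))
  also have "\<dots> = ap i [L, R] (\<one> L \<otimes> f) [L, R'] (cup i h L R s)"
    using assms o by (simp add: ap_comp vgen_def)
  also have "\<dots> = ap (Suc i) [R] f [R'] (cup i h L R s)"
    using assms o by (simp add: ap_tensor_id calc)
  finally show ?thesis .
qed

lemma transpose_typed:
  assumes "L \<in> Obj V" "R \<in> Obj V" "h \<in> Arr V" "Dom V h = \<I>" "Cod V h = L \<odot> R"
    and "L' \<in> Obj V" "R' \<in> Obj V" "h' \<in> Arr V" "Dom V h' = \<I>" "Cod V h' = L' \<odot> R'"
    and "f \<in> Arr V" "Dom V f = R" "Cod V f = R'"
  shows "transpose L R h L' R' h' f \<in> Arr V"
    "Dom V (transpose L R h L' R' h' f) = L'" "Cod V (transpose L R h L' R' h' f) = L"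
  using assms by (auto simp: transpose_def)

text \<open>One zigzag of \<open>h'\<close> straightens; for \<open>h\<close> only the typing
  matters.\<close>

lemma transpose_name:
  assumes "L \<in> Obj V" "R \<in> Obj V" "h \<in> Arr V" "Dom V h = \<I>" "Cod V h = L \<odot> R"
    and d: "dual_pair L' R' h'"
    and "f \<in> Arr V" "Dom V f = R" "Cod V f = R'"
  shows "(transpose L R h L' R' h' f \<otimes> \<one> R') \<cdot> h' = (\<one> L \<otimes> f) \<cdot> h"
  unfolding transpose_def using assms dual_pairD[OF d]
  by (intro ap_faithful [where s = "nI 0 (init [])"])
    (simp_all add: expand ap_expand_state [of L R] ap_expand_state [of L' R'] ap_interchange' calc)

text \<open>An arrow out of \<open>L\<close> is recovered from its name by bending the
  \<open>R\<close> leg back with a snake.\<close>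

lemma dual_pair_unique:
  assumes d: "dual_pair L R h" and eq: "(k \<otimes> \<one> R) \<cdot> h = (k' \<otimes> \<one> R) \<cdot> h"
    and "k \<in> Arr V" "Dom V k = L" "Cod V k = Y" "k' \<in> Arr V" "Dom V k' = L" "Cod V k' = Y"
  shows "k = k'"
proof -
  note [simp] = dual_pairD[OF d]
  have o [simp]: "Y \<in> Obj V"
    using assms cod_obj by auto
  let ?w = "cap 1 h L R (sw 1 R L (cup 0 h L R (init [L])))"
  have k: "ap 0 [L] g [Y] (init [L]) = cap 1 h L R (sw 1 R L (ap 0 [L] g [Y] (cup 0 h L R (init [L]))))"
    if "g \<in> Arr V" "Dom V g = L" "Cod V g = Y" for g
  proof -
    have "ap 0 [L] g [Y] (init [L]) = ap 0 [L] g [Y] ?w"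
      by (simp add: calc)
    then show ?thesis
      using that by (simp add: ap_interchange calc)
  qed
  have "ap 0 [L] g [Y] (cup 0 h L R (init [L])) = ap 0 [] ((g \<otimes> \<one> R) \<cdot> h) [Y, R] (init [L])"
    if "g \<in> Arr V" "Dom V g = L" "Cod V g = Y" for g
  proof -
    have "ap 0 [L] g [Y] (cup 0 h L R (init [L])) = ap 0 [L, R] (g \<otimes> \<one> R) [Y, R] (cup 0 h L R (init [L]))"
      using that by (simp add: ap_tensor_id calc)
    then show ?thesis
      using that by (simp add: ap_comp vgen_def)
  qed
  with k assms have "ap 0 [L] k [Y] (init [L]) = ap 0 [L] k' [Y] (init [L])"
    by simp
  then show ?thesis
    by (rule ap_faithful) (use assms in auto)
qed

text \<open>By uniqueness \<open>k\<close> is the transpose of \<open>f\<close>. Its dagger turns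
  every cup into a cap and conversely, and one remaining zigzag of \<open>h\<close> straightens.
  This is the reason why conjugation commutes with the dagger.\<close>

lemma dual_pair_dagger:
  assumes d: "dual_pair L R h" and d': "dual_pair L' R' h'"
    and k: "k \<in> Arr V" "Dom V k = L'" "Cod V k = L"
    and f: "f \<in> Arr V" "Dom V f = R" "Cod V f = R'"
    and eq: "(k \<otimes> \<one> R') \<cdot> h' = (\<one> L \<otimes> f) \<cdot> h"
  shows "(k\<dagger> \<otimes> \<one> R) \<cdot> h = (\<one> L' \<otimes> f\<dagger>) \<cdot> h'"
proof -
  note [simp] = dual_pairD[OF d] dual_pairD[OF d'] k f
  note t [simp] = transpose_typed [OF dual_pairD(1-5)[OF d] dual_pairD(1-5)[OF d'] f]
  have "k = transpose L R h L' R' h' f"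
    by (rule dual_pair_unique [OF d'])
      (simp_all add: eq transpose_name [OF dual_pairD(1-5)[OF d] d' f])
  then have kd: "k\<dagger> = (transpose L R h L' R' h' f)\<dagger>"
    by simp
  have kd: "k\<dagger> = \<Lambda> L' \<cdot> (h\<dagger> \<otimes> \<one> L') \<cdot> (\<alpha> L R L')\<dagger> \<cdot> (\<one> L \<otimes> (f\<dagger> \<otimes> \<one> L')) \<cdot> (\<one> L \<otimes> (\<sigma> L' R' \<cdot> h')) \<cdot> (\<rho> L)\<dagger>"
    unfolding kd transpose_def by (simp add: dagger_comp' cassoc)
  let ?H = "cup 0 h L R (init [])" and ?H' = "cup 0 h' L' R' (init [])"
  let ?z = "sw 0 L' R' ?H'"
  \<comment> \<open>The cup of \<open>h'\<close> stands between the legs of \<open>h\<close>.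
    Sliding it out, with one use of the braid relation, lets the cap of \<open>h\<close> meet the
    cup of \<open>h\<close> in a snake.\<close>
  have "cup (Suc 0) h' L' R' ?H = sw 0 L' L (sw (Suc 0) R' L (cup 0 h' L' R' ?H))"
    using cup_sw(3) [of h' L' R' 0 L ?H] by (simp add: calc)
  then have "sw (Suc 0) L' R' (cup (Suc 0) h' L' R' ?H) = sw 0 R' L (sw (Suc 0) L' L (sw 0 L' R' (cup 0 h' L' R' ?H)))"
    using sw_YB [of 0 L' R' L "cup 0 h' L' R' ?H"] by (simp add: calc)
  also have "cup 0 h' L' R' ?H = cup (Suc (Suc 0)) h L R ?H'"
    by (simp add: ap_interchange')
  also have "sw 0 L' R' (cup (Suc (Suc 0)) h L R ?H') = cup (Suc (Suc 0)) h L R ?z"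
    by (simp add: ap_interchange')
  also have "sw (Suc 0) L' L (cup (Suc (Suc 0)) h L R ?z) = sw (Suc (Suc 0)) R L' (cup (Suc 0) h L R ?z)"
    using cup_sw(1) [of h L R "Suc 0" L' ?z] by (simp add: calc)
  finally have A: "ap (Suc 0) [R'] (f\<dagger>) [R] (sw (Suc 0) L' R' (cup (Suc 0) h' L' R' ?H))
      = ap (Suc 0) [R'] (f\<dagger>) [R] (sw 0 R' L (sw (Suc (Suc 0)) R L' (cup (Suc 0) h L R ?z)))"
    by simp
  also have "\<dots> = sw 0 R L (ap 0 [R'] (f\<dagger>) [R] (sw (Suc (Suc 0)) R L' (cup (Suc 0) h L R ?z)))"
    using sw_nat(1) [of "f\<dagger>" R' R L 0 "sw (Suc (Suc 0)) R L' (cup (Suc 0) h L R ?z)"] by (simp add: calc)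
  finally have "cap 0 h L R (ap (Suc 0) [R'] (f\<dagger>) [R] (sw (Suc 0) L' R' (cup (Suc 0) h' L' R' ?H)))
      = cap 0 h L R (sw 0 R L (ap 0 [R'] (f\<dagger>) [R] (sw (Suc (Suc 0)) R L' (cup (Suc 0) h L R ?z))))"
    by simp
  also have "\<dots> = sw 0 R L' (cap 0 h L R (sw 0 R L (cup (Suc 0) h L R (ap 0 [R'] (f\<dagger>) [R] ?z))))"
    by (simp add: ap_interchange')
  also have "\<dots> = sw 0 R L' (ap 0 [R'] (f\<dagger>) [R] ?z)"
    by (simp add: calc)
  also have "\<dots> = ap (Suc 0) [R'] (f\<dagger>) [R] ?H'"
    using sw_nat(1) [of "f\<dagger>" R' R L' 0 ?z] by (simp add: calc)
  finally have W: "cap 0 h L R (ap (Suc 0) [R'] (f\<dagger>) [R] (sw (Suc 0) L' R' (cup (Suc 0) h' L' R' ?H)))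
      = ap (Suc 0) [R'] (f\<dagger>) [R] ?H'"
    by simp
  show ?thesis
    unfolding kd
    by (rule ap_faithful [where s = "nI 0 (init [])"])
      (simp_all add: expand ap_expand_state [of L R] ap_expand_state [of L' R'] ap_interchange' W calc)
qed

text \<open>By the previous lemma with an identity on \<open>R\<close>, the dagger of the comparison
  compares in the opposite direction; uniqueness makes both composites identities.\<close>

lemma dual_pair_unitary:
  assumes d: "dual_pair L R h" and d': "dual_pair L' R h'"
    and k: "k \<in> Arr V" "Dom V k = L'" "Cod V k = L"
    and eq: "(k \<otimes> \<one> R) \<cdot> h' = h"
  shows "unitary V L' L k"
proof -
  note [simp] = dual_pairD(1-5)[OF d] dual_pairD(1-5)[OF d'] k
  have eq': "(k\<dagger> \<otimes> \<one> R) \<cdot> h = h'"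
    using dual_pair_dagger [OF d d' k, of "\<one> R"] eq by simp
  have "((k \<cdot> k\<dagger>) \<otimes> \<one> R) \<cdot> h = (k \<otimes> \<one> R) \<cdot> ((k\<dagger> \<otimes> \<one> R) \<cdot> h)"
    by (simp add: tensor_comp_reduce)
  then have 1: "k \<cdot> k\<dagger> = \<one> L"
    by - (rule dual_pair_unique [OF d], simp_all add: eq eq')
  have "((k\<dagger> \<cdot> k) \<otimes> \<one> R) \<cdot> h' = (k\<dagger> \<otimes> \<one> R) \<cdot> ((k \<otimes> \<one> R) \<cdot> h')"
    by (simp add: tensor_comp_reduce)
  then have 2: "k\<dagger> \<cdot> k = \<one> L'"
    by - (rule dual_pair_unique [OF d'], simp_all add: eq eq')
  from 1 2 show ?thesis
    by (simp add: unitary_def hom_def)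
qed

text \<open>The interleaved cups separate after sliding one past the other, and then the two given
  snakes straighten one at a time.\<close>

lemma dual_pair_tensor:
  assumes d1: "dual_pair L R h" and d2: "dual_pair L' R' h'"
  shows "dual_pair (L \<odot> L') (R \<odot> R') (interchange V L R L' R' \<cdot> (h \<otimes> h') \<cdot> (\<Lambda> \<I>)\<dagger>)"
proof -
  note [simp] = dual_pairD[OF d1] dual_pairD[OF d2]
  let ?h = "interchange V L R L' R' \<cdot> (h \<otimes> h') \<cdot> (\<Lambda> \<I>)\<dagger>"
  have hd: "?h\<dagger> = \<Lambda> \<I> \<cdot> (h\<dagger> \<otimes> h'\<dagger>) \<cdot> interchange V L L' R R'"
    by (simp add: dagger_comp' cassoc)
  have cu: "cup i ?h (L \<odot> L') (R \<odot> R') s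
      = mg i L L' (mg (Suc (Suc i)) R R' (sw (Suc i) R L' (cup (Suc (Suc i)) h' L' R' (cup i h L R s))))"
    if "has i [] s" for i s
  proof -
    from that obtain us vs where s [simp]: "ty s = Some (us @ vs)" "i = length us"
      by (auto elim: has_ty)
    have "cup i ?h (L \<odot> L') (R \<odot> R') s = sp i (L \<odot> L') (R \<odot> R') (ap i [\<I>] ?h [(L \<odot> L') \<odot> (R \<odot> R')] (nI i s))"
      by (simp add: ap_comp calc)
    then show ?thesis
      by (simp add: coh ap_expand_state [of L R] ap_expand_state [of L' R'])
  qed
  have ca: "cap i ?h (L \<odot> L') (R \<odot> R') s
      = cap i h L R (cap (Suc (Suc i)) h' L' R' (sw (Suc i) L' R (sp (Suc (Suc i)) R R' (sp i L L' s))))"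
    if "has i [L \<odot> L', R \<odot> R'] s" for i s
  proof -
    from that obtain us vs where s [simp]: "ty s = Some (us @ [L \<odot> L', R \<odot> R'] @ vs)" "i = length us"
      by (auto elim: has_ty)
    have "cap i ?h (L \<odot> L') (R \<odot> R') s = dI i (ap i [(L \<odot> L') \<odot> (R \<odot> R')] (?h\<dagger>) [\<I>] (mg i (L \<odot> L') (R \<odot> R') s))"
      by (simp add: ap_comp calc)
    then show ?thesis
      unfolding hd by (simp add: coh ap_expand_state [of L R] ap_expand_state [of L' R'])
  qed
  note cup_l = cup_sw(1) [of h L R _ R'] cup_sw(1) [of h' L' R' _ R]
  note cup_r = cup_sw(1) [of h L R _ L', symmetric] cup_sw(1) [of h' L' R' _ L, symmetric]
  show ?thesis
    unfolding dual_pair_def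
  proof (intro conjI allI impI)
    fix i s
    assume "has i [R \<odot> R'] s"
    then obtain us vs where s [simp]: "ty s = Some (us @ [R \<odot> R'] @ vs)" "i = length us"
      by (rule has_ty)
    show "cap i ?h (L \<odot> L') (R \<odot> R') (sw i (R \<odot> R') (L \<odot> L') (cup (Suc i) ?h (L \<odot> L') (R \<odot> R') s)) = s"
      by (simp add: cu ca sw_expand_left sw_expand_right ap_interchange' cup_l calc)
  next
    fix i s
    assume "has i [L \<odot> L'] s"
    then obtain us vs where s [simp]: "ty s = Some (us @ [L \<odot> L'] @ vs)" "i = length us"
      by (rule has_ty)
    show "cap (Suc i) ?h (L \<odot> L') (R \<odot> R') (sw (Suc i) (R \<odot> R') (L \<odot> L') (cup i ?h (L \<odot> L') (R \<odot> R') s)) = s"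
      by (simp add: cu ca sw_expand_left sw_expand_right ap_interchange cup_r calc)
  qed (auto simp: hom_def)
qed

end

section \<open>Conjugation is a symmetric monoidal functor\<close>

context dagger_compact_category
begin

lemmas inter_nat' = inter_nat [OF _ _ _ _ refl refl refl refl]

lemma dual_map_transpose:
  assumes "f \<in> Arr V" "Dom V f = A" "Cod V f = B"
  shows "dual_map V f = transpose (A\<star>) A (\<eta> A) (B\<star>) B (\<eta> B) f"
  using assms by (simp add: dual_map_def transpose_def eps_def Let_def)

lemma dual_map_typed [simp]:
  assumes "f \<in> Arr V"
  shows "dual_map V f \<in> Arr V" "Dom V (dual_map V f) = (Cod V f)\<star>" "Cod V (dual_map V f) = (Dom V f)\<star>"
  using assms dom_obj [of f] cod_obj [of f] transpose_typed
  by (auto simp: dual_map_transpose [OF _ refl refl])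

lemma dual_name:
  assumes "f \<in> Arr V" "Dom V f = A" "Cod V f = B"
  shows "(dual_map V f \<otimes> \<one> B) \<cdot> \<eta> B = (\<one> (A\<star>) \<otimes> f) \<cdot> \<eta> A"
proof -
  have "A \<in> Obj V" "B \<in> Obj V"
    using assms dom_obj cod_obj by auto
  then show ?thesis
    unfolding dual_map_transpose [OF assms] using assms by (intro transpose_name dual_pair_eta) auto
qed

lemma conj_typed [simp]:
  assumes "f \<in> Arr V"
  shows "conj_map V f \<in> Arr V" "Dom V (conj_map V f) = (Dom V f)\<star>" "Cod V (conj_map V f) = (Cod V f)\<star>"
  using assms by (auto simp: conj_map_def)

lemma conj_name:
  assumes "f \<in> Arr V" "Dom V f = A" "Cod V f = B"
  shows "(conj_map V f \<otimes> \<one> A) \<cdot> \<eta> A = (\<one> (B\<star>) \<otimes> f\<dagger>) \<cdot> \<eta> B"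
  using assms dual_name [of "f\<dagger>" B A] by (simp add: conj_map_def)

lemma dual_map_conj: "f \<in> Arr V \<Longrightarrow> dual_map V f = conj_map V (f\<dagger>)"
  by (simp add: conj_map_def)

text \<open>The common method for all identities about conjugates below: both sides are compared
  after composing with the cup.\<close>

lemma conj_unique:
  assumes "(k \<otimes> \<one> A) \<cdot> \<eta> A = (k' \<otimes> \<one> A) \<cdot> \<eta> A" "A \<in> Obj V"
    and "k \<in> Arr V" "Dom V k = A\<star>" "Cod V k = Y" "k' \<in> Arr V" "Dom V k' = A\<star>" "Cod V k' = Y"
  shows "k = k'"
  using assms by - (rule dual_pair_unique [OF dual_pair_eta], auto)

lemma conj_ident [simp]:
  assumes "A \<in> Obj V"
  shows "conj_map V (\<one> A) = \<one> (A\<star>)"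
  using assms conj_name [of "\<one> A" A A] by - (rule conj_unique [of _ A], auto)

text \<open>Each factor slides to the other leg of the cup as its dagger. Two reversals of order, by
  dualising and by the dagger, leave a covariant assignment.\<close>

lemma conj_comp:
  assumes "f \<in> Arr V" "g \<in> Arr V" "Cod V f = Dom V g"
  shows "conj_map V (g \<cdot> f) = conj_map V g \<cdot> conj_map V f"
proof (rule conj_unique)
  let ?A = "Dom V f" and ?B = "Dom V g" and ?D = "Cod V g"
  have o [simp]: "?A \<in> Obj V" "?B \<in> Obj V" "?D \<in> Obj V"
    using assms dom_obj cod_obj by auto
  have "((conj_map V g \<cdot> conj_map V f) \<otimes> \<one> ?A) \<cdot> \<eta> ?A = (conj_map V g \<otimes> \<one> ?A) \<cdot> ((conj_map V f \<otimes> \<one> ?A) \<cdot> \<eta> ?A)"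
    using assms by (simp add: tensor_comp_reduce)
  also have "\<dots> = (conj_map V g \<otimes> \<one> ?A) \<cdot> ((\<one> (?B\<star>) \<otimes> f\<dagger>) \<cdot> \<eta> ?B)"
    using assms conj_name [of f ?A ?B] by simp
  also have "\<dots> = (\<one> (?D\<star>) \<otimes> f\<dagger>) \<cdot> ((conj_map V g \<otimes> \<one> ?B) \<cdot> \<eta> ?B)"
    using assms by (simp add: tensor_comp_reduce)
  also have "\<dots> = (\<one> (?D\<star>) \<otimes> f\<dagger>) \<cdot> ((\<one> (?D\<star>) \<otimes> g\<dagger>) \<cdot> \<eta> ?D)"
    using assms conj_name [of g ?B ?D] by simp
  also have "\<dots> = (conj_map V (g \<cdot> f) \<otimes> \<one> ?A) \<cdot> \<eta> ?A"
    using assms conj_name [of "g \<cdot> f" ?A ?D] by (simp add: tensor_comp_reduce dagger_comp')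
  finally show "(conj_map V (g \<cdot> f) \<otimes> \<one> ?A) \<cdot> \<eta> ?A = ((conj_map V g \<cdot> conj_map V f) \<otimes> \<one> ?A) \<cdot> \<eta> ?A"
    by simp
qed (use assms dom_obj in auto)

lemma conj_dagger:
  assumes "f \<in> Arr V"
  shows "conj_map V (f\<dagger>) = (conj_map V f)\<dagger>"
proof -
  let ?A = "Dom V f" and ?B = "Cod V f"
  have o [simp]: "?A \<in> Obj V" "?B \<in> Obj V"
    using assms dom_obj cod_obj by auto
  have "((conj_map V f)\<dagger> \<otimes> \<one> ?B) \<cdot> \<eta> ?B = (\<one> (?A\<star>) \<otimes> (f\<dagger>)\<dagger>) \<cdot> \<eta> ?A"
    using assms conj_name [of f ?A ?B] by - (rule dual_pair_dagger [OF dual_pair_eta dual_pair_eta], auto)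
  then show ?thesis
    using assms conj_name [of "f\<dagger>" ?B ?A] by - (rule conj_unique [of _ ?B], auto)
qed

text \<open>The symmetry undoes the reversal of factors in \<open>dual_tensor\<close>, so that
  conjugation becomes monoidal in the given order.\<close>

definition dmon :: "'o \<Rightarrow> 'o \<Rightarrow> 'a" where
  "dmon A B = \<sigma> (B\<star>) (A\<star>) \<cdot> dual_tensor V A B"

lemma nested_eta_typed:
  assumes "A \<in> Obj V" "B \<in> Obj V"
  shows "nested_eta V A B \<in> Arr V" "Dom V (nested_eta V A B) = \<I>"
    "Cod V (nested_eta V A B) = (B\<star> \<odot> A\<star>) \<odot> (A \<odot> B)"
  using assms by (auto simp: nested_eta_def)

lemma dual_tensor_transpose:
  assumes "A \<in> Obj V" "B \<in> Obj V"
  shows "dual_tensor V A B = transpose (B\<star> \<odot> A\<star>) (A \<odot> B) (nested_eta V A B) ((A \<odot> B)\<star>) (A \<odot> B) (\<eta> (A \<odot> B)) (\<one> (A \<odot> B))"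
  using assms by (simp add: dual_tensor_def transpose_def eps_def nested_eta_typed)

lemma dual_tensor_typed [simp]:
  assumes "A \<in> Obj V" "B \<in> Obj V"
  shows "dual_tensor V A B \<in> Arr V" "Dom V (dual_tensor V A B) = (A \<odot> B)\<star>"
    "Cod V (dual_tensor V A B) = B\<star> \<odot> A\<star>"
  using assms transpose_typed by (auto simp: dual_tensor_transpose nested_eta_typed)

lemma dmon_typed [simp]:
  assumes "A \<in> Obj V" "B \<in> Obj V"
  shows "dmon A B \<in> Arr V" "Dom V (dmon A B) = (A \<odot> B)\<star>" "Cod V (dmon A B) = A\<star> \<odot> B\<star>"
  using assms by (auto simp: dmon_def)

text \<open>This determines \<open>dmon\<close>: it turns the cup of a tensor product into two
  interleaved cups. The coherence proofs use it through this equation.\<close>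

lemma dmon_name:
  assumes "A \<in> Obj V" "B \<in> Obj V"
  shows "(dmon A B \<otimes> \<one> (A \<odot> B)) \<cdot> \<eta> (A \<odot> B)
    = interchange V (A\<star>) A (B\<star>) B \<cdot> (\<eta> A \<otimes> \<eta> B) \<cdot> (\<Lambda> \<I>)\<dagger>"
proof -
  note [simp] = nested_eta_typed
  have "(dmon A B \<otimes> \<one> (A \<odot> B)) \<cdot> \<eta> (A \<odot> B)
      = (\<sigma> (B\<star>) (A\<star>) \<otimes> \<one> (A \<odot> B)) \<cdot> ((dual_tensor V A B \<otimes> \<one> (A \<odot> B)) \<cdot> \<eta> (A \<odot> B))"
    using assms by (simp add: dmon_def tensor_comp_reduce)
  also have "(dual_tensor V A B \<otimes> \<one> (A \<odot> B)) \<cdot> \<eta> (A \<odot> B) = (\<one> (B\<star> \<odot> A\<star>) \<otimes> \<one> (A \<odot> B)) \<cdot> nested_eta V A B"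
    unfolding dual_tensor_transpose [OF assms] using assms by (intro transpose_name dual_pair_eta) auto
  also have "\<dots> = nested_eta V A B"
    using assms by simp
  also have "(\<sigma> (B\<star>) (A\<star>) \<otimes> \<one> (A \<odot> B)) \<cdot> nested_eta V A B
      = interchange V (A\<star>) A (B\<star>) B \<cdot> (\<eta> A \<otimes> \<eta> B) \<cdot> (\<Lambda> \<I>)\<dagger>"
  proof (rule ap_faithful [where s = "nI 0 (init [])"])
    let ?A = "cup 0 (\<eta> A) (A\<star>) A" and ?B = "cup 0 (\<eta> B) (B\<star>) B (init [])"
    \<comment> \<open>The cup of \<open>A\<close>, nested inside the cup of \<open>B\<close>, slides
      out past the wire \<open>B\<star>\<close>.\<close>
    have "sw 0 (B\<star>) (A\<star>) (cup (Suc 0) (\<eta> A) (A\<star>) A ?B) = sw (Suc 0) A (B\<star>) (?A ?B)"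
      using assms by (intro cup_sw) (simp_all add: calc)
    then show "ap 0 [\<I>] ((\<sigma> (B\<star>) (A\<star>) \<otimes> \<one> (A \<odot> B)) \<cdot> nested_eta V A B) [(A\<star> \<odot> B\<star>) \<odot> (A \<odot> B)] (nI 0 (init []))
        = ap 0 [\<I>] (interchange V (A\<star>) A (B\<star>) B \<cdot> (\<eta> A \<otimes> \<eta> B) \<cdot> (\<Lambda> \<I>)\<dagger>) [(A\<star> \<odot> B\<star>) \<odot> (A \<odot> B)] (nI 0 (init []))"
      using assms by (simp add: nested_eta_def expand ap_expand_inter ap_expand_eta ap_interchange' calc)
  qed (use assms in \<open>simp_all add: calc\<close>)
  finally show ?thesis .
qed

lemma dmon_unitary:
  assumes "A \<in> Obj V" "B \<in> Obj V"
  shows "unitary V ((A \<odot> B)\<star>) (A\<star> \<odot> B\<star>) (dmon A B)"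
  using assms by (intro dual_pair_unitary [OF dual_pair_tensor [OF dual_pair_eta dual_pair_eta] dual_pair_eta _ _ _ dmon_name]) auto

lemma dmon_nat:
  assumes "f \<in> Arr V" "g \<in> Arr V" "Dom V f = A" "Dom V g = B" "Cod V f = A'" "Cod V g = B'"
  shows "dmon A' B' \<cdot> conj_map V (f \<otimes> g) = (conj_map V f \<otimes> conj_map V g) \<cdot> dmon A B"
proof -
  have o [simp]: "A \<in> Obj V" "B \<in> Obj V" "A' \<in> Obj V" "B' \<in> Obj V"
    using assms dom_obj cod_obj by auto
  note [simp] = assms
  have "((dmon A' B' \<cdot> conj_map V (f \<otimes> g)) \<otimes> \<one> (A \<odot> B)) \<cdot> \<eta> (A \<odot> B)
      = (dmon A' B' \<otimes> \<one> (A \<odot> B)) \<cdot> ((conj_map V (f \<otimes> g) \<otimes> \<one> (A \<odot> B)) \<cdot> \<eta> (A \<odot> B))"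
    by (simp add: tensor_comp_reduce)
  also have "\<dots> = (dmon A' B' \<otimes> \<one> (A \<odot> B)) \<cdot> ((\<one> ((A' \<odot> B')\<star>) \<otimes> (f \<otimes> g)\<dagger>) \<cdot> \<eta> (A' \<odot> B'))"
    by (subst conj_name [where B = "A' \<odot> B'"]) simp_all
  also have "\<dots> = (\<one> (A'\<star> \<odot> B'\<star>) \<otimes> (f \<otimes> g)\<dagger>) \<cdot> ((dmon A' B' \<otimes> \<one> (A' \<odot> B')) \<cdot> \<eta> (A' \<odot> B'))"
    by (simp add: tensor_comp_reduce)
  also have "\<dots> = ((\<one> (A'\<star>) \<otimes> \<one> (B'\<star>)) \<otimes> (f\<dagger> \<otimes> g\<dagger>)) \<cdot> interchange V (A'\<star>) A' (B'\<star>) B' \<cdot> (\<eta> A' \<otimes> \<eta> B') \<cdot> (\<Lambda> \<I>)\<dagger>"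
    by (simp add: dmon_name)
  also have "\<dots> = (((\<one> (A'\<star>) \<otimes> \<one> (B'\<star>)) \<otimes> (f\<dagger> \<otimes> g\<dagger>)) \<cdot> interchange V (A'\<star>) A' (B'\<star>) B') \<cdot> (\<eta> A' \<otimes> \<eta> B') \<cdot> (\<Lambda> \<I>)\<dagger>"
    by (simp add: cassoc)
  also have "((\<one> (A'\<star>) \<otimes> \<one> (B'\<star>)) \<otimes> (f\<dagger> \<otimes> g\<dagger>)) \<cdot> interchange V (A'\<star>) A' (B'\<star>) B'
      = interchange V (A'\<star>) A (B'\<star>) B \<cdot> ((\<one> (A'\<star>) \<otimes> f\<dagger>) \<otimes> (\<one> (B'\<star>) \<otimes> g\<dagger>))"
    using inter_nat' [of "\<one> (A'\<star>)" "f\<dagger>" "\<one> (B'\<star>)" "g\<dagger>"] by simp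
  also have "(\<dots>) \<cdot> (\<eta> A' \<otimes> \<eta> B') \<cdot> (\<Lambda> \<I>)\<dagger>
      = interchange V (A'\<star>) A (B'\<star>) B \<cdot> (((\<one> (A'\<star>) \<otimes> f\<dagger>) \<cdot> \<eta> A') \<otimes> ((\<one> (B'\<star>) \<otimes> g\<dagger>) \<cdot> \<eta> B')) \<cdot> (\<Lambda> \<I>)\<dagger>"
    by (simp add: cassoc tensor_comp_reduce)
  also have "\<dots> = interchange V (A'\<star>) A (B'\<star>) B \<cdot> (((conj_map V f \<otimes> \<one> A) \<cdot> \<eta> A) \<otimes> ((conj_map V g \<otimes> \<one> B) \<cdot> \<eta> B)) \<cdot> (\<Lambda> \<I>)\<dagger>"
    using conj_name [of f A A'] conj_name [of g B B'] by simp
  also have "\<dots> = (interchange V (A'\<star>) A (B'\<star>) B \<cdot> ((conj_map V f \<otimes> \<one> A) \<otimes> (conj_map V g \<otimes> \<one> B))) \<cdot> (\<eta> A \<otimes> \<eta> B) \<cdot> (\<Lambda> \<I>)\<dagger>"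
    by (simp add: cassoc tensor_comp_reduce)
  also have "interchange V (A'\<star>) A (B'\<star>) B \<cdot> ((conj_map V f \<otimes> \<one> A) \<otimes> (conj_map V g \<otimes> \<one> B))
      = ((conj_map V f \<otimes> conj_map V g) \<otimes> \<one> (A \<odot> B)) \<cdot> interchange V (A\<star>) A (B\<star>) B"
    using inter_nat' [of "conj_map V f" "\<one> A" "conj_map V g" "\<one> B"] by simp
  also have "(\<dots>) \<cdot> (\<eta> A \<otimes> \<eta> B) \<cdot> (\<Lambda> \<I>)\<dagger>
      = ((conj_map V f \<otimes> conj_map V g) \<otimes> \<one> (A \<odot> B)) \<cdot> ((dmon A B \<otimes> \<one> (A \<odot> B)) \<cdot> \<eta> (A \<odot> B))"
    by (simp add: dmon_name cassoc)
  also have "\<dots> = (((conj_map V f \<otimes> conj_map V g) \<cdot> dmon A B) \<otimes> \<one> (A \<odot> B)) \<cdot> \<eta> (A \<odot> B)"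
    by (simp add: tensor_comp_reduce)
  finally show ?thesis
    by (rule conj_unique) auto
qed

lemma tensor_left_comp:
  assumes "f \<in> Arr V" "g \<in> Arr V" "Cod V f = Dom V g" "D \<in> Obj V"
  shows "(g \<cdot> f) \<otimes> \<one> D = (g \<otimes> \<one> D) \<cdot> (f \<otimes> \<one> D)" "\<one> D \<otimes> (g \<cdot> f) = (\<one> D \<otimes> g) \<cdot> (\<one> D \<otimes> f)"
  using assms by (simp_all add: tensor_comp')

lemma dmon_assoc:
  assumes "A \<in> Obj V" "B \<in> Obj V" "D \<in> Obj V"
  shows "\<alpha> (A\<star>) (B\<star>) (D\<star>) \<cdot> (dmon A B \<otimes> \<one> (D\<star>)) \<cdot> dmon (A \<odot> B) D
    = (\<one> (A\<star>) \<otimes> dmon B D) \<cdot> dmon A (B \<odot> D) \<cdot> conj_map V (\<alpha> A B D)"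
proof (rule conj_unique)
  note [simp] = assms
  let ?T = "(A \<odot> B) \<odot> D" and ?T' = "A \<odot> (B \<odot> D)"
  let ?hAB = "interchange V (A\<star>) A (B\<star>) B \<cdot> (\<eta> A \<otimes> \<eta> B) \<cdot> (\<Lambda> \<I>)\<dagger>"
  let ?hBD = "interchange V (B\<star>) B (D\<star>) D \<cdot> (\<eta> B \<otimes> \<eta> D) \<cdot> (\<Lambda> \<I>)\<dagger>"
  have "((\<alpha> (A\<star>) (B\<star>) (D\<star>) \<cdot> (dmon A B \<otimes> \<one> (D\<star>)) \<cdot> dmon (A \<odot> B) D) \<otimes> \<one> ?T) \<cdot> \<eta> ?T
      = (\<alpha> (A\<star>) (B\<star>) (D\<star>) \<otimes> \<one> ?T) \<cdot> (((dmon A B \<otimes> \<one> (D\<star>)) \<otimes> (\<one> (A \<odot> B) \<otimes> \<one> D)) \<cdot>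
          interchange V ((A \<odot> B)\<star>) (A \<odot> B) (D\<star>) D) \<cdot> (\<eta> (A \<odot> B) \<otimes> \<eta> D) \<cdot> (\<Lambda> \<I>)\<dagger>"
    by (simp add: tensor_left_comp cassoc dmon_name)
  also have "((dmon A B \<otimes> \<one> (D\<star>)) \<otimes> (\<one> (A \<odot> B) \<otimes> \<one> D)) \<cdot> interchange V ((A \<odot> B)\<star>) (A \<odot> B) (D\<star>) D
      = interchange V (A\<star> \<odot> B\<star>) (A \<odot> B) (D\<star>) D \<cdot> ((dmon A B \<otimes> \<one> (A \<odot> B)) \<otimes> (\<one> (D\<star>) \<otimes> \<one> D))"
    using inter_nat' [of "dmon A B" "\<one> (A \<odot> B)" "\<one> (D\<star>)" "\<one> D"] by simp
  also have "(\<alpha> (A\<star>) (B\<star>) (D\<star>) \<otimes> \<one> ?T) \<cdot> (\<dots>) \<cdot> (\<eta> (A \<odot> B) \<otimes> \<eta> D) \<cdot> (\<Lambda> \<I>)\<dagger>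
      = (\<alpha> (A\<star>) (B\<star>) (D\<star>) \<otimes> \<one> ?T) \<cdot> interchange V (A\<star> \<odot> B\<star>) (A \<odot> B) (D\<star>) D \<cdot> (?hAB \<otimes> \<eta> D) \<cdot> (\<Lambda> \<I>)\<dagger>"
    by (simp add: cassoc tensor_comp_reduce dmon_name)
  \<comment> \<open>Both sides consist of the same three cups, interleaved in the same way; the
    associator of the dual side reappears inverted on the other legs.\<close>
  also have "\<dots> = (\<one> (A\<star> \<odot> (B\<star> \<odot> D\<star>)) \<otimes> (\<alpha> A B D)\<dagger>) \<cdot> interchange V (A\<star>) A (B\<star> \<odot> D\<star>) (B \<odot> D) \<cdot> (\<eta> A \<otimes> ?hBD) \<cdot> (\<Lambda> \<I>)\<dagger>"
    by (rule ap_faithful [where s = "nI 0 (init [])"]) (simp_all add: coh ap_expand_eta)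
  also have "\<dots> = (\<one> (A\<star> \<odot> (B\<star> \<odot> D\<star>)) \<otimes> (\<alpha> A B D)\<dagger>) \<cdot> (interchange V (A\<star>) A (B\<star> \<odot> D\<star>) (B \<odot> D) \<cdot>
      ((\<one> (A\<star>) \<otimes> \<one> A) \<otimes> (dmon B D \<otimes> \<one> (B \<odot> D)))) \<cdot> (\<eta> A \<otimes> \<eta> (B \<odot> D)) \<cdot> (\<Lambda> \<I>)\<dagger>"
    by (simp add: cassoc tensor_comp_reduce dmon_name)
  also have "interchange V (A\<star>) A (B\<star> \<odot> D\<star>) (B \<odot> D) \<cdot> ((\<one> (A\<star>) \<otimes> \<one> A) \<otimes> (dmon B D \<otimes> \<one> (B \<odot> D)))
      = ((\<one> (A\<star>) \<otimes> dmon B D) \<otimes> \<one> ?T') \<cdot> interchange V (A\<star>) A ((B \<odot> D)\<star>) (B \<odot> D)"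
    using inter_nat' [of "\<one> (A\<star>)" "\<one> A" "dmon B D" "\<one> (B \<odot> D)"] by simp
  also have "(\<one> (A\<star> \<odot> (B\<star> \<odot> D\<star>)) \<otimes> (\<alpha> A B D)\<dagger>) \<cdot> (\<dots>) \<cdot> (\<eta> A \<otimes> \<eta> (B \<odot> D)) \<cdot> (\<Lambda> \<I>)\<dagger>
      = (\<one> (A\<star> \<odot> (B\<star> \<odot> D\<star>)) \<otimes> (\<alpha> A B D)\<dagger>) \<cdot> ((\<one> (A\<star>) \<otimes> dmon B D) \<otimes> \<one> ?T') \<cdot> (dmon A (B \<odot> D) \<otimes> \<one> ?T') \<cdot> \<eta> ?T'"
    by (simp add: cassoc dmon_name)
  also have "\<dots> = (((\<one> (A\<star>) \<otimes> dmon B D) \<cdot> dmon A (B \<odot> D)) \<otimes> \<one> ?T) \<cdot> ((\<one> (?T'\<star>) \<otimes> (\<alpha> A B D)\<dagger>) \<cdot> \<eta> ?T')"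
    by (simp add: tensor_comp_reduce)
  also have "(\<one> (?T'\<star>) \<otimes> (\<alpha> A B D)\<dagger>) \<cdot> \<eta> ?T' = (conj_map V (\<alpha> A B D) \<otimes> \<one> ?T) \<cdot> \<eta> ?T"
    by (rule conj_name [symmetric]) simp_all
  also have "(((\<one> (A\<star>) \<otimes> dmon B D) \<cdot> dmon A (B \<odot> D)) \<otimes> \<one> ?T) \<cdot> \<dots>
      = (((\<one> (A\<star>) \<otimes> dmon B D) \<cdot> dmon A (B \<odot> D) \<cdot> conj_map V (\<alpha> A B D)) \<otimes> \<one> ?T) \<cdot> \<eta> ?T"
    by (simp add: tensor_comp_reduce cassoc)
  finally show "((\<alpha> (A\<star>) (B\<star>) (D\<star>) \<cdot> (dmon A B \<otimes> \<one> (D\<star>)) \<cdot> dmon (A \<odot> B) D) \<otimes> \<one> ?T) \<cdot> \<eta> ?T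
      = (((\<one> (A\<star>) \<otimes> dmon B D) \<cdot> dmon A (B \<odot> D) \<cdot> conj_map V (\<alpha> A B D)) \<otimes> \<one> ?T) \<cdot> \<eta> ?T" .
qed (use assms in auto)

lemma dmon_sym:
  assumes "A \<in> Obj V" "B \<in> Obj V"
  shows "\<sigma> (A\<star>) (B\<star>) \<cdot> dmon A B = dmon B A \<cdot> conj_map V (\<sigma> A B)"
proof (rule conj_unique)
  note [simp] = assms
  let ?T = "A \<odot> B" and ?T' = "B \<odot> A"
  have "((\<sigma> (A\<star>) (B\<star>) \<cdot> dmon A B) \<otimes> \<one> ?T) \<cdot> \<eta> ?T
      = (\<sigma> (A\<star>) (B\<star>) \<otimes> \<one> ?T) \<cdot> interchange V (A\<star>) A (B\<star>) B \<cdot> (\<eta> A \<otimes> \<eta> B) \<cdot> (\<Lambda> \<I>)\<dagger>"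
    by (simp add: tensor_left_comp cassoc dmon_name)
  also have "\<dots> = (\<one> (B\<star> \<odot> A\<star>) \<otimes> \<sigma> B A) \<cdot> interchange V (B\<star>) B (A\<star>) A \<cdot> (\<eta> B \<otimes> \<eta> A) \<cdot> (\<Lambda> \<I>)\<dagger>"
  proof (rule ap_faithful [where s = "nI 0 (init [])"])
    let ?i = "init []"
    let ?e = "cup 0 (\<eta> B) (B\<star>) B ?i"
    \<comment> \<open>The cup of \<open>A\<close>, created to the right of that of \<open>B\<close>,
      slides left past \<open>B\<close> and then past \<open>B\<star>\<close>, which exchanges the
      two cups.\<close>
    have 1: "cup (Suc (Suc 0)) (\<eta> A) (A\<star>) A ?e = sw (Suc 0) (A\<star>) B (sw (Suc (Suc 0)) A B (cup (Suc 0) (\<eta> A) (A\<star>) A ?e))"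
      using cup_sw(3) [of "\<eta> A" "A\<star>" A "Suc 0" B ?e] by (simp add: calc)
    have 2: "cup (Suc 0) (\<eta> A) (A\<star>) A ?e = sw 0 (A\<star>) (B\<star>) (sw (Suc 0) A (B\<star>) (cup 0 (\<eta> A) (A\<star>) A ?e))"
      using cup_sw(3) [of "\<eta> A" "A\<star>" A 0 "B\<star>" ?e] by (simp add: calc)
    have "sw (Suc 0) B (A\<star>) (cup (Suc (Suc 0)) (\<eta> A) (A\<star>) A ?e)
        = sw (Suc (Suc 0)) A B (sw 0 (A\<star>) (B\<star>) (sw (Suc 0) A (B\<star>) (cup 0 (\<eta> A) (A\<star>) A ?e)))"
      unfolding 1 2 by (simp add: calc)
    then have 3: "sw (Suc (Suc 0)) B A (sw (Suc 0) B (A\<star>) (cup (Suc (Suc 0)) (\<eta> A) (A\<star>) A ?e))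
        = sw 0 (A\<star>) (B\<star>) (sw (Suc 0) A (B\<star>) (cup 0 (\<eta> A) (A\<star>) A ?e))"
      by (simp add: calc)
    show "ap 0 [\<I>] ((\<sigma> (A\<star>) (B\<star>) \<otimes> \<one> ?T) \<cdot> interchange V (A\<star>) A (B\<star>) B \<cdot> (\<eta> A \<otimes> \<eta> B) \<cdot> (\<Lambda> \<I>)\<dagger>) [(B\<star> \<odot> A\<star>) \<odot> ?T] (nI 0 ?i)
      = ap 0 [\<I>] ((\<one> (B\<star> \<odot> A\<star>) \<otimes> \<sigma> B A) \<cdot> interchange V (B\<star>) B (A\<star>) A \<cdot> (\<eta> B \<otimes> \<eta> A) \<cdot> (\<Lambda> \<I>)\<dagger>) [(B\<star> \<odot> A\<star>) \<odot> ?T] (nI 0 ?i)"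
      using 3 by (simp add: coh ap_expand_eta)
  qed (simp_all add: calc)
  also have "\<dots> = (\<one> (B\<star> \<odot> A\<star>) \<otimes> \<sigma> B A) \<cdot> (dmon B A \<otimes> \<one> ?T') \<cdot> \<eta> ?T'"
    by (simp add: dmon_name)
  also have "\<dots> = (dmon B A \<otimes> \<one> ?T) \<cdot> ((\<one> (?T'\<star>) \<otimes> (\<sigma> A B)\<dagger>) \<cdot> \<eta> ?T')"
    by (simp add: tensor_comp_reduce)
  also have "(\<one> (?T'\<star>) \<otimes> (\<sigma> A B)\<dagger>) \<cdot> \<eta> ?T' = (conj_map V (\<sigma> A B) \<otimes> \<one> ?T) \<cdot> \<eta> ?T"
    by (rule conj_name [symmetric]) simp_all
  finally show "((\<sigma> (A\<star>) (B\<star>) \<cdot> dmon A B) \<otimes> \<one> ?T) \<cdot> \<eta> ?T = ((dmon B A \<cdot> conj_map V (\<sigma> A B)) \<otimes> \<one> ?T) \<cdot> \<eta> ?T"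
    by (simp add: tensor_left_comp cassoc)
qed (use assms in auto)

end

section \<open>Completely positive maps\<close>

context dagger_compact_category
begin

abbreviation "dbl A \<equiv> A\<star> \<odot> A"
abbreviation "sh \<equiv> cpm_shuffle V"

text \<open>The arrow carried by \<open>cpm_pure f\<close>: the doubling
  \<open>f\<^sub>* \<otimes> f\<close>.\<close>

definition pm :: "'a \<Rightarrow> 'a" where
  "pm f = conj_map V f \<otimes> f"

lemma pm_typed [simp]:
  assumes "f \<in> Arr V"
  shows "pm f \<in> Arr V" "Dom V (pm f) = dbl (Dom V f)" "Cod V (pm f) = dbl (Cod V f)"
  using assms by (auto simp: pm_def)

lemma pm_ident [simp]: "A \<in> Obj V \<Longrightarrow> pm (\<one> A) = \<one> (dbl A)"
  by (simp add: pm_def)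

lemma pm_comp: "\<lbrakk>f \<in> Arr V; g \<in> Arr V; Cod V f = Dom V g\<rbrakk> \<Longrightarrow> pm (g \<cdot> f) = pm g \<cdot> pm f"
  by (simp add: pm_def conj_comp tensor_comp')

lemma pm_dagger: "f \<in> Arr V \<Longrightarrow> pm (f\<dagger>) = (pm f)\<dagger>"
  by (simp add: pm_def conj_dagger)

lemma shuffle_dmon:
  assumes "A \<in> Obj V" "B \<in> Obj V"
  shows "sh A B = interchange V (A\<star>) (B\<star>) A B \<cdot> (dmon A B \<otimes> \<one> (A \<odot> B))"
  using assms by (simp add: cpm_shuffle_def dmon_def tensor_comp')

lemma sh_unitary:
  assumes "A \<in> Obj V" "B \<in> Obj V"
  shows "unitary V (dbl (A \<odot> B)) (dbl A \<odot> dbl B) (sh A B)"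
  using assms unfolding shuffle_dmon [OF assms]
  by (intro unitary_comp [OF unitary_tensor [OF dmon_unitary unitary_ident] inter_unitary]) auto

lemmas sh_simps [simp] = unitary_cancel [OF sh_unitary]

text \<open>Combines naturality of \<open>dmon\<close> with that of the interchange. The shuffle is
  the monoidal structure of doubling, and the lemmas on \<open>sh\<close> that follow supply its
  coherence.\<close>

lemma sh_nat:
  assumes "f \<in> Arr V" "g \<in> Arr V" "Dom V f = A" "Dom V g = B" "Cod V f = A'" "Cod V g = B'"
  shows "sh A' B' \<cdot> pm (f \<otimes> g) = (pm f \<otimes> pm g) \<cdot> sh A B"
proof -
  have o [simp]: "A \<in> Obj V" "B \<in> Obj V" "A' \<in> Obj V" "B' \<in> Obj V"
    using assms dom_obj cod_obj by auto
  note [simp] = assms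
  have "sh A' B' \<cdot> pm (f \<otimes> g) = interchange V (A'\<star>) (B'\<star>) A' B' \<cdot> ((dmon A' B' \<cdot> conj_map V (f \<otimes> g)) \<otimes> (f \<otimes> g))"
    by (simp add: shuffle_dmon pm_def cassoc tensor_comp')
  also have "\<dots> = interchange V (A'\<star>) (B'\<star>) A' B' \<cdot> (((conj_map V f \<otimes> conj_map V g) \<cdot> dmon A B) \<otimes> (f \<otimes> g))"
    by (simp add: dmon_nat)
  also have "\<dots> = (interchange V (A'\<star>) (B'\<star>) A' B' \<cdot> ((conj_map V f \<otimes> conj_map V g) \<otimes> (f \<otimes> g))) \<cdot> (dmon A B \<otimes> \<one> (A \<odot> B))"
    by (simp add: cassoc tensor_comp')
  also have "\<dots> = (((conj_map V f \<otimes> f) \<otimes> (conj_map V g \<otimes> g)) \<cdot> interchange V (A\<star>) (B\<star>) A B) \<cdot> (dmon A B \<otimes> \<one> (A \<odot> B))"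
    using inter_nat' [of "conj_map V f" "conj_map V g" f g] by simp
  also have "\<dots> = (pm f \<otimes> pm g) \<cdot> sh A B"
    by (simp add: shuffle_dmon pm_def cassoc)
  finally show ?thesis .
qed

lemma sh_assoc:
  assumes [simp]: "A \<in> Obj V" "B \<in> Obj V" "D \<in> Obj V"
  shows "\<alpha> (dbl A) (dbl B) (dbl D) \<cdot> (sh A B \<otimes> \<one> (dbl D)) \<cdot> sh (A \<odot> B) D
    = (\<one> (dbl A) \<otimes> sh B D) \<cdot> sh A (B \<odot> D) \<cdot> pm (\<alpha> A B D)"
proof -
  let ?i = "interchange V"
  have "\<alpha> (dbl A) (dbl B) (dbl D) \<cdot> (sh A B \<otimes> \<one> (dbl D)) \<cdot> sh (A \<odot> B) D
      = \<alpha> (dbl A) (dbl B) (dbl D) \<cdot> (?i (A\<star>) (B\<star>) A B \<otimes> \<one> (dbl D)) \<cdot>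
        (((dmon A B \<otimes> \<one> (A \<odot> B)) \<otimes> (\<one> (D\<star>) \<otimes> \<one> D)) \<cdot> ?i ((A \<odot> B)\<star>) (D\<star>) (A \<odot> B) D) \<cdot> (dmon (A \<odot> B) D \<otimes> \<one> ((A \<odot> B) \<odot> D))"
    by (simp add: shuffle_dmon tensor_left_comp cassoc)
  also have "((dmon A B \<otimes> \<one> (A \<odot> B)) \<otimes> (\<one> (D\<star>) \<otimes> \<one> D)) \<cdot> ?i ((A \<odot> B)\<star>) (D\<star>) (A \<odot> B) D
      = ?i (A\<star> \<odot> B\<star>) (D\<star>) (A \<odot> B) D \<cdot> ((dmon A B \<otimes> \<one> (D\<star>)) \<otimes> (\<one> (A \<odot> B) \<otimes> \<one> D))"
    using inter_nat' [of "dmon A B" "\<one> (D\<star>)" "\<one> (A \<odot> B)" "\<one> D"] by simp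
  also have "\<alpha> (dbl A) (dbl B) (dbl D) \<cdot> (?i (A\<star>) (B\<star>) A B \<otimes> \<one> (dbl D)) \<cdot> (\<dots>) \<cdot> (dmon (A \<odot> B) D \<otimes> \<one> ((A \<odot> B) \<odot> D))
      = (\<alpha> (dbl A) (dbl B) (dbl D) \<cdot> (?i (A\<star>) (B\<star>) A B \<otimes> \<one> (dbl D)) \<cdot> ?i (A\<star> \<odot> B\<star>) (D\<star>) (A \<odot> B) D) \<cdot>
        (((dmon A B \<otimes> \<one> (D\<star>)) \<cdot> dmon (A \<odot> B) D) \<otimes> \<one> ((A \<odot> B) \<odot> D))"
    by (simp add: cassoc tensor_comp_reduce tensor_comp')
  also have "\<dots> = ((\<one> (dbl A) \<otimes> ?i (B\<star>) (D\<star>) B D) \<cdot> ?i (A\<star>) (B\<star> \<odot> D\<star>) A (B \<odot> D) \<cdot> (\<alpha> (A\<star>) (B\<star>) (D\<star>) \<otimes> \<alpha> A B D)) \<cdot>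
        (((dmon A B \<otimes> \<one> (D\<star>)) \<cdot> dmon (A \<odot> B) D) \<otimes> \<one> ((A \<odot> B) \<odot> D))"
    by (simp only: inter_assoc obj_dual assms)
  also have "\<dots> = (\<one> (dbl A) \<otimes> ?i (B\<star>) (D\<star>) B D) \<cdot> ?i (A\<star>) (B\<star> \<odot> D\<star>) A (B \<odot> D) \<cdot>
        ((\<alpha> (A\<star>) (B\<star>) (D\<star>) \<cdot> (dmon A B \<otimes> \<one> (D\<star>)) \<cdot> dmon (A \<odot> B) D) \<otimes> \<alpha> A B D)"
    by (simp add: cassoc tensor_comp')
  also have "\<dots> = (\<one> (dbl A) \<otimes> ?i (B\<star>) (D\<star>) B D) \<cdot> (?i (A\<star>) (B\<star> \<odot> D\<star>) A (B \<odot> D) \<cdot> ((\<one> (A\<star>) \<otimes> dmon B D) \<otimes> (\<one> A \<otimes> \<one> (B \<odot> D)))) \<cdot>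
        (dmon A (B \<odot> D) \<otimes> \<one> (A \<odot> (B \<odot> D))) \<cdot> (conj_map V (\<alpha> A B D) \<otimes> \<alpha> A B D)"
    by (simp add: dmon_assoc cassoc tensor_comp')
  also have "?i (A\<star>) (B\<star> \<odot> D\<star>) A (B \<odot> D) \<cdot> ((\<one> (A\<star>) \<otimes> dmon B D) \<otimes> (\<one> A \<otimes> \<one> (B \<odot> D)))
      = ((\<one> (A\<star>) \<otimes> \<one> A) \<otimes> (dmon B D \<otimes> \<one> (B \<odot> D))) \<cdot> ?i (A\<star>) ((B \<odot> D)\<star>) A (B \<odot> D)"
    using inter_nat' [of "\<one> (A\<star>)" "dmon B D" "\<one> A" "\<one> (B \<odot> D)"] by simp
  also have "(\<one> (dbl A) \<otimes> ?i (B\<star>) (D\<star>) B D) \<cdot> (\<dots>) \<cdot> (dmon A (B \<odot> D) \<otimes> \<one> (A \<odot> (B \<odot> D))) \<cdot> (conj_map V (\<alpha> A B D) \<otimes> \<alpha> A B D)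
      = (\<one> (dbl A) \<otimes> sh B D) \<cdot> sh A (B \<odot> D) \<cdot> pm (\<alpha> A B D)"
    by (simp add: shuffle_dmon pm_def tensor_left_comp cassoc)
  finally show ?thesis .
qed

lemma sh_sym:
  assumes [simp]: "A \<in> Obj V" "B \<in> Obj V"
  shows "\<sigma> (dbl A) (dbl B) \<cdot> sh A B = sh B A \<cdot> pm (\<sigma> A B)"
proof -
  have "\<sigma> (dbl A) (dbl B) \<cdot> sh A B
      = (\<sigma> (dbl A) (dbl B) \<cdot> interchange V (A\<star>) (B\<star>) A B) \<cdot> (dmon A B \<otimes> \<one> (A \<odot> B))"
    by (simp add: shuffle_dmon cassoc)
  also have "\<dots> = interchange V (B\<star>) (A\<star>) B A \<cdot> ((\<sigma> (A\<star>) (B\<star>) \<cdot> dmon A B) \<otimes> \<sigma> A B)"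
    by (simp add: inter_sym [symmetric] cassoc tensor_comp')
  also have "\<dots> = sh B A \<cdot> pm (\<sigma> A B)"
    by (simp add: dmon_sym shuffle_dmon pm_def cassoc tensor_comp')
  finally show ?thesis .
qed

text \<open>The interchange contained in the shuffle undoes the interleaving of cups in
  \<open>dmon_name\<close>. Thus tracing out a tensor product traces out its factors.\<close>

lemma sh_eta:
  assumes [simp]: "A \<in> Obj V" "B \<in> Obj V"
  shows "sh A B \<cdot> \<eta> (A \<odot> B) = (\<eta> A \<otimes> \<eta> B) \<cdot> (\<Lambda> \<I>)\<dagger>"
proof -
  have "interchange V (A\<star>) (B\<star>) A B \<cdot> (interchange V (A\<star>) A (B\<star>) B \<cdot> x) = x"
    if "x \<in> Arr V" "Cod V x = dbl A \<odot> dbl B" for x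
    using that inter_simps(3) [of "A\<star>" A "B\<star>" B x] by simp
  then show ?thesis
    by (simp add: shuffle_dmon cassoc dmon_name)
qed

lemma nI_nI:
  assumes "has i [\<I>] s"
  shows "nI (Suc i) s = nI i s"
proof -
  from assms obtain us vs where s [simp]: "ty s = Some (us @ [\<I>] @ vs)" "i = length us"
    by (rule has_ty)
  have "dI i (nI (Suc i) s) = dI (Suc i) (nI (Suc i) s)"
    by (rule dI_dI [symmetric]) (simp add: calc)
  then have "nI i (dI i (nI (Suc i) s)) = nI i s"
    by (simp add: calc)
  then show ?thesis
    by (simp add: calc)
qed

text \<open>Swapping units is trivial because an inserted unit may stand on either side of a unit
  wire.\<close>

lemma sw_unit_unit:
  assumes "has i [\<I>, \<I>] s"
  shows "sw i \<I> \<I> s = s"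
proof -
  from assms obtain us vs where s [simp]: "ty s = Some (us @ [\<I>, \<I>] @ vs)" "i = length us"
    by (rule has_ty)
  have "sw i \<I> \<I> (nI i (dI i s)) = nI (Suc i) (dI i s)"
    by (rule sw_unit) (simp add: calc)
  also have "\<dots> = nI i (dI i s)"
    by (rule nI_nI) (simp add: calc)
  finally show ?thesis
    by (simp add: calc)
qed

text \<open>All cups and caps of the unit reduce to insertion and deletion of unit wires, whose
  positions do not matter.\<close>

lemma dual_pair_unit: "dual_pair \<I> \<I> ((\<Lambda> \<I>)\<dagger>)"
proof -
  have u: "cup i ((\<Lambda> \<I>)\<dagger>) \<I> \<I> s = nI i (nI i s)" if "has i [] s" for i s
  proof -
    from that obtain us vs where s [simp]: "ty s = Some (us @ vs)" "i = length us"
      by (auto elim: has_ty)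
    have "cup i ((\<Lambda> \<I>)\<dagger>) \<I> \<I> s = sp i \<I> \<I> (ap i [\<I>] ((\<Lambda> \<I>)\<dagger>) [\<I> \<odot> \<I>] (nI i s))"
      by (simp add: ap_comp calc)
    then show ?thesis
      by (simp add: expand calc)
  qed
  have a: "ap i [\<I>, \<I>] (\<Lambda> \<I>) [] s = dI i (dI i s)" if "has i [\<I>, \<I>] s" for i s
  proof -
    from that obtain us vs where s [simp]: "ty s = Some (us @ [\<I>, \<I>] @ vs)" "i = length us"
      by (auto elim: has_ty)
    have "ap i [\<I>, \<I>] (\<Lambda> \<I>) [] s = dI i (ap i [\<I> \<odot> \<I>] (\<Lambda> \<I>) [\<I>] (mg i \<I> \<I> s))"
      by (simp add: ap_comp calc)
    then show ?thesis
      by (simp add: expand calc)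
  qed
  show ?thesis
    unfolding dual_pair_def
  proof (intro conjI allI impI)
    fix i s
    assume "has i [\<I>] s"
    then obtain us vs where s [simp]: "ty s = Some (us @ [\<I>] @ vs)" "i = length us"
      by (rule has_ty)
    have 1: "nI (Suc i) (nI (Suc i) s) = nI i (nI i s)"
      using nI_nI [of i s] nI_nI [of i "nI i s"] by (simp add: calc)
    show "cap i ((\<Lambda> \<I>)\<dagger>) \<I> \<I> (sw i \<I> \<I> (cup (Suc i) ((\<Lambda> \<I>)\<dagger>) \<I> \<I> s)) = s"
      using 1 by (simp add: u a sw_unit_unit calc)
    have 2: "dI (Suc i) (nI i (nI i s)) = nI i s"
      using dI_dI [of i "nI i (nI i s)"] by (simp add: calc)
    have 3: "dI (Suc i) (nI i s) = s"
      using dI_dI [of i "nI i s"] by (simp add: calc)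
    show "cap (Suc i) ((\<Lambda> \<I>)\<dagger>) \<I> \<I> (sw (Suc i) \<I> \<I> (cup i ((\<Lambda> \<I>)\<dagger>) \<I> \<I> s)) = s"
      using 2 3 by (simp add: u a sw_unit_unit calc)
  qed (auto simp: hom_def)
qed

definition dunit :: 'a where
  "dunit = transpose \<I> \<I> ((\<Lambda> \<I>)\<dagger>) (\<I>\<star>) \<I> (\<eta> \<I>) (\<one> \<I>)"

lemma dunit_typed [simp]: "dunit \<in> Arr V" "Dom V dunit = \<I>\<star>" "Cod V dunit = \<I>"
  unfolding dunit_def by (rule transpose_typed, auto)+

lemma dunit_name: "(dunit \<otimes> \<one> \<I>) \<cdot> \<eta> \<I> = (\<Lambda> \<I>)\<dagger>"
proof -
  have "(dunit \<otimes> \<one> \<I>) \<cdot> \<eta> \<I> = (\<one> \<I> \<otimes> \<one> \<I>) \<cdot> (\<Lambda> \<I>)\<dagger>"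
    unfolding dunit_def by (rule transpose_name) (auto intro: dual_pair_eta)
  then show ?thesis
    by simp
qed

lemma dunit_unitary: "unitary V (\<I>\<star>) \<I> dunit"
  by (rule dual_pair_unitary [OF dual_pair_unit dual_pair_eta _ _ _ dunit_name]) auto

lemma eta_unit: "\<eta> \<I> = (dunit\<dagger> \<otimes> \<one> \<I>) \<cdot> (\<Lambda> \<I>)\<dagger>"
  using dual_pair_dagger [OF dual_pair_unit dual_pair_eta, of \<I> dunit "\<one> \<I>"] dunit_name by simp

text \<open>Up to the comparison \<open>\<I>\<star> \<rightarrow> \<I>\<close>, which is unitary as
  both are duals of the unit, this is the inverse unitor. It makes the double of the unit a unit for
  the doubled tensor.\<close>

lemma eta_unit_unitary: "unitary V \<I> (dbl \<I>) (\<eta> \<I>)"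
  unfolding eta_unit
  by (intro unitary_comp [OF unitary_dagger [OF lunit_unitary] unitary_tensor [OF unitary_dagger [OF dunit_unitary] unitary_ident]]) auto

lemmas eta_unit_simps [simp] = unitary_cancel(4-) [OF eta_unit_unitary]

lemma dmon_lunit:
  assumes [simp]: "A \<in> Obj V"
  shows "conj_map V (\<Lambda> A) = \<Lambda> (A\<star>) \<cdot> (dunit \<otimes> \<one> (A\<star>)) \<cdot> dmon \<I> A"
proof (rule conj_unique)
  let ?T = "\<I> \<odot> A"
  have "((\<Lambda> (A\<star>) \<cdot> (dunit \<otimes> \<one> (A\<star>)) \<cdot> dmon \<I> A) \<otimes> \<one> ?T) \<cdot> \<eta> ?T
      = (\<Lambda> (A\<star>) \<otimes> \<one> ?T) \<cdot> (((dunit \<otimes> \<one> (A\<star>)) \<otimes> (\<one> \<I> \<otimes> \<one> A)) \<cdot> interchange V (\<I>\<star>) \<I> (A\<star>) A) \<cdot> (\<eta> \<I> \<otimes> \<eta> A) \<cdot> (\<Lambda> \<I>)\<dagger>"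
    by (simp add: tensor_left_comp cassoc dmon_name)
  also have "((dunit \<otimes> \<one> (A\<star>)) \<otimes> (\<one> \<I> \<otimes> \<one> A)) \<cdot> interchange V (\<I>\<star>) \<I> (A\<star>) A
      = interchange V \<I> \<I> (A\<star>) A \<cdot> ((dunit \<otimes> \<one> \<I>) \<otimes> (\<one> (A\<star>) \<otimes> \<one> A))"
    using inter_nat' [of dunit "\<one> \<I>" "\<one> (A\<star>)" "\<one> A"] by simp
  also have "(\<Lambda> (A\<star>) \<otimes> \<one> ?T) \<cdot> (\<dots>) \<cdot> (\<eta> \<I> \<otimes> \<eta> A) \<cdot> (\<Lambda> \<I>)\<dagger>
      = (\<Lambda> (A\<star>) \<otimes> \<one> ?T) \<cdot> interchange V \<I> \<I> (A\<star>) A \<cdot> ((\<Lambda> \<I>)\<dagger> \<otimes> \<eta> A) \<cdot> (\<Lambda> \<I>)\<dagger>"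
    by (simp add: cassoc tensor_comp_reduce dunit_name)
  also have "\<dots> = (\<one> (A\<star>) \<otimes> (\<Lambda> A)\<dagger>) \<cdot> \<eta> A"
    by (rule ap_faithful [where s = "nI 0 (init [])"]) (simp_all add: coh ap_expand_eta sw_unit)
  also have "\<dots> = (conj_map V (\<Lambda> A) \<otimes> \<one> ?T) \<cdot> \<eta> ?T"
    by (rule conj_name [symmetric]) simp_all
  finally show "(conj_map V (\<Lambda> A) \<otimes> \<one> ?T) \<cdot> \<eta> ?T = ((\<Lambda> (A\<star>) \<cdot> (dunit \<otimes> \<one> (A\<star>)) \<cdot> dmon \<I> A) \<otimes> \<one> ?T) \<cdot> \<eta> ?T"
    by simp
qed auto

lemma inter_lunit2:
  assumes "A \<in> Obj V" "B \<in> Obj V"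
  shows "\<Lambda> (A \<odot> B) \<cdot> (\<Lambda> \<I> \<otimes> \<one> (A \<odot> B)) \<cdot> interchange V \<I> A \<I> B = \<Lambda> A \<otimes> \<Lambda> B"
proof -
  have s': "sw (Suc 0) A \<I> (nI 0 (nI (Suc 0) (init [A, B]))) = nI 0 (nI 0 (init [A, B]))"
  proof -
    have "sw (Suc 0) A \<I> (nI 0 (nI (Suc 0) (init [A, B]))) = nI 0 (sw 0 A \<I> (nI (Suc 0) (init [A, B])))"
      by (simp add: ap_interchange)
    then show ?thesis
      using assms by (simp add: sw_unit calc)
  qed
  have d: "dI 0 (sw 0 A \<I> (nI (Suc 0) (init [A, B]))) = init [A, B]"
    using assms by (simp add: sw_unit calc)
  show ?thesis
    using assms s' d by (intro ap_faithful [where s = "mg 0 (\<I> \<odot> A) (\<I> \<odot> B) (mg 0 \<I> A (mg 2 \<I> B (nI 0 (nI 1 (init [A, B])))))"])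
      (simp_all add: coh sw_unit)
qed

lemma sh_lunit:
  assumes [simp]: "A \<in> Obj V"
  shows "\<Lambda> (dbl A) \<cdot> ((\<eta> \<I>)\<dagger> \<otimes> \<one> (dbl A)) \<cdot> sh \<I> A = pm (\<Lambda> A)"
proof -
  \<comment> \<open>Through \<open>dunit\<close> the cap of the unit becomes a unitor, which the
    interchange can absorb.\<close>
  have e: "(\<eta> \<I>)\<dagger> = \<Lambda> \<I> \<cdot> (dunit \<otimes> \<one> \<I>)"
    by (subst eta_unit) (simp add: dagger_comp')
  have "\<Lambda> (dbl A) \<cdot> ((\<eta> \<I>)\<dagger> \<otimes> \<one> (dbl A)) \<cdot> sh \<I> A
      = \<Lambda> (dbl A) \<cdot> (\<Lambda> \<I> \<otimes> \<one> (dbl A)) \<cdot> (((dunit \<otimes> \<one> \<I>) \<otimes> (\<one> (A\<star>) \<otimes> \<one> A)) \<cdot> interchange V (\<I>\<star>) (A\<star>) \<I> A) \<cdot>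
        (dmon \<I> A \<otimes> \<one> (\<I> \<odot> A))"
    by (simp add: e tensor_left_comp cassoc shuffle_dmon)
  also have "((dunit \<otimes> \<one> \<I>) \<otimes> (\<one> (A\<star>) \<otimes> \<one> A)) \<cdot> interchange V (\<I>\<star>) (A\<star>) \<I> A
      = interchange V \<I> (A\<star>) \<I> A \<cdot> ((dunit \<otimes> \<one> (A\<star>)) \<otimes> (\<one> \<I> \<otimes> \<one> A))"
    using inter_nat' [of dunit "\<one> (A\<star>)" "\<one> \<I>" "\<one> A"] by simp
  also have "\<Lambda> (dbl A) \<cdot> (\<Lambda> \<I> \<otimes> \<one> (dbl A)) \<cdot> (\<dots>) \<cdot> (dmon \<I> A \<otimes> \<one> (\<I> \<odot> A))
      = (\<Lambda> (dbl A) \<cdot> (\<Lambda> \<I> \<otimes> \<one> (dbl A)) \<cdot> interchange V \<I> (A\<star>) \<I> A) \<cdot> (((dunit \<otimes> \<one> (A\<star>)) \<cdot> dmon \<I> A) \<otimes> \<one> (\<I> \<odot> A))"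
    by (simp add: cassoc tensor_comp')
  also have "\<dots> = pm (\<Lambda> A)"
    by (simp add: inter_lunit2 pm_def dmon_lunit tensor_comp')
  finally show ?thesis .
qed

lemma lunit_sym: 
  assumes "A \<in> Obj V"
  shows "\<Lambda> A \<cdot> \<sigma> A \<I> = \<rho> A" "\<rho> A \<cdot> \<sigma> \<I> A = \<Lambda> A"
proof -
  show 1: "\<Lambda> A \<cdot> \<sigma> A \<I> = \<rho> A"
    using assms by (intro ap_faithful [where s = "mg 0 A \<I> (init [A, \<I>])"]) (simp_all add: coh sw_dI)
  show "\<rho> A \<cdot> \<sigma> \<I> A = \<Lambda> A"
    using assms sym_sym [of "\<I>" A] by (simp add: cassoc flip: 1)
qed

text \<open>Reduced to the left case by the symmetry, which the shuffle respects.\<close>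

lemma sh_runit:
  assumes [simp]: "A \<in> Obj V"
  shows "\<rho> (dbl A) \<cdot> (\<one> (dbl A) \<otimes> (\<eta> \<I>)\<dagger>) \<cdot> sh A \<I> = pm (\<rho> A)"
proof -
  have "\<rho> (dbl A) \<cdot> (\<one> (dbl A) \<otimes> (\<eta> \<I>)\<dagger>) \<cdot> sh A \<I>
      = \<Lambda> (dbl A) \<cdot> (\<sigma> (dbl A) \<I> \<cdot> (\<one> (dbl A) \<otimes> (\<eta> \<I>)\<dagger>)) \<cdot> sh A \<I>"
    by (simp add: cassoc flip: lunit_sym(1) [of "dbl A"])
  also have "\<sigma> (dbl A) \<I> \<cdot> (\<one> (dbl A) \<otimes> (\<eta> \<I>)\<dagger>) = ((\<eta> \<I>)\<dagger> \<otimes> \<one> (dbl A)) \<cdot> \<sigma> (dbl A) (dbl \<I>)"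
    using sym_nat [of "\<one> (dbl A)" "(\<eta> \<I>)\<dagger>"] by simp
  also have "\<Lambda> (dbl A) \<cdot> (\<dots>) \<cdot> sh A \<I> = (\<Lambda> (dbl A) \<cdot> ((\<eta> \<I>)\<dagger> \<otimes> \<one> (dbl A)) \<cdot> sh \<I> A) \<cdot> pm (\<sigma> A \<I>)"
    by (simp add: cassoc sh_sym)
  also have "\<dots> = pm (\<rho> A)"
    by (simp add: sh_lunit pm_comp [symmetric] lunit_sym)
  finally show ?thesis .
qed

end

section \<open>Tracing out an environment, and closure of complete positivity\<close>

context dagger_compact_category
begin

text \<open>As \<open>coh\<close>, but in the opposite normal form: generators further to the right
  are performed last.\<close>

lemmas coh' = expand ap_expand_inter sw_expand_left sw_expand_right ap_interchange' calc

text \<open>The partial trace over the environment \<open>X\<close>, phrased with the shuffle so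
  that its properties reduce to coherence of \<open>sh\<close>.\<close>

definition disc :: "'o \<Rightarrow> 'o \<Rightarrow> 'a" where
  "disc X B = \<Lambda> (dbl B) \<cdot> ((\<eta> X)\<dagger> \<otimes> \<one> (dbl B)) \<cdot> sh X B"

lemma disc_typed [simp]:
  assumes "X \<in> Obj V" "B \<in> Obj V"
  shows "disc X B \<in> Arr V" "Dom V (disc X B) = dbl (X \<odot> B)" "Cod V (disc X B) = dbl B"
  using assms by (auto simp: disc_def)

lemma cap_sw:
  assumes "h \<in> Arr V" "Dom V h = \<I>" "Cod V h = L \<odot> R" "L \<in> Obj V" "R \<in> Obj V"
  shows "has i [E, L, R] s \<Longrightarrow> cap i h L R (sw (Suc i) E R (sw i E L s)) = cap (Suc i) h L R s"
    and "has i [L, R, E] s \<Longrightarrow> cap (Suc i) h L R (sw i L E (sw (Suc i) R E s)) = cap i h L R s"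
proof -
  assume h: "has i [E, L, R] s"
  have "swr i E [] (cap (Suc i) h L R s) = cap i h L R (swr i E [L, R] s)"
    using assms h by (intro swr_nat) (auto simp: vgen_def)
  then show "cap i h L R (sw (Suc i) E R (sw i E L s)) = cap (Suc i) h L R s"
    by simp
next
  assume h: "has i [L, R, E] s"
  have "swl i [] E (cap i h L R s) = cap (Suc i) h L R (swl i [L, R] E s)"
    using assms h by (intro swl_nat) (auto simp: vgen_def)
  then show "cap (Suc i) h L R (sw i L E (sw (Suc i) R E s)) = cap i h L R s"
    by simp
qed

lemma snake_right:
  assumes d: "dual_pair L R h" and s: "has i [L] s"
  shows "cap (Suc i) h L R (sw i L L (cup (Suc i) h L R s)) = s"
  using dual_pairD [OF d] s cup_sw(1) [of h L R i L s] by simp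

lemma snake_left:
  assumes d: "dual_pair L R h" and s: "has i [R] s"
  shows "cap i h L R (sw (Suc i) R R (cup i h L R s)) = s"
  using dual_pairD(6) [OF d s] dual_pairD(1-5) [OF d] s cup_sw(1) [of h L R i R s] by simp

text \<open>In \<open>kraus\<close> the environment sits between \<open>B\<star>\<close> and
  \<open>B\<close>; in \<open>disc\<close> it is first brought to the front. The cap may slide past
  the wire \<open>B\<star>\<close>.\<close>

lemma kraus_disc:
  assumes "X \<in> Obj V" "B \<in> Obj V" "g \<in> hom V A (X \<odot> B)"
  shows "kraus V X B g = disc X B \<cdot> pm g"
proof -
  note [simp] = assms(1,2)
  have g [simp]: "g \<in> Arr V" "Dom V g = A" "Cod V g = X \<odot> B"
    using assms(3) by (auto simp: hom_def)
  have c: "cap 0 (\<eta> X) (X\<star>) X (sw (Suc 0) (B\<star>) X (sw 0 (B\<star>) (X\<star>) (init [B\<star>, X\<star>, X, B])))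
      = cap (Suc 0) (\<eta> X) (X\<star>) X (init [B\<star>, X\<star>, X, B])"
    by (rule cap_sw) (auto simp: calc)
  have "(\<one> (B\<star>) \<otimes> \<Lambda> B) \<cdot> (\<one> (B\<star>) \<otimes> ((\<eta> X)\<dagger> \<otimes> \<one> B)) \<cdot> (\<one> (B\<star>) \<otimes> (\<alpha> (X\<star>) X B)\<dagger>) \<cdot>
      \<alpha> (B\<star>) (X\<star>) (X \<odot> B)
    = \<Lambda> (dbl B) \<cdot> ((\<eta> X)\<dagger> \<otimes> \<one> (dbl B)) \<cdot> interchange V (X\<star>) (B\<star>) X B \<cdot> (\<sigma> (B\<star>) (X\<star>) \<otimes> \<one> (X \<odot> B))"
    (is "?l = ?r")
    using c by (intro ap_faithful [where s = "mg 0 (B\<star> \<odot> X\<star>) (X \<odot> B) (mg 0 (B\<star>) (X\<star>) (mg (Suc (Suc 0)) X B (init [B\<star>, X\<star>, X, B])))"])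
      (simp_all add: coh' ap_expand_eta)
  then have "?l \<cdot> ((dual_tensor V X B \<otimes> \<one> (X \<odot> B)) \<cdot> (conj_map V g \<otimes> g))
      = ?r \<cdot> ((dual_tensor V X B \<otimes> \<one> (X \<odot> B)) \<cdot> (conj_map V g \<otimes> g))"
    by (rule arg_cong)
  then show ?thesis
    by (simp add: kraus_def disc_def cpm_shuffle_def pm_def cassoc)
qed

lemma completely_positive_iff:
  assumes "B \<in> Obj V"
  shows "completely_positive V A B f \<longleftrightarrow>
    (\<exists>X \<in> Obj V. \<exists>g \<in> Arr V. Dom V g = A \<and> Cod V g = X \<odot> B \<and> f = disc X B \<cdot> pm g)"
proof
  assume "completely_positive V A B f"
  then obtain X g where "X \<in> Obj V" "g \<in> hom V A (X \<odot> B)" "f = kraus V X B g"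
    by (auto simp: completely_positive_def)
  then show "\<exists>X \<in> Obj V. \<exists>g \<in> Arr V. Dom V g = A \<and> Cod V g = X \<odot> B \<and> f = disc X B \<cdot> pm g"
    using assms kraus_disc [of X B g A] by (auto simp: hom_def)
next
  assume "\<exists>X \<in> Obj V. \<exists>g \<in> Arr V. Dom V g = A \<and> Cod V g = X \<odot> B \<and> f = disc X B \<cdot> pm g"
  then obtain X g where *: "X \<in> Obj V" "g \<in> Arr V" "Dom V g = A" "Cod V g = X \<odot> B" "f = disc X B \<cdot> pm g"
    by blast
  then have "g \<in> hom V A (X \<odot> B)"
    by (simp add: hom_def)
  moreover from this have "f = kraus V X B g"
    using * assms kraus_disc [of X B g A] by simp
  ultimately show "completely_positive V A B f"
    using *(1) unfolding completely_positive_def by blast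
qed

lemma cp_typed:
  assumes "completely_positive V A B f" "B \<in> Obj V"
  shows "f \<in> Arr V" "Dom V f = dbl A" "Cod V f = dbl B"
  using assms by (auto simp: completely_positive_iff)

lemma disc_nat:
  assumes "f \<in> Arr V" "Dom V f = B" "Cod V f = B'" "X \<in> Obj V"
  shows "pm f \<cdot> disc X B = disc X B' \<cdot> pm (\<one> X \<otimes> f)"
proof -
  have o [simp]: "B \<in> Obj V" "B' \<in> Obj V"
    using assms dom_obj cod_obj by auto
  note [simp] = assms
  have "pm f \<cdot> disc X B = (pm f \<cdot> \<Lambda> (dbl B)) \<cdot> ((\<eta> X)\<dagger> \<otimes> \<one> (dbl B)) \<cdot> sh X B"
    by (simp add: disc_def cassoc)
  also have "\<dots> = \<Lambda> (dbl B') \<cdot> ((\<one> \<I> \<otimes> pm f) \<cdot> ((\<eta> X)\<dagger> \<otimes> \<one> (dbl B))) \<cdot> sh X B"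
    by (simp add: lunit_nat cassoc)
  also have "\<dots> = \<Lambda> (dbl B') \<cdot> ((\<eta> X)\<dagger> \<otimes> \<one> (dbl B')) \<cdot> ((pm (\<one> X) \<otimes> pm f) \<cdot> sh X B)"
    by (simp add: tensor_comp_reduce tensor_comp')
  also have "(pm (\<one> X) \<otimes> pm f) \<cdot> sh X B = sh X B' \<cdot> pm (\<one> X \<otimes> f)"
    by (rule sh_nat [symmetric]) simp_all
  finally show ?thesis
    by (simp add: disc_def cassoc)
qed

lemma disc_unit: "A \<in> Obj V \<Longrightarrow> disc \<I> A = pm (\<Lambda> A)"
  by (simp add: disc_def sh_lunit)

lemma sh_assoc':
  assumes [simp]: "X \<in> Obj V" "Y \<in> Obj V" "B \<in> Obj V"
  shows "(\<one> (dbl X) \<otimes> sh Y B) \<cdot> sh X (Y \<odot> B)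
      = \<alpha> (dbl X) (dbl Y) (dbl B) \<cdot> (sh X Y \<otimes> \<one> (dbl B)) \<cdot> sh (X \<odot> Y) B \<cdot> pm ((\<alpha> X Y B)\<dagger>)"
proof -
  have "\<alpha> (dbl X) (dbl Y) (dbl B) \<cdot> (sh X Y \<otimes> \<one> (dbl B)) \<cdot> sh (X \<odot> Y) B \<cdot> pm ((\<alpha> X Y B)\<dagger>)
      = (\<alpha> (dbl X) (dbl Y) (dbl B) \<cdot> (sh X Y \<otimes> \<one> (dbl B)) \<cdot> sh (X \<odot> Y) B) \<cdot> pm ((\<alpha> X Y B)\<dagger>)"
    by (simp add: cassoc)
  also have "\<dots> = (\<one> (dbl X) \<otimes> sh Y B) \<cdot> sh X (Y \<odot> B) \<cdot> (pm (\<alpha> X Y B) \<cdot> pm ((\<alpha> X Y B)\<dagger>))"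
    by (simp add: sh_assoc cassoc)
  also have "pm (\<alpha> X Y B) \<cdot> pm ((\<alpha> X Y B)\<dagger>) = \<one> (dbl (X \<odot> (Y \<odot> B)))"
    by (simp add: pm_comp [symmetric])
  finally show ?thesis by simp
qed

text \<open>Two successive traces are one trace over the product: the cap of a product splits by
  \<open>sh_eta\<close>, and associativity of the shuffle aligns the rest.\<close>

lemma disc_disc:
  assumes [simp]: "X \<in> Obj V" "Y \<in> Obj V" "B \<in> Obj V"
  shows "disc Y B \<cdot> disc X (Y \<odot> B) = disc (X \<odot> Y) B \<cdot> pm ((\<alpha> X Y B)\<dagger>)"
proof -
  let ?P = "dbl B"
  have e: "(\<eta> (X \<odot> Y))\<dagger> = \<Lambda> \<I> \<cdot> ((\<eta> X)\<dagger> \<otimes> (\<eta> Y)\<dagger>) \<cdot> sh X Y"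
  proof -
    have "\<eta> (X \<odot> Y) = (sh X Y)\<dagger> \<cdot> (\<eta> X \<otimes> \<eta> Y) \<cdot> (\<Lambda> \<I>)\<dagger>"
      using sh_simps(6) [of X Y "\<eta> (X \<odot> Y)"] by (simp add: sh_eta)
    then show ?thesis
      by (simp add: dagger_comp' cassoc)
  qed
  note a = sh_assoc' [OF assms(1,2,3)]
  have k: "\<Lambda> ?P \<cdot> ((\<eta> Y)\<dagger> \<otimes> \<one> ?P) \<cdot> \<Lambda> (dbl Y \<odot> ?P) \<cdot> ((\<eta> X)\<dagger> \<otimes> \<one> (dbl Y \<odot> ?P)) \<cdot> \<alpha> (dbl X) (dbl Y) ?P
      = \<Lambda> ?P \<cdot> ((\<Lambda> \<I> \<cdot> ((\<eta> X)\<dagger> \<otimes> (\<eta> Y)\<dagger>)) \<otimes> \<one> ?P)"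
    by (rule ap_faithful [where s = "mg 0 (dbl X \<odot> dbl Y) ?P (mg 0 (dbl X) (dbl Y) (mg 0 (X\<star>) X (mg (Suc (Suc 0)) (Y\<star>) Y (init [X\<star>, X, Y\<star>, Y, ?P]))))"])
      (simp_all add: coh ap_expand_eta)
  have "disc Y B \<cdot> disc X (Y \<odot> B)
      = \<Lambda> ?P \<cdot> ((\<eta> Y)\<dagger> \<otimes> \<one> ?P) \<cdot> (sh Y B \<cdot> \<Lambda> (dbl (Y \<odot> B))) \<cdot> ((\<eta> X)\<dagger> \<otimes> \<one> (dbl (Y \<odot> B))) \<cdot> sh X (Y \<odot> B)"
    by (simp add: disc_def cassoc)
  also have "sh Y B \<cdot> \<Lambda> (dbl (Y \<odot> B)) = \<Lambda> (dbl Y \<odot> ?P) \<cdot> (\<one> \<I> \<otimes> sh Y B)"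
    by (simp add: lunit_nat)
  also have "\<Lambda> ?P \<cdot> ((\<eta> Y)\<dagger> \<otimes> \<one> ?P) \<cdot> (\<dots>) \<cdot> ((\<eta> X)\<dagger> \<otimes> \<one> (dbl (Y \<odot> B))) \<cdot> sh X (Y \<odot> B)
     = \<Lambda> ?P \<cdot> ((\<eta> Y)\<dagger> \<otimes> \<one> ?P) \<cdot> \<Lambda> (dbl Y \<odot> ?P) \<cdot> ((\<eta> X)\<dagger> \<otimes> \<one> (dbl Y \<odot> ?P)) \<cdot> ((\<one> (dbl X) \<otimes> sh Y B) \<cdot> sh X (Y \<odot> B))"
    by (simp add: cassoc tensor_comp_reduce)
  also have "\<dots> = (\<Lambda> ?P \<cdot> ((\<eta> Y)\<dagger> \<otimes> \<one> ?P) \<cdot> \<Lambda> (dbl Y \<odot> ?P) \<cdot> ((\<eta> X)\<dagger> \<otimes> \<one> (dbl Y \<odot> ?P)) \<cdot> \<alpha> (dbl X) (dbl Y) ?P) \<cdot>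
      (sh X Y \<otimes> \<one> ?P) \<cdot> sh (X \<odot> Y) B \<cdot> pm ((\<alpha> X Y B)\<dagger>)"
    unfolding a by (simp add: cassoc)
  also have "\<dots> = disc (X \<odot> Y) B \<cdot> pm ((\<alpha> X Y B)\<dagger>)"
    unfolding k by (simp add: disc_def e tensor_left_comp cassoc)
  finally show ?thesis .
qed

text \<open>The adjoint of tracing out \<open>X\<close> inserts the cup \<open>\<eta> X\<close>.
  That cup is itself a partial trace, namely over \<open>X\<star>\<close>, of the doubled arrow
  \<open>pm (\<eta> X)\<close>; hence the new environment \<open>X\<star>\<close>.\<close>

lemma disc_dagger:
  assumes [simp]: "X \<in> Obj V" "B \<in> Obj V"
  shows "(disc X B)\<dagger> = disc (X\<star>) (X \<odot> B) \<cdot> pm (\<alpha> (X\<star>) X B \<cdot> (\<eta> X \<otimes> \<one> B) \<cdot> (\<Lambda> B)\<dagger>)"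
proof -
  let ?P = "dbl B" and ?Y = "X\<star>"
  \<comment> \<open>The core: tracing the first leg out of the doubled cup of \<open>X\<close> gives
    that cup again.\<close>
  have E: "\<Lambda> (dbl X) \<cdot> ((\<eta> ?Y)\<dagger> \<otimes> \<one> (dbl X)) \<cdot> sh ?Y X \<cdot> pm (\<eta> X) \<cdot> \<eta> \<I> = \<eta> X"
  proof -
    have "sh ?Y X \<cdot> pm (\<eta> X) \<cdot> \<eta> \<I> = sh ?Y X \<cdot> (\<one> ((dbl X)\<star>) \<otimes> \<eta> X) \<cdot> ((conj_map V (\<eta> X) \<otimes> \<one> \<I>) \<cdot> \<eta> \<I>)"
      by (simp add: pm_def tensor_comp_reduce)
    also have "(conj_map V (\<eta> X) \<otimes> \<one> \<I>) \<cdot> \<eta> \<I> = (\<one> ((dbl X)\<star>) \<otimes> (\<eta> X)\<dagger>) \<cdot> \<eta> (dbl X)"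
      by (rule conj_name) simp_all
    also have "sh ?Y X \<cdot> (\<one> ((dbl X)\<star>) \<otimes> \<eta> X) \<cdot> (\<dots>)
        = interchange V (?Y\<star>) (X\<star>) ?Y X \<cdot> ((\<one> (?Y\<star>) \<otimes> \<one> (X\<star>)) \<otimes> (\<eta> X \<cdot> (\<eta> X)\<dagger>)) \<cdot> ((dmon ?Y X \<otimes> \<one> (dbl X)) \<cdot> \<eta> (dbl X))"
      by (simp add: shuffle_dmon cassoc tensor_comp_reduce)
    finally have 1: "\<Lambda> (dbl X) \<cdot> ((\<eta> ?Y)\<dagger> \<otimes> \<one> (dbl X)) \<cdot> sh ?Y X \<cdot> pm (\<eta> X) \<cdot> \<eta> \<I>
       = \<Lambda> (dbl X) \<cdot> ((\<eta> ?Y)\<dagger> \<otimes> \<one> (dbl X)) \<cdot> interchange V (?Y\<star>) (X\<star>) ?Y X \<cdot> ((\<one> (?Y\<star>) \<otimes> \<one> (X\<star>)) \<otimes> (\<eta> X \<cdot> (\<eta> X)\<dagger>)) \<cdot>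
         interchange V (?Y\<star>) ?Y (X\<star>) X \<cdot> (\<eta> ?Y \<otimes> \<eta> X) \<cdot> (\<Lambda> \<I>)\<dagger>"
      by (simp add: dmon_name)
    \<comment> \<open>Conjugating \<open>\<eta> X\<close> slides it through a cup as a cap, which
      leaves two zigzags. This equation straightens the one of \<open>X\<close>, the next that of
      \<open>X\<star>\<close>.\<close>
    have 2: "((\<one> (?Y\<star>) \<otimes> \<one> (X\<star>)) \<otimes> (\<eta> X)\<dagger>) \<cdot> interchange V (?Y\<star>) ?Y (X\<star>) X \<cdot> (\<eta> ?Y \<otimes> \<eta> X) \<cdot> (\<Lambda> \<I>)\<dagger>
        = (\<rho> (dbl ?Y))\<dagger> \<cdot> \<eta> ?Y"
    proof (rule ap_faithful [where s = "nI 0 (init [])"])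
      let ?e = "cup 0 (\<eta> ?Y) (?Y\<star>) ?Y (init [])"
      have "cap (Suc (Suc 0)) (\<eta> X) (X\<star>) X (sw (Suc 0) (X\<star>) (X\<star>) (cup (Suc (Suc 0)) (\<eta> X) (X\<star>) X ?e)) = ?e"
        by (rule snake_right [OF dual_pair_eta]) (simp_all add: calc)
      then show "ap 0 [\<I>] (((\<one> (?Y\<star>) \<otimes> \<one> (X\<star>)) \<otimes> (\<eta> X)\<dagger>) \<cdot> interchange V (?Y\<star>) ?Y (X\<star>) X \<cdot> (\<eta> ?Y \<otimes> \<eta> X) \<cdot> (\<Lambda> \<I>)\<dagger>)
          [dbl ?Y \<odot> \<I>] (nI 0 (init [])) = ap 0 [\<I>] ((\<rho> (dbl ?Y))\<dagger> \<cdot> \<eta> ?Y) [dbl ?Y \<odot> \<I>] (nI 0 (init []))"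
        by (simp add: coh ap_expand_eta)
    qed (simp_all add: calc)
    have 3: "\<Lambda> (dbl X) \<cdot> ((\<eta> ?Y)\<dagger> \<otimes> \<one> (dbl X)) \<cdot> interchange V (?Y\<star>) (X\<star>) ?Y X \<cdot> ((\<one> (?Y\<star>) \<otimes> \<one> (X\<star>)) \<otimes> \<eta> X) \<cdot>
        (\<rho> (dbl ?Y))\<dagger> \<cdot> \<eta> ?Y = \<eta> X"
    proof (rule ap_faithful [where s = "nI 0 (init [])"])
      let ?e = "cup 0 (\<eta> X) (X\<star>) X (init [])"
      have "cap 0 (\<eta> ?Y) (?Y\<star>) ?Y (sw (Suc 0) (X\<star>) (X\<star>) (cup 0 (\<eta> ?Y) (?Y\<star>) ?Y ?e)) = ?e"
        by (rule snake_left [OF dual_pair_eta]) (simp_all add: calc)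
      then show "ap 0 [\<I>] (\<Lambda> (dbl X) \<cdot> ((\<eta> ?Y)\<dagger> \<otimes> \<one> (dbl X)) \<cdot> interchange V (?Y\<star>) (X\<star>) ?Y X \<cdot> ((\<one> (?Y\<star>) \<otimes> \<one> (X\<star>)) \<otimes> \<eta> X) \<cdot>
          (\<rho> (dbl ?Y))\<dagger> \<cdot> \<eta> ?Y) [dbl X] (nI 0 (init [])) = ap 0 [\<I>] (\<eta> X) [dbl X] (nI 0 (init []))"
        by (simp add: coh' ap_expand_eta)
    qed (simp_all add: calc)
    have "((\<one> (?Y\<star>) \<otimes> \<one> (X\<star>)) \<otimes> (\<eta> X \<cdot> (\<eta> X)\<dagger>))
        = ((\<one> (?Y\<star>) \<otimes> \<one> (X\<star>)) \<otimes> \<eta> X) \<cdot> ((\<one> (?Y\<star>) \<otimes> \<one> (X\<star>)) \<otimes> (\<eta> X)\<dagger>)"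
      by (simp add: tensor_comp')
    then have "\<Lambda> (dbl X) \<cdot> ((\<eta> ?Y)\<dagger> \<otimes> \<one> (dbl X)) \<cdot> interchange V (?Y\<star>) (X\<star>) ?Y X \<cdot> ((\<one> (?Y\<star>) \<otimes> \<one> (X\<star>)) \<otimes> (\<eta> X \<cdot> (\<eta> X)\<dagger>)) \<cdot>
         interchange V (?Y\<star>) ?Y (X\<star>) X \<cdot> (\<eta> ?Y \<otimes> \<eta> X) \<cdot> (\<Lambda> \<I>)\<dagger>
       = \<Lambda> (dbl X) \<cdot> ((\<eta> ?Y)\<dagger> \<otimes> \<one> (dbl X)) \<cdot> interchange V (?Y\<star>) (X\<star>) ?Y X \<cdot> ((\<one> (?Y\<star>) \<otimes> \<one> (X\<star>)) \<otimes> \<eta> X) \<cdot>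
         (((\<one> (?Y\<star>) \<otimes> \<one> (X\<star>)) \<otimes> (\<eta> X)\<dagger>) \<cdot> interchange V (?Y\<star>) ?Y (X\<star>) X \<cdot> (\<eta> ?Y \<otimes> \<eta> X) \<cdot> (\<Lambda> \<I>)\<dagger>)"
      by (simp add: cassoc)
    then show ?thesis
      unfolding 1 2 3 .
  qed
  have a: "sh ?Y (X \<odot> B) \<cdot> pm (\<alpha> ?Y X B) = (\<one> (dbl ?Y) \<otimes> (sh X B)\<dagger>) \<cdot> \<alpha> (dbl ?Y) (dbl X) ?P \<cdot> (sh ?Y X \<otimes> \<one> ?P) \<cdot> sh (?Y \<odot> X) B"
    unfolding sh_assoc [of ?Y X B, simplified] by (simp add: tensor_comp_reduce)
  have b: "sh (dbl X) B \<cdot> pm (\<eta> X \<otimes> \<one> B) = (pm (\<eta> X) \<otimes> \<one> ?P) \<cdot> sh \<I> B"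
    using sh_nat [of "\<eta> X" "\<one> B"] by simp
  have c: "sh \<I> B \<cdot> pm ((\<Lambda> B)\<dagger>) = (\<eta> \<I> \<otimes> \<one> ?P) \<cdot> (\<Lambda> ?P)\<dagger>"
  proof -
    have "pm ((\<Lambda> B)\<dagger>) = (sh \<I> B)\<dagger> \<cdot> (\<eta> \<I> \<otimes> \<one> ?P) \<cdot> (\<Lambda> ?P)\<dagger>"
      by (simp add: pm_dagger dagger_comp' cassoc flip: sh_lunit)
    then show ?thesis
      by simp
  qed
  have d: "\<Lambda> (dbl (X \<odot> B)) \<cdot> (\<one> \<I> \<otimes> (sh X B)\<dagger>) = (sh X B)\<dagger> \<cdot> \<Lambda> (dbl X \<odot> ?P)"
    using lunit_nat [of "(sh X B)\<dagger>"] by simp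
  have "disc ?Y (X \<odot> B) \<cdot> pm (\<alpha> ?Y X B \<cdot> (\<eta> X \<otimes> \<one> B) \<cdot> (\<Lambda> B)\<dagger>)
      = \<Lambda> (dbl (X \<odot> B)) \<cdot> ((\<eta> ?Y)\<dagger> \<otimes> \<one> (dbl (X \<odot> B))) \<cdot> (sh ?Y (X \<odot> B) \<cdot> pm (\<alpha> ?Y X B)) \<cdot> pm (\<eta> X \<otimes> \<one> B) \<cdot> pm ((\<Lambda> B)\<dagger>)"
    by (simp add: disc_def pm_comp cassoc)
  also have "\<dots> = \<Lambda> (dbl (X \<odot> B)) \<cdot> (\<one> \<I> \<otimes> (sh X B)\<dagger>) \<cdot> ((\<eta> ?Y)\<dagger> \<otimes> \<one> (dbl X \<odot> ?P)) \<cdot> \<alpha> (dbl ?Y) (dbl X) ?P \<cdot> (sh ?Y X \<otimes> \<one> ?P) \<cdot>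
      (sh (?Y \<odot> X) B \<cdot> pm (\<eta> X \<otimes> \<one> B)) \<cdot> pm ((\<Lambda> B)\<dagger>)"
    unfolding a by (simp add: cassoc tensor_comp_reduce)
  also have "\<dots> = (\<Lambda> (dbl (X \<odot> B)) \<cdot> (\<one> \<I> \<otimes> (sh X B)\<dagger>)) \<cdot> ((\<eta> ?Y)\<dagger> \<otimes> (\<one> (dbl X) \<otimes> \<one> ?P)) \<cdot> \<alpha> (dbl ?Y) (dbl X) ?P \<cdot> (sh ?Y X \<otimes> \<one> ?P) \<cdot>
      (pm (\<eta> X) \<otimes> \<one> ?P) \<cdot> (\<eta> \<I> \<otimes> \<one> ?P) \<cdot> (\<Lambda> ?P)\<dagger>"
    unfolding b by (simp add: cassoc c)
  also have "\<dots> = (sh X B)\<dagger> \<cdot> \<Lambda> (dbl X \<odot> ?P) \<cdot> (((\<eta> ?Y)\<dagger> \<otimes> (\<one> (dbl X) \<otimes> \<one> ?P)) \<cdot> \<alpha> (dbl ?Y) (dbl X) ?P) \<cdot> (sh ?Y X \<otimes> \<one> ?P) \<cdot>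
      (pm (\<eta> X) \<otimes> \<one> ?P) \<cdot> (\<eta> \<I> \<otimes> \<one> ?P) \<cdot> (\<Lambda> ?P)\<dagger>"
    unfolding d by (simp add: cassoc)
  also have "((\<eta> ?Y)\<dagger> \<otimes> (\<one> (dbl X) \<otimes> \<one> ?P)) \<cdot> \<alpha> (dbl ?Y) (dbl X) ?P = \<alpha> \<I> (dbl X) ?P \<cdot> (((\<eta> ?Y)\<dagger> \<otimes> \<one> (dbl X)) \<otimes> \<one> ?P)"
    by (simp add: assoc_nat del: tensor_id)
  also have "(sh X B)\<dagger> \<cdot> \<Lambda> (dbl X \<odot> ?P) \<cdot> (\<dots>) \<cdot> (sh ?Y X \<otimes> \<one> ?P) \<cdot>
      (pm (\<eta> X) \<otimes> \<one> ?P) \<cdot> (\<eta> \<I> \<otimes> \<one> ?P) \<cdot> (\<Lambda> ?P)\<dagger>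
    = (sh X B)\<dagger> \<cdot> (\<Lambda> (dbl X \<odot> ?P) \<cdot> \<alpha> \<I> (dbl X) ?P) \<cdot> ((((\<eta> ?Y)\<dagger> \<otimes> \<one> (dbl X)) \<cdot> sh ?Y X \<cdot> pm (\<eta> X) \<cdot> \<eta> \<I>) \<otimes> \<one> ?P) \<cdot> (\<Lambda> ?P)\<dagger>"
    by (simp add: cassoc tensor_comp_reduce)
  also have "\<dots> = (sh X B)\<dagger> \<cdot> ((\<Lambda> (dbl X) \<cdot> ((\<eta> ?Y)\<dagger> \<otimes> \<one> (dbl X)) \<cdot> sh ?Y X \<cdot> pm (\<eta> X) \<cdot> \<eta> \<I>) \<otimes> \<one> ?P) \<cdot> (\<Lambda> ?P)\<dagger>"
    by (simp add: lunit_tensor tensor_comp_reduce)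
  also have "\<dots> = (disc X B)\<dagger>"
    unfolding E by (simp add: disc_def dagger_comp' cassoc)
  finally show ?thesis ..
qed

text \<open>The traced wires \<open>Y\<star>\<close>, \<open>Y\<close> lie to the right of the
  double of \<open>A\<close>; the cap slides left past both of its wires, and the Kraus side records
  this as a permutation.\<close>

lemma disc_tensor:
  assumes [simp]: "A \<in> Obj V" "Y \<in> Obj V" "D \<in> Obj V"
  shows "(\<one> (dbl A) \<otimes> disc Y D) \<cdot> sh A (Y \<odot> D)
    = sh A D \<cdot> disc Y (A \<odot> D) \<cdot> pm (\<alpha> Y A D \<cdot> (\<sigma> A Y \<otimes> \<one> D) \<cdot> (\<alpha> A Y D)\<dagger>)"
proof -
  let ?A = "dbl A" and ?Y = "dbl Y" and ?D = "dbl D"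
  have s: "sh A Y = \<sigma> ?Y ?A \<cdot> sh Y A \<cdot> pm (\<sigma> A Y)"
    by (simp add: sh_sym [symmetric])
  have k: "(\<one> ?A \<otimes> \<Lambda> ?D) \<cdot> (\<one> ?A \<otimes> ((\<eta> Y)\<dagger> \<otimes> \<one> ?D)) \<cdot> \<alpha> ?A ?Y ?D \<cdot> (\<sigma> ?Y ?A \<otimes> \<one> ?D)
      = \<Lambda> (?A \<odot> ?D) \<cdot> ((\<eta> Y)\<dagger> \<otimes> \<one> (?A \<odot> ?D)) \<cdot> \<alpha> ?Y ?A ?D"
  proof (rule ap_faithful [where s = "mg 0 (?Y \<odot> ?A) ?D (mg 0 ?Y ?A (mg 0 (Y\<star>) Y (mg (Suc (Suc 0)) (A\<star>) A (init [Y\<star>, Y, A\<star>, A, ?D]))))"])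
    let ?w = "init [Y\<star>, Y, A\<star>, A, ?D]"
    have 1: "cap (Suc 0) (\<eta> Y) (Y\<star>) Y (sw 0 (Y\<star>) (A\<star>) (sw (Suc 0) Y (A\<star>) ?w)) = cap 0 (\<eta> Y) (Y\<star>) Y ?w"
      by (rule cap_sw) (simp_all add: calc)
    have 2: "cap (Suc (Suc 0)) (\<eta> Y) (Y\<star>) Y (sw (Suc 0) (Y\<star>) A (sw (Suc (Suc 0)) Y A (sw 0 (Y\<star>) (A\<star>) (sw (Suc 0) Y (A\<star>) ?w))))
        = cap (Suc 0) (\<eta> Y) (Y\<star>) Y (sw 0 (Y\<star>) (A\<star>) (sw (Suc 0) Y (A\<star>) ?w))"
      by (rule cap_sw) (simp_all add: calc)
    have 3: "cap (Suc (Suc 0)) (\<eta> Y) (Y\<star>) Y (sw (Suc 0) (Y\<star>) A (sw 0 (Y\<star>) (A\<star>) (sw (Suc (Suc 0)) Y A (sw (Suc 0) Y (A\<star>) ?w))))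
        = cap 0 (\<eta> Y) (Y\<star>) Y ?w"
      using 2 unfolding 1 by (simp add: ap_interchange)
    show "ap 0 [(?Y \<odot> ?A) \<odot> ?D] ((\<one> ?A \<otimes> \<Lambda> ?D) \<cdot> (\<one> ?A \<otimes> ((\<eta> Y)\<dagger> \<otimes> \<one> ?D)) \<cdot> \<alpha> ?A ?Y ?D \<cdot> (\<sigma> ?Y ?A \<otimes> \<one> ?D)) [?A \<odot> ?D]
        (mg 0 (?Y \<odot> ?A) ?D (mg 0 ?Y ?A (mg 0 (Y\<star>) Y (mg (Suc (Suc 0)) (A\<star>) A ?w))))
      = ap 0 [(?Y \<odot> ?A) \<odot> ?D] (\<Lambda> (?A \<odot> ?D) \<cdot> ((\<eta> Y)\<dagger> \<otimes> \<one> (?A \<odot> ?D)) \<cdot> \<alpha> ?Y ?A ?D) [?A \<odot> ?D]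
        (mg 0 (?Y \<odot> ?A) ?D (mg 0 ?Y ?A (mg 0 (Y\<star>) Y (mg (Suc (Suc 0)) (A\<star>) A ?w))))"
      using 3 by (simp add: coh ap_expand_eta)
  qed (simp_all add: calc)
  have "(\<one> ?A \<otimes> disc Y D) \<cdot> sh A (Y \<odot> D)
      = (\<one> ?A \<otimes> \<Lambda> ?D) \<cdot> (\<one> ?A \<otimes> ((\<eta> Y)\<dagger> \<otimes> \<one> ?D)) \<cdot> (\<one> ?A \<otimes> sh Y D) \<cdot> sh A (Y \<odot> D)"
    by (simp add: disc_def tensor_left_comp cassoc)
  also have "\<dots> = ((\<one> ?A \<otimes> \<Lambda> ?D) \<cdot> (\<one> ?A \<otimes> ((\<eta> Y)\<dagger> \<otimes> \<one> ?D)) \<cdot> \<alpha> ?A ?Y ?D \<cdot> (\<sigma> ?Y ?A \<otimes> \<one> ?D)) \<cdot>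
      (sh Y A \<otimes> \<one> ?D) \<cdot> ((pm (\<sigma> A Y) \<otimes> pm (\<one> D)) \<cdot> sh (A \<odot> Y) D) \<cdot> pm ((\<alpha> A Y D)\<dagger>)"
    by (simp add: sh_assoc') (simp add: s tensor_left_comp cassoc)
  also have "(pm (\<sigma> A Y) \<otimes> pm (\<one> D)) \<cdot> sh (A \<odot> Y) D = sh (Y \<odot> A) D \<cdot> pm (\<sigma> A Y \<otimes> \<one> D)"
    by (rule sh_nat [symmetric]) simp_all
  also have "(\<one> ?A \<otimes> \<Lambda> ?D) \<cdot> (\<one> ?A \<otimes> ((\<eta> Y)\<dagger> \<otimes> \<one> ?D)) \<cdot> \<alpha> ?A ?Y ?D \<cdot> (\<sigma> ?Y ?A \<otimes> \<one> ?D)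
      = \<Lambda> (?A \<odot> ?D) \<cdot> ((\<eta> Y)\<dagger> \<otimes> \<one> (?A \<odot> ?D)) \<cdot> \<alpha> ?Y ?A ?D"
    by (rule k)
  also have "(\<dots>) \<cdot> (sh Y A \<otimes> \<one> ?D) \<cdot> (sh (Y \<odot> A) D \<cdot> pm (\<sigma> A Y \<otimes> \<one> D)) \<cdot> pm ((\<alpha> A Y D)\<dagger>)
      = \<Lambda> (?A \<odot> ?D) \<cdot> ((\<eta> Y)\<dagger> \<otimes> \<one> (?A \<odot> ?D)) \<cdot> (\<alpha> ?Y ?A ?D \<cdot> (sh Y A \<otimes> \<one> ?D) \<cdot> sh (Y \<odot> A) D) \<cdot> pm (\<sigma> A Y \<otimes> \<one> D) \<cdot> pm ((\<alpha> A Y D)\<dagger>)"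
    by (simp add: cassoc)
  also have "\<dots> = (\<Lambda> (?A \<odot> ?D) \<cdot> (\<one> \<I> \<otimes> sh A D)) \<cdot> ((\<eta> Y)\<dagger> \<otimes> \<one> (dbl (A \<odot> D))) \<cdot> sh Y (A \<odot> D) \<cdot> pm (\<alpha> Y A D) \<cdot> pm (\<sigma> A Y \<otimes> \<one> D) \<cdot> pm ((\<alpha> A Y D)\<dagger>)"
    by (simp add: sh_assoc cassoc tensor_comp_reduce)
  also have "\<Lambda> (?A \<odot> ?D) \<cdot> (\<one> \<I> \<otimes> sh A D) = sh A D \<cdot> \<Lambda> (dbl (A \<odot> D))"
    using lunit_nat [of "sh A D"] by simp
  finally show ?thesis
    by (simp add: disc_def pm_comp cassoc)
qed

text \<open>The environment is the unit, and tracing it out is a doubled unitor.\<close>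

lemma cp_pure:
  assumes "f \<in> Arr V" "Dom V f = A" "Cod V f = B"
  shows "completely_positive V A B (pm f)"
proof -
  have o: "A \<in> Obj V" "B \<in> Obj V"
    using assms dom_obj cod_obj by auto
  then have "pm f = disc \<I> B \<cdot> pm ((\<Lambda> B)\<dagger> \<cdot> f)"
    using assms by (simp add: disc_unit pm_comp [symmetric])
  with o assms show ?thesis
    by (auto simp: completely_positive_iff intro!: bexI [of _ \<I>] bexI [of _ "(\<Lambda> B)\<dagger> \<cdot> f"])
qed

text \<open>The environments multiply: the second Kraus arrow is moved past the first trace by
  \<open>disc_nat\<close>, after which two traces become one.\<close>

lemma cp_comp:
  assumes f: "completely_positive V A B f" and g: "completely_positive V B D g"
    and [simp]: "B \<in> Obj V" "D \<in> Obj V"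
  shows "completely_positive V A D (g \<cdot> f)"
proof -
  obtain X k where k [simp]: "X \<in> Obj V" "k \<in> Arr V" "Dom V k = A" "Cod V k = X \<odot> B" and f: "f = disc X B \<cdot> pm k"
    using f by (auto simp: completely_positive_iff)
  obtain Y h where h [simp]: "Y \<in> Obj V" "h \<in> Arr V" "Dom V h = B" "Cod V h = Y \<odot> D" and g: "g = disc Y D \<cdot> pm h"
    using g by (auto simp: completely_positive_iff)
  let ?k = "(\<alpha> X Y D)\<dagger> \<cdot> (\<one> X \<otimes> h) \<cdot> k"
  have "g \<cdot> f = disc Y D \<cdot> (pm h \<cdot> disc X B) \<cdot> pm k"
    by (simp add: f g cassoc)
  also have "\<dots> = (disc Y D \<cdot> disc X (Y \<odot> D)) \<cdot> pm (\<one> X \<otimes> h) \<cdot> pm k"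
    by (simp add: disc_nat [of h] cassoc)
  also have "\<dots> = disc (X \<odot> Y) D \<cdot> pm ?k"
    by (simp add: disc_disc pm_comp cassoc)
  finally show ?thesis
    by (auto simp: completely_positive_iff intro!: bexI [of _ "X \<odot> Y"] bexI [of _ ?k])
qed

lemma cp_dagger:
  assumes f: "completely_positive V A B f" and [simp]: "A \<in> Obj V" "B \<in> Obj V"
  shows "completely_positive V B A (f\<dagger>)"
proof -
  obtain X k where k [simp]: "X \<in> Obj V" "k \<in> Arr V" "Dom V k = A" "Cod V k = X \<odot> B" and f: "f = disc X B \<cdot> pm k"
    using f by (auto simp: completely_positive_iff)
  let ?h = "\<alpha> (X\<star>) X B \<cdot> (\<eta> X \<otimes> \<one> B) \<cdot> (\<Lambda> B)\<dagger>"
  have "f\<dagger> = pm (k\<dagger>) \<cdot> (disc (X\<star>) (X \<odot> B) \<cdot> pm ?h)"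
    by (simp add: f dagger_comp' disc_dagger pm_dagger)
  moreover have "completely_positive V B (X \<odot> B) (disc (X\<star>) (X \<odot> B) \<cdot> pm ?h)"
    by (auto simp: completely_positive_iff intro!: bexI [of _ "X\<star>"] bexI [of _ ?h])
  ultimately show ?thesis
    using cp_comp [OF _ cp_pure [of "k\<dagger>" "X \<odot> B" A]] by simp
qed

text \<open>The tensor of \<open>CPM[V]\<close> on underlying arrows. The objects are arguments
  because \<open>A\<star> \<odot> A\<close> need not determine \<open>A\<close>.\<close>

definition tens :: "'o \<Rightarrow> 'o \<Rightarrow> 'a \<Rightarrow> 'o \<Rightarrow> 'o \<Rightarrow> 'a \<Rightarrow> 'a" where
  "tens A B f D E g = (sh B E)\<dagger> \<cdot> (f \<otimes> g) \<cdot> sh A D"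

lemma cp_tensor_right:
  assumes g: "completely_positive V D E g" and [simp]: "A \<in> Obj V" "D \<in> Obj V" "E \<in> Obj V"
  shows "completely_positive V (A \<odot> D) (A \<odot> E) (tens A A (\<one> (dbl A)) D E g)"
proof -
  obtain Y h where h [simp]: "Y \<in> Obj V" "h \<in> Arr V" "Dom V h = D" "Cod V h = Y \<odot> E" and g: "g = disc Y E \<cdot> pm h"
    using g by (auto simp: completely_positive_iff)
  let ?t = "\<alpha> Y A E \<cdot> (\<sigma> A Y \<otimes> \<one> E) \<cdot> (\<alpha> A Y E)\<dagger>"
  have "tens A A (\<one> (dbl A)) D E g = (sh A E)\<dagger> \<cdot> (\<one> (dbl A) \<otimes> disc Y E) \<cdot> (pm (\<one> A) \<otimes> pm h) \<cdot> sh A D"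
    by (simp add: tens_def g tensor_left_comp cassoc)
  also have "(pm (\<one> A) \<otimes> pm h) \<cdot> sh A D = sh A (Y \<odot> E) \<cdot> pm (\<one> A \<otimes> h)"
    by (rule sh_nat [symmetric]) simp_all
  also have "(sh A E)\<dagger> \<cdot> (\<one> (dbl A) \<otimes> disc Y E) \<cdot> \<dots> = (sh A E)\<dagger> \<cdot> ((\<one> (dbl A) \<otimes> disc Y E) \<cdot> sh A (Y \<odot> E)) \<cdot> pm (\<one> A \<otimes> h)"
    by (simp add: cassoc)
  also have "\<dots> = disc Y (A \<odot> E) \<cdot> pm (?t \<cdot> (\<one> A \<otimes> h))"
    by (simp add: disc_tensor pm_comp cassoc)
  finally show ?thesis
    by (auto simp: completely_positive_iff intro!: bexI [of _ Y] bexI [of _ "?t \<cdot> (\<one> A \<otimes> h)"])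
qed

lemma tens_sym:
  assumes [simp]: "A \<in> Obj V" "B \<in> Obj V" "D \<in> Obj V" "E \<in> Obj V"
    and f [simp]: "f \<in> Arr V" "Dom V f = dbl A" "Cod V f = dbl B"
    and g [simp]: "g \<in> Arr V" "Dom V g = dbl D" "Cod V g = dbl E"
  shows "tens A B f D E g = pm (\<sigma> E B) \<cdot> tens D E g A B f \<cdot> pm (\<sigma> A D)"
proof -
  have s: "pm (\<sigma> E B) \<cdot> (sh E B)\<dagger> = (sh B E)\<dagger> \<cdot> \<sigma> (dbl E) (dbl B)"
    using arg_cong [OF sh_sym [of B E], of "\<lambda>x. x\<dagger>"] by (simp add: dagger_comp' pm_dagger [symmetric])
  have "pm (\<sigma> E B) \<cdot> tens D E g A B f \<cdot> pm (\<sigma> A D)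
      = (pm (\<sigma> E B) \<cdot> (sh E B)\<dagger>) \<cdot> (g \<otimes> f) \<cdot> (sh D A \<cdot> pm (\<sigma> A D))"
    by (simp add: tens_def cassoc)
  also have "\<dots> = (sh B E)\<dagger> \<cdot> (\<sigma> (dbl E) (dbl B) \<cdot> (g \<otimes> f)) \<cdot> \<sigma> (dbl A) (dbl D) \<cdot> sh A D"
    by (simp add: s cassoc flip: sh_sym)
  also have "\<sigma> (dbl E) (dbl B) \<cdot> (g \<otimes> f) = (f \<otimes> g) \<cdot> \<sigma> (dbl D) (dbl A)"
    using sym_nat [of g f] by simp
  finally show ?thesis
    by (simp add: tens_def cassoc)
qed

text \<open>Factored into two tensors with an identity; the one acting on the left is conjugated by
  the symmetry into the other kind.\<close>

lemma cp_tensor: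
  assumes f: "completely_positive V A B f" and g: "completely_positive V D E g"
    and [simp]: "A \<in> Obj V" "B \<in> Obj V" "D \<in> Obj V" "E \<in> Obj V"
  shows "completely_positive V (A \<odot> D) (B \<odot> E) (tens A B f D E g)"
proof -
  note [simp] = cp_typed [OF f assms(4)] cp_typed [OF g assms(6)]
  have "completely_positive V (A \<odot> D) (B \<odot> D) (tens A B f D D (\<one> (dbl D)))"
  proof -
    have "completely_positive V (A \<odot> D) (B \<odot> D) (pm (\<sigma> D B) \<cdot> tens D D (\<one> (dbl D)) A B f \<cdot> pm (\<sigma> A D))"
      by (intro cp_comp [OF cp_comp [OF cp_pure cp_tensor_right [OF f]] cp_pure]) auto
    then show ?thesis
      by (simp add: tens_sym [of A B D D])
  qed
  then have "completely_positive V (A \<odot> D) (B \<odot> E) (tens B B (\<one> (dbl B)) D E g \<cdot> tens A B f D D (\<one> (dbl D)))"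
    using cp_tensor_right [OF g] by (rule cp_comp) auto
  then show ?thesis
    by (simp add: tens_def cassoc tensor_comp_reduce)
qed

end

section \<open>The dagger symmetric monoidal structure of completely positive maps\<close>

context dagger_compact_category
begin

lemma tens_typed [simp]:
  assumes "A \<in> Obj V" "B \<in> Obj V" "D \<in> Obj V" "E \<in> Obj V"
    and "f \<in> Arr V" "Dom V f = dbl A" "Cod V f = dbl B"
    and "g \<in> Arr V" "Dom V g = dbl D" "Cod V g = dbl E"
  shows "tens A B f D E g \<in> Arr V" "Dom V (tens A B f D E g) = dbl (A \<odot> D)"
    "Cod V (tens A B f D E g) = dbl (B \<odot> E)"
  using assms by (auto simp: tens_def)

lemma tens_comp:
  assumes [simp]: "A \<in> Obj V" "B \<in> Obj V" "C \<in> Obj V" "A' \<in> Obj V" "B' \<in> Obj V" "C' \<in> Obj V"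
    and [simp]: "f \<in> Arr V" "Dom V f = dbl A" "Cod V f = dbl B" "g \<in> Arr V" "Dom V g = dbl B" "Cod V g = dbl C"
    and [simp]: "f' \<in> Arr V" "Dom V f' = dbl A'" "Cod V f' = dbl B'" "g' \<in> Arr V" "Dom V g' = dbl B'" "Cod V g' = dbl C'"
  shows "tens A C (g \<cdot> f) A' C' (g' \<cdot> f') = tens B C g B' C' g' \<cdot> tens A B f A' B' f'"
  by (simp add: tens_def cassoc tensor_comp_reduce)

lemma tens_dagger:
  assumes [simp]: "A \<in> Obj V" "B \<in> Obj V" "D \<in> Obj V" "E \<in> Obj V"
    and [simp]: "f \<in> Arr V" "Dom V f = dbl A" "Cod V f = dbl B"
    and [simp]: "g \<in> Arr V" "Dom V g = dbl D" "Cod V g = dbl E"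
  shows "(tens A B f D E g)\<dagger> = tens B A (f\<dagger>) E D (g\<dagger>)"
  by (simp add: tens_def dagger_comp' cassoc)

text \<open>Doubling is strictly compatible with this tensor, so equations between coherence arrows
  of \<open>CPM[V]\<close> are doubles of those in \<open>V\<close>.\<close>

lemma tens_pm:
  assumes [simp]: "f \<in> Arr V" "Dom V f = A" "Cod V f = B" "g \<in> Arr V" "Dom V g = D" "Cod V g = E"
  shows "tens A B (pm f) D E (pm g) = pm (f \<otimes> g)"
proof -
  have [simp]: "A \<in> Obj V" "B \<in> Obj V" "D \<in> Obj V" "E \<in> Obj V"
    using dom_obj [of f] cod_obj [of f] dom_obj [of g] cod_obj [of g] by auto
  show ?thesis
    by (simp add: tens_def flip: sh_nat)
qed

lemma tens_assoc:
  assumes [simp]: "A \<in> Obj V" "B \<in> Obj V" "D \<in> Obj V" "A' \<in> Obj V" "B' \<in> Obj V" "D' \<in> Obj V"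
    and [simp]: "f \<in> Arr V" "Dom V f = dbl A" "Cod V f = dbl A'"
    and [simp]: "g \<in> Arr V" "Dom V g = dbl B" "Cod V g = dbl B'"
    and [simp]: "h \<in> Arr V" "Dom V h = dbl D" "Cod V h = dbl D'"
  shows "pm (\<alpha> A' B' D') \<cdot> tens (A \<odot> B) (A' \<odot> B') (tens A A' f B B' g) D D' h
    = tens A A' f (B \<odot> D) (B' \<odot> D') (tens B B' g D D' h) \<cdot> pm (\<alpha> A B D)"
proof -
  let ?a = "\<alpha> (dbl A) (dbl B) (dbl D)" and ?a' = "\<alpha> (dbl A') (dbl B') (dbl D')"
  have p: "pm (\<alpha> A' B' D') = (sh A' (B' \<odot> D'))\<dagger> \<cdot> (\<one> (dbl A') \<otimes> (sh B' D')\<dagger>) \<cdot> ?a' \<cdot> (sh A' B' \<otimes> \<one> (dbl D')) \<cdot> sh (A' \<odot> B') D'"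
    unfolding sh_assoc [of A' B' D', simplified] by (simp add: tensor_comp_reduce)
  have "pm (\<alpha> A' B' D') \<cdot> tens (A \<odot> B) (A' \<odot> B') (tens A A' f B B' g) D D' h
      = (sh A' (B' \<odot> D'))\<dagger> \<cdot> (\<one> (dbl A') \<otimes> (sh B' D')\<dagger>) \<cdot> (?a' \<cdot> ((f \<otimes> g) \<otimes> h)) \<cdot> (sh A B \<otimes> \<one> (dbl D)) \<cdot> sh (A \<odot> B) D"
    unfolding p by (simp add: tens_def cassoc tensor_comp_reduce)
  also have "?a' \<cdot> ((f \<otimes> g) \<otimes> h) = (f \<otimes> (g \<otimes> h)) \<cdot> ?a"
    by (simp add: assoc_nat)
  also have "(sh A' (B' \<odot> D'))\<dagger> \<cdot> (\<one> (dbl A') \<otimes> (sh B' D')\<dagger>) \<cdot> (\<dots>) \<cdot> (sh A B \<otimes> \<one> (dbl D)) \<cdot> sh (A \<odot> B) D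
      = (sh A' (B' \<odot> D'))\<dagger> \<cdot> (\<one> (dbl A') \<otimes> (sh B' D')\<dagger>) \<cdot> (f \<otimes> (g \<otimes> h)) \<cdot> (\<one> (dbl A) \<otimes> sh B D) \<cdot> sh A (B \<odot> D) \<cdot> pm (\<alpha> A B D)"
    by (simp add: cassoc sh_assoc)
  also have "\<dots> = tens A A' f (B \<odot> D) (B' \<odot> D') (tens B B' g D D' h) \<cdot> pm (\<alpha> A B D)"
    by (simp add: tens_def cassoc tensor_comp_reduce)
  finally show ?thesis .
qed

lemma tens_lunit:
  assumes [simp]: "A \<in> Obj V" "B \<in> Obj V" "f \<in> Arr V" "Dom V f = dbl A" "Cod V f = dbl B"
  shows "pm (\<Lambda> B) \<cdot> tens \<I> \<I> (\<one> (dbl \<I>)) A B f = f \<cdot> pm (\<Lambda> A)"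
proof -
  have "pm (\<Lambda> B) \<cdot> tens \<I> \<I> (\<one> (dbl \<I>)) A B f
      = (\<Lambda> (dbl B) \<cdot> (\<one> \<I> \<otimes> f)) \<cdot> ((\<eta> \<I>)\<dagger> \<otimes> \<one> (dbl A)) \<cdot> sh \<I> A"
    by (simp add: tens_def cassoc tensor_comp_reduce flip: sh_lunit)
  also have "\<Lambda> (dbl B) \<cdot> (\<one> \<I> \<otimes> f) = f \<cdot> \<Lambda> (dbl A)"
    by (simp add: lunit_nat)
  finally show ?thesis
    by (simp add: cassoc flip: sh_lunit)
qed

lemma tens_runit:
  assumes [simp]: "A \<in> Obj V" "B \<in> Obj V" "f \<in> Arr V" "Dom V f = dbl A" "Cod V f = dbl B"
  shows "pm (\<rho> B) \<cdot> tens A B f \<I> \<I> (\<one> (dbl \<I>)) = f \<cdot> pm (\<rho> A)"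
proof -
  have "pm (\<rho> B) \<cdot> tens A B f \<I> \<I> (\<one> (dbl \<I>))
      = (\<rho> (dbl B) \<cdot> (f \<otimes> \<one> \<I>)) \<cdot> (\<one> (dbl A) \<otimes> (\<eta> \<I>)\<dagger>) \<cdot> sh A \<I>"
    by (simp add: tens_def cassoc tensor_comp_reduce flip: sh_runit)
  also have "\<rho> (dbl B) \<cdot> (f \<otimes> \<one> \<I>) = f \<cdot> \<rho> (dbl A)"
    by (simp add: runit_nat)
  finally show ?thesis
    by (simp add: cassoc flip: sh_runit)
qed

lemma tens_sym':
  assumes [simp]: "A \<in> Obj V" "B \<in> Obj V" "D \<in> Obj V" "E \<in> Obj V"
    and [simp]: "f \<in> Arr V" "Dom V f = dbl A" "Cod V f = dbl B"
    and [simp]: "g \<in> Arr V" "Dom V g = dbl D" "Cod V g = dbl E"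
  shows "pm (\<sigma> B E) \<cdot> tens A B f D E g = tens D E g A B f \<cdot> pm (\<sigma> A D)"
proof -
  have "pm (\<sigma> B E) \<cdot> (pm (\<sigma> E B) \<cdot> x) = x" if "x \<in> Arr V" "Cod V x = dbl (E \<odot> B)" for x
    using that by (simp add: pm_comp [symmetric] sym_sym flip: cassoc)
  then show ?thesis
    by (simp add: tens_sym [of A B D E f g])
qed

abbreviation "W \<equiv> CPM V"

lemma CPM_sel [simp]:
  "Obj W = Obj V" "Dom W = source" "Cod W = target"
  "Ident W A = Arrow A (\<one> (dbl A)) A"
  "Comp W k h = Arrow (source h) (und k \<cdot> und h) (target k)"
  "Dagger W h = Arrow (target h) ((und h)\<dagger>) (source h)"
  "Unit W = \<I>" "TensorO W A B = A \<odot> B"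
  "TensorA W h k = Arrow (source h \<odot> source k)
     (tens (source h) (target h) (und h) (source k) (target k) (und k)) (target h \<odot> target k)"
  by (simp_all add: CPM_def tens_def)

lemma Arr_CPM [simp]: "Arrow A f B \<in> Arr W \<longleftrightarrow> A \<in> Obj V \<and> B \<in> Obj V \<and> completely_positive V A B f"
  by (simp add: CPM_def)

lemma hom_CPM: "h \<in> hom W A B \<longleftrightarrow>
    (\<exists>f. h = Arrow A f B \<and> A \<in> Obj V \<and> B \<in> Obj V \<and> completely_positive V A B f)"
  by (cases h) (auto simp: hom_def)

lemma Arr_CPM_E:
  assumes "h \<in> Arr W"
  obtains A f B where "h = Arrow A f B" "A \<in> Obj V" "B \<in> Obj V" "completely_positive V A B f"
  using assms by (cases h) auto

lemma CPM_coherence [simp]: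
  "\<lbrakk>A \<in> Obj V; B \<in> Obj V; D \<in> Obj V\<rbrakk> \<Longrightarrow> Assoc W A B D = Arrow ((A \<odot> B) \<odot> D) (pm (\<alpha> A B D)) (A \<odot> (B \<odot> D))"
  "A \<in> Obj V \<Longrightarrow> LUnit W A = Arrow (\<I> \<odot> A) (pm (\<Lambda> A)) A"
  "A \<in> Obj V \<Longrightarrow> RUnit W A = Arrow (A \<odot> \<I>) (pm (\<rho> A)) A"
  "\<lbrakk>A \<in> Obj V; B \<in> Obj V\<rbrakk> \<Longrightarrow> Sym W A B = Arrow (A \<odot> B) (pm (\<sigma> A B)) (B \<odot> A)"
  by (simp_all add: CPM_def cpm_pure_def pm_def)

lemma cp_ident: "A \<in> Obj V \<Longrightarrow> completely_positive V A A (\<one> (dbl A))"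
  using cp_pure [of "\<one> A" A A] by simp

lemma unitary_CPM_pure:
  assumes "unitary V A B f"
  shows "unitary W A B (Arrow A (pm f) B)"
proof -
  note [simp] = unitary_cancel(1-5) [OF assms]
  have [simp]: "A \<in> Obj V" "B \<in> Obj V"
    using dom_obj [of f] cod_obj [of f] by auto
  show ?thesis
    by (auto simp: unitary_def [of W] hom_CPM intro!: cp_pure) (simp_all add: pm_dagger [symmetric] pm_comp [symmetric])
qed

lemma CPM_dagger_category: "dagger_category W"
proof unfold_locales
  fix h assume "h \<in> Arr W"
  then show "Dom W h \<in> Obj W" "Cod W h \<in> Obj W"
    by (auto elim: Arr_CPM_E)
next
  fix A assume "A \<in> Obj W"
  then show "Ident W A \<in> hom W A A"
    by (simp add: hom_CPM cp_ident)
next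
  fix f g A B D assume "f \<in> hom W A B" "g \<in> hom W B D"
  then show "Comp W g f \<in> hom W A D"
    by (auto simp: hom_CPM intro: cp_comp)
next
  fix f A B assume "f \<in> hom W A B"
  then show "Comp W f (Ident W A) = f" "Comp W (Ident W B) f = f"
    by (auto simp: hom_CPM cp_typed)
next
  fix f g h A B D E assume "f \<in> hom W A B" "g \<in> hom W B D" "h \<in> hom W D E"
  then show "Comp W (Comp W h g) f = Comp W h (Comp W g f)"
    by (auto simp: hom_CPM cp_typed cassoc)
next
  fix f A B assume "f \<in> hom W A B"
  then show "Dagger W f \<in> hom W B A"
    by (auto simp: hom_CPM intro: cp_dagger)
next
  fix h assume "h \<in> Arr W"
  then show "Dagger W (Dagger W h) = h"
    by (auto elim!: Arr_CPM_E simp: cp_typed)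
next
  fix A assume "A \<in> Obj W"
  then show "Dagger W (Ident W A) = Ident W A"
    by simp
next
  fix f g A B D assume "f \<in> hom W A B" "g \<in> hom W B D"
  then show "Dagger W (Comp W g f) = Comp W (Dagger W f) (Dagger W g)"
    by (auto simp: hom_CPM cp_typed dagger_comp')
qed

text \<open>Coherence axioms are transported from \<open>V\<close> by \<open>tens_pm\<close>;
  naturality against arbitrary completely positive maps comes from the lemmas on
  \<open>tens\<close>.\<close>

lemma CPM_dsm: "dagger_symmetric_monoidal_category W"
proof (intro dagger_symmetric_monoidal_category.intro CPM_dagger_category, unfold_locales)
  show "Unit W \<in> Obj W" by simp
next
  fix A B assume "A \<in> Obj W" "B \<in> Obj W"
  then show "TensorO W A B \<in> Obj W" 
    and "TensorA W (Ident W A) (Ident W B) = Ident W (TensorO W A B)"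
    and "unitary W (TensorO W A B) (TensorO W B A) (Sym W A B)"
    and "Comp W (TensorA W (Ident W A) (LUnit W B)) (Assoc W A (Unit W) B)
      = TensorA W (RUnit W A) (Ident W B)"
    and "Comp W (Sym W B A) (Sym W A B) = Ident W (TensorO W A B)"
    by (simp_all add: unitary_CPM_pure sym_unitary tens_pm triangle sym_sym flip: pm_ident pm_comp)
next
  fix f g A B A' B' assume "f \<in> hom W A B" "g \<in> hom W A' B'"
  then show "TensorA W f g \<in> hom W (TensorO W A A') (TensorO W B B')"
    and "Comp W (Sym W B B') (TensorA W f g) = Comp W (TensorA W g f) (Sym W A A')"
    by (auto simp: hom_CPM tens_sym' cp_typed intro: cp_tensor)
next
  fix f g f' g' A B D A' B' D'
  assume "f \<in> hom W A B" "g \<in> hom W B D" "f' \<in> hom W A' B'" "g' \<in> hom W B' D'"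
  then show "TensorA W (Comp W g f) (Comp W g' f') = Comp W (TensorA W g g') (TensorA W f f')"
    using tens_comp [of A B D A' B' D' "und f" "und g" "und f'" "und g'"]
    by (auto simp: hom_CPM cp_typed)
next
  fix f g assume "f \<in> Arr W" "g \<in> Arr W"
  then show "Dagger W (TensorA W f g) = TensorA W (Dagger W f) (Dagger W g)"
    by (auto elim!: Arr_CPM_E simp: tens_dagger cp_typed)
next
  fix A B D assume "A \<in> Obj W" "B \<in> Obj W" "D \<in> Obj W"
  then show "unitary W (TensorO W (TensorO W A B) D) (TensorO W A (TensorO W B D)) (Assoc W A B D)"
    and "Comp W (Assoc W B D A) (Comp W (Sym W A (TensorO W B D)) (Assoc W A B D))
      = Comp W (TensorA W (Ident W B) (Sym W A D)) (Comp W (Assoc W B A D) (TensorA W (Sym W A B) (Ident W D)))"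
    by (simp_all add: unitary_CPM_pure assoc_unitary tens_pm hexagon flip: pm_ident pm_comp)
next
  fix A assume "A \<in> Obj W"
  then show "unitary W (TensorO W (Unit W) A) A (LUnit W A)"
    and "unitary W (TensorO W A (Unit W)) A (RUnit W A)"
    by (simp_all add: unitary_CPM_pure lunit_unitary runit_unitary)
next
  fix f g h A A' B B' D D'
  assume "f \<in> hom W A A'" "g \<in> hom W B B'" "h \<in> hom W D D'"
  then show "Comp W (Assoc W A' B' D') (TensorA W (TensorA W f g) h)
    = Comp W (TensorA W f (TensorA W g h)) (Assoc W A B D)"
    by (auto simp: hom_CPM tens_assoc cp_typed)
next
  fix f A B assume "f \<in> hom W A B"
  then show "Comp W (LUnit W B) (TensorA W (Ident W (Unit W)) f) = Comp W f (LUnit W A)"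
    and "Comp W (RUnit W B) (TensorA W f (Ident W (Unit W))) = Comp W f (RUnit W A)"
    by (auto simp: hom_CPM tens_lunit tens_runit cp_typed)
next
  fix A B D E assume "A \<in> Obj W" "B \<in> Obj W" "D \<in> Obj W" "E \<in> Obj W"
  then show "Comp W (TensorA W (Ident W A) (Assoc W B D E))
      (Comp W (Assoc W A (TensorO W B D) E) (TensorA W (Assoc W A B D) (Ident W E)))
    = Comp W (Assoc W A B (TensorO W D E)) (Assoc W (TensorO W A B) D E)"
    by (simp add: tens_pm pentagon flip: pm_ident pm_comp)
qed

end

section \<open>Splitting dagger idempotents in a dagger symmetric monoidal category\<close>

context dagger_symmetric_monoidal_category
begin

abbreviation "SD \<equiv> Split_dagger C"

lemma SD_sel [simp]:
  "Dom SD = source" "Cod SD = target"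
  "Ident SD (A, p) = Arrow (A, p) p (A, p)"
  "Comp SD k h = Arrow (source h) (und k \<cdot> und h) (target k)"
  "Dagger SD h = Arrow (target h) ((und h)\<dagger>) (source h)"
  "Unit SD = (\<I>, \<one> \<I>)"
  "TensorO SD (A, p) (B, q) = (A \<odot> B, p \<otimes> q)"
  "TensorA SD h k = Arrow (TensorO SD (source h) (source k)) (und h \<otimes> und k) (TensorO SD (target h) (target k))"
  "Assoc SD (A, p) (B, q) (D, r) = Arrow ((A \<odot> B) \<odot> D, (p \<otimes> q) \<otimes> r) (\<alpha> A B D \<cdot> ((p \<otimes> q) \<otimes> r)) (A \<odot> (B \<odot> D), p \<otimes> (q \<otimes> r))"
  "LUnit SD (A, p) = Arrow (\<I> \<odot> A, \<one> \<I> \<otimes> p) (\<Lambda> A \<cdot> (\<one> \<I> \<otimes> p)) (A, p)"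
  "RUnit SD (A, p) = Arrow (A \<odot> \<I>, p \<otimes> \<one> \<I>) (\<rho> A \<cdot> (p \<otimes> \<one> \<I>)) (A, p)"
  "Sym SD (A, p) (B, q) = Arrow (A \<odot> B, p \<otimes> q) (\<sigma> A B \<cdot> (p \<otimes> q)) (B \<odot> A, q \<otimes> p)"
  by (simp_all add: Split_dagger_def Let_def)

lemma Obj_SD: "(A, p) \<in> Obj SD \<longleftrightarrow> p \<in> Arr C \<and> Dom C p = A \<and> Cod C p = A \<and> p \<cdot> p = p \<and> p\<dagger> = p"
  using dom_obj [of p] by (auto simp: Split_dagger_def Let_def hom_def)

text \<open>By idempotence, being fixed by both idempotents together amounts to being fixed by each
  separately, the form in which the condition is used.\<close>

lemma Arr_SD: "Arrow (A, p) f (B, q) \<in> Arr SD \<longleftrightarrow> (A, p) \<in> Obj SD \<and> (B, q) \<in> Obj SD \<and>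
    f \<in> Arr C \<and> Dom C f = A \<and> Cod C f = B \<and> q \<cdot> f = f \<and> f \<cdot> p = f"
proof -
  have "q \<cdot> f = f \<and> f \<cdot> p = f" if "f = q \<cdot> f \<cdot> p" "f \<in> Arr C" "Dom C f = A" "Cod C f = B"
      and "(A, p) \<in> Obj SD" "(B, q) \<in> Obj SD"
  proof -
    have t: "p \<in> Arr C" "Dom C p = A" "Cod C p = A" "p \<cdot> p = p" "q \<in> Arr C" "Dom C q = B" "Cod C q = B" "q \<cdot> q = q"
      using that by (auto simp: Obj_SD)
    have "q \<cdot> f = q \<cdot> (q \<cdot> (f \<cdot> p))"
      using that(1) by (rule arg_cong)
    also have "\<dots> = (q \<cdot> q) \<cdot> (f \<cdot> p)"
      using that(2-4) t(1-3,5-7) by (simp add: cassoc)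
    finally have 1: "q \<cdot> f = f"
      using that(1) t by simp
    have "f \<cdot> p = (q \<cdot> (f \<cdot> p)) \<cdot> p"
      using that(1) by (rule arg_cong)
    also have "\<dots> = q \<cdot> (f \<cdot> (p \<cdot> p))"
      using that(2-4) t(1-3,5-7) by (simp add: cassoc)
    finally have "f \<cdot> p = f"
      using that(1) t by simp
    with 1 show ?thesis ..
  qed
  moreover have "f = q \<cdot> f \<cdot> p" if "q \<cdot> f = f" "f \<cdot> p = f"
    using that by simp
  moreover have "Arrow (A, p) f (B, q) \<in> Arr SD \<longleftrightarrow> (A, p) \<in> Obj SD \<and> (B, q) \<in> Obj SD \<and>
      f \<in> Arr C \<and> Dom C f = A \<and> Cod C f = B \<and> f = q \<cdot> f \<cdot> p"
    by (cases "Dom C f = A"; cases "Cod C f = B"; simp add: Split_dagger_def Let_def hom_def conj_ac)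
  ultimately show ?thesis
    by blast
qed

lemma Arr_SD_E:
  assumes "h \<in> Arr SD"
  obtains A p f B q where "h = Arrow (A, p) f (B, q)" "p \<in> Arr C" "Dom C p = A" "Cod C p = A" "p \<cdot> p = p" "p\<dagger> = p"
    "q \<in> Arr C" "Dom C q = B" "Cod C q = B" "q \<cdot> q = q" "q\<dagger> = q" "A \<in> Obj C" "B \<in> Obj C"
    "f \<in> Arr C" "Dom C f = A" "Cod C f = B" "q \<cdot> f = f" "f \<cdot> p = f"
  using assms dom_obj
  by (cases h; cases "source h"; cases "target h") (auto simp: Arr_SD Obj_SD)

lemma Obj_SD_E:
  assumes "X \<in> Obj SD"
  obtains A p where "X = (A, p)" "p \<in> Arr C" "Dom C p = A" "Cod C p = A" "p \<cdot> p = p" "p\<dagger> = p" "A \<in> Obj C"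
  using assms dom_obj by (cases X) (auto simp: Obj_SD)

lemma hom_SD: "h \<in> hom SD X Y \<longleftrightarrow> h \<in> Arr SD \<and> source h = X \<and> target h = Y"
  by (simp add: hom_def)

lemma absorb:
  "\<lbrakk>q \<cdot> f = f; q \<in> Arr C; f \<in> Arr C; Dom C q = Cod C f; x \<in> Arr C; Cod C x = Dom C f\<rbrakk> \<Longrightarrow> q \<cdot> (f \<cdot> x) = f \<cdot> x"
  by (rule comp_reduce1) auto

text \<open>A unitary that intertwines two projections restricts to a unitary between their ranges.
  All coherence arrows of the splitting arise in this way.\<close>

lemma unitary_SD:
  assumes c: "unitary C A B c" and "c \<cdot> p = q \<cdot> c" and "(A, p) \<in> Obj SD" "(B, q) \<in> Obj SD"
  shows "unitary SD (A, p) (B, q) (Arrow (A, p) (c \<cdot> p) (B, q))"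
proof -
  note [simp] = unitary_cancel [OF c]
  have p [simp]: "p \<in> Arr C" "Dom C p = A" "Cod C p = A" "p \<cdot> p = p" "p\<dagger> = p"
    and q [simp]: "q \<in> Arr C" "Dom C q = B" "Cod C q = B" "q \<cdot> q = q" "q\<dagger> = q"
    using assms by (auto simp: Obj_SD)
  have 1: "q \<cdot> (c \<cdot> p) = c \<cdot> p"
    using assms(2) by (simp add: absorb)
  have 2: "(c \<cdot> p)\<dagger> \<cdot> (c \<cdot> p) = p"
    by (simp add: dagger_comp' cassoc)
  have "(c \<cdot> p) \<cdot> (c \<cdot> p)\<dagger> = (c \<cdot> p) \<cdot> c\<dagger>"
    by (simp add: dagger_comp' cassoc absorb)
  also have "\<dots> = q"
    unfolding assms(2) by (simp add: cassoc)
  finally have 3: "(c \<cdot> p) \<cdot> (c \<cdot> p)\<dagger> = q" .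
  show ?thesis
    using assms(3,4) 1 2 3 by (simp add: unitary_def [of SD] hom_SD Arr_SD cassoc)
qed

lemma Obj_SD_tensor: "\<lbrakk>(A, p) \<in> Obj SD; (B, q) \<in> Obj SD\<rbrakk> \<Longrightarrow> (A \<odot> B, p \<otimes> q) \<in> Obj SD"
  by (simp add: Obj_SD tensor_comp')

lemma Obj_SD_unit: "(\<I>, \<one> \<I>) \<in> Obj SD"
  by (simp add: Obj_SD)

lemma SD_dagger_category: "dagger_category SD"
proof unfold_locales
  fix h assume "h \<in> Arr SD"
  then show "Dom SD h \<in> Obj SD" "Cod SD h \<in> Obj SD"
    by (auto elim!: Arr_SD_E simp: Obj_SD)
next
  fix A assume "A \<in> Obj SD"
  then show "Ident SD A \<in> hom SD A A"
    by (auto elim!: Obj_SD_E simp: hom_SD Arr_SD Obj_SD)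
next
  fix f g A B D assume "f \<in> hom SD A B" "g \<in> hom SD B D"
  then show "Comp SD g f \<in> hom SD A D"
    by (auto elim!: Arr_SD_E simp: hom_SD Arr_SD Obj_SD cassoc absorb)
next
  fix f A B assume "f \<in> hom SD A B"
  then show "Comp SD f (Ident SD A) = f" "Comp SD (Ident SD B) f = f"
    by (auto elim!: Arr_SD_E simp: hom_SD)
next
  fix f g h A B D E assume "f \<in> hom SD A B" "g \<in> hom SD B D" "h \<in> hom SD D E"
  then show "Comp SD (Comp SD h g) f = Comp SD h (Comp SD g f)"
    by (auto elim!: Arr_SD_E simp: hom_SD cassoc)
next
  fix f A B assume "f \<in> hom SD A B"
  then show "Dagger SD f \<in> hom SD B A"
    using dagger_comp' by (auto elim!: Arr_SD_E simp: hom_SD Arr_SD Obj_SD) (metis)+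
next
  fix h assume "h \<in> Arr SD"
  then show "Dagger SD (Dagger SD h) = h"
    by (auto elim!: Arr_SD_E)
next
  fix A assume "A \<in> Obj SD"
  then show "Dagger SD (Ident SD A) = Ident SD A"
    by (auto elim!: Obj_SD_E)
next
  fix f g A B D assume "f \<in> hom SD A B" "g \<in> hom SD B D"
  then show "Dagger SD (Comp SD g f) = Comp SD (Dagger SD f) (Dagger SD g)"
    by (auto elim!: Arr_SD_E simp: hom_SD dagger_comp')
qed

text \<open>Each coherence arrow carries projections. Naturality moves them all to the right, where
  idempotence merges them, and the axiom of \<open>C\<close> remains in front.\<close>

lemma SD_dsm: "dagger_symmetric_monoidal_category SD"
proof (intro dagger_symmetric_monoidal_category.intro SD_dagger_category, unfold_locales)
  show "Unit SD \<in> Obj SD" by (simp add: Obj_SD_unit)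
next
  fix X Y assume "X \<in> Obj SD" "Y \<in> Obj SD"
  then obtain A p B q where X: "X = (A, p)" "(A, p) \<in> Obj SD" and Y: "Y = (B, q)" "(B, q) \<in> Obj SD"
    by (cases X; cases Y) auto
  then have [simp]: "p \<in> Arr C" "Dom C p = A" "Cod C p = A" "p \<cdot> p = p" "p\<dagger> = p" "A \<in> Obj C"
    "q \<in> Arr C" "Dom C q = B" "Cod C q = B" "q \<cdot> q = q" "q\<dagger> = q" "B \<in> Obj C"
    using dom_obj [of p] dom_obj [of q] by (auto simp: Obj_SD)
  show "TensorO SD X Y \<in> Obj SD"
    using X Y by (simp add: Obj_SD_tensor)
  show "TensorA SD (Ident SD X) (Ident SD Y) = Ident SD (TensorO SD X Y)"
    by (simp add: X Y)
  show "unitary SD (TensorO SD X Y) (TensorO SD Y X) (Sym SD X Y)"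
    using X Y sym_nat [of p q] by (simp add: unitary_SD sym_unitary Obj_SD_tensor)
  show "Comp SD (Sym SD Y X) (Sym SD X Y) = Ident SD (TensorO SD X Y)"
  proof -
    have "(\<sigma> B A \<cdot> (q \<otimes> p)) \<cdot> (\<sigma> A B \<cdot> (p \<otimes> q)) = \<sigma> B A \<cdot> ((q \<otimes> p) \<cdot> \<sigma> A B) \<cdot> (p \<otimes> q)"
      by (simp add: cassoc)
    also have "\<dots> = p \<otimes> q"
      unfolding sym_nat [of p q A B, simplified] by (simp add: cassoc tensor_comp')
    finally show ?thesis by (simp add: X Y)
  qed
  show "Comp SD (TensorA SD (Ident SD X) (LUnit SD Y)) (Assoc SD X (Unit SD) Y)
      = TensorA SD (RUnit SD X) (Ident SD Y)"
  proof -
    have "(p \<otimes> (\<Lambda> B \<cdot> (\<one> \<I> \<otimes> q))) \<cdot> (\<alpha> A \<I> B \<cdot> ((p \<otimes> \<one> \<I>) \<otimes> q))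
        = (\<one> A \<otimes> \<Lambda> B) \<cdot> ((p \<otimes> (\<one> \<I> \<otimes> q)) \<cdot> \<alpha> A \<I> B) \<cdot> ((p \<otimes> \<one> \<I>) \<otimes> q)"
      by (simp add: cassoc tensor_comp_reduce)
    also have "\<dots> = ((\<one> A \<otimes> \<Lambda> B) \<cdot> \<alpha> A \<I> B) \<cdot> ((p \<otimes> \<one> \<I>) \<otimes> q)"
      by (simp add: assoc_nat cassoc tensor_comp')
    also have "\<dots> = (\<rho> A \<cdot> (p \<otimes> \<one> \<I>)) \<otimes> q"
      by (simp add: triangle tensor_comp')
    finally show ?thesis by (simp add: X Y)
  qed
next
  fix f g A B A' B' assume "f \<in> hom SD A B" "g \<in> hom SD A' B'"
  then show "TensorA SD f g \<in> hom SD (TensorO SD A A') (TensorO SD B B')"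
    by (auto elim!: Arr_SD_E simp: hom_SD Arr_SD Obj_SD tensor_comp')
next
  fix f g A B A' B' assume "f \<in> hom SD A A'" "g \<in> hom SD B B'"
  then show "Comp SD (Sym SD A' B') (TensorA SD f g) = Comp SD (TensorA SD g f) (Sym SD A B)"
    by (auto elim!: Arr_SD_E simp: hom_SD cassoc tensor_comp') (simp add: sym_nat tensor_comp' flip: cassoc, simp add: cassoc tensor_comp')
next
  fix f g f' g' A B D A' B' D'
  assume "f \<in> hom SD A B" "g \<in> hom SD B D" "f' \<in> hom SD A' B'" "g' \<in> hom SD B' D'"
  then show "TensorA SD (Comp SD g f) (Comp SD g' f') = Comp SD (TensorA SD g g') (TensorA SD f f')"
    by (auto elim!: Arr_SD_E simp: hom_SD tensor_comp')
next
  fix f g assume "f \<in> Arr SD" "g \<in> Arr SD"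
  then show "Dagger SD (TensorA SD f g) = TensorA SD (Dagger SD f) (Dagger SD g)"
    by (auto elim!: Arr_SD_E)
next
  fix X Y Z assume "X \<in> Obj SD" "Y \<in> Obj SD" "Z \<in> Obj SD"
  then obtain A p B q D r where X: "X = (A, p)" "(A, p) \<in> Obj SD" and Y: "Y = (B, q)" "(B, q) \<in> Obj SD"
      and Z: "Z = (D, r)" "(D, r) \<in> Obj SD"
    by (cases X; cases Y; cases Z) auto
  then have [simp]: "p \<in> Arr C" "Dom C p = A" "Cod C p = A" "p \<cdot> p = p" "p\<dagger> = p" "A \<in> Obj C"
    "q \<in> Arr C" "Dom C q = B" "Cod C q = B" "q \<cdot> q = q" "q\<dagger> = q" "B \<in> Obj C"
    "r \<in> Arr C" "Dom C r = D" "Cod C r = D" "r \<cdot> r = r" "r\<dagger> = r" "D \<in> Obj C"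
    using dom_obj [of p] dom_obj [of q] dom_obj [of r] by (auto simp: Obj_SD)
  show "unitary SD (TensorO SD (TensorO SD X Y) Z) (TensorO SD X (TensorO SD Y Z)) (Assoc SD X Y Z)"
    using X Y Z assoc_nat [of p q r] by (simp add: unitary_SD assoc_unitary Obj_SD_tensor)
  show "Comp SD (Assoc SD Y Z X) (Comp SD (Sym SD X (TensorO SD Y Z)) (Assoc SD X Y Z))
      = Comp SD (TensorA SD (Ident SD Y) (Sym SD X Z)) (Comp SD (Assoc SD Y X Z) (TensorA SD (Sym SD X Y) (Ident SD Z)))"
  proof -
    let ?P = "(p \<otimes> q) \<otimes> r"
    have "(\<alpha> B D A \<cdot> ((q \<otimes> r) \<otimes> p)) \<cdot> (\<sigma> A (B \<odot> D) \<cdot> (p \<otimes> (q \<otimes> r))) \<cdot> (\<alpha> A B D \<cdot> ?P)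
       = \<alpha> B D A \<cdot> ((q \<otimes> r) \<otimes> p) \<cdot> \<sigma> A (B \<odot> D) \<cdot> ((p \<otimes> (q \<otimes> r)) \<cdot> \<alpha> A B D) \<cdot> ?P"
      by (simp add: cassoc)
    also have "\<dots> = \<alpha> B D A \<cdot> (((q \<otimes> r) \<otimes> p) \<cdot> \<sigma> A (B \<odot> D)) \<cdot> \<alpha> A B D \<cdot> ?P"
      by (simp add: assoc_nat cassoc tensor_comp')
    also have "\<dots> = \<alpha> B D A \<cdot> \<sigma> A (B \<odot> D) \<cdot> ((p \<otimes> (q \<otimes> r)) \<cdot> \<alpha> A B D) \<cdot> ?P"
      by (simp add: sym_nat cassoc)
    also have "\<dots> = (\<alpha> B D A \<cdot> \<sigma> A (B \<odot> D) \<cdot> \<alpha> A B D) \<cdot> ?P"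
      by (simp add: assoc_nat cassoc tensor_comp')
    also have "\<dots> = ((\<one> B \<otimes> \<sigma> A D) \<cdot> \<alpha> B A D \<cdot> (\<sigma> A B \<otimes> \<one> D)) \<cdot> ?P"
      by (simp add: hexagon)
    finally have l: "(\<alpha> B D A \<cdot> ((q \<otimes> r) \<otimes> p)) \<cdot> (\<sigma> A (B \<odot> D) \<cdot> (p \<otimes> (q \<otimes> r))) \<cdot> (\<alpha> A B D \<cdot> ?P)
      = ((\<one> B \<otimes> \<sigma> A D) \<cdot> \<alpha> B A D \<cdot> (\<sigma> A B \<otimes> \<one> D)) \<cdot> ?P" .
    have s: "((q \<otimes> p) \<otimes> r) \<cdot> (\<sigma> A B \<otimes> \<one> D) = (\<sigma> A B \<otimes> \<one> D) \<cdot> ?P"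
      using sym_nat [of p q A B] by (simp add: tensor_comp')
    have "(q \<otimes> (\<sigma> A D \<cdot> (p \<otimes> r))) \<cdot> (\<alpha> B A D \<cdot> ((q \<otimes> p) \<otimes> r)) \<cdot> ((\<sigma> A B \<cdot> (p \<otimes> q)) \<otimes> r)
       = (\<one> B \<otimes> \<sigma> A D) \<cdot> ((q \<otimes> (p \<otimes> r)) \<cdot> \<alpha> B A D) \<cdot> (((q \<otimes> p) \<otimes> r) \<cdot> (\<sigma> A B \<otimes> \<one> D)) \<cdot> ?P"
      by (simp add: cassoc tensor_comp_reduce) (simp add: cassoc tensor_comp')
    also have "\<dots> = (\<one> B \<otimes> \<sigma> A D) \<cdot> \<alpha> B A D \<cdot> (((q \<otimes> p) \<otimes> r) \<cdot> ((q \<otimes> p) \<otimes> r)) \<cdot> (\<sigma> A B \<otimes> \<one> D) \<cdot> ?P"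
      by (simp add: assoc_nat cassoc)
    also have "((q \<otimes> p) \<otimes> r) \<cdot> ((q \<otimes> p) \<otimes> r) = (q \<otimes> p) \<otimes> r"
      by (simp add: tensor_comp')
    also have "(\<one> B \<otimes> \<sigma> A D) \<cdot> \<alpha> B A D \<cdot> \<dots> \<cdot> (\<sigma> A B \<otimes> \<one> D) \<cdot> ?P
        = (\<one> B \<otimes> \<sigma> A D) \<cdot> \<alpha> B A D \<cdot> (((q \<otimes> p) \<otimes> r) \<cdot> (\<sigma> A B \<otimes> \<one> D)) \<cdot> ?P"
      by (simp add: cassoc)
    also have "\<dots> = (\<one> B \<otimes> \<sigma> A D) \<cdot> \<alpha> B A D \<cdot> (\<sigma> A B \<otimes> \<one> D) \<cdot> ?P"
      unfolding s by (simp add: cassoc tensor_comp')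
    finally show ?thesis
      using l by (simp add: X Y Z cassoc)
  qed
next
  fix X assume "X \<in> Obj SD"
  then obtain A p where X: "X = (A, p)" "(A, p) \<in> Obj SD"
    by (cases X) auto
  then have [simp]: "p \<in> Arr C" "Dom C p = A" "Cod C p = A" "p \<cdot> p = p" "p\<dagger> = p" "A \<in> Obj C"
    using dom_obj [of p] by (auto simp: Obj_SD)
  show "unitary SD (TensorO SD (Unit SD) X) X (LUnit SD X)"
    using X lunit_nat [of p A] Obj_SD_tensor [OF Obj_SD_unit X(2)] by (simp add: unitary_SD lunit_unitary)
  show "unitary SD (TensorO SD X (Unit SD)) X (RUnit SD X)"
    using X runit_nat [of p A] Obj_SD_tensor [OF X(2) Obj_SD_unit] by (simp add: unitary_SD runit_unitary)
next
  fix f g h X X' Y Y' Z Z'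
  assume "f \<in> hom SD X X'" "g \<in> hom SD Y Y'" "h \<in> hom SD Z Z'"
  then show "Comp SD (Assoc SD X' Y' Z') (TensorA SD (TensorA SD f g) h)
    = Comp SD (TensorA SD f (TensorA SD g h)) (Assoc SD X Y Z)"
    by (auto elim!: Arr_SD_E simp: hom_SD cassoc tensor_comp') (simp add: assoc_nat flip: cassoc, simp add: cassoc tensor_comp')
next
  fix f X Y assume "f \<in> hom SD X Y"
  then show "Comp SD (LUnit SD Y) (TensorA SD (Ident SD (Unit SD)) f) = Comp SD f (LUnit SD X)"
    by (auto elim!: Arr_SD_E simp: hom_SD cassoc tensor_comp') (simp add: lunit_nat flip: cassoc, simp add: cassoc tensor_comp')
next
  fix f X Y assume "f \<in> hom SD X Y"
  then show "Comp SD (RUnit SD Y) (TensorA SD f (Ident SD (Unit SD))) = Comp SD f (RUnit SD X)"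
    by (auto elim!: Arr_SD_E simp: hom_SD cassoc tensor_comp') (simp add: runit_nat flip: cassoc, simp add: cassoc tensor_comp')
next
  fix X Y Z W assume "X \<in> Obj SD" "Y \<in> Obj SD" "Z \<in> Obj SD" "W \<in> Obj SD"
  then obtain A p B q D r E t where X: "X = (A, p)" "(A, p) \<in> Obj SD" and Y: "Y = (B, q)" "(B, q) \<in> Obj SD"
      and Z: "Z = (D, r)" "(D, r) \<in> Obj SD" and W: "W = (E, t)" "(E, t) \<in> Obj SD"
    by (cases X; cases Y; cases Z; cases W) auto
  then have [simp]: "p \<in> Arr C" "Dom C p = A" "Cod C p = A" "p \<cdot> p = p" "p\<dagger> = p" "A \<in> Obj C"
    "q \<in> Arr C" "Dom C q = B" "Cod C q = B" "q \<cdot> q = q" "q\<dagger> = q" "B \<in> Obj C"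
    "r \<in> Arr C" "Dom C r = D" "Cod C r = D" "r \<cdot> r = r" "r\<dagger> = r" "D \<in> Obj C"
    "t \<in> Arr C" "Dom C t = E" "Cod C t = E" "t \<cdot> t = t" "t\<dagger> = t" "E \<in> Obj C"
    using dom_obj [of p] dom_obj [of q] dom_obj [of r] dom_obj [of t] by (auto simp: Obj_SD)
  let ?P = "((p \<otimes> q) \<otimes> r) \<otimes> t"
  have d: "((p \<otimes> (q \<otimes> r)) \<otimes> t) \<cdot> (\<alpha> A B D \<otimes> \<one> E) = (\<alpha> A B D \<otimes> \<one> E) \<cdot> ?P"
    by (simp add: tensor_comp' assoc_nat)
  have "(p \<otimes> (\<alpha> B D E \<cdot> ((q \<otimes> r) \<otimes> t))) \<cdot> (\<alpha> A (B \<odot> D) E \<cdot> ((p \<otimes> (q \<otimes> r)) \<otimes> t)) \<cdot> ((\<alpha> A B D \<cdot> ((p \<otimes> q) \<otimes> r)) \<otimes> t)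
      = (\<one> A \<otimes> \<alpha> B D E) \<cdot> ((p \<otimes> ((q \<otimes> r) \<otimes> t)) \<cdot> \<alpha> A (B \<odot> D) E) \<cdot> (((p \<otimes> (q \<otimes> r)) \<otimes> t) \<cdot> (\<alpha> A B D \<otimes> \<one> E)) \<cdot> ?P"
    by (simp add: cassoc tensor_comp_reduce) (simp add: cassoc tensor_comp')
  also have "\<dots> = (\<one> A \<otimes> \<alpha> B D E) \<cdot> \<alpha> A (B \<odot> D) E \<cdot> (((p \<otimes> (q \<otimes> r)) \<otimes> t) \<cdot> ((p \<otimes> (q \<otimes> r)) \<otimes> t)) \<cdot> (\<alpha> A B D \<otimes> \<one> E) \<cdot> ?P"
    by (simp add: assoc_nat cassoc)
  also have "((p \<otimes> (q \<otimes> r)) \<otimes> t) \<cdot> ((p \<otimes> (q \<otimes> r)) \<otimes> t) = (p \<otimes> (q \<otimes> r)) \<otimes> t"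
    by (simp add: tensor_comp')
  also have "(\<one> A \<otimes> \<alpha> B D E) \<cdot> \<alpha> A (B \<odot> D) E \<cdot> \<dots> \<cdot> (\<alpha> A B D \<otimes> \<one> E) \<cdot> ?P
      = (\<one> A \<otimes> \<alpha> B D E) \<cdot> \<alpha> A (B \<odot> D) E \<cdot> (((p \<otimes> (q \<otimes> r)) \<otimes> t) \<cdot> (\<alpha> A B D \<otimes> \<one> E)) \<cdot> ?P"
    by (simp add: cassoc)
  also have "\<dots> = ((\<one> A \<otimes> \<alpha> B D E) \<cdot> \<alpha> A (B \<odot> D) E \<cdot> (\<alpha> A B D \<otimes> \<one> E)) \<cdot> ?P"
    unfolding d by (simp add: cassoc tensor_comp')
  also have "\<dots> = (\<alpha> A B (D \<odot> E) \<cdot> \<alpha> (A \<odot> B) D E) \<cdot> ?P"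
    by (simp add: pentagon)
  also have "\<dots> = (\<alpha> A B (D \<odot> E) \<cdot> ((p \<otimes> q) \<otimes> (r \<otimes> t))) \<cdot> (\<alpha> (A \<odot> B) D E \<cdot> ?P)"
  proof -
    have "(\<alpha> A B (D \<odot> E) \<cdot> ((p \<otimes> q) \<otimes> (r \<otimes> t))) \<cdot> (\<alpha> (A \<odot> B) D E \<cdot> ?P)
        = \<alpha> A B (D \<odot> E) \<cdot> (((p \<otimes> q) \<otimes> (r \<otimes> t)) \<cdot> \<alpha> (A \<odot> B) D E) \<cdot> ?P"
      by (simp add: cassoc)
    then show ?thesis
      by (simp add: assoc_nat cassoc tensor_comp')
  qed
  finally show "Comp SD (TensorA SD (Ident SD X) (Assoc SD Y Z W))
      (Comp SD (Assoc SD X (TensorO SD Y Z) W) (TensorA SD (Assoc SD X Y Z) (Ident SD W)))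
    = Comp SD (Assoc SD X Y (TensorO SD Z W)) (Assoc SD (TensorO SD X Y) Z W)"
    by (simp add: X Y Z W)
qed

end

section \<open>Normalisable dagger Frobenius algebras\<close>

locale frob = dagger_compact_category V
  for V :: "('o, 'a, 'z) dc_cat_scheme" (structure) +
  fixes M :: "('o, 'a) algebra"
  assumes dfa: "dagger_frobenius_algebra V M"
begin

abbreviation "A \<equiv> carrier M"
abbreviation "m \<equiv> mult M"
abbreviation "u \<equiv> unt M"
abbreviation "mu i \<equiv> ap i [A, A] m [A]"
abbreviation "un i \<equiv> ap i [] u [A]"
abbreviation "de i \<equiv> ap i [A] (m\<dagger>) [A, A]"
abbreviation "co i \<equiv> ap i [A] (u\<dagger>) []"
abbreviation "at f i \<equiv> ap i [A] f [A]"

lemma alg_typed [simp]: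
  "A \<in> Obj V" "m \<in> Arr V" "Dom V m = A \<odot> A" "Cod V m = A" "u \<in> Arr V" "Dom V u = \<I>" "Cod V u = A"
  using dfa by (auto simp: dagger_frobenius_algebra_def frobenius_algebra_def hom_def)

lemma alg_laws:
  "m \<cdot> (m \<otimes> \<one> A) = m \<cdot> (\<one> A \<otimes> m) \<cdot> \<alpha> A A A"
  "m \<cdot> (u \<otimes> \<one> A) = \<Lambda> A" "m \<cdot> (\<one> A \<otimes> u) = \<rho> A"
  "\<alpha> A A A \<cdot> (m\<dagger> \<otimes> \<one> A) \<cdot> m\<dagger> = (\<one> A \<otimes> m\<dagger>) \<cdot> m\<dagger>"
  "\<Lambda> A \<cdot> (u\<dagger> \<otimes> \<one> A) \<cdot> m\<dagger> = \<one> A" "\<rho> A \<cdot> (\<one> A \<otimes> u\<dagger>) \<cdot> m\<dagger> = \<one> A"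
  "(\<one> A \<otimes> m) \<cdot> \<alpha> A A A \<cdot> (m\<dagger> \<otimes> \<one> A) = m\<dagger> \<cdot> m"
  "m\<dagger> \<cdot> m = (m \<otimes> \<one> A) \<cdot> (\<alpha> A A A)\<dagger> \<cdot> (\<one> A \<otimes> m\<dagger>)"
  using dfa by (auto simp: dagger_frobenius_algebra_def frobenius_algebra_def)

lemma ap_expand_alg:
  "ap i [A \<odot> A] m [A] s = mu i (sp i A A s)" "ap i [A] (m\<dagger>) [A \<odot> A] s = mg i A A (de i s)"
  "ap i [\<I>] u [A] s = un i (dI i s)" "ap i [A] (u\<dagger>) [\<I>] s = nI i (co i s)"
  by (rule ap_in_split ap_out_split ap_in_unit ap_out_unit; simp)+

lemma mu_mu:
  assumes "has i [A, A, A] s"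
  shows "mu i (mu i s) = mu i (mu (Suc i) s)"
proof -
  from assms obtain us vs where [simp]: "ty s = Some (us @ [A, A, A] @ vs)" "i = length us"
    by (rule has_ty)
  let ?t = "mg i (A \<odot> A) A (mg i A A s)"
  have "ap i [(A \<odot> A) \<odot> A] (m \<cdot> (m \<otimes> \<one> A)) [A] ?t = ap i [(A \<odot> A) \<odot> A] (m \<cdot> (\<one> A \<otimes> m) \<cdot> \<alpha> A A A) [A] ?t"
    by (simp only: alg_laws)
  then show ?thesis
    by (simp add: coh ap_expand_alg)
qed

lemma mu_un:
  assumes "has i [A] s"
  shows "mu i (un i s) = s" "mu i (un (Suc i) s) = s"
proof -
  from assms obtain us vs where [simp]: "ty s = Some (us @ [A] @ vs)" "i = length us"
    by (rule has_ty)
  have "ap i [\<I> \<odot> A] (m \<cdot> (u \<otimes> \<one> A)) [A] (mg i \<I> A (nI i s)) = ap i [\<I> \<odot> A] (\<Lambda> A) [A] (mg i \<I> A (nI i s))"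
    by (simp only: alg_laws)
  then show "mu i (un i s) = s"
    by (simp add: coh ap_expand_alg)
  have "ap i [A \<odot> \<I>] (m \<cdot> (\<one> A \<otimes> u)) [A] (mg i A \<I> (nI (Suc i) s)) = ap i [A \<odot> \<I>] (\<rho> A) [A] (mg i A \<I> (nI (Suc i) s))"
    by (simp only: alg_laws)
  then show "mu i (un (Suc i) s) = s"
    by (simp add: coh ap_expand_alg)
qed

lemma co_de:
  assumes "has i [A] s"
  shows "co i (de i s) = s" "co (Suc i) (de i s) = s"
proof -
  from assms obtain us vs where [simp]: "ty s = Some (us @ [A] @ vs)" "i = length us"
    by (rule has_ty)
  have "ap i [A] (\<Lambda> A \<cdot> (u\<dagger> \<otimes> \<one> A) \<cdot> m\<dagger>) [A] s = ap i [A] (\<one> A) [A] s"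
    by (simp only: alg_laws)
  then show "co i (de i s) = s"
    by (simp add: coh ap_expand_alg)
  have "ap i [A] (\<rho> A \<cdot> (\<one> A \<otimes> u\<dagger>) \<cdot> m\<dagger>) [A] s = ap i [A] (\<one> A) [A] s"
    by (simp only: alg_laws)
  then show "co (Suc i) (de i s) = s"
    by (simp add: coh ap_expand_alg)
qed

lemma mg_inject:
  assumes "mg i A A s = mg i A A t" "has i [A, A] s" "has i [A, A] t"
  shows "s = t"
  using arg_cong [OF assms(1), of "sp i A A"] assms(2,3) by simp

lemma frob_words:
  assumes "has i [A, A] s"
  shows "mu (Suc i) (de i s) = de i (mu i s)" "mu i (de (Suc i) s) = de i (mu i s)"
proof -
  from assms obtain us vs where [simp]: "ty s = Some (us @ [A, A] @ vs)" "i = length us"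
    by (rule has_ty)
  have "ap i [A \<odot> A] ((\<one> A \<otimes> m) \<cdot> \<alpha> A A A \<cdot> (m\<dagger> \<otimes> \<one> A)) [A \<odot> A] (mg i A A s) = ap i [A \<odot> A] (m\<dagger> \<cdot> m) [A \<odot> A] (mg i A A s)"
    by (simp only: alg_laws)
  then have "mg i A A (mu (Suc i) (de i s)) = mg i A A (de i (mu i s))"
    by (simp add: coh ap_expand_alg)
  then show "mu (Suc i) (de i s) = de i (mu i s)"
    by (rule mg_inject) (simp_all add: calc)
  have "ap i [A \<odot> A] ((m \<otimes> \<one> A) \<cdot> (\<alpha> A A A)\<dagger> \<cdot> (\<one> A \<otimes> m\<dagger>)) [A \<odot> A] (mg i A A s) = ap i [A \<odot> A] (m\<dagger> \<cdot> m) [A \<odot> A] (mg i A A s)"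
    by (simp only: alg_laws)
  then have "mg i A A (mu i (de (Suc i) s)) = mg i A A (de i (mu i s))"
    by (simp add: coh ap_expand_alg)
  then show "mu i (de (Suc i) s) = de i (mu i s)"
    by (rule mg_inject) (simp_all add: calc)
qed

text \<open>\<open>c\<close> is the cup of the self-duality of \<open>A\<close> that the Frobenius form induces, and \<open>j\<close> below is the
  resulting isomorphism \<open>A\<star> \<rightarrow> A\<close>. They turn traces into words in the algebra structure alone.\<close>

definition c :: 'a where
  "c = m\<dagger> \<cdot> u"

abbreviation "cu i \<equiv> cup i c A A"

lemma c_typed [simp]: "c \<in> Arr V" "Dom V c = \<I>" "Cod V c = A \<odot> A"
  by (simp_all add: c_def)

lemma cu_eq: "cu i s = de i (un i s)"
  by (simp add: c_def ap_comp vgen_def)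

text \<open>The Frobenius law at the unit: multiplying with one leg of \<open>c\<close> is
  comultiplication, on either side. So comultiplications can be traded for multiplications and
  cups.\<close>

lemma mu_cu:
  assumes "has i [A] s"
  shows "mu i (cu (Suc i) s) = de i s" "mu (Suc i) (cu i s) = de i s"
proof -
  from assms obtain us vs where [simp]: "ty s = Some (us @ [A] @ vs)" "i = length us"
    by (rule has_ty)
  show "mu i (cu (Suc i) s) = de i s" "mu (Suc i) (cu i s) = de i s"
    using frob_words(2) [of i "un (Suc i) s"] frob_words(1) [of i "un i s"]
    by (simp_all add: cu_eq mu_un calc)
qed

lemma snake_frob:
  assumes "has i [A] s"
  shows "co i (mu i (cu (Suc i) s)) = s" "co (Suc i) (mu (Suc i) (cu i s)) = s"
  using assms by (simp_all add: mu_cu co_de)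

abbreviation "cp i \<equiv> cup i (\<eta> A) (A\<star>) A"
abbreviation "ca i \<equiv> cap i (\<eta> A) (A\<star>) A"

lemmas snakes = dual_pairD(6,7) [OF dual_pair_eta [OF alg_typed(1)]] snake_left [OF dual_pair_eta [OF alg_typed(1)]]
  snake_right [OF dual_pair_eta [OF alg_typed(1)]]

definition j :: 'a where
  "j = transpose A A (\<sigma> A A \<cdot> c) (A\<star>) A (\<eta> A) (\<one> A)"

abbreviation "J i \<equiv> ap i [A\<star>] j [A]"

lemma j_typed [simp]: "j \<in> Arr V" "Dom V j = A\<star>" "Cod V j = A"
  unfolding j_def by (rule transpose_typed, auto)+

lemma j_name: "(j \<otimes> \<one> A) \<cdot> \<eta> A = \<sigma> A A \<cdot> c"
proof -
  have "(j \<otimes> \<one> A) \<cdot> \<eta> A = (\<one> A \<otimes> \<one> A) \<cdot> (\<sigma> A A \<cdot> c)"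
    unfolding j_def by (rule transpose_name) (auto intro: dual_pair_eta)
  then show ?thesis by simp
qed

lemma J_cp:
  assumes "has i [] s"
  shows "J i (cp i s) = sw i A A (cu i s)"
proof -
  from assms obtain us vs where [simp]: "ty s = Some (us @ vs)" "i = length us"
    by (auto elim: has_ty)
  have "J i (cp i s) = ap i [A\<star>, A] (j \<otimes> \<one> A) [A, A] (cp i s)"
    by (simp add: ap_tensor_id calc)
  also have "\<dots> = ap i [] (\<sigma> A A \<cdot> c) [A, A] s"
    by (simp add: ap_comp vgen_def j_name)
  also have "\<dots> = sw i A A (cu i s)"
    by (simp add: ap_comp vgen_def)
  finally show ?thesis .
qed

text \<open>The wire \<open>A\<close> is replaced by its Frobenius snake, whose cup factors through
  \<open>j\<close>. The zigzag of \<open>\<eta>\<close> that results straightens, and the cap turns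
  into the form \<open>u\<dagger> \<cdot> m\<close> after \<open>j\<close>.\<close>

lemma ca_J:
  assumes "has i [A\<star>, A] s"
  shows "ca i s = co i (mu i (J i s))"
proof -
  from assms obtain us vs where [simp]: "ty s = Some (us @ [A\<star>, A] @ vs)" "i = length us"
    by (rule has_ty)
  have J: "cu (Suc i) s = J (Suc (Suc i)) (sw (Suc i) (A\<star>) A (cp (Suc i) s))"
    using sw_nat(1) [of j "A\<star>" A A "Suc i" "cp (Suc i) s"] J_cp [of "Suc i" s] by (simp add: calc)
  have "ca i s = ca i (co (Suc (Suc i)) (mu (Suc (Suc i)) (cu (Suc i) s)))"
    using snake_frob(2) [of "Suc i" s] by (simp add: calc)
  also have "\<dots> = co i (mu i (J i (ca i (sw (Suc i) (A\<star>) A (cp (Suc i) s)))))"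
    unfolding J by (simp add: ap_interchange')
  also have "ca i (sw (Suc i) (A\<star>) A (cp (Suc i) s)) = s"
  proof -
    have "ca i (sw (Suc i) (A\<star>) A (cp (Suc i) s)) = ca (Suc i) (sw i (A\<star>) (A\<star>) (sw (Suc i) A (A\<star>) (sw (Suc i) (A\<star>) A (cp (Suc i) s))))"
      using cap_sw(2) [of "\<eta> A" "A\<star>" A i "A\<star>" "sw (Suc i) (A\<star>) A (cp (Suc i) s)"] by (simp add: calc)
    also have "\<dots> = s"
      using snakes(4) [of i s] by (simp add: calc)
    finally show ?thesis .
  qed
  finally show ?thesis .
qed

text \<open>\<open>TL\<close> and \<open>TR\<close> send \<open>x\<close> to the trace of left and right multiplication by \<open>x\<close>.\<close>

abbreviation "TL i s \<equiv> ca i (sw i A (A\<star>) (mu i (sw (Suc i) (A\<star>) A (cp (Suc i) s))))"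
abbreviation "TR i s \<equiv> ca i (mu (Suc i) (cp i s))"

text \<open>Removes the dual object: the cap becomes the Frobenius form and the cup becomes
  \<open>c\<close>, leaving a word in the algebra operations and crossings.\<close>

lemma TL_eq:
  assumes "has i [A] s"
  shows "TL i s = co i (mu i (sw i A A (mu i (cu (Suc i) s))))"
proof -
  from assms obtain us vs where [simp]: "ty s = Some (us @ [A] @ vs)" "i = length us"
    by (rule has_ty)
  let ?q = "mu i (sw (Suc i) (A\<star>) A (cp (Suc i) s))"
  have "TL i s = co i (mu i (J i (sw i A (A\<star>) ?q)))"
    by (rule ca_J) (simp add: calc)
  also have "J i (sw i A (A\<star>) ?q) = sw i A A (J (Suc i) ?q)"
    using sw_nat(2) [of j "A\<star>" A A i ?q] by (simp add: calc)
  also have "J (Suc i) ?q = mu i (J (Suc (Suc i)) (sw (Suc i) (A\<star>) A (cp (Suc i) s)))"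
    by (simp add: ap_interchange)
  also have "J (Suc (Suc i)) (sw (Suc i) (A\<star>) A (cp (Suc i) s)) = cu (Suc i) s"
    using sw_nat(1) [of j "A\<star>" A A "Suc i" "cp (Suc i) s"] J_cp [of "Suc i" s] by (simp add: calc)
  finally show ?thesis .
qed

lemma mu_sw:
  assumes "E \<in> Obj V"
  shows "has i [A, A, E] s \<Longrightarrow> sw i A E (mu i s) = mu (Suc i) (sw i A E (sw (Suc i) A E s))"
    and "has i [E, A, A] s \<Longrightarrow> sw i E A (mu (Suc i) s) = mu i (sw (Suc i) E A (sw i E A s))"
  using swl_nat [of i "[A, A]" E s m "[A]"] swr_nat [of i E "[A, A]" s m "[A]"] assms
  by (auto simp: vgen_def)

text \<open>Left multiplication by a product is a composite, so this is cyclicity of the trace. Both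
  sides are brought to four wires and differ only by a permutation and by the place of one
  multiplication.\<close>

lemma TL_sym:
  assumes "has i [A, A] s"
  shows "TL i (mu i (sw i A A s)) = TL i (mu i s)"
proof -
  from assms obtain us vs where [simp]: "ty s = Some (us @ [A, A] @ vs)" "i = length us"
    by (rule has_ty)
  have TL: "TL i (mu i t) = co i (mu i (sw i A A (mu i (mu (Suc i) (cu (Suc (Suc i)) t)))))"
    if [simp]: "ty t = Some (us @ [A, A] @ vs)" for t
  proof -
    have "cu (Suc i) (mu i t) = mu i (cu (Suc (Suc i)) t)"
      by (simp add: ap_interchange)
    then have "mu i (cu (Suc i) (mu i t)) = mu i (mu (Suc i) (cu (Suc (Suc i)) t))"
      using mu_mu [of i "cu (Suc (Suc i)) t"] by (simp add: calc)
    then show ?thesis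
      using TL_eq [of i "mu i t"] by (simp add: calc)
  qed
  let ?q = "cu (Suc (Suc i)) s" and ?r = "cu (Suc i) s"
  have r: "?r = sw (Suc (Suc i)) A A (sw (Suc i) A A ?q)"
    using cup_sw(2) [of c A A "Suc i" A s] by (simp add: calc)
  \<comment> \<open>The braid relation relates the permutations obtained from the two positions of
    the cup \<open>c\<close>.\<close>
  have "sw (Suc i) A A (sw (Suc (Suc i)) A A (sw (Suc i) A A ?q)) = sw (Suc (Suc i)) A A (sw (Suc i) A A (sw (Suc (Suc i)) A A ?q))"
    using sw_YB [of "Suc i" A A A ?q] by (simp add: calc)
  then have "sw (Suc i) A A (sw i A A (sw (Suc (Suc i)) A A (sw (Suc i) A A ?r)))
      = sw (Suc i) A A (sw i A A (sw (Suc i) A A (sw (Suc (Suc i)) A A ?q)))"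
    unfolding r by (simp add: calc)
  also have "\<dots> = sw i A A (sw (Suc i) A A (sw i A A (sw (Suc (Suc i)) A A ?q)))"
    using sw_YB [of i A A A "sw (Suc (Suc i)) A A ?q"] by (simp add: calc)
  also have "\<dots> = sw i A A (sw (Suc i) A A (sw (Suc (Suc i)) A A (sw i A A ?q)))"
    by (simp add: ap_interchange)
  finally have perm: "sw (Suc i) A A (sw i A A (sw (Suc (Suc i)) A A (sw (Suc i) A A ?r)))
      = sw i A A (sw (Suc i) A A (sw (Suc (Suc i)) A A (sw i A A ?q)))" (is "?P1 = ?P2") .
  have t1 [simp]: "ty ?P1 = Some (us @ [A, A, A, A] @ vs)"
    by (simp add: calc)
  \<comment> \<open>Both sides are a comultiplication of the second factor, so the cup
    \<open>c\<close> may stand on either side of it.\<close>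
  have "mu (Suc i) ?q = mu (Suc (Suc i)) ?r"
    using mu_cu [of "Suc i" s] by (simp add: calc)
  then have "TL i (mu i s) = co i (mu i (sw i A A (mu i (mu (Suc (Suc i)) ?r))))"
    using TL [of s] by simp
  also have "sw i A A (mu i (mu (Suc (Suc i)) ?r)) = mu (Suc i) (mu i ?P1)"
    using mu_sw(1) [of A i "mu (Suc (Suc i)) ?r"] mu_sw(2) [of A "Suc i" ?r] mu_sw(2) [of A i "sw (Suc (Suc i)) A A (sw (Suc i) A A ?r)"]
    by (simp add: calc)
  finally have 1: "TL i (mu i s) = co i (mu i (mu (Suc i) (mu i ?P1)))" .
  let ?q' = "sw i A A ?q"
  have "cu (Suc (Suc i)) (sw i A A s) = ?q'"
    by (simp add: ap_interchange)
  then have "TL i (mu i (sw i A A s)) = co i (mu i (sw i A A (mu i (mu (Suc i) ?q'))))"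
    using TL [of "sw i A A s"] by (simp add: calc)
  also have "sw i A A (mu i (mu (Suc i) ?q')) = mu (Suc i) (mu (Suc (Suc i)) ?P2)"
    using mu_sw(1) [of A i "mu (Suc i) ?q'"] mu_sw(1) [of A "Suc i" ?q']
    by (simp add: calc) (simp add: ap_interchange')
  also have "mu i (mu (Suc i) (mu (Suc (Suc i)) ?P2)) = mu i (mu i (mu (Suc (Suc i)) ?P2))"
    using t1 unfolding perm by (intro mu_mu [symmetric]) (simp add: calc)
  also have "mu i (mu (Suc (Suc i)) ?P2) = mu (Suc i) (mu i ?P2)"
    by (simp add: ap_interchange')
  finally show ?thesis
    unfolding 1 perm .
qed

lemma ap_central:
  assumes z: "central V M z"
  shows "z \<in> Arr V" "Dom V z = A" "Cod V z = A"
    and "has i [A, A] s \<Longrightarrow> mu i (at z i s) = at z i (mu i s)"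
    and "has i [A, A] s \<Longrightarrow> mu i (at z (Suc i) s) = at z i (mu i s)"
proof -
  show z' [simp]: "z \<in> Arr V" "Dom V z = A" "Cod V z = A"
    using z by (auto simp: central_def hom_def Let_def)
  have e: "m \<cdot> (z \<otimes> \<one> A) = z \<cdot> m" "m \<cdot> (\<one> A \<otimes> z) = z \<cdot> m"
    using z by (auto simp: central_def Let_def)
  {
    assume h: "has i [A, A] s"
    have "mu i (ap i [A, A] (z \<otimes> \<one> A) [A, A] s) = at z i (mu i s)"
      by (simp add: ap_comp vgen_def e)
    then show "mu i (at z i s) = at z i (mu i s)"
      using h by (simp add: ap_tensor_id)
    have "mu i (ap i [A, A] (\<one> A \<otimes> z) [A, A] s) = at z i (mu i s)"
      by (simp add: ap_comp vgen_def e)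
    then show "mu i (at z (Suc i) s) = at z i (mu i s)"
      using h by (simp add: ap_tensor_id)
  }
qed

lemma ap_central_dagger:
  assumes z: "central V M z" and d [simp]: "z\<dagger> = z" and h: "has i [A] s"
  shows "de i (at z i s) = at z i (de i s)" "at z (Suc i) (de i s) = at z i (de i s)"
proof -
  note [simp] = ap_central(1-3) [OF z]
  have "m \<cdot> (z \<otimes> \<one> A) = z \<cdot> m" "m \<cdot> (\<one> A \<otimes> z) = z \<cdot> m"
    using z by (auto simp: central_def Let_def)
  from this [THEN arg_cong [of _ _ "\<lambda>x. x\<dagger>"]]
  have e: "(z \<otimes> \<one> A) \<cdot> m\<dagger> = m\<dagger> \<cdot> z" "(\<one> A \<otimes> z) \<cdot> m\<dagger> = m\<dagger> \<cdot> z"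
    by (simp_all add: dagger_comp')
  from h obtain us vs where [simp]: "ty s = Some (us @ [A] @ vs)" "i = length us"
    by (rule has_ty)
  have "de i (at z i s) = ap i [A, A] (z \<otimes> \<one> A) [A, A] (de i s)"
    by (simp add: ap_comp vgen_def e)
  then show 1: "de i (at z i s) = at z i (de i s)"
    by (simp add: ap_tensor_id calc)
  have "de i (at z i s) = ap i [A, A] (\<one> A \<otimes> z) [A, A] (de i s)"
    by (simp add: ap_comp vgen_def e)
  then show "at z (Suc i) (de i s) = at z i (de i s)"
    unfolding 1 by (simp add: ap_tensor_id calc)
qed

lemma positive_self_adjoint:
  assumes "positive V y" "y \<in> Arr V" "Dom V y = A" "Cod V y = A"
  obtains h where "h \<in> Arr V" "Dom V h = A" "y = h\<dagger> \<cdot> h" "y\<dagger> = y"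
proof -
  from assms(1) obtain h where h: "h \<in> Arr V" "y = h\<dagger> \<cdot> h"
    by (auto simp: positive_def)
  then have "Dom V h = A"
    using assms(3) by simp
  with h show thesis
    by (intro that [of h]) (simp_all add: dagger_comp')
qed

abbreviation "a \<equiv> act V M"

lemma a_typed [simp]: "a \<in> Arr V" "Dom V a = A" "Cod V a = dbl A"
  by (simp_all add: act_def Let_def)

lemma coact_eq: "coact V M = a\<dagger>"
  by (simp add: coact_def act_def Let_def dagger_comp' cassoc)

lemma ap_act: "has i [A] s \<Longrightarrow> ap i [A] a [dbl A] s = mg i (A\<star>) A (mu (Suc i) (cp i s))"
  by (elim has_ty) (simp add: act_def Let_def coh' ap_expand_alg ap_expand_eta)

lemma ap_coact: "has i [dbl A] s \<Longrightarrow> ap i [dbl A] (a\<dagger>) [A] s = ca i (de (Suc i) (sp i (A\<star>) A s))"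
  by (elim has_ty) (simp add: act_def Let_def dagger_comp' coh' ap_expand_alg ap_expand_eta)

text \<open>The half of \<open>kraus V A A (m\<dagger>)\<close> that lives on \<open>A\<star>\<close>.\<close>

definition kap :: 'a where
  "kap = dmon A A \<cdot> conj_map V (m\<dagger>)"

abbreviation "Kp i \<equiv> ap i [A\<star>] kap [A\<star>, A\<star>]"

lemma kap_typed [simp]: "kap \<in> Arr V" "Dom V kap = A\<star>" "Cod V kap = A\<star> \<odot> A\<star>"
  by (simp_all add: kap_def)

lemma kap_name: "(kap \<otimes> \<one> A) \<cdot> \<eta> A = (\<one> (A\<star> \<odot> A\<star>) \<otimes> m) \<cdot> interchange V (A\<star>) A (A\<star>) A \<cdot> (\<eta> A \<otimes> \<eta> A) \<cdot> (\<Lambda> \<I>)\<dagger>"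
proof -
  have "(kap \<otimes> \<one> A) \<cdot> \<eta> A = (dmon A A \<otimes> \<one> A) \<cdot> ((conj_map V (m\<dagger>) \<otimes> \<one> A) \<cdot> \<eta> A)"
    by (simp add: kap_def tensor_left_comp cassoc)
  also have "\<dots> = (dmon A A \<otimes> \<one> A) \<cdot> ((\<one> ((A \<odot> A)\<star>) \<otimes> m) \<cdot> \<eta> (A \<odot> A))"
    using conj_name [of "m\<dagger>" A "A \<odot> A"] by simp
  also have "\<dots> = (\<one> (A\<star> \<odot> A\<star>) \<otimes> m) \<cdot> ((dmon A A \<otimes> \<one> (A \<odot> A)) \<cdot> \<eta> (A \<odot> A))"
    by (simp add: tensor_comp_reduce)
  finally show ?thesis
    by (simp add: dmon_name)
qed

text \<open>Conjugating the comultiplication makes it slide through the cup as a multiplication on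
  the other leg.\<close>

lemma Kp_cp:
  assumes "has i [] s"
  shows "Kp i (cp i s) = mu (Suc (Suc i)) (sw (Suc i) A (A\<star>) (cp (Suc (Suc i)) (cp i s)))"
proof -
  from assms obtain us vs where [simp]: "ty s = Some (us @ vs)" "i = length us"
    by (auto elim: has_ty)
  let ?L = "(kap \<otimes> \<one> A) \<cdot> \<eta> A"
  have "mg i (A\<star> \<odot> A\<star>) A (mg i (A\<star>) (A\<star>) (Kp i (cp i s))) = ap i [\<I>] ?L [(A\<star> \<odot> A\<star>) \<odot> A] (nI i s)"
    by (simp add: coh' ap_expand_eta ap_out_split [of "A\<star>" "A\<star>" _ _ kap])
  also have "\<dots> = mg i (A\<star> \<odot> A\<star>) A (mg i (A\<star>) (A\<star>) (mu (Suc (Suc i)) (sw (Suc i) A (A\<star>) (cp (Suc (Suc i)) (cp i s)))))"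
    unfolding kap_name by (simp add: coh' ap_expand_eta ap_expand_alg)
  finally have "sp i (A\<star>) (A\<star>) (sp i (A\<star> \<odot> A\<star>) A (mg i (A\<star> \<odot> A\<star>) A (mg i (A\<star>) (A\<star>) (Kp i (cp i s)))))
     = sp i (A\<star>) (A\<star>) (sp i (A\<star> \<odot> A\<star>) A (mg i (A\<star> \<odot> A\<star>) A (mg i (A\<star>) (A\<star>) (mu (Suc (Suc i)) (sw (Suc i) A (A\<star>) (cp (Suc (Suc i)) (cp i s)))))))"
    by simp
  then show ?thesis
    by (simp add: calc)
qed

end

text \<open>Symmetry of the form is isolated as an assumption because it has two sources: a
  normaliser forces it, while for tensor and unit algebras it is checked directly, before their
  normalisers are established.\<close>

locale symmetric_frob = frob V M
  for V :: "('o, 'a, 'z) dc_cat_scheme" (structure) and M +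
  assumes counit_sym: "u\<dagger> \<cdot> m \<cdot> \<sigma> A A = u\<dagger> \<cdot> m"
begin

lemma co_sym:
  assumes "has i [A, A] s"
  shows "co i (mu i (sw i A A s)) = co i (mu i s)"
proof -
  have "co i (mu i (sw i A A s)) = ap i [A, A] (u\<dagger> \<cdot> m \<cdot> \<sigma> A A) [] s" "co i (mu i s) = ap i [A, A] (u\<dagger> \<cdot> m) [] s"
    by (simp_all add: ap_comp vgen_def)
  then show ?thesis
    by (simp add: counit_sym)
qed

lemma c_sym: "\<sigma> A A \<cdot> c = c"
proof -
  from arg_cong [OF counit_sym, of "\<lambda>x. x\<dagger>"] show ?thesis
    by (simp add: c_def dagger_comp' cassoc)
qed

lemma cu_sym: "has i [] s \<Longrightarrow> sw i A A (cu i s) = cu i s"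
  using c_sym by (simp add: ap_comp vgen_def)

text \<open>With a symmetric form, \<open>j\<close> carries the cup to \<open>c\<close> itself. Two
  uses of the symmetry, with associativity and a slide of \<open>c\<close>, turn one trace into the
  other.\<close>

lemma TR_TL:
  assumes "has i [A] s"
  shows "TR i s = TL i s"
proof -
  from assms obtain us vs where s [simp]: "ty s = Some (us @ [A] @ vs)" "i = length us"
    by (rule has_ty)
  have "TR i s = co i (mu i (J i (mu (Suc i) (cp i s))))"
    by (rule ca_J) (simp add: calc)
  also have "J i (mu (Suc i) (cp i s)) = mu (Suc i) (J i (cp i s))"
    by (simp add: ap_interchange)
  also have "J i (cp i s) = cu i s"
    by (simp add: J_cp cu_sym calc)
  also have "mu i (mu (Suc i) (cu i s)) = mu i (mu i (cu i s))"
    by (rule mu_mu [symmetric]) (simp add: calc)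
  also have "co i \<dots> = co i (mu i (sw i A A (mu i (cu i s))))"
    by (rule co_sym [symmetric]) (simp add: calc)
  also have "sw i A A (mu i (cu i s)) = mu (Suc i) (cu (Suc i) s)"
    using mu_sw(1) [of A i "cu i s"] cup_sw(3) [of c A A i A s] by (simp add: calc)
  also have "mu i (mu (Suc i) (cu (Suc i) s)) = mu i (mu i (cu (Suc i) s))"
    by (rule mu_mu [symmetric]) (simp add: calc)
  also have "co i \<dots> = co i (mu i (sw i A A (mu i (cu (Suc i) s))))"
    by (rule co_sym [symmetric]) (simp add: calc)
  also have "\<dots> = TL i s"
    by (rule TL_eq [symmetric]) (simp add: calc)
  finally show ?thesis .
qed

text \<open>Writing the comultiplication as a product with a leg of the symmetric cup
  \<open>c\<close>, both sides become one and the same word, in which the cup has been rotated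
  around the other wires.\<close>

lemma frob_rotate:
  assumes "has i [A, A] s"
  shows "mu i (sw (Suc i) A A (de (Suc i) s)) = sw i A A (mu i (sw i A A (de (Suc i) s)))"
proof -
  from assms obtain us vs where s [simp]: "ty s = Some (us @ [A, A] @ vs)" "i = length us"
    by (rule has_ty)
  let ?s = "sw i A A s"
  let ?q = "cu (Suc (Suc i)) s" and ?v = "cu (Suc (Suc i)) ?s" and ?p = "cu (Suc i) ?s"
  have d: "de (Suc i) s = mu (Suc i) ?q"
    using mu_cu(1) [of "Suc i" s] by (simp add: calc)
  have v: "?v = sw i A A ?q"
    by (simp add: ap_interchange)
  have p1: "sw (Suc (Suc i)) A A (sw (Suc i) A A ?v) = ?p"
    using cup_sw(2) [of c A A "Suc i" A ?s] by (simp add: calc)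
  have vp: "mu (Suc i) ?v = mu (Suc (Suc i)) ?p"
    using mu_cu [of "Suc i" ?s] by (simp add: calc)
  have "mu i (sw (Suc i) A A (de (Suc i) s)) = mu i (mu (Suc (Suc i)) (sw (Suc i) A A ?q))"
    using mu_sw(1) [of A "Suc i" ?q] cu_sym [of "Suc (Suc i)" s] unfolding d by (simp add: calc)
  also have "\<dots> = mu (Suc i) (mu i (sw (Suc i) A A (sw i A A ?v)))"
    unfolding v by (simp add: calc) (simp add: ap_interchange')
  also have "\<dots> = mu (Suc i) (sw i A A (mu (Suc i) ?v))"
    using mu_sw(2) [of A i ?v] by (simp add: calc)
  finally have l: "mu i (sw (Suc i) A A (de (Suc i) s)) = mu (Suc i) (sw i A A (mu (Suc (Suc i)) ?p))"
    unfolding vp .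
  let ?w = "sw (Suc i) A A ?v"
  have w: "?w = sw (Suc (Suc i)) A A (sw (Suc i) A A ?p)"
  proof -
    have "sw (Suc i) A A ?p = ?p"
      using cu_sym [of "Suc i" ?s] by (simp add: calc)
    then show ?thesis
      using p1 [symmetric] by (simp add: calc)
  qed
  have "sw i A A (de (Suc i) s) = mu i ?w"
    using mu_sw(2) [of A i ?q] unfolding d v by (simp add: calc)
  then have "sw i A A (mu i (sw i A A (de (Suc i) s))) = sw i A A (mu i (mu (Suc i) ?w))"
    using mu_mu [of i ?w] by (simp add: calc)
  also have "mu (Suc i) ?w = sw (Suc i) A A (mu (Suc (Suc i)) ?p)"
    using mu_sw(2) [of A "Suc i" ?p] unfolding w by (simp add: calc)
  also have "sw i A A (mu i (sw (Suc i) A A (mu (Suc (Suc i)) ?p))) = mu (Suc i) (sw i A A (mu (Suc (Suc i)) ?p))"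
    using mu_sw(1) [of A i "sw (Suc i) A A (mu (Suc (Suc i)) ?p)"] by (simp add: calc)
  finally show ?thesis
    unfolding l ..
qed

text \<open>Bending the \<open>A\<star>\<close> input with a cup loses nothing, so arrows out of
  \<open>A\<star> \<odot> A\<close> may be compared on states where that wire is one leg of a cup
  and the other leg is an output.\<close>

lemma bend_input:
  assumes "F \<in> Arr V" "Dom V F = dbl A" "Cod V F = Z" "G \<in> Arr V" "Dom V G = dbl A" "Cod V G = Z"
    and eq: "\<And>s. has 0 [A] s \<Longrightarrow> ap 0 [A\<star>, A] F [Z] (sw (Suc 0) A A (cp 0 s)) = ap 0 [A\<star>, A] G [Z] (sw (Suc 0) A A (cp 0 s))"
  shows "F = G"
proof -
  have [simp]: "Z \<in> Obj V"
    using assms cod_obj by auto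
  let ?t = "init [A\<star>, A]"
  let ?t' = "sw 0 (A\<star>) A ?t"
  let ?b = "sw (Suc 0) A A (cp 0 ?t')"
  have "?t = ca (Suc 0) (sw (Suc 0) A (A\<star>) (cp 0 ?t))"
    using snakes(2) [of 0 ?t] by (simp add: calc)
  also have "\<dots> = ca (Suc (Suc 0)) (sw (Suc 0) (A\<star>) A (sw (Suc (Suc 0)) A A (sw (Suc 0) A (A\<star>) (cp 0 ?t))))"
    using cap_sw(2) [of "\<eta> A" "A\<star>" A "Suc 0" A "sw (Suc 0) A (A\<star>) (cp 0 ?t)"] by (simp add: calc)
  also have "sw (Suc 0) (A\<star>) A (sw (Suc (Suc 0)) A A (sw (Suc 0) A (A\<star>) (cp 0 ?t)))
      = sw (Suc (Suc 0)) A (A\<star>) (sw (Suc 0) A A (sw (Suc (Suc 0)) (A\<star>) A (cp 0 ?t)))"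
    using sw_YB [of "Suc 0" A "A\<star>" A "cp 0 ?t"] by (simp add: calc)
  also have "sw (Suc (Suc 0)) (A\<star>) A (cp 0 ?t) = cp 0 ?t'"
    by (simp add: ap_interchange)
  \<comment> \<open>The plain state on \<open>A\<star>\<close>, \<open>A\<close> is the bent one
    closed by a cap; the crossing with \<open>A\<close> is what required the braid relation.\<close>
  finally have t: "?t = ca (Suc (Suc 0)) (sw (Suc (Suc 0)) A (A\<star>) ?b)" .
  have k: "ap 0 [A\<star>, A] H [Z] ?t = ca (Suc 0) (sw (Suc 0) A (A\<star>) (ap 0 [A\<star>, A] H [Z] ?b))" for H
    by (subst t) (simp add: ap_interchange')
  have "ap 0 [A\<star>, A] F [Z] ?b = ap 0 [A\<star>, A] G [Z] ?b"
    by (rule eq) (simp add: calc)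
  then have "ap 0 [A\<star>, A] F [Z] ?t = ap 0 [A\<star>, A] G [Z] ?t"
    by (simp only: k)
  then have "ap 0 [dbl A] F [Z] (mg 0 (A\<star>) A ?t) = ap 0 [dbl A] G [Z] (mg 0 (A\<star>) A ?t)"
    by (simp add: ap_in_split [of "A\<star>" A _ F] ap_in_split [of "A\<star>" A _ G] calc)
  then show ?thesis
    by (rule ap_faithful) (use assms in \<open>simp_all add: calc\<close>)
qed

text \<open>The right side is the doubled comultiplication with its first legs traced out against
  \<open>y\<close>. After bending the input, both sides become words that multiply and comultiply on
  \<open>A\<close> alone, and they agree by \<open>frob_rotate\<close> and centrality.\<close>

lemma act_coact_kraus:
  assumes y: "central V M y" and d: "y\<dagger> = y"
  shows "a \<cdot> y \<cdot> a\<dagger> = \<Lambda> (dbl A) \<cdot> (((\<eta> A)\<dagger> \<cdot> (\<one> (A\<star>) \<otimes> y)) \<otimes> \<one> (dbl A)) \<cdot> sh A A \<cdot> pm (m\<dagger>)"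
    (is "?l = ?r")
proof (rule bend_input)
  note [simp] = ap_central(1-3) [OF y]
  fix s
  assume h: "has 0 [A] s"
  then obtain vs where s [simp]: "ty s = Some (A # vs)"
    by (auto elim: has_ty)
  let ?d = "de 0 s"
  let ?f = "cp 0 ?d"
  let ?Y = "at y"
  have f: "?f = de (Suc (Suc 0)) (cp 0 s)"
    by (simp add: ap_interchange)
  have u: "de (Suc 0) (sw (Suc 0) A A (cp 0 s)) = sw (Suc (Suc 0)) A A (sw (Suc 0) A A ?f)"
    using swr_nat [of "Suc 0" A "[A]" "cp 0 s" "m\<dagger>" "[A, A]"] unfolding f by (simp add: calc)
  have "ap 0 [A\<star>, A] ?l [dbl A] (sw (Suc 0) A A (cp 0 s))
      = mg 0 (A\<star>) A (mu (Suc 0) (cp 0 (?Y 0 (ca 0 (sw (Suc (Suc 0)) A A (sw (Suc 0) A A ?f))))))"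
  proof -
    let ?b = "sw (Suc 0) A A (cp 0 s)"
    have "ap 0 [dbl A] ?l [dbl A] (mg 0 (A\<star>) A ?b) = mg 0 (A\<star>) A (mu (Suc 0) (cp 0 (?Y 0 (ca 0 (de (Suc 0) ?b)))))"
      by (simp add: ap_expand_comp ap_act ap_coact calc)
    then show ?thesis
      unfolding u by (simp add: ap_in_split [of "A\<star>" A _ ?l] calc)
  qed
  also have "ca 0 (sw (Suc (Suc 0)) A A (sw (Suc 0) A A ?f)) = sw 0 A A ?d"
    using snakes(3) [of 0 ?d] by (simp add: ap_interchange' calc)
  also have "mu (Suc 0) (cp 0 (?Y 0 (sw 0 A A ?d))) = mu (Suc 0) (?Y (Suc (Suc 0)) (sw (Suc (Suc 0)) A A ?f))"
    by (simp add: ap_interchange')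
  also have "\<dots> = ?Y (Suc 0) (mu (Suc 0) (sw (Suc (Suc 0)) A A ?f))"
    using ap_central(5) [OF y, of "Suc 0" "sw (Suc (Suc 0)) A A ?f"] by (simp add: calc)
  \<comment> \<open>Rotation puts the left side into the form that the right side reaches
    below.\<close>
  also have "\<dots> = ?Y (Suc 0) (sw (Suc 0) A A (mu (Suc 0) (sw (Suc 0) A A ?f)))"
    using frob_rotate [of "Suc 0" "cp 0 s"] unfolding f by (simp add: calc)
  finally have L: "ap 0 [A\<star>, A] ?l [dbl A] (sw (Suc 0) A A (cp 0 s))
      = mg 0 (A\<star>) A (?Y (Suc 0) (sw (Suc 0) A A (mu (Suc 0) (sw (Suc 0) A A ?f))))" .
  show "ap 0 [A\<star>, A] ?l [dbl A] (sw (Suc 0) A A (cp 0 s)) = ap 0 [A\<star>, A] ?r [dbl A] (sw (Suc 0) A A (cp 0 s))"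
  proof -
    let ?b = "sw (Suc 0) A A (cp 0 s)" and ?g = "sw (Suc 0) A (A\<star>) (cp 0 ?f)"
    let ?f2 = "sw (Suc (Suc 0)) A A (sw (Suc 0) A A ?f)"
    let ?f3 = "sw 0 (A\<star>) A ?f2"
    \<comment> \<open>The dual half of the doubled comultiplication is \<open>kap\<close>, on which
      the sliding rule \<open>Kp_cp\<close> acts.\<close>
    have r: "?r = \<Lambda> (dbl A) \<cdot> (((\<eta> A)\<dagger> \<cdot> (\<one> (A\<star>) \<otimes> y)) \<otimes> \<one> (dbl A)) \<cdot> interchange V (A\<star>) (A\<star>) A A \<cdot> (kap \<otimes> m\<dagger>)"
      by (simp add: shuffle_dmon pm_def kap_def cassoc tensor_comp')
    have "ap 0 [dbl A] ?r [dbl A] (mg 0 (A\<star>) A ?b)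
        = mg 0 (A\<star>) A (ca 0 (?Y (Suc 0) (sw (Suc 0) (A\<star>) A (Kp 0 (de (Suc 0) ?b)))))"
      unfolding r by (simp add: coh' ap_expand_eta ap_expand_alg ap_out_split [of "A\<star>" "A\<star>" _ _ kap])
    then have R: "ap 0 [A\<star>, A] ?r [dbl A] ?b
        = mg 0 (A\<star>) A (ca 0 (?Y (Suc 0) (sw (Suc 0) (A\<star>) A (Kp 0 ?f2))))"
      unfolding u by (simp add: ap_in_split [of "A\<star>" A _ ?r] calc)
    have K: "Kp 0 ?f = mu (Suc (Suc 0)) ?g"
      using Kp_cp [of 0 ?d] by (simp add: calc) (simp add: ap_interchange)
    have "Kp 0 ?f2 = sw (Suc (Suc (Suc 0))) A A (sw (Suc (Suc 0)) A A (Kp 0 ?f))"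
      by (simp add: ap_interchange')
    also have "\<dots> = mu (Suc (Suc (Suc (Suc 0)))) (sw (Suc (Suc (Suc 0))) A A (sw (Suc (Suc (Suc (Suc 0)))) A A
        (sw (Suc (Suc 0)) A A (sw (Suc (Suc (Suc 0))) A A ?g))))"
      using mu_sw(1) [of A "Suc (Suc 0)" ?g] mu_sw(1) [of A "Suc (Suc (Suc 0))" "sw (Suc (Suc 0)) A A (sw (Suc (Suc (Suc 0))) A A ?g)"]
      unfolding K by (simp add: calc)
    finally have "ca 0 (?Y (Suc 0) (sw (Suc 0) (A\<star>) A (Kp 0 ?f2)))
        = mu (Suc (Suc 0)) (ca 0 (?Y (Suc 0) (sw (Suc 0) (A\<star>) A (sw (Suc (Suc (Suc 0))) A A (sw (Suc (Suc (Suc (Suc 0)))) A A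
           (sw (Suc (Suc 0)) A A (sw (Suc (Suc (Suc 0))) A A ?g)))))))"
      by (simp add: ap_interchange')
    also have "sw (Suc 0) (A\<star>) A (sw (Suc (Suc (Suc 0))) A A (sw (Suc (Suc (Suc (Suc 0)))) A A
           (sw (Suc (Suc 0)) A A (sw (Suc (Suc (Suc 0))) A A ?g))))
        = sw (Suc (Suc (Suc 0))) A A (sw (Suc (Suc 0)) A (A\<star>) (sw (Suc 0) A A (cp 0 ?f3)))"
    proof -
      have Y: "sw (Suc 0) (A\<star>) A (sw (Suc (Suc 0)) A A (sw (Suc 0) A (A\<star>) (cp 0 ?f2))) = sw (Suc (Suc 0)) A (A\<star>) (sw (Suc 0) A A (cp 0 ?f3))"
        using sw_YB [of "Suc 0" A "A\<star>" A "cp 0 ?f2"] by (simp add: calc) (simp add: ap_interchange)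
      show ?thesis
        unfolding Y [symmetric] by (simp add: ap_interchange')
    qed
    also have "ca 0 (?Y (Suc 0) (\<dots>)) = sw (Suc 0) A A (sw 0 A (A\<star>) (ca 0 (?Y (Suc 0) (sw (Suc 0) A A (cp 0 ?f3)))))"
      by (simp add: ap_interchange')
    also have "?Y (Suc 0) (sw (Suc 0) A A (cp 0 ?f3)) = sw (Suc 0) A A (cp 0 (?Y 0 ?f3))"
      using sw_nat(2) [of y A A A "Suc 0" "cp 0 ?f3"] by (simp add: calc) (simp add: ap_interchange)
    \<comment> \<open>Here the trace over the environment closes to a snake.\<close>
    also have "ca 0 (sw (Suc 0) A A (cp 0 (?Y 0 ?f3))) = ?Y 0 ?f3"
      using snakes(3) [of 0 "?Y 0 ?f3"] by (simp add: calc)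
    also have "?Y 0 ?f3 = sw 0 (A\<star>) A (?Y (Suc 0) ?f2)"
      using sw_nat(2) [of y A A "A\<star>" 0 ?f2] by (simp add: calc)
    also have "sw 0 A (A\<star>) (sw 0 (A\<star>) A (?Y (Suc 0) ?f2)) = sw (Suc (Suc 0)) A A (?Y (Suc 0) (sw (Suc 0) A A ?f))"
      by (simp add: calc) (simp add: ap_interchange')
    also have "?Y (Suc 0) (sw (Suc 0) A A ?f) = sw (Suc 0) A A (?Y (Suc (Suc 0)) ?f)"
      using sw_nat(2) [of y A A A "Suc 0" ?f] by (simp add: calc)
    \<comment> \<open>Centrality: \<open>y\<close> moves to the other leg of the
      comultiplication.\<close>
    also have "?Y (Suc (Suc 0)) ?f = ?Y (Suc (Suc (Suc 0))) ?f"
      using ap_central_dagger(2) [OF y d, of "Suc (Suc 0)" "cp 0 s"] unfolding f by (simp add: calc)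
    also have "sw (Suc 0) A A (?Y (Suc (Suc (Suc 0))) ?f) = ?Y (Suc (Suc (Suc 0))) (sw (Suc 0) A A ?f)"
      by (simp add: ap_interchange)
    also have "sw (Suc (Suc 0)) A A (?Y (Suc (Suc (Suc 0))) (sw (Suc 0) A A ?f)) = ?Y (Suc (Suc 0)) ?f2"
      using sw_nat(2) [of y A A A "Suc (Suc 0)" "sw (Suc 0) A A ?f"] by (simp add: calc)
    also have "sw (Suc 0) A A (?Y (Suc (Suc 0)) ?f2) = ?Y (Suc 0) (sw (Suc 0) A A ?f2)"
      using sw_nat(2) [of y A A A "Suc 0" ?f2] by (simp add: calc)
    also have "mu (Suc (Suc 0)) (?Y (Suc 0) (sw (Suc 0) A A ?f2)) = ?Y (Suc 0) (mu (Suc (Suc 0)) (sw (Suc 0) A A ?f2))"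
      by (simp add: ap_interchange)
    also have "mu (Suc (Suc 0)) (sw (Suc 0) A A ?f2) = sw (Suc 0) A A (mu (Suc 0) (sw (Suc 0) A A ?f))"
      using mu_sw(1) [of A "Suc 0" "sw (Suc 0) A A ?f"] by (simp add: calc)
    finally show ?thesis
      unfolding L R by simp
  qed
qed (use y ap_central(1-3) [OF y] in simp_all)

text \<open>Splitting \<open>y\<close> as \<open>h\<dagger> \<cdot> h\<close> distributes it over
  the two legs of the traced cap, so \<open>h\<close> can be absorbed into the Kraus arrow, with the
  codomain of \<open>h\<close> as environment.\<close>

lemma act_coact_cp:
  assumes y: "central V M y" "positive V y"
  shows "completely_positive V A A (a \<cdot> y \<cdot> a\<dagger>)"
proof -
  note [simp] = ap_central(1-3) [OF y(1)]
  obtain h where h [simp]: "h \<in> Arr V" "Dom V h = A" and yh: "y = h\<dagger> \<cdot> h" and d: "y\<dagger> = y"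
    using positive_self_adjoint [OF y(2)] by auto
  let ?Y = "Cod V h"
  have [simp]: "?Y \<in> Obj V"
    by (simp add: cod_obj)
  have "(conj_map V (h\<dagger>) \<otimes> \<one> ?Y) \<cdot> \<eta> ?Y = (\<one> (A\<star>) \<otimes> h) \<cdot> \<eta> A"
    using conj_name [of "h\<dagger>" ?Y A] by simp
  from arg_cong [OF this, of "\<lambda>x. x\<dagger>"]
  \<comment> \<open>The conjugate of \<open>h\<close> slides around the cap and arrives as
    \<open>h\<dagger>\<close>.\<close>
  have n: "(\<eta> ?Y)\<dagger> \<cdot> (conj_map V h \<otimes> \<one> ?Y) = (\<eta> A)\<dagger> \<cdot> (\<one> (A\<star>) \<otimes> h\<dagger>)"
    by (simp add: dagger_comp' conj_dagger)
  have "(\<eta> ?Y)\<dagger> \<cdot> pm h = ((\<eta> ?Y)\<dagger> \<cdot> (conj_map V h \<otimes> \<one> ?Y)) \<cdot> (\<one> (A\<star>) \<otimes> h)"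
    by (simp add: pm_def cassoc tensor_comp')
  also have "\<dots> = (\<eta> A)\<dagger> \<cdot> (\<one> (A\<star>) \<otimes> y)"
    unfolding n by (simp add: yh cassoc tensor_comp')
  finally have e: "(\<eta> A)\<dagger> \<cdot> (\<one> (A\<star>) \<otimes> y) = (\<eta> ?Y)\<dagger> \<cdot> pm h" ..
  have "a \<cdot> y \<cdot> a\<dagger> = \<Lambda> (dbl A) \<cdot> ((\<eta> ?Y)\<dagger> \<otimes> \<one> (dbl A)) \<cdot> ((pm h \<otimes> pm (\<one> A)) \<cdot> sh A A) \<cdot> pm (m\<dagger>)"
    unfolding act_coact_kraus [OF y(1) d] e by (simp add: tensor_left_comp cassoc)
  also have "(pm h \<otimes> pm (\<one> A)) \<cdot> sh A A = sh ?Y A \<cdot> pm (h \<otimes> \<one> A)"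
    by (rule sh_nat [symmetric]) simp_all
  finally have "a \<cdot> y \<cdot> a\<dagger> = disc ?Y A \<cdot> pm ((h \<otimes> \<one> A) \<cdot> m\<dagger>)"
    by (simp add: disc_def pm_comp cassoc)
  then show ?thesis
    by (auto simp: completely_positive_iff intro!: bexI [of _ ?Y] bexI [of _ "(h \<otimes> \<one> A) \<cdot> m\<dagger>"])
qed

lemma ap_trace:
  assumes "has i [A] s"
  shows "ap i [A] (trace_mult V M) [\<I>] s = nI i (TL i s)"
  using assms by (elim has_ty) (simp add: trace_mult_def Let_def eps_def coh' ap_expand_alg ap_expand_eta)

lemma trace_typed [simp]: "trace_mult V M \<in> Arr V" "Dom V (trace_mult V M) = A" "Cod V (trace_mult V M) = \<I>"
  by (simp_all add: trace_mult_def Let_def eps_def)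

text \<open>The converse of the isometry condition. By the Frobenius law
  \<open>u\<dagger> \<cdot> a\<dagger> \<cdot> a\<close> is a trace of right multiplication, which
  equals the left trace when the form is symmetric.\<close>

lemma normaliserI:
  assumes z: "central V M z" "positive_definite V z" and az: "a\<dagger> \<cdot> a \<cdot> z \<cdot> z = \<one> A"
  shows "normaliser V M z"
proof -
  note [simp] = ap_central(1-3) [OF z(1)]
  have "trace_mult V M = u\<dagger> \<cdot> a\<dagger> \<cdot> a"
  proof (rule ap_faithful [where s = "init [A]"])
    let ?s = "init [A]"
    have "co 0 (ca 0 (de (Suc 0) (mu (Suc 0) (cp 0 ?s)))) = co 0 (TR 0 (de 0 ?s))"
      using frob_words(2) [of "Suc 0" "cp 0 ?s"] by (simp add: calc) (simp add: ap_interchange)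
    also have "\<dots> = TR 0 (co (Suc 0) (de 0 ?s))"
      by (simp add: ap_interchange')
    also have "\<dots> = TL 0 ?s"
      by (simp add: co_de TR_TL calc)
    finally show "ap 0 [A] (trace_mult V M) [\<I>] ?s = ap 0 [A] (u\<dagger> \<cdot> a\<dagger> \<cdot> a) [\<I>] ?s"
      by (simp add: ap_trace ap_expand_comp ap_act ap_coact ap_expand_alg calc)
  qed (simp_all add: calc)
  then have "trace_mult V M \<cdot> z \<cdot> z = u\<dagger> \<cdot> (a\<dagger> \<cdot> a \<cdot> z \<cdot> z)"
    by (simp add: cassoc)
  then show ?thesis
    using z az by (simp add: normaliser_def)
qed

end

section \<open>Symmetry and isometry forced by a normaliser\<close>

locale normalised_frob = frob V M
  for V :: "('o, 'a, 'z) dc_cat_scheme" (structure) and M +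
  fixes z
  assumes nz: "normaliser V M z"
begin

lemma z_central: "central V M z"
  and z_pd: "positive_definite V z"
  and z_trace: "trace_mult V M \<cdot> z \<cdot> z = u\<dagger>"
  using nz by (auto simp: normaliser_def)

lemmas z_typed [simp] = ap_central(1-3) [OF z_central]

lemma z_dagger [simp]: "z\<dagger> = z"
  using z_pd by (auto simp: positive_definite_def elim: positive_self_adjoint)

lemma co_TL:
  assumes "has i [A] s"
  shows "co i s = TL i (at z i (at z i s))"
proof -
  from assms obtain us vs where [simp]: "ty s = Some (us @ [A] @ vs)" "i = length us"
    by (rule has_ty)
  have "ap i [A] (trace_mult V M \<cdot> z \<cdot> z) [\<I>] s = ap i [A] (u\<dagger>) [\<I>] s"
    by (simp only: z_trace)
  then have "nI i (TL i (at z i (at z i s))) = nI i (co i s)"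
    by (simp add: trace_mult_def Let_def eps_def coh' ap_expand_alg ap_expand_eta)
  then have "dI i (nI i (TL i (at z i (at z i s)))) = dI i (nI i (co i s))"
    by simp
  then show ?thesis
    by (simp add: calc)
qed

text \<open>The counit is the trace weighted by \<open>z\<close> twice. Centrality places both
  copies on one factor before multiplying, where the symmetry of the trace applies.\<close>

lemma co_sym_normalised:
  assumes "has i [A, A] s"
  shows "co i (mu i (sw i A A s)) = co i (mu i s)"
proof -
  from assms obtain us vs where s [simp]: "ty s = Some (us @ [A, A] @ vs)" "i = length us"
    by (rule has_ty)
  let ?r = "at z (Suc i) (at z (Suc i) s)"
  note cl = ap_central(4) [OF z_central] and cr = ap_central(5) [OF z_central]
  have "at z i (at z i (mu i (sw i A A s))) = mu i (at z i (at z i (sw i A A s)))"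
    using cl [of i "sw i A A s"] cl [of i "at z i (sw i A A s)"] by (simp add: calc)
  also have "at z i (at z i (sw i A A s)) = sw i A A ?r"
    using sw_nat(2) [of z A A A i s] sw_nat(2) [of z A A A i "at z (Suc i) s"] by (simp add: calc)
  finally have "co i (mu i (sw i A A s)) = TL i (mu i (sw i A A ?r))"
    using co_TL [of i "mu i (sw i A A s)"] by (simp add: calc)
  also have "\<dots> = TL i (mu i ?r)"
    by (rule TL_sym) (simp add: calc)
  also have "mu i ?r = at z i (at z i (mu i s))"
    using cr [of i s] cr [of i "at z (Suc i) s"] by (simp add: calc)
  also have "TL i \<dots> = co i (mu i s)"
    using co_TL [of i "mu i s"] by (simp add: calc)
  finally show ?thesis .
qed

lemma counit_sym_normalised: "u\<dagger> \<cdot> m \<cdot> \<sigma> A A = u\<dagger> \<cdot> m"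
  by (rule ap_faithful [where s = "mg 0 A A (init [A, A])"])
    (simp_all add: coh ap_expand_alg co_sym_normalised)

sublocale symmetric_frob V M
  by unfold_locales (rule counit_sym_normalised)

text \<open>By the Frobenius law \<open>a\<dagger> \<cdot> a\<close> is comultiplication followed by
  a right trace. That trace equals the left one, the two copies of \<open>z\<close> turn it into the
  counit, and the counit law finishes.\<close>

lemma act_z: "a\<dagger> \<cdot> a \<cdot> z \<cdot> z = \<one> A"
proof (rule ap_faithful [where s = "init [A]"])
  let ?s = "init [A]"
  let ?t = "at z 0 (at z 0 ?s)"
  have "ca 0 (de (Suc 0) (mu (Suc 0) (cp 0 ?t))) = TR 0 (de 0 ?t)"
    using frob_words(2) [of "Suc 0" "cp 0 ?t"] by (simp add: calc) (simp add: ap_interchange)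
  also have "de 0 ?t = at z 0 (at z 0 (de 0 ?s))"
    by (simp add: ap_central_dagger [OF z_central] calc)
  also have "TR 0 \<dots> = co 0 (de 0 ?s)"
    using co_TL [of 0 "de 0 ?s"] by (subst TR_TL) (simp_all add: calc)
  also have "\<dots> = ?s"
    by (simp add: co_de calc)
  finally show "ap 0 [A] (a\<dagger> \<cdot> a \<cdot> z \<cdot> z) [A] ?s = ap 0 [A] (\<one> A) [A] ?s"
    by (simp add: ap_expand_comp ap_act ap_coact calc)
qed (simp_all add: calc)

end

section \<open>Action maps of tensor products and along algebra isomorphisms\<close>

context dagger_compact_category
begin

lemma ap_conj_eta:
  assumes f: "f \<in> Arr V" "Dom V f = A" "Cod V f = B" and "has i [] s"
  shows "ap i [A\<star>] (conj_map V f) [B\<star>] (cup i (\<eta> A) (A\<star>) A s) = ap (Suc i) [B] (f\<dagger>) [A] (cup i (\<eta> B) (B\<star>) B s)"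
proof -
  have "A \<in> Obj V" "B \<in> Obj V"
    using f dom_obj [of f] cod_obj [of f] by auto
  then show ?thesis
    using f assms(4) by (intro ap_name [OF conj_name]) auto
qed

lemma inter_inter [simp]:
  assumes "A \<in> Obj V" "B \<in> Obj V" "D \<in> Obj V" "E \<in> Obj V"
  shows "interchange V A D B E \<cdot> interchange V A B D E = \<one> ((A \<odot> B) \<odot> (D \<odot> E))"
    and "\<lbrakk>x \<in> Arr V; Cod V x = (A \<odot> B) \<odot> (D \<odot> E)\<rbrakk> \<Longrightarrow> interchange V A D B E \<cdot> (interchange V A B D E \<cdot> x) = x"
  using inter_simps(1) [of A B D E] inter_simps(3) [of A B D E x] assms by simp_all

lemma frobI: "dagger_frobenius_algebra V M \<Longrightarrow> frob V M"
  by unfold_locales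

lemma central_ident:
  assumes "dagger_frobenius_algebra V M"
  shows "central V M (\<one> (carrier M))"
proof -
  interpret frob V M
    using assms by (rule frobI)
  show ?thesis
    by (simp add: central_def Let_def hom_def)
qed

text \<open>\<open>z\<close> being self-adjoint, its conjugate reaches the other leg of the cup as
  \<open>z\<close>; centrality carries both copies through the multiplication to the input.\<close>

lemma pm_act_central:
  assumes "dagger_frobenius_algebra V M" and z: "central V M z" and d [simp]: "z\<dagger> = z"
  shows "pm z \<cdot> act V M = act V M \<cdot> z \<cdot> z"
proof -
  interpret frob V M
    using assms(1) by (rule frobI)
  note [simp] = ap_central(1-3) [OF z]
  let ?s = "init [A]"
  have e: "ap 0 [A\<star>] (conj_map V z) [A\<star>] (mu (Suc 0) (cp 0 ?s)) = mu (Suc 0) (cp 0 (at z 0 ?s))"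
  proof -
    have "ap 0 [A\<star>] (conj_map V z) [A\<star>] (mu (Suc 0) (cp 0 ?s)) = mu (Suc 0) (ap 0 [A\<star>] (conj_map V z) [A\<star>] (cp 0 ?s))"
      by (simp add: ap_interchange')
    also have "\<dots> = mu (Suc 0) (at z (Suc 0) (cp 0 ?s))"
      by (simp add: ap_conj_eta calc)
    also have "\<dots> = mu (Suc 0) (at z (Suc (Suc 0)) (cp 0 ?s))"
      using ap_central(4,5) [OF z, of "Suc 0" "cp 0 ?s"] by (simp add: calc)
    also have "\<dots> = mu (Suc 0) (cp 0 (at z 0 ?s))"
      by (simp add: ap_interchange)
    finally show ?thesis .
  qed
  have "at z (Suc 0) (mu (Suc 0) (cp 0 (at z 0 ?s))) = mu (Suc 0) (cp 0 (at z 0 (at z 0 ?s)))"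
    using ap_central(5) [OF z, of "Suc 0" "cp 0 (at z 0 ?s)"] by (simp add: calc) (simp add: ap_interchange)
  moreover have "ap 0 [A\<star>] (conj_map V z) [A\<star>] (at z (Suc 0) (mu (Suc 0) (cp 0 ?s))) = at z (Suc 0) (mu (Suc 0) (cp 0 (at z 0 ?s)))"
    unfolding e [symmetric] by (simp add: ap_interchange')
  ultimately show ?thesis
    by (intro ap_faithful [where s = ?s]) (simp_all add: pm_def ap_expand_comp ap_act ap_expand_tensor calc)
qed

text \<open>The conjugate of \<open>f\<close> slides through the cup as \<open>f\<dagger>\<close>,
  which unitarity cancels against one of the two copies of \<open>f\<close> produced by
  multiplicativity.\<close>

lemma pm_act_hom:
  assumes "dagger_frobenius_algebra V M" "dagger_frobenius_algebra V N"
    and f: "unitary V (carrier M) (carrier N) f" and h: "mult N \<cdot> (f \<otimes> f) = f \<cdot> mult M"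
  shows "pm f \<cdot> act V M = act V N \<cdot> f"
proof -
  interpret m: frob V M
    using assms(1) by (rule frobI)
  interpret n: frob V N
    using assms(2) by (rule frobI)
  note [simp] = unitary_cancel [OF f]
  let ?A = "carrier M" and ?B = "carrier N" let ?s = "init [?A]"
  let ?F = "\<lambda>i. ap i [?A] f [?B]" and ?G = "\<lambda>i. ap i [?B] (f\<dagger>) [?A]"
  have mu: "?F (Suc 0) (m.mu (Suc 0) t) = n.mu (Suc 0) (?F (Suc 0) (?F (Suc (Suc 0)) t))" for t
    by (simp add: ap_comp vgen_def h flip: ap_tensor)
  have "ap 0 [?A\<star>] (conj_map V f) [?B\<star>] (?F (Suc 0) (m.mu (Suc 0) (m.cp 0 ?s)))
      = ap 0 [?A\<star>] (conj_map V f) [?B\<star>] (n.mu (Suc 0) (?F (Suc 0) (?F (Suc (Suc 0)) (m.cp 0 ?s))))"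
    by (simp only: mu)
  also have "\<dots> = n.mu (Suc 0) (?F (Suc 0) (?F (Suc (Suc 0)) (ap 0 [?A\<star>] (conj_map V f) [?B\<star>] (m.cp 0 ?s))))"
    by (simp add: ap_interchange')
  also have "ap 0 [?A\<star>] (conj_map V f) [?B\<star>] (m.cp 0 ?s) = ?G (Suc 0) (n.cp 0 ?s)"
    by (simp add: ap_conj_eta calc)
  also have "?F (Suc 0) (?F (Suc (Suc 0)) (?G (Suc 0) (n.cp 0 ?s))) = ?F (Suc 0) (?G (Suc 0) (?F (Suc (Suc 0)) (n.cp 0 ?s)))"
    by (simp add: ap_interchange)
  also have "\<dots> = ?F (Suc (Suc 0)) (n.cp 0 ?s)"
    by (rule ap_cancel) (simp_all add: calc)
  also have "\<dots> = n.cp 0 (?F 0 ?s)"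
    by (simp add: ap_interchange)
  finally show ?thesis
    by (intro ap_faithful [where s = ?s])
      (simp_all add: pm_def ap_expand_comp m.ap_act n.ap_act ap_expand_tensor ap_interchange calc)
qed

text \<open>With the comultiplication and counit given as daggers, the comonoid laws and one of the
  Frobenius laws are daggers of the assumptions.\<close>

lemma dfaI:
  assumes [simp]: "A \<in> Obj V" "m \<in> Arr V" "Dom V m = A \<odot> A" "Cod V m = A" "u \<in> Arr V" "Dom V u = \<I>" "Cod V u = A"
    and a: "m \<cdot> (m \<otimes> \<one> A) = m \<cdot> (\<one> A \<otimes> m) \<cdot> \<alpha> A A A"
    and l: "m \<cdot> (u \<otimes> \<one> A) = \<Lambda> A" and r: "m \<cdot> (\<one> A \<otimes> u) = \<rho> A"
    and f: "(\<one> A \<otimes> m) \<cdot> \<alpha> A A A \<cdot> (m\<dagger> \<otimes> \<one> A) = m\<dagger> \<cdot> m"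
  shows "dagger_frobenius_algebra V \<lparr>carrier = A, mult = m, unt = u\<rparr>"
proof -
  have "(m\<dagger> \<otimes> \<one> A) \<cdot> m\<dagger> = (\<alpha> A A A)\<dagger> \<cdot> (\<one> A \<otimes> m\<dagger>) \<cdot> m\<dagger>"
    using arg_cong [OF a, of "\<lambda>x. x\<dagger>"] by (simp add: dagger_comp' cassoc)
  then have "\<alpha> A A A \<cdot> (m\<dagger> \<otimes> \<one> A) \<cdot> m\<dagger> = (\<one> A \<otimes> m\<dagger>) \<cdot> m\<dagger>"
    by simp
  moreover have "(u\<dagger> \<otimes> \<one> A) \<cdot> m\<dagger> = (\<Lambda> A)\<dagger>" "(\<one> A \<otimes> u\<dagger>) \<cdot> m\<dagger> = (\<rho> A)\<dagger>"
    using arg_cong [OF l, of "\<lambda>x. x\<dagger>"] arg_cong [OF r, of "\<lambda>x. x\<dagger>"] by (simp_all add: dagger_comp')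
  moreover have "(m \<otimes> \<one> A) \<cdot> (\<alpha> A A A)\<dagger> \<cdot> (\<one> A \<otimes> m\<dagger>) = m\<dagger> \<cdot> m"
    using arg_cong [OF f, of "\<lambda>x. x\<dagger>"] by (simp add: dagger_comp' cassoc)
  ultimately show ?thesis
    using a l r f by (simp add: dagger_frobenius_algebra_def frobenius_algebra_def hom_def)
qed

lemma positive_definite_tensor:
  assumes "positive_definite V z" "positive_definite V w"
  shows "positive_definite V (z \<otimes> w)"
proof -
  obtain h k where [simp]: "h \<in> Arr V" "k \<in> Arr V" and e: "z = h\<dagger> \<cdot> h" "w = k\<dagger> \<cdot> k"
    using assms by (auto simp: positive_definite_def positive_def)
  have "z \<otimes> w = (h \<otimes> k)\<dagger> \<cdot> (h \<otimes> k)"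
    by (simp add: e tensor_comp')
  then have "positive V (z \<otimes> w)"
    by (auto simp: positive_def intro!: bexI [of _ "h \<otimes> k"])
  moreover obtain z' w' where "z \<in> Arr V" "w \<in> Arr V" "z' \<in> Arr V" "w' \<in> Arr V" "Dom V z' = Cod V z" "Cod V z' = Dom V z"
      "Dom V w' = Cod V w" "Cod V w' = Dom V w" "z' \<cdot> z = \<one> (Dom V z)" "z \<cdot> z' = \<one> (Cod V z)"
      "w' \<cdot> w = \<one> (Dom V w)" "w \<cdot> w' = \<one> (Cod V w)"
    using assms by (auto simp: positive_definite_def is_iso_def hom_def)
  then have "is_iso V (z \<otimes> w)"
    using dom_obj cod_obj by (auto simp: is_iso_def hom_def tensor_comp' intro!: exI [of _ "z' \<otimes> w'"])
  ultimately show ?thesis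
    by (simp add: positive_definite_def)
qed

lemma tensor_algebra_sel [simp]:
  "carrier (tensor_algebra V M N) = carrier M \<odot> carrier N"
  "mult (tensor_algebra V M N) = (mult M \<otimes> mult N) \<cdot> interchange V (carrier M) (carrier N) (carrier M) (carrier N)"
  "unt (tensor_algebra V M N) = (unt M \<otimes> unt N) \<cdot> (\<Lambda> \<I>)\<dagger>"
  by (simp_all add: tensor_algebra_def Let_def)

lemma unit_algebra_sel [simp]:
  "carrier (unit_algebra V) = \<I>" "mult (unit_algebra V) = \<Lambda> \<I>" "unt (unit_algebra V) = \<one> \<I>"
  by (simp_all add: unit_algebra_def)

text \<open>Naturality of the interchange makes the operations act factorwise; the remaining
  permutations match by \<open>inter_assoc'\<close>, the unit laws of the interchange and, for the
  Frobenius law, \<open>inter_assoc\<close>.\<close>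

lemma tensor_algebra_dfa:
  assumes "dagger_frobenius_algebra V M" "dagger_frobenius_algebra V N"
  shows "dagger_frobenius_algebra V (tensor_algebra V M N)"
proof -
  interpret m: frob V M
    using assms(1) by (rule frobI)
  interpret n: frob V N
    using assms(2) by (rule frobI)
  let ?A = "carrier M" and ?B = "carrier N" and ?m = "mult M" and ?n = "mult N" and ?u = "unt M" and ?v = "unt N"
  let ?i = "interchange V" let ?t = "(?m \<otimes> ?n) \<cdot> ?i ?A ?B ?A ?B" and ?w = "(?u \<otimes> ?v) \<cdot> (\<Lambda> \<I>)\<dagger>"
  have nl: "?i ?A ?B ?A ?B \<cdot> ((f \<otimes> g) \<otimes> \<one> (?A \<odot> ?B)) = ((f \<otimes> \<one> ?A) \<otimes> (g \<otimes> \<one> ?B)) \<cdot> ?i (Dom V f) (Dom V g) ?A ?B"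
    if "f \<in> Arr V" "g \<in> Arr V" "Cod V f = ?A" "Cod V g = ?B" for f g
    using inter_nat' [of f g "\<one> ?A" "\<one> ?B"] that by simp
  have nr: "?i ?A ?B ?A ?B \<cdot> (\<one> (?A \<odot> ?B) \<otimes> (f \<otimes> g)) = ((\<one> ?A \<otimes> f) \<otimes> (\<one> ?B \<otimes> g)) \<cdot> ?i ?A ?B (Dom V f) (Dom V g)"
    if "f \<in> Arr V" "g \<in> Arr V" "Cod V f = ?A" "Cod V g = ?B" for f g
    using inter_nat' [of "\<one> ?A" "\<one> ?B" f g] that by simp
  have a: "?t \<cdot> (?t \<otimes> \<one> (?A \<odot> ?B)) = ?t \<cdot> (\<one> (?A \<odot> ?B) \<otimes> ?t) \<cdot> \<alpha> (?A \<odot> ?B) (?A \<odot> ?B) (?A \<odot> ?B)"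
  proof -
    have "?t \<cdot> (?t \<otimes> \<one> (?A \<odot> ?B)) = (?m \<otimes> ?n) \<cdot> (?i ?A ?B ?A ?B \<cdot> ((?m \<otimes> ?n) \<otimes> \<one> (?A \<odot> ?B))) \<cdot> (?i ?A ?B ?A ?B \<otimes> \<one> (?A \<odot> ?B))"
      by (simp add: tensor_left_comp cassoc)
    also have "\<dots> = ((?m \<cdot> (?m \<otimes> \<one> ?A)) \<otimes> (?n \<cdot> (?n \<otimes> \<one> ?B))) \<cdot> ?i (?A \<odot> ?A) (?B \<odot> ?B) ?A ?B \<cdot> (?i ?A ?B ?A ?B \<otimes> \<one> (?A \<odot> ?B))"
      by (simp add: nl cassoc tensor_comp_reduce)
    also have "\<dots> = ((?m \<cdot> (\<one> ?A \<otimes> ?m)) \<otimes> (?n \<cdot> (\<one> ?B \<otimes> ?n))) \<cdot> ((\<alpha> ?A ?A ?A \<otimes> \<alpha> ?B ?B ?B) \<cdot> ?i (?A \<odot> ?A) (?B \<odot> ?B) ?A ?B \<cdot> (?i ?A ?B ?A ?B \<otimes> \<one> (?A \<odot> ?B)))"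
      by (simp add: m.alg_laws(1) n.alg_laws(1) cassoc tensor_comp_reduce)
    also have "\<dots> = (?m \<otimes> ?n) \<cdot> (((\<one> ?A \<otimes> ?m) \<otimes> (\<one> ?B \<otimes> ?n)) \<cdot> ?i ?A ?B (?A \<odot> ?A) (?B \<odot> ?B)) \<cdot> (\<one> (?A \<odot> ?B) \<otimes> ?i ?A ?B ?A ?B) \<cdot> \<alpha> (?A \<odot> ?B) (?A \<odot> ?B) (?A \<odot> ?B)"
      by (simp add: inter_assoc' cassoc tensor_comp_reduce)
    also have "((\<one> ?A \<otimes> ?m) \<otimes> (\<one> ?B \<otimes> ?n)) \<cdot> ?i ?A ?B (?A \<odot> ?A) (?B \<odot> ?B) = ?i ?A ?B ?A ?B \<cdot> (\<one> (?A \<odot> ?B) \<otimes> (?m \<otimes> ?n))"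
      by (simp add: nr)
    finally show ?thesis
      by (simp add: tensor_left_comp cassoc)
  qed
  have l: "?t \<cdot> (?w \<otimes> \<one> (?A \<odot> ?B)) = \<Lambda> (?A \<odot> ?B)"
  proof -
    have "?t \<cdot> (?w \<otimes> \<one> (?A \<odot> ?B)) = (?m \<otimes> ?n) \<cdot> (?i ?A ?B ?A ?B \<cdot> ((?u \<otimes> ?v) \<otimes> \<one> (?A \<odot> ?B))) \<cdot> ((\<Lambda> \<I>)\<dagger> \<otimes> \<one> (?A \<odot> ?B))"
      by (simp add: tensor_left_comp cassoc)
    also have "\<dots> = ((?m \<cdot> (?u \<otimes> \<one> ?A)) \<otimes> (?n \<cdot> (?v \<otimes> \<one> ?B))) \<cdot> ?i \<I> \<I> ?A ?B \<cdot> ((\<Lambda> \<I>)\<dagger> \<otimes> \<one> (?A \<odot> ?B))"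
      by (simp add: nl cassoc tensor_comp_reduce)
    finally show ?thesis
      by (simp add: m.alg_laws(2) n.alg_laws(2) inter_lunit)
  qed
  have r: "?t \<cdot> (\<one> (?A \<odot> ?B) \<otimes> ?w) = \<rho> (?A \<odot> ?B)"
  proof -
    have "?t \<cdot> (\<one> (?A \<odot> ?B) \<otimes> ?w) = (?m \<otimes> ?n) \<cdot> (?i ?A ?B ?A ?B \<cdot> (\<one> (?A \<odot> ?B) \<otimes> (?u \<otimes> ?v))) \<cdot> (\<one> (?A \<odot> ?B) \<otimes> (\<Lambda> \<I>)\<dagger>)"
      by (simp add: tensor_left_comp cassoc)
    also have "\<dots> = ((?m \<cdot> (\<one> ?A \<otimes> ?u)) \<otimes> (?n \<cdot> (\<one> ?B \<otimes> ?v))) \<cdot> ?i ?A ?B \<I> \<I> \<cdot> (\<one> (?A \<odot> ?B) \<otimes> (\<Lambda> \<I>)\<dagger>)"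
      by (simp add: nr cassoc tensor_comp_reduce)
    finally show ?thesis
      by (simp add: m.alg_laws(3) n.alg_laws(3) inter_runit)
  qed
  have f: "(\<one> (?A \<odot> ?B) \<otimes> ?t) \<cdot> \<alpha> (?A \<odot> ?B) (?A \<odot> ?B) (?A \<odot> ?B) \<cdot> (?t\<dagger> \<otimes> \<one> (?A \<odot> ?B)) = ?t\<dagger> \<cdot> ?t"
  proof -
    have e: "(\<one> (?A \<odot> ?B) \<otimes> ?i ?A ?B ?A ?B) \<cdot> \<alpha> (?A \<odot> ?B) (?A \<odot> ?B) (?A \<odot> ?B) \<cdot> (?i ?A ?A ?B ?B \<otimes> \<one> (?A \<odot> ?B))
        = ?i ?A (?A \<odot> ?A) ?B (?B \<odot> ?B) \<cdot> (\<alpha> ?A ?A ?A \<otimes> \<alpha> ?B ?B ?B) \<cdot> ?i (?A \<odot> ?A) (?B \<odot> ?B) ?A ?B" (is "?L = ?R")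
    proof -
      have "?L = (\<one> (?A \<odot> ?B) \<otimes> ?i ?A ?B ?A ?B) \<cdot> (\<alpha> (?A \<odot> ?B) (?A \<odot> ?B) (?A \<odot> ?B) \<cdot> (?i ?A ?A ?B ?B \<otimes> \<one> (?A \<odot> ?B)) \<cdot>
          ?i (?A \<odot> ?A) ?A (?B \<odot> ?B) ?B) \<cdot> ?i (?A \<odot> ?A) (?B \<odot> ?B) ?A ?B"
        by (simp add: cassoc)
      also have "\<dots> = ?R"
        unfolding inter_assoc [OF m.alg_typed(1) m.alg_typed(1) m.alg_typed(1) n.alg_typed(1) n.alg_typed(1) n.alg_typed(1)]
        by (simp add: cassoc tensor_comp_reduce)
      finally show ?thesis .
    qed
    have "(\<one> (?A \<odot> ?B) \<otimes> ?t) \<cdot> \<alpha> (?A \<odot> ?B) (?A \<odot> ?B) (?A \<odot> ?B) \<cdot> (?t\<dagger> \<otimes> \<one> (?A \<odot> ?B))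
        = (\<one> (?A \<odot> ?B) \<otimes> (?m \<otimes> ?n)) \<cdot> ?L \<cdot> ((?m\<dagger> \<otimes> ?n\<dagger>) \<otimes> \<one> (?A \<odot> ?B))"
      by (simp add: tensor_left_comp dagger_comp' cassoc)
    also have "\<dots> = ((\<one> (?A \<odot> ?B) \<otimes> (?m \<otimes> ?n)) \<cdot> ?i ?A (?A \<odot> ?A) ?B (?B \<odot> ?B)) \<cdot> (\<alpha> ?A ?A ?A \<otimes> \<alpha> ?B ?B ?B) \<cdot>
        (?i (?A \<odot> ?A) (?B \<odot> ?B) ?A ?B \<cdot> ((?m\<dagger> \<otimes> ?n\<dagger>) \<otimes> \<one> (?A \<odot> ?B)))"
      unfolding e by (simp add: cassoc)
    also have "(\<one> (?A \<odot> ?B) \<otimes> (?m \<otimes> ?n)) \<cdot> ?i ?A (?A \<odot> ?A) ?B (?B \<odot> ?B) = ?i ?A ?A ?B ?B \<cdot> ((\<one> ?A \<otimes> ?m) \<otimes> (\<one> ?B \<otimes> ?n))"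
      using inter_nat' [of "\<one> ?A" ?m "\<one> ?B" ?n] by simp
    also have "?i (?A \<odot> ?A) (?B \<odot> ?B) ?A ?B \<cdot> ((?m\<dagger> \<otimes> ?n\<dagger>) \<otimes> \<one> (?A \<odot> ?B)) = ((?m\<dagger> \<otimes> \<one> ?A) \<otimes> (?n\<dagger> \<otimes> \<one> ?B)) \<cdot> ?i ?A ?B ?A ?B"
      using inter_nat' [of "?m\<dagger>" "?n\<dagger>" "\<one> ?A" "\<one> ?B"] by simp
    also have "(?i ?A ?A ?B ?B \<cdot> ((\<one> ?A \<otimes> ?m) \<otimes> (\<one> ?B \<otimes> ?n))) \<cdot> (\<alpha> ?A ?A ?A \<otimes> \<alpha> ?B ?B ?B) \<cdot> ((?m\<dagger> \<otimes> \<one> ?A) \<otimes> (?n\<dagger> \<otimes> \<one> ?B)) \<cdot> ?i ?A ?B ?A ?B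
        = ?i ?A ?A ?B ?B \<cdot> (((\<one> ?A \<otimes> ?m) \<cdot> \<alpha> ?A ?A ?A \<cdot> (?m\<dagger> \<otimes> \<one> ?A)) \<otimes> ((\<one> ?B \<otimes> ?n) \<cdot> \<alpha> ?B ?B ?B \<cdot> (?n\<dagger> \<otimes> \<one> ?B))) \<cdot> ?i ?A ?B ?A ?B"
      by (simp add: cassoc tensor_comp_reduce)
    also have "\<dots> = ?t\<dagger> \<cdot> ?t"
      by (simp add: m.alg_laws(7) n.alg_laws(7) dagger_comp' cassoc tensor_comp_reduce)
    finally show ?thesis .
  qed
  show ?thesis
    unfolding tensor_algebra_def Let_def by (rule dfaI) (use a l r f in simp_all)
qed

text \<open>Up to the unitary shuffle the action map is monoidal. This reduces isometry, complete
  positivity and coherence for tensor algebras to the factors.\<close>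

lemma sh_act_tensor:
  assumes "dagger_frobenius_algebra V M" "dagger_frobenius_algebra V N"
  shows "sh (carrier M) (carrier N) \<cdot> act V (tensor_algebra V M N) = act V M \<otimes> act V N"
proof -
  interpret m: frob V M
    using assms(1) by (rule frobI)
  interpret n: frob V N
    using assms(2) by (rule frobI)
  let ?A = "carrier M" and ?B = "carrier N" and ?t = "mult (tensor_algebra V M N)"
  let ?i = "interchange V" let ?T = "?A \<odot> ?B" let ?D = "?A\<star> \<odot> ?B\<star>"
  have "sh ?A ?B \<cdot> act V (tensor_algebra V M N)
      = ?i (?A\<star>) (?B\<star>) ?A ?B \<cdot> ((dmon ?A ?B \<otimes> ?t) \<cdot> \<alpha> (?T\<star>) ?T ?T) \<cdot> (\<eta> ?T \<otimes> \<one> ?T) \<cdot> (\<Lambda> ?T)\<dagger>"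
    by (simp add: shuffle_dmon act_def Let_def cassoc tensor_comp_reduce)
  also have "(dmon ?A ?B \<otimes> ?t) \<cdot> \<alpha> (?T\<star>) ?T ?T = (\<one> ?D \<otimes> ?t) \<cdot> (\<alpha> ?D ?T ?T \<cdot> ((dmon ?A ?B \<otimes> \<one> ?T) \<otimes> \<one> ?T))"
    using assoc_natural [of "dmon ?A ?B" "?T\<star>" ?D "\<one> ?T" ?T ?T "\<one> ?T" ?T ?T] by (simp add: hom_def tensor_comp_reduce)
  also have "?i (?A\<star>) (?B\<star>) ?A ?B \<cdot> (\<dots>) \<cdot> (\<eta> ?T \<otimes> \<one> ?T) \<cdot> (\<Lambda> ?T)\<dagger>
      = ?i (?A\<star>) (?B\<star>) ?A ?B \<cdot> (\<one> ?D \<otimes> ?t) \<cdot> \<alpha> ?D ?T ?T \<cdot> (((dmon ?A ?B \<otimes> \<one> ?T) \<cdot> \<eta> ?T) \<otimes> \<one> ?T) \<cdot> (\<Lambda> ?T)\<dagger>"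
    by (simp add: cassoc tensor_left_comp)
  also have "\<dots> = ?i (?A\<star>) (?B\<star>) ?A ?B \<cdot> (\<one> ?D \<otimes> ?t) \<cdot> \<alpha> ?D ?T ?T \<cdot>
      ((?i (?A\<star>) ?A (?B\<star>) ?B \<cdot> (\<eta> ?A \<otimes> \<eta> ?B) \<cdot> (\<Lambda> \<I>)\<dagger>) \<otimes> \<one> ?T) \<cdot> (\<Lambda> ?T)\<dagger>"
    by (simp add: dmon_name)
  also have "\<dots> = act V M \<otimes> act V N"
  proof (rule ap_faithful [where s = "mg 0 ?A ?B (init [?A, ?B])"])
    let ?x = "m.cp 0 (init [?A, ?B])"
    let ?y = "sw (Suc (Suc (Suc 0))) ?B ?A (sw (Suc 0) ?A (?B\<star>) (n.cp (Suc (Suc 0)) ?x))"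
    \<comment> \<open>The cup of the second factor has to be slid out of the multiplication of the
      first one.\<close>
    have "sw (Suc 0) (?B\<star>) ?A (m.mu (Suc (Suc 0)) ?y) = m.mu (Suc 0) (sw (Suc (Suc 0)) (?B\<star>) ?A (sw (Suc 0) (?B\<star>) ?A ?y))"
      using m.mu_sw(2) [of "?B\<star>" "Suc 0" ?y] by (simp add: calc)
    also have "sw (Suc 0) (?B\<star>) ?A ?y = sw (Suc (Suc (Suc 0))) ?B ?A (n.cp (Suc (Suc 0)) ?x)"
      by (simp add: ap_interchange' calc)
    also have "sw (Suc (Suc 0)) (?B\<star>) ?A (\<dots>) = n.cp (Suc (Suc (Suc 0))) ?x"
      by (rule cup_sw) (simp_all add: calc)
    also have "m.mu (Suc 0) (\<dots>) = n.cp (Suc (Suc 0)) (m.mu (Suc 0) ?x)"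
      by (simp add: ap_interchange')
    finally show "ap 0 [?T] (?i (?A\<star>) (?B\<star>) ?A ?B \<cdot> (\<one> ?D \<otimes> ?t) \<cdot> \<alpha> ?D ?T ?T \<cdot>
      ((?i (?A\<star>) ?A (?B\<star>) ?B \<cdot> (\<eta> ?A \<otimes> \<eta> ?B) \<cdot> (\<Lambda> \<I>)\<dagger>) \<otimes> \<one> ?T) \<cdot> (\<Lambda> ?T)\<dagger>) [dbl ?A \<odot> dbl ?B] (mg 0 ?A ?B (init [?A, ?B]))
     = ap 0 [?T] (act V M \<otimes> act V N) [dbl ?A \<odot> dbl ?B] (mg 0 ?A ?B (init [?A, ?B]))"
      by (simp add: coh' ap_expand_eta m.ap_expand_alg n.ap_expand_alg m.ap_act n.ap_act)
  qed (simp_all add: calc)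
  finally show ?thesis .
qed

lemma normalised_frobI: "\<lbrakk>dagger_frobenius_algebra V M; normaliser V M z\<rbrakk> \<Longrightarrow> normalised_frob V M z"
  by (intro normalised_frob.intro frobI normalised_frob_axioms.intro)

lemma central_tensor:
  assumes "central V M z" "central V N w" and M: "dagger_frobenius_algebra V M" "dagger_frobenius_algebra V N"
  shows "central V (tensor_algebra V M N) (z \<otimes> w)"
proof -
  interpret m: frob V M
    using M(1) by (rule frobI)
  interpret n: frob V N
    using M(2) by (rule frobI)
  note [simp] = m.ap_central(1-3) [OF assms(1)] n.ap_central(1-3) [OF assms(2)]
  let ?A = "carrier M" and ?B = "carrier N" let ?i = "interchange V ?A ?B ?A ?B"
  have "?i \<cdot> ((z \<otimes> w) \<otimes> \<one> (?A \<odot> ?B)) = ((z \<otimes> \<one> ?A) \<otimes> (w \<otimes> \<one> ?B)) \<cdot> ?i"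
      "?i \<cdot> (\<one> (?A \<odot> ?B) \<otimes> (z \<otimes> w)) = ((\<one> ?A \<otimes> z) \<otimes> (\<one> ?B \<otimes> w)) \<cdot> ?i"
    using inter_nat' [of z w "\<one> ?A" "\<one> ?B"] inter_nat' [of "\<one> ?A" "\<one> ?B" z w] by simp_all
  moreover have "mult M \<cdot> (z \<otimes> \<one> ?A) = z \<cdot> mult M" "mult M \<cdot> (\<one> ?A \<otimes> z) = z \<cdot> mult M"
      "mult N \<cdot> (w \<otimes> \<one> ?B) = w \<cdot> mult N" "mult N \<cdot> (\<one> ?B \<otimes> w) = w \<cdot> mult N"
    using assms(1,2) by (simp_all add: central_def Let_def)
  ultimately show ?thesis
    by (simp add: central_def Let_def hom_def cassoc tensor_comp_reduce tensor_comp')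
qed

text \<open>The tensor form is symmetric since both factors are, so \<open>normaliserI\<close>
  applies; in its isometry condition the unitary shuffle drops out and the conditions of the factors
  remain.\<close>

lemma normaliser_tensor:
  assumes M: "dagger_frobenius_algebra V M" "normaliser V M z" and N: "dagger_frobenius_algebra V N" "normaliser V N w"
  shows "normaliser V (tensor_algebra V M N) (z \<otimes> w)"
proof -
  interpret m: normalised_frob V M z
    using M by (rule normalised_frobI)
  interpret n: normalised_frob V N w
    using N by (rule normalised_frobI)
  let ?T = "tensor_algebra V M N" and ?A = "carrier M" and ?B = "carrier N"
  have "(mult M \<otimes> mult N) \<cdot> interchange V ?A ?B ?A ?B \<cdot> \<sigma> (?A \<odot> ?B) (?A \<odot> ?B)
      = ((mult M \<cdot> \<sigma> ?A ?A) \<otimes> (mult N \<cdot> \<sigma> ?B ?B)) \<cdot> interchange V ?A ?B ?A ?B"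
    by (simp add: inter_sym' [symmetric] tensor_comp_reduce)
  then have "(unt ?T)\<dagger> \<cdot> mult ?T \<cdot> \<sigma> (?A \<odot> ?B) (?A \<odot> ?B) = (unt ?T)\<dagger> \<cdot> mult ?T"
    using m.counit_sym n.counit_sym by (simp add: dagger_comp' cassoc tensor_comp_reduce)
  then interpret t: symmetric_frob V ?T
    by unfold_locales (use tensor_algebra_dfa [OF M(1) N(1)] in simp_all)
  let ?s = "sh ?A ?B"
  have s: "act V ?T = ?s\<dagger> \<cdot> (act V M \<otimes> act V N)"
    using arg_cong [OF sh_act_tensor [OF M(1) N(1)], of "\<lambda>x. ?s\<dagger> \<cdot> x"] by simp
  show ?thesis
  proof (rule t.normaliserI)
    show "central V ?T (z \<otimes> w)"
      by (rule central_tensor) (use M N m.z_central n.z_central in auto)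
    show "positive_definite V (z \<otimes> w)"
      by (rule positive_definite_tensor [OF m.z_pd n.z_pd])
    show "(act V ?T)\<dagger> \<cdot> act V ?T \<cdot> (z \<otimes> w) \<cdot> (z \<otimes> w) = \<one> (carrier ?T)"
      using m.act_z n.act_z by (simp add: s dagger_comp' cassoc tensor_comp' tensor_comp_reduce)
  qed
qed

lemma unit_algebra_dfa: "dagger_frobenius_algebra V (unit_algebra V)"
proof -
  have t: "(\<one> \<I> \<otimes> \<Lambda> \<I>) \<cdot> \<alpha> \<I> \<I> \<I> = \<Lambda> \<I> \<otimes> \<one> \<I>"
    using triangle [of \<I> \<I>] by (simp flip: lunit_unit)
  have t': "(\<one> \<I> \<otimes> \<Lambda> \<I>) \<cdot> \<alpha> \<I> \<I> \<I> \<cdot> ((\<Lambda> \<I>)\<dagger> \<otimes> \<one> \<I>) = \<one> (\<I> \<odot> \<I>)"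
    by (simp add: comp_reduce1 [OF t] tensor_comp')
  show ?thesis
    unfolding unit_algebra_def by (rule dfaI) (use t' in \<open>simp_all add: t lunit_unit [symmetric]\<close>)
qed

lemma act_unit_algebra: "act V (unit_algebra V) = \<eta> \<I>"
proof (rule ap_faithful [where s = "nI 0 (init [])"])
  let ?t = "cup 0 (\<eta> \<I>) (\<I>\<star>) \<I> (nI 0 (init []))"
  have "dI (Suc 0) ?t = dI (Suc (Suc 0)) ?t"
    by (rule dI_dI [symmetric]) (simp add: calc)
  also have "\<dots> = cup 0 (\<eta> \<I>) (\<I>\<star>) \<I> (init [])"
    by (simp add: ap_interchange calc)
  finally show "ap 0 [\<I>] (act V (unit_algebra V)) [dbl \<I>] (nI 0 (init [])) = ap 0 [\<I>] (\<eta> \<I>) [dbl \<I>] (nI 0 (init []))"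
    by (simp add: act_def Let_def coh ap_expand_eta)
qed (simp_all add: act_def Let_def calc)

lemma normaliser_unit: "normaliser V (unit_algebra V) (\<one> \<I>)"
proof -
  interpret symmetric_frob V "unit_algebra V"
    by unfold_locales (use unit_algebra_dfa in \<open>simp_all add: lunit_sym lunit_unit\<close>)
  show ?thesis
    by (rule normaliserI) (auto simp: central_ident [OF unit_algebra_dfa, simplified] act_unit_algebra positive_definite_def
      positive_def is_iso_def hom_def intro!: bexI [of _ "\<one> \<I>"])
qed

lemma normalisable_tensor: "\<lbrakk>normalisable V M; normalisable V N\<rbrakk> \<Longrightarrow> normalisable V (tensor_algebra V M N)"
  by (auto simp: normalisable_def intro: tensor_algebra_dfa normaliser_tensor)

lemma normalisable_unit: "normalisable V (unit_algebra V)"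
  using unit_algebra_dfa normaliser_unit by (auto simp: normalisable_def)

text \<open>Exactly what \<open>pm_act_hom\<close> needs for the doubled map to intertwine the
  actions; the coherence isomorphisms and the symmetry are instances.\<close>

definition alg_iso :: "('o, 'a) algebra \<Rightarrow> ('o, 'a) algebra \<Rightarrow> 'a \<Rightarrow> bool" where
  "alg_iso M N f \<longleftrightarrow> unitary V (carrier M) (carrier N) f \<and> mult N \<cdot> (f \<otimes> f) = f \<cdot> mult M"

lemma alg_typed':
  assumes "normalisable V M"
  shows "carrier M \<in> Obj V" "mult M \<in> Arr V" "Dom V (mult M) = carrier M \<odot> carrier M" "Cod V (mult M) = carrier M"
    "act V M \<in> Arr V" "Dom V (act V M) = carrier M" "Cod V (act V M) = dbl (carrier M)"
  using assms frob.alg_typed [OF frobI] frob.a_typed [OF frobI] by (auto simp: normalisable_def)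

lemma alg_iso_assoc:
  assumes "normalisable V L" "normalisable V M" "normalisable V N"
  shows "alg_iso (tensor_algebra V (tensor_algebra V L M) N) (tensor_algebra V L (tensor_algebra V M N))
    (\<alpha> (carrier L) (carrier M) (carrier N))"
proof -
  note [simp] = assms [THEN alg_typed'(1)] assms [THEN alg_typed'(2)] assms [THEN alg_typed'(3)] assms [THEN alg_typed'(4)]
  let ?A = "carrier L" and ?B = "carrier M" and ?D = "carrier N" let ?i = "interchange V"
  have "(\<one> (?A \<odot> ?A) \<otimes> ?i ?B ?D ?B ?D) \<cdot> ?i ?A (?B \<odot> ?D) ?A (?B \<odot> ?D) \<cdot> (\<alpha> ?A ?B ?D \<otimes> \<alpha> ?A ?B ?D)
      = \<alpha> (?A \<odot> ?A) (?B \<odot> ?B) (?D \<odot> ?D) \<cdot> (?i ?A ?B ?A ?B \<otimes> \<one> (?D \<odot> ?D)) \<cdot> ?i (?A \<odot> ?B) ?D (?A \<odot> ?B) ?D"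
    by (simp add: inter_assoc)
  from arg_cong [OF this, of "\<lambda>x. (mult L \<otimes> (mult M \<otimes> mult N)) \<cdot> x"]
  have "(mult L \<otimes> ((mult M \<otimes> mult N) \<cdot> ?i ?B ?D ?B ?D)) \<cdot> ?i ?A (?B \<odot> ?D) ?A (?B \<odot> ?D) \<cdot> (\<alpha> ?A ?B ?D \<otimes> \<alpha> ?A ?B ?D)
      = ((mult L \<otimes> (mult M \<otimes> mult N)) \<cdot> \<alpha> (?A \<odot> ?A) (?B \<odot> ?B) (?D \<odot> ?D)) \<cdot> (?i ?A ?B ?A ?B \<otimes> \<one> (?D \<odot> ?D)) \<cdot> ?i (?A \<odot> ?B) ?D (?A \<odot> ?B) ?D"
    by (simp add: cassoc tensor_comp_reduce)
  then show ?thesis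
    by (simp add: alg_iso_def assoc_unitary assoc_nat cassoc tensor_comp_reduce)
qed

lemma alg_iso_lunit:
  assumes "normalisable V M"
  shows "alg_iso (tensor_algebra V (unit_algebra V) M) M (\<Lambda> (carrier M))"
proof -
  note [simp] = alg_typed' [OF assms]
  let ?A = "carrier M"
  have "mult M \<cdot> (\<Lambda> ?A \<otimes> \<Lambda> ?A) = (mult M \<cdot> \<Lambda> (?A \<odot> ?A)) \<cdot> (\<Lambda> \<I> \<otimes> \<one> (?A \<odot> ?A)) \<cdot> interchange V \<I> ?A \<I> ?A"
    by (simp add: inter_lunit2 [symmetric] cassoc)
  then show ?thesis
    by (simp add: alg_iso_def lunit_unitary lunit_nat cassoc tensor_comp_reduce)
qed

lemma alg_iso_sym:
  assumes "normalisable V M" "normalisable V N"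
  shows "alg_iso (tensor_algebra V M N) (tensor_algebra V N M) (\<sigma> (carrier M) (carrier N))"
proof -
  note [simp] = assms [THEN alg_typed'(1)] assms [THEN alg_typed'(2)] assms [THEN alg_typed'(3)] assms [THEN alg_typed'(4)]
  let ?A = "carrier M" and ?B = "carrier N"
  have "(mult N \<otimes> mult M) \<cdot> interchange V ?B ?A ?B ?A \<cdot> (\<sigma> ?A ?B \<otimes> \<sigma> ?A ?B)
      = ((mult N \<otimes> mult M) \<cdot> \<sigma> (?A \<odot> ?A) (?B \<odot> ?B)) \<cdot> interchange V ?A ?B ?A ?B"
    by (simp add: inter_sym cassoc)
  then show ?thesis
    by (simp add: alg_iso_def sym_unitary sym_nat cassoc)
qed

lemma alg_iso_comp:
  assumes "alg_iso L M f" "alg_iso M N g" "normalisable V L" "normalisable V M" "normalisable V N"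
  shows "alg_iso L N (g \<cdot> f)"
proof -
  note [simp] = assms(3,4,5) [THEN alg_typed'(1)] assms(3,4,5) [THEN alg_typed'(2)]
    assms(3,4,5) [THEN alg_typed'(3)] assms(3,4,5) [THEN alg_typed'(4)]
  have f: "unitary V (carrier L) (carrier M) f" and g: "unitary V (carrier M) (carrier N) g"
    and f': "mult M \<cdot> (f \<otimes> f) = f \<cdot> mult L" and g': "mult N \<cdot> (g \<otimes> g) = g \<cdot> mult M"
    using assms by (auto simp: alg_iso_def)
  note [simp] = unitary_cancel(1-3) [OF f] unitary_cancel(1-3) [OF g]
  have "mult N \<cdot> ((g \<cdot> f) \<otimes> (g \<cdot> f)) = (mult N \<cdot> (g \<otimes> g)) \<cdot> (f \<otimes> f)"
    by (simp add: cassoc tensor_comp')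
  also have "\<dots> = (g \<cdot> f) \<cdot> mult L"
    unfolding g' by (simp add: cassoc f')
  finally show ?thesis
    using unitary_comp [OF f g] by (simp add: alg_iso_def)
qed

lemma alg_iso_runit:
  assumes "normalisable V M"
  shows "alg_iso (tensor_algebra V M (unit_algebra V)) M (\<rho> (carrier M))"
  using alg_iso_comp [OF alg_iso_sym [OF assms normalisable_unit] alg_iso_lunit [OF assms]] assms normalisable_unit
  by (simp add: normalisable_tensor lunit_sym alg_typed')

end

section \<open>The category of normalisable dagger Frobenius algebras\<close>

context dagger_compact_category
begin

text \<open>The defining conditions on arrows of \<open>CPstar\<close>, with the coaction rewritten
  as the dagger of the action.\<close>

definition cpstar_map :: "('o, 'a) algebra \<Rightarrow> ('o, 'a) algebra \<Rightarrow> 'a \<Rightarrow> bool" where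
  "cpstar_map M N f \<longleftrightarrow> f \<in> hom V (carrier M) (carrier N) \<and>
    completely_positive V (carrier M) (carrier N) (act V N \<cdot> f \<cdot> (act V M)\<dagger>)"

lemma cpstar_map_typed: "cpstar_map M N f \<Longrightarrow> f \<in> Arr V \<and> Dom V f = carrier M \<and> Cod V f = carrier N"
  by (simp add: cpstar_map_def hom_def)

lemma coact_act: "normalisable V M \<Longrightarrow> coact V M = (act V M)\<dagger>"
  using frob.coact_eq [OF frobI] by (auto simp: normalisable_def)

lemma normalisable_frob:
  assumes "normalisable V M"
  obtains z where "normalised_frob V M z"
  using assms normalised_frobI by (auto simp: normalisable_def)

text \<open>The middle \<open>a\<dagger> \<cdot> a\<close> does not cancel by itself. Inserting the
  doubled arrow \<open>pm z\<close>, which is completely positive, turns it into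
  \<open>a\<dagger> \<cdot> a \<cdot> z \<cdot> z = \<one>\<close>.\<close>

lemma cpstar_map_comp:
  assumes f: "cpstar_map L M f" and g: "cpstar_map M N g" and o: "normalisable V L" "normalisable V M" "normalisable V N"
  shows "cpstar_map L N (g \<cdot> f)"
proof -
  obtain z where "normalised_frob V M z"
    using normalisable_frob [OF o(2)] .
  then interpret m: normalised_frob V M z .
  note [simp] = alg_typed' [OF o(1)] alg_typed' [OF o(3)]
  have [simp]: "f \<in> Arr V" "Dom V f = carrier L" "Cod V f = carrier M" "g \<in> Arr V" "Dom V g = carrier M" "Cod V g = carrier N"
    using cpstar_map_typed [OF f] cpstar_map_typed [OF g] by auto
  have 1: "(act V M)\<dagger> \<cdot> (pm z \<cdot> act V M) = \<one> (carrier M)"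
    using m.act_z by (simp add: pm_act_central m.dfa m.z_central)
  have "(act V N \<cdot> g \<cdot> (act V M)\<dagger>) \<cdot> pm z \<cdot> (act V M \<cdot> f \<cdot> (act V L)\<dagger>)
      = act V N \<cdot> g \<cdot> ((act V M)\<dagger> \<cdot> (pm z \<cdot> act V M)) \<cdot> f \<cdot> (act V L)\<dagger>"
    by (simp add: cassoc)
  also have "\<dots> = act V N \<cdot> (g \<cdot> f) \<cdot> (act V L)\<dagger>"
    unfolding 1 by (simp add: cassoc)
  finally have e: "act V N \<cdot> (g \<cdot> f) \<cdot> (act V L)\<dagger> = (act V N \<cdot> g \<cdot> (act V M)\<dagger>) \<cdot> pm z \<cdot> (act V M \<cdot> f \<cdot> (act V L)\<dagger>)" ..
  have "completely_positive V (carrier L) (carrier N) (act V N \<cdot> (g \<cdot> f) \<cdot> (act V L)\<dagger>)"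
    unfolding e using f g by (intro cp_comp [OF cp_comp [OF _ cp_pure]]) (auto simp: cpstar_map_def)
  then show ?thesis
    by (simp add: cpstar_map_def hom_def)
qed

lemma cpstar_map_dagger:
  assumes f: "cpstar_map M N f" and o: "normalisable V M" "normalisable V N"
  shows "cpstar_map N M (f\<dagger>)"
proof -
  note [simp] = alg_typed' [OF o(1)] alg_typed' [OF o(2)] 
  have [simp]: "f \<in> Arr V" "Dom V f = carrier M" "Cod V f = carrier N"
    using cpstar_map_typed [OF f] by auto
  have "completely_positive V (carrier N) (carrier M) ((act V N \<cdot> f \<cdot> (act V M)\<dagger>)\<dagger>)"
    using f by (intro cp_dagger) (simp_all add: cpstar_map_def)
  then show ?thesis
    by (simp add: cpstar_map_def hom_def dagger_comp' cassoc)
qed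

text \<open>The doubled isomorphism comes out in front by \<open>pm_act_hom\<close>, and
  \<open>a \<cdot> a\<dagger>\<close> is completely positive as the case of a trivial central
  element.\<close>

lemma cpstar_map_alg_iso:
  assumes f: "alg_iso M N f" and o: "normalisable V M" "normalisable V N"
  shows "cpstar_map M N f"
proof -
  note [simp] = alg_typed' [OF o(1)] alg_typed' [OF o(2)] 
  obtain z where "normalised_frob V M z"
    using normalisable_frob [OF o(1)] .
  then interpret m: normalised_frob V M z .
  have [simp]: "f \<in> Arr V" "Dom V f = carrier M" "Cod V f = carrier N"
    using f by (auto simp: alg_iso_def unitary_cancel(1-3))
  have "positive V (\<one> (carrier M))"
    by (auto simp: positive_def intro!: bexI [of _ "\<one> (carrier M)"])
  then have "completely_positive V (carrier M) (carrier M) (act V M \<cdot> (act V M)\<dagger>)"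
    using m.act_coact_cp [of "\<one> (carrier M)"] by (simp add: central_ident m.dfa)
  moreover have "pm f \<cdot> act V M = act V N \<cdot> f"
    using f o by (intro pm_act_hom) (auto simp: alg_iso_def normalisable_def)
  then have "act V N \<cdot> f \<cdot> (act V M)\<dagger> = pm f \<cdot> act V M \<cdot> (act V M)\<dagger>"
    by (simp flip: cassoc)
  ultimately show ?thesis
    by (simp add: cpstar_map_def hom_def cp_comp [OF _ cp_pure])
qed

lemma alg_iso_ident: "normalisable V M \<Longrightarrow> alg_iso M M (\<one> (carrier M))"
  by (simp add: alg_iso_def unitary_ident alg_typed')

lemma act_tensor:
  assumes "normalisable V M" "normalisable V N"
  shows "act V (tensor_algebra V M N) = (sh (carrier M) (carrier N))\<dagger> \<cdot> (act V M \<otimes> act V N)"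
  using arg_cong [OF sh_act_tensor [of M N], of "\<lambda>x. (sh (carrier M) (carrier N))\<dagger> \<cdot> x"] assms
    alg_typed' [OF assms(1)] alg_typed' [OF assms(2)] alg_typed'(5-) [OF normalisable_tensor [OF assms]]
  by (simp add: normalisable_def)

lemma cpstar_map_tensor:
  assumes f: "cpstar_map M N f" and g: "cpstar_map M' N' g"
    and o: "normalisable V M" "normalisable V N" "normalisable V M'" "normalisable V N'"
  shows "cpstar_map (tensor_algebra V M M') (tensor_algebra V N N') (f \<otimes> g)"
proof -
  note [simp] = alg_typed' [OF o(1)] alg_typed' [OF o(2)] alg_typed' [OF o(3)] alg_typed' [OF o(4)]
  have [simp]: "f \<in> Arr V" "Dom V f = carrier M" "Cod V f = carrier N" "g \<in> Arr V" "Dom V g = carrier M'" "Cod V g = carrier N'"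
    using cpstar_map_typed [OF f] cpstar_map_typed [OF g] by auto
  have "act V (tensor_algebra V N N') \<cdot> (f \<otimes> g) \<cdot> (act V (tensor_algebra V M M'))\<dagger>
      = tens (carrier M) (carrier N) (act V N \<cdot> f \<cdot> (act V M)\<dagger>) (carrier M') (carrier N') (act V N' \<cdot> g \<cdot> (act V M')\<dagger>)"
    by (simp add: act_tensor o tens_def dagger_comp' cassoc tensor_comp_reduce)
  then show ?thesis
    using cp_tensor f g by (simp add: cpstar_map_def hom_def)
qed

abbreviation "CS \<equiv> CPstar V"

lemma CS_sel [simp]:
  "Obj CS = {M. normalisable V M}" "Dom CS = source" "Cod CS = target"
  "Ident CS M = Arrow M (\<one> (carrier M)) M"
  "Comp CS k h = Arrow (source h) (und k \<cdot> und h) (target k)"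
  "Dagger CS h = Arrow (target h) ((und h)\<dagger>) (source h)"
  "Unit CS = unit_algebra V" "TensorO CS M N = tensor_algebra V M N"
  "TensorA CS h k = Arrow (tensor_algebra V (source h) (source k)) (und h \<otimes> und k)
     (tensor_algebra V (target h) (target k))"
  "Assoc CS L M N = Arrow (tensor_algebra V (tensor_algebra V L M) N) (\<alpha> (carrier L) (carrier M) (carrier N))
     (tensor_algebra V L (tensor_algebra V M N))"
  "LUnit CS M = Arrow (tensor_algebra V (unit_algebra V) M) (\<Lambda> (carrier M)) M"
  "RUnit CS M = Arrow (tensor_algebra V M (unit_algebra V)) (\<rho> (carrier M)) M"
  "Sym CS M N = Arrow (tensor_algebra V M N) (\<sigma> (carrier M) (carrier N)) (tensor_algebra V N M)"
  by (simp_all add: CPstar_def)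

lemma Arr_CS [simp]: "Arrow M f N \<in> Arr CS \<longleftrightarrow> normalisable V M \<and> normalisable V N \<and> cpstar_map M N f"
  by (auto simp: CPstar_def cpstar_map_def coact_act)

lemma Arr_CS_E:
  assumes "h \<in> Arr CS"
  obtains M f N where "h = Arrow M f N" "normalisable V M" "normalisable V N" "cpstar_map M N f"
    "f \<in> Arr V" "Dom V f = carrier M" "Cod V f = carrier N"
  using assms cpstar_map_typed by (cases h) auto

lemma hom_CS: "h \<in> hom CS M N \<longleftrightarrow> (\<exists>f. h = Arrow M f N \<and> normalisable V M \<and> normalisable V N \<and> cpstar_map M N f)"
  by (cases h) (auto simp: hom_def)

lemma hom_CS_E:
  assumes "h \<in> hom CS M N"
  obtains f where "h = Arrow M f N" "normalisable V M" "normalisable V N" "cpstar_map M N f"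
    "f \<in> Arr V" "Dom V f = carrier M" "Cod V f = carrier N" "carrier M \<in> Obj V" "carrier N \<in> Obj V"
  using assms cpstar_map_typed by (auto simp: hom_CS alg_typed')

lemma unitary_CS:
  assumes "alg_iso M N f" "normalisable V M" "normalisable V N"
  shows "unitary CS M N (Arrow M f N)"
  using cpstar_map_alg_iso [OF assms] cpstar_map_dagger assms unfolding alg_iso_def
  by (auto simp: unitary_def [of CS] hom_CS) (auto simp: unitary_def)

lemma CS_dagger_category: "dagger_category CS"
proof unfold_locales
  fix h assume "h \<in> Arr CS"
  then show "Dom CS h \<in> Obj CS" "Cod CS h \<in> Obj CS"
    by (auto elim: Arr_CS_E)
next
  fix A assume "A \<in> Obj CS"
  then show "Ident CS A \<in> hom CS A A"
    by (simp add: hom_CS cpstar_map_alg_iso alg_iso_ident)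
next
  fix f g A B D assume "f \<in> hom CS A B" "g \<in> hom CS B D"
  then show "Comp CS g f \<in> hom CS A D"
    by (auto simp: hom_CS intro: cpstar_map_comp)
next
  fix f A B assume "f \<in> hom CS A B"
  then show "Comp CS f (Ident CS A) = f" "Comp CS (Ident CS B) f = f"
    by (auto elim!: hom_CS_E)
next
  fix f g h A B D E assume "f \<in> hom CS A B" "g \<in> hom CS B D" "h \<in> hom CS D E"
  then show "Comp CS (Comp CS h g) f = Comp CS h (Comp CS g f)"
    by (auto elim!: hom_CS_E simp: cassoc)
next
  fix f A B assume "f \<in> hom CS A B"
  then show "Dagger CS f \<in> hom CS B A"
    by (auto simp: hom_CS intro: cpstar_map_dagger)
next
  fix h assume "h \<in> Arr CS"
  then show "Dagger CS (Dagger CS h) = h"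
    by (auto elim!: Arr_CS_E)
next
  fix A assume "A \<in> Obj CS"
  then show "Dagger CS (Ident CS A) = Ident CS A"
    by (simp add: alg_typed')
next
  fix f g A B D assume "f \<in> hom CS A B" "g \<in> hom CS B D"
  then show "Dagger CS (Comp CS g f) = Comp CS (Dagger CS f) (Dagger CS g)"
    by (auto elim!: hom_CS_E simp: dagger_comp')
qed

text \<open>The underlying arrows are those of \<open>V\<close>, so every axiom is inherited; the
  content is that they are arrows of \<open>CPstar\<close>, which for coherence arrows follows from
  \<open>alg_iso\<close>.\<close>

lemma CS_dsm: "dagger_symmetric_monoidal_category CS"
proof (intro dagger_symmetric_monoidal_category.intro CS_dagger_category, unfold_locales)
  show "Unit CS \<in> Obj CS"
    by (simp add: normalisable_unit)
next
  fix A B assume "A \<in> Obj CS" "B \<in> Obj CS"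
  then show "TensorO CS A B \<in> Obj CS"
    and "TensorA CS (Ident CS A) (Ident CS B) = Ident CS (TensorO CS A B)"
    and "unitary CS (TensorO CS A B) (TensorO CS B A) (Sym CS A B)"
    and "Comp CS (TensorA CS (Ident CS A) (LUnit CS B)) (Assoc CS A (Unit CS) B) = TensorA CS (RUnit CS A) (Ident CS B)"
    and "Comp CS (Sym CS B A) (Sym CS A B) = Ident CS (TensorO CS A B)"
    by (simp_all add: normalisable_tensor alg_typed' unitary_CS alg_iso_sym triangle sym_sym)
next
  fix f g A B A' B' assume "f \<in> hom CS A B" "g \<in> hom CS A' B'"
  then show "TensorA CS f g \<in> hom CS (TensorO CS A A') (TensorO CS B B')"
    and "Comp CS (Sym CS B B') (TensorA CS f g) = Comp CS (TensorA CS g f) (Sym CS A A')"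
    by (auto elim!: hom_CS_E simp: sym_nat) (auto simp: hom_CS intro: cpstar_map_tensor normalisable_tensor)
next
  fix f g f' g' A B D A' B' D'
  assume "f \<in> hom CS A B" "g \<in> hom CS B D" "f' \<in> hom CS A' B'" "g' \<in> hom CS B' D'"
  then show "TensorA CS (Comp CS g f) (Comp CS g' f') = Comp CS (TensorA CS g g') (TensorA CS f f')"
    by (auto elim!: hom_CS_E simp: tensor_comp')
next
  fix f g assume "f \<in> Arr CS" "g \<in> Arr CS"
  then show "Dagger CS (TensorA CS f g) = TensorA CS (Dagger CS f) (Dagger CS g)"
    by (auto elim!: Arr_CS_E)
next
  fix A B D assume "A \<in> Obj CS" "B \<in> Obj CS" "D \<in> Obj CS"
  then show "unitary CS (TensorO CS (TensorO CS A B) D) (TensorO CS A (TensorO CS B D)) (Assoc CS A B D)"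
    and "Comp CS (Assoc CS B D A) (Comp CS (Sym CS A (TensorO CS B D)) (Assoc CS A B D))
      = Comp CS (TensorA CS (Ident CS B) (Sym CS A D)) (Comp CS (Assoc CS B A D) (TensorA CS (Sym CS A B) (Ident CS D)))"
    by (simp_all add: unitary_CS alg_iso_assoc normalisable_tensor alg_typed' hexagon)
next
  fix A assume "A \<in> Obj CS"
  then show "unitary CS (TensorO CS (Unit CS) A) A (LUnit CS A)"
    and "unitary CS (TensorO CS A (Unit CS)) A (RUnit CS A)"
    by (simp_all add: unitary_CS alg_iso_lunit alg_iso_runit normalisable_tensor normalisable_unit)
next
  fix f g h A A' B B' D D'
  assume "f \<in> hom CS A A'" "g \<in> hom CS B B'" "h \<in> hom CS D D'"
  then show "Comp CS (Assoc CS A' B' D') (TensorA CS (TensorA CS f g) h) = Comp CS (TensorA CS f (TensorA CS g h)) (Assoc CS A B D)"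
    by (auto elim!: hom_CS_E simp: assoc_nat)
next
  fix f A B assume "f \<in> hom CS A B"
  then show "Comp CS (LUnit CS B) (TensorA CS (Ident CS (Unit CS)) f) = Comp CS f (LUnit CS A)"
    and "Comp CS (RUnit CS B) (TensorA CS f (Ident CS (Unit CS))) = Comp CS f (RUnit CS A)"
    by (auto elim!: hom_CS_E simp: lunit_nat runit_nat)
next
  fix A B D E assume "A \<in> Obj CS" "B \<in> Obj CS" "D \<in> Obj CS" "E \<in> Obj CS"
  then show "Comp CS (TensorA CS (Ident CS A) (Assoc CS B D E)) (Comp CS (Assoc CS A (TensorO CS B D) E) (TensorA CS (Assoc CS A B D) (Ident CS E)))
    = Comp CS (Assoc CS A B (TensorO CS D E)) (Assoc CS (TensorO CS A B) D E)"
    by (simp add: alg_typed' pentagon)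
qed

end

section \<open>The functor\<close>

locale cpstar_functor = dagger_compact_category V
  for V :: "('o, 'a, 'z) dc_cat_scheme" (structure) +
  fixes nrm :: "('o, 'a) algebra \<Rightarrow> 'a"
  assumes nrm: "normalisable V M \<Longrightarrow> normaliser V M (nrm M)"
begin

lemma nrm_normalised_frob: "normalisable V M \<Longrightarrow> normalised_frob V M (nrm M)"
  using nrm normalised_frobI by (auto simp: normalisable_def)

definition emb :: "('o, 'a) algebra \<Rightarrow> 'a" where
  "emb M = act V M \<cdot> nrm M"

lemma nrm_typed [simp]:
  assumes "normalisable V M"
  shows "nrm M \<in> Arr V" "Dom V (nrm M) = carrier M" "Cod V (nrm M) = carrier M" "(nrm M)\<dagger> = nrm M"
  using normalised_frob.z_typed [OF nrm_normalised_frob [OF assms]] normalised_frob.z_dagger [OF nrm_normalised_frob [OF assms]] by auto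

lemmas [simp] = alg_typed'

lemma emb_typed [simp]:
  assumes "normalisable V M"
  shows "emb M \<in> Arr V" "Dom V (emb M) = carrier M" "Cod V (emb M) = dbl (carrier M)"
  using assms by (simp_all add: emb_def)

lemma act_normaliser:
  assumes "normalisable V M" "normaliser V M z"
  shows "(act V M)\<dagger> \<cdot> act V M \<cdot> z \<cdot> z = \<one> (carrier M)" "z \<cdot> z \<cdot> (act V M)\<dagger> \<cdot> act V M = \<one> (carrier M)"
    "z \<cdot> (act V M)\<dagger> \<cdot> act V M \<cdot> z = \<one> (carrier M)" "pm z \<cdot> act V M = act V M \<cdot> z \<cdot> z"
    "completely_positive V (carrier M) (carrier M) (act V M \<cdot> z \<cdot> (act V M)\<dagger>)"
    "completely_positive V (carrier M) (carrier M) (act V M \<cdot> z \<cdot> z \<cdot> z \<cdot> (act V M)\<dagger>)"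
proof -
  interpret normalised_frob V M z
    using assms by (auto intro: normalised_frobI simp: normalisable_def)
  show 1: "a\<dagger> \<cdot> a \<cdot> z \<cdot> z = \<one> A"
    by (rule act_z)
  from arg_cong [OF 1, of "\<lambda>x. x\<dagger>"] show "z \<cdot> z \<cdot> a\<dagger> \<cdot> a = \<one> A"
    by (simp add: dagger_comp' cassoc)
  \<comment> \<open>The inverse of \<open>z\<close> cancels one of the two adjacent copies, which
    can then be put back on the other side.\<close>
  obtain z' where z' [simp]: "z' \<in> Arr V" "Dom V z' = A" "Cod V z' = A" "z \<cdot> z' = \<one> A"
    using z_pd by (auto simp: positive_definite_def is_iso_def hom_def)
  have "a\<dagger> \<cdot> a \<cdot> z = (a\<dagger> \<cdot> a \<cdot> z \<cdot> z) \<cdot> z'"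
    by (simp add: cassoc)
  then show "z \<cdot> a\<dagger> \<cdot> a \<cdot> z = \<one> A"
    unfolding 1 by simp
  show 2: "pm z \<cdot> a = a \<cdot> z \<cdot> z"
    by (simp add: pm_act_central dfa z_central)
  show 3: "completely_positive V A A (a \<cdot> z \<cdot> a\<dagger>)"
    using z_pd by (intro act_coact_cp z_central) (simp add: positive_definite_def)
  have "pm z \<cdot> (a \<cdot> z \<cdot> a\<dagger>) = a \<cdot> z \<cdot> z \<cdot> z \<cdot> a\<dagger>"
    using comp_reduce1 [OF 2, of "z \<cdot> a\<dagger>"] by (simp add: cassoc)
  then show "completely_positive V A A (a \<cdot> z \<cdot> z \<cdot> z \<cdot> a\<dagger>)"
    using cp_comp [OF 3 cp_pure [of z A A]] by simp
qed

lemma emb_isometry: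
  assumes "normalisable V M"
  shows "(emb M)\<dagger> \<cdot> emb M = \<one> (carrier M)"
    and "\<lbrakk>x \<in> Arr V; Cod V x = carrier M\<rbrakk> \<Longrightarrow> (emb M)\<dagger> \<cdot> (emb M \<cdot> x) = x"
proof -
  show 1: "(emb M)\<dagger> \<cdot> emb M = \<one> (carrier M)"
    using act_normaliser(3) [OF assms nrm [OF assms]] assms by (simp add: emb_def dagger_comp' cassoc)
  show "(emb M)\<dagger> \<cdot> (emb M \<cdot> x) = x" if "x \<in> Arr V" "Cod V x = carrier M"
    using comp_reduce1 [OF 1, of x] that assms by simp
qed

lemma cp_emb:
  assumes f: "cpstar_map M N f" and o [simp]: "normalisable V M" "normalisable V N"
  shows "completely_positive V (carrier M) (carrier N) (emb N \<cdot> f \<cdot> (emb M)\<dagger>)"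
proof -
  have [simp]: "f \<in> Arr V" "Dom V f = carrier M" "Cod V f = carrier N"
    using cpstar_map_typed [OF f] by auto
  let ?a = "act V M" and ?b = "act V N" and ?z = "nrm M" and ?w = "nrm N"
  note z = act_normaliser [OF o(1) nrm [OF o(1)]] and w = act_normaliser [OF o(2) nrm [OF o(2)]]
  have "(?b \<cdot> ?w \<cdot> ?w \<cdot> ?w \<cdot> ?b\<dagger>) \<cdot> ((?b \<cdot> f \<cdot> ?a\<dagger>) \<cdot> (?a \<cdot> ?z \<cdot> ?z \<cdot> ?z \<cdot> ?a\<dagger>))
      = ?b \<cdot> ?w \<cdot> (?w \<cdot> ?w \<cdot> ?b\<dagger> \<cdot> ?b) \<cdot> f \<cdot> (?a\<dagger> \<cdot> ?a \<cdot> ?z \<cdot> ?z) \<cdot> ?z \<cdot> ?a\<dagger>"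
    by (simp add: cassoc)
  also have "\<dots> = emb N \<cdot> f \<cdot> (emb M)\<dagger>"
    unfolding z(1) w(2) by (simp add: emb_def dagger_comp' cassoc)
  finally have e: "emb N \<cdot> f \<cdot> (emb M)\<dagger>
      = (?b \<cdot> ?w \<cdot> ?w \<cdot> ?w \<cdot> ?b\<dagger>) \<cdot> ((?b \<cdot> f \<cdot> ?a\<dagger>) \<cdot> (?a \<cdot> ?z \<cdot> ?z \<cdot> ?z \<cdot> ?a\<dagger>))" ..
  show ?thesis
    unfolding e using cp_comp [OF cp_comp [OF z(6) _] w(6)] f by (simp add: cpstar_map_def)
qed

text \<open>Compressing by the isometries leaves \<open>z\<close> between action and coaction on
  each side, which is completely positive without any cancellation.\<close>

lemma cpstar_map_emb:
  assumes g: "completely_positive V (carrier M) (carrier N) g" and o [simp]: "normalisable V M" "normalisable V N"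
  shows "cpstar_map M N ((emb N)\<dagger> \<cdot> g \<cdot> emb M)"
proof -
  note [simp] = cp_typed [OF g alg_typed'(1) [OF o(2)]]
  let ?a = "act V M" and ?b = "act V N"
  have e: "?b \<cdot> ((emb N)\<dagger> \<cdot> g \<cdot> emb M) \<cdot> ?a\<dagger> = (?b \<cdot> nrm N \<cdot> ?b\<dagger>) \<cdot> (g \<cdot> (?a \<cdot> nrm M \<cdot> ?a\<dagger>))"
    by (simp add: emb_def dagger_comp' cassoc)
  have "completely_positive V (carrier M) (carrier N) (?b \<cdot> ((emb N)\<dagger> \<cdot> g \<cdot> emb M) \<cdot> ?a\<dagger>)"
    unfolding e using cp_comp [OF cp_comp [OF act_normaliser(5) [OF o(1) nrm [OF o(1)]] g] act_normaliser(5) [OF o(2) nrm [OF o(2)]]] by simp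
  then show ?thesis
    by (simp add: cpstar_map_def hom_def)
qed

text \<open>The isometry built from \<open>nrm M\<close> and \<open>nrm N\<close>. It differs from
  \<open>emb (tensor_algebra V M N)\<close> as far as the chosen normaliser of the tensor algebra
  differs from \<open>nrm M \<otimes> nrm N\<close>.\<close>

definition bemb :: "('o, 'a) algebra \<Rightarrow> ('o, 'a) algebra \<Rightarrow> 'a" where
  "bemb M N = (sh (carrier M) (carrier N))\<dagger> \<cdot> (emb M \<otimes> emb N)"

lemma bemb_typed [simp]:
  assumes "normalisable V M" "normalisable V N"
  shows "bemb M N \<in> Arr V" "Dom V (bemb M N) = carrier M \<odot> carrier N" "Cod V (bemb M N) = dbl (carrier M \<odot> carrier N)"
  using assms by (simp_all add: bemb_def)

lemma tens_bemb:
  assumes "normalisable V M" "normalisable V N" "B \<in> Obj V" "E \<in> Obj V"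
    and "f \<in> Arr V" "Dom V f = dbl (carrier M)" "Cod V f = dbl B"
    and "g \<in> Arr V" "Dom V g = dbl (carrier N)" "Cod V g = dbl E"
  shows "tens (carrier M) B f (carrier N) E g \<cdot> bemb M N = (sh B E)\<dagger> \<cdot> ((f \<cdot> emb M) \<otimes> (g \<cdot> emb N))"
  using assms by (simp add: tens_def bemb_def cassoc tensor_comp')

lemma bemb_isometry:
  assumes "normalisable V M" "normalisable V N"
  shows "(bemb M N)\<dagger> \<cdot> bemb M N = \<one> (carrier M \<odot> carrier N)"
    and "\<lbrakk>x \<in> Arr V; Cod V x = carrier M \<odot> carrier N\<rbrakk> \<Longrightarrow> (bemb M N)\<dagger> \<cdot> (bemb M N \<cdot> x) = x"
proof -
  show 1: "(bemb M N)\<dagger> \<cdot> bemb M N = \<one> (carrier M \<odot> carrier N)"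
    using assms by (simp add: bemb_def dagger_comp' cassoc tensor_comp' emb_isometry)
  show "(bemb M N)\<dagger> \<cdot> (bemb M N \<cdot> x) = x" if "x \<in> Arr V" "Cod V x = carrier M \<odot> carrier N"
    using comp_reduce1 [OF 1, of x] that assms by simp
qed

definition phi :: "('o, 'a) algebra \<Rightarrow> ('o, 'a) algebra \<Rightarrow> 'a" where
  "phi M N = bemb M N \<cdot> (emb (tensor_algebra V M N))\<dagger>"

lemma phi_typed [simp]:
  assumes "normalisable V M" "normalisable V N"
  shows "phi M N \<in> Arr V" "Dom V (phi M N) = dbl (carrier M \<odot> carrier N)" "Cod V (phi M N) = dbl (carrier M \<odot> carrier N)"
  using assms by (simp_all add: phi_def normalisable_tensor)

text \<open>\<open>nrm M \<otimes> nrm N\<close> is a second normaliser \<open>w\<close> of the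
  tensor algebra, so \<open>phi\<close> is \<open>a \<cdot> w \<cdot> z \<cdot> a\<dagger>\<close>.
  The cube of \<open>w\<close> lets this be written as a composite of two completely positive maps,
  one for each normaliser.\<close>

lemma cp_phi:
  assumes o [simp]: "normalisable V M" "normalisable V N"
  shows "completely_positive V (carrier M \<odot> carrier N) (carrier M \<odot> carrier N) (phi M N)"
proof -
  let ?T = "tensor_algebra V M N"
  have T [simp]: "normalisable V ?T"
    by (rule normalisable_tensor) simp_all
  let ?a = "act V ?T" and ?z = "nrm ?T" and ?w = "nrm M \<otimes> nrm N"
  have w: "normaliser V ?T ?w"
    using o nrm by (intro normaliser_tensor) (auto simp: normalisable_def)
  note z = act_normaliser [OF T nrm [OF T]] and w' = act_normaliser [OF T w]
  have "(?a \<cdot> ?w \<cdot> ?w \<cdot> ?w \<cdot> ?a\<dagger>) \<cdot> (?a \<cdot> ?z \<cdot> ?a\<dagger>) = ?a \<cdot> ?w \<cdot> (?w \<cdot> ?w \<cdot> ?a\<dagger> \<cdot> ?a) \<cdot> ?z \<cdot> ?a\<dagger>"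
    by (simp add: cassoc tensor_comp_reduce)
  also have "\<dots> = phi M N"
    unfolding w'(2) by (simp add: phi_def bemb_def emb_def dagger_comp' cassoc act_tensor tensor_comp_reduce)
  finally have e: "phi M N = (?a \<cdot> ?w \<cdot> ?w \<cdot> ?w \<cdot> ?a\<dagger>) \<cdot> (?a \<cdot> ?z \<cdot> ?a\<dagger>)" ..
  show ?thesis
    unfolding e using cp_comp [OF z(5) w'(6)] by simp
qed

abbreviation "U \<equiv> unit_algebra V"

text \<open>The action map of the unit algebra is \<open>\<eta> \<I>\<close>, the isometry belonging
  to its normaliser \<open>\<one> \<I>\<close>; \<open>phi0\<close> compares it with the one for the
  chosen normaliser.\<close>

definition phi0 :: 'a where
  "phi0 = \<eta> \<I> \<cdot> (emb U)\<dagger>"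

lemmas [simp] = normalisable_unit

lemma phi0_typed [simp]: "phi0 \<in> Arr V" "Dom V phi0 = dbl \<I>" "Cod V phi0 = dbl \<I>"
  by (simp_all add: phi0_def)

lemma cp_phi0: "completely_positive V \<I> \<I> phi0"
  using act_normaliser(5) [OF normalisable_unit nrm [OF normalisable_unit]]
  by (simp add: phi0_def emb_def act_unit_algebra dagger_comp' cassoc)

abbreviation "idem M \<equiv> emb M \<cdot> (emb M)\<dagger>"

text \<open>For a self-adjoint normaliser the dual is the conjugate, and the doubled
  \<open>z\<close> is absorbed into the coaction as two further factors.\<close>

lemma idem_eq:
  assumes [simp]: "normalisable V M"
  shows "act V M \<cdot> coact V M \<cdot> (dual_map V (nrm M) \<otimes> nrm M) = idem M"
proof -
  have "(act V M)\<dagger> \<cdot> pm (nrm M) = (pm (nrm M) \<cdot> act V M)\<dagger>"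
    by (simp add: dagger_comp' flip: pm_dagger)
  then show ?thesis
    by (simp add: act_normaliser(4) nrm coact_act dual_map_conj emb_def dagger_comp' cassoc flip: pm_def)
qed

lemma cp_idem: "normalisable V M \<Longrightarrow> completely_positive V (carrier M) (carrier M) (idem M)"
  using cp_emb [of M M "\<one> (carrier M)"] by (simp add: cpstar_map_alg_iso alg_iso_ident)

abbreviation "S \<equiv> Split_dagger W"

lemmas S_sel [simp] = dagger_symmetric_monoidal_category.SD_sel [OF CPM_dsm]
lemmas Arr_S = dagger_symmetric_monoidal_category.Arr_SD [OF CPM_dsm]
lemmas Obj_S = dagger_symmetric_monoidal_category.Obj_SD [OF CPM_dsm]
lemmas hom_S = dagger_symmetric_monoidal_category.hom_SD [OF CPM_dsm]

definition Fobj :: "('o, 'a) algebra \<Rightarrow> 'o \<times> ('o, 'a) arrow" where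
  "Fobj M = (carrier M, Arrow (carrier M) (idem M) (carrier M))"

definition Farr :: "(('o, 'a) algebra, 'a) arrow \<Rightarrow> ('o \<times> ('o, 'a) arrow, ('o, 'a) arrow) arrow" where
  "Farr h = Arrow (Fobj (source h))
    (Arrow (carrier (source h)) (emb (target h) \<cdot> und h \<cdot> (emb (source h))\<dagger>) (carrier (target h)))
    (Fobj (target h))"

definition F :: "(('o, 'a) algebra, (('o, 'a) algebra, 'a) arrow, 'o \<times> ('o, 'a) arrow, ('o \<times> ('o, 'a) arrow, ('o, 'a) arrow) arrow) cat_map" where
  "F = \<lparr>on_obj = Fobj, on_arr = Farr\<rparr>"

lemma F_sel [simp]: "on_obj F = Fobj" "on_arr F = Farr"
  by (simp_all add: F_def)

lemma Obj_Fobj: "normalisable V M \<Longrightarrow> Fobj M \<in> Obj S"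
  by (simp add: Fobj_def Obj_S cp_idem cassoc emb_isometry dagger_comp')

lemma Arr_F:
  assumes [simp]: "normalisable V M" "normalisable V N"
  shows "Arrow (Fobj M) (Arrow A g B) (Fobj N) \<in> Arr S \<longleftrightarrow> A = carrier M \<and> B = carrier N \<and>
    completely_positive V (carrier M) (carrier N) g \<and> idem N \<cdot> g = g \<and> g \<cdot> idem M = g"
  using Obj_Fobj [OF assms(1)] Obj_Fobj [OF assms(2)] unfolding Fobj_def
  by (cases "A = carrier M"; cases "B = carrier N"; simp add: Arr_S)

lemma hom_F:
  assumes "normalisable V M" "normalisable V N"
  shows "h \<in> hom S (Fobj M) (Fobj N) \<longleftrightarrow> (\<exists>g. h = Arrow (Fobj M) (Arrow (carrier M) g (carrier N)) (Fobj N) \<and>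
    completely_positive V (carrier M) (carrier N) g \<and> idem N \<cdot> g = g \<and> g \<cdot> idem M = g)" (is "_ \<longleftrightarrow> ?r")
proof -
  obtain X A g B Y where h: "h = Arrow X (Arrow A g B) Y"
    by (metis arrow.exhaust)
  have "h \<in> hom S (Fobj M) (Fobj N) \<longleftrightarrow> Arrow (Fobj M) (Arrow A g B) (Fobj N) \<in> Arr S \<and> X = Fobj M \<and> Y = Fobj N"
    unfolding h hom_S arrow.sel by blast
  also have "\<dots> \<longleftrightarrow> ?r"
    unfolding Arr_F [OF assms] h by blast
  finally show ?thesis .
qed

lemma Farr_hom: "h \<in> Arr CS \<Longrightarrow> Farr h \<in> hom S (Fobj (source h)) (Fobj (target h))"
  by (auto elim!: Arr_CS_E simp: hom_F Farr_def cp_emb cassoc emb_isometry)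

lemma F_functor: "is_functor CS S F"
proof -
  have "category CS" "category S"
    using CS_dagger_category dagger_symmetric_monoidal_category.SD_dagger_category [OF CPM_dsm]
    by (auto simp: dagger_category_def)
  moreover have "Farr (Comp CS g f) = Comp S (Farr g) (Farr f)"
    if "f \<in> Arr CS" "g \<in> Arr CS" "Cod CS f = Dom CS g" for f g
    using that by (auto elim!: Arr_CS_E simp: Farr_def cassoc emb_isometry)
  ultimately show ?thesis
    using Farr_hom by (simp add: is_functor_def Obj_Fobj) (simp add: Farr_def Fobj_def)
qed

lemma F_dagger: "dagger_functor CS S F"
  using F_functor CS_dagger_category dagger_symmetric_monoidal_category.SD_dagger_category [OF CPM_dsm]
  by (auto simp: dagger_functor_def Farr_def dagger_comp' cassoc elim!: Arr_CS_E)

lemma F_full: "full CS S F"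
  unfolding full_def F_sel
proof (intro ballI)
  fix M N h
  assume "M \<in> Obj CS" "N \<in> Obj CS" and h: "h \<in> hom S (Fobj M) (Fobj N)"
  then have o [simp]: "normalisable V M" "normalisable V N"
    by simp_all
  from h obtain g where g: "h = Arrow (Fobj M) (Arrow (carrier M) g (carrier N)) (Fobj N)"
      "completely_positive V (carrier M) (carrier N) g" "idem N \<cdot> g = g" "g \<cdot> idem M = g"
    by (auto simp: hom_F)
  note [simp] = cp_typed [OF g(2) alg_typed'(1) [OF o(2)]]
  \<comment> \<open>The preimage of \<open>g\<close> is its compression by the isometries;
    recovering \<open>g\<close> uses that it is fixed by both projections.\<close>
  have "emb N \<cdot> ((emb N)\<dagger> \<cdot> g \<cdot> emb M) \<cdot> (emb M)\<dagger> = (idem N \<cdot> g) \<cdot> idem M"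
    by (simp add: cassoc)
  also have "\<dots> = g"
    unfolding g(3) by (rule g(4))
  finally show "\<exists>f \<in> hom CS M N. Farr f = h"
    using cpstar_map_emb [OF g(2)] by (intro bexI [of _ "Arrow M ((emb N)\<dagger> \<cdot> g \<cdot> emb M) N"]) (simp_all add: hom_CS Farr_def g(1))
qed

lemma F_faithful: "faithful CS S F"
  unfolding faithful_def F_sel
proof (intro ballI inj_onI)
  fix M N h k
  assume "h \<in> hom CS M N" "k \<in> hom CS M N" and e: "Farr h = Farr k"
  then obtain f g where hk: "h = Arrow M f N" "k = Arrow M g N" and o [simp]: "normalisable V M" "normalisable V N"
      and [simp]: "f \<in> Arr V" "Dom V f = carrier M" "Cod V f = carrier N" "g \<in> Arr V" "Dom V g = carrier M" "Cod V g = carrier N"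
    by (auto elim!: hom_CS_E)
  have "emb N \<cdot> f \<cdot> (emb M)\<dagger> = emb N \<cdot> g \<cdot> (emb M)\<dagger>"
    using e by (simp add: Farr_def hk)
  from arg_cong [OF this, of "\<lambda>x. (emb N)\<dagger> \<cdot> x \<cdot> emb M"] show "h = k"
    by (simp add: hk cassoc emb_isometry)
qed

text \<open>The tensor of two range projections is the range projection of \<open>bemb\<close>.
  Hence \<open>phi\<close> relates the ranges of two isometries with a common source, which makes it
  unitary there.\<close>

lemma idem_tensor:
  assumes [simp]: "normalisable V M" "normalisable V N"
  shows "tens (carrier M) (carrier M) (idem M) (carrier N) (carrier N) (idem N) = bemb M N \<cdot> (bemb M N)\<dagger>"
  by (simp add: tens_def bemb_def dagger_comp' cassoc tensor_comp_reduce)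

lemma idem_bemb:
  assumes [simp]: "normalisable V M" "normalisable V N"
  shows "tens (carrier M) (carrier M) (idem M) (carrier N) (carrier N) (idem N) \<cdot> bemb M N = bemb M N"
  by (simp add: idem_tensor cassoc bemb_isometry)

text \<open>\<open>phi\<close> exchanges one isometry for the other; the coherence proofs below
  reduce to statements about \<open>bemb\<close> by this rule.\<close>

lemma phi_emb:
  assumes "normalisable V M" "normalisable V N" "x \<in> Arr V" "Cod V x = carrier M \<odot> carrier N"
  shows "phi M N \<cdot> (emb (tensor_algebra V M N) \<cdot> x) = bemb M N \<cdot> x"
  using assms by (simp add: phi_def cassoc emb_isometry normalisable_tensor)

definition Phi :: "('o, 'a) algebra \<Rightarrow> ('o, 'a) algebra \<Rightarrow> ('o \<times> ('o, 'a) arrow, ('o, 'a) arrow) arrow" where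
  "Phi M N = Arrow (Fobj (tensor_algebra V M N)) (Arrow (carrier M \<odot> carrier N) (phi M N) (carrier M \<odot> carrier N))
    (TensorO S (Fobj M) (Fobj N))"

definition Phi0 :: "('o \<times> ('o, 'a) arrow, ('o, 'a) arrow) arrow" where
  "Phi0 = Arrow (Fobj U) (Arrow \<I> phi0 \<I>) (Unit S)"

lemma Phi_unitary:
  assumes [simp]: "normalisable V M" "normalisable V N"
  shows "unitary S (Fobj (tensor_algebra V M N)) (TensorO S (Fobj M) (Fobj N)) (Phi M N)"
proof -
  have T [simp]: "normalisable V (tensor_algebra V M N)"
    by (rule normalisable_tensor) simp_all
  have o: "Fobj (tensor_algebra V M N) \<in> Obj S" "TensorO S (Fobj M) (Fobj N) \<in> Obj S"
    using dagger_symmetric_monoidal_category.tensor_obj [OF dagger_symmetric_monoidal_category.SD_dsm [OF CPM_dsm]]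
    by (simp_all add: Obj_Fobj)
  show ?thesis
    using o unfolding Fobj_def Phi_def
    by (simp add: unitary_def [of S] hom_S Arr_S cp_phi idem_tensor)
      (simp add: phi_def dagger_comp' cassoc emb_isometry bemb_isometry)
qed

lemma Phi0_unitary: "unitary S (Fobj U) (Unit S) Phi0"
proof -
  have o: "Fobj U \<in> Obj S" "Unit S \<in> Obj S"
    using dagger_symmetric_monoidal_category.unit_obj [OF dagger_symmetric_monoidal_category.SD_dsm [OF CPM_dsm]]
    by (simp_all add: Obj_Fobj)
  show ?thesis
    using o unfolding Fobj_def Phi0_def
    by (simp add: unitary_def [of S] hom_S Arr_S cp_phi0) (simp add: phi0_def dagger_comp' cassoc emb_isometry)
qed

lemma Phi_natural:
  assumes "f \<in> Arr CS" "g \<in> Arr CS"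
  shows "Comp S (Phi (Cod CS f) (Cod CS g)) (Farr (TensorA CS f g))
    = Comp S (TensorA S (Farr f) (Farr g)) (Phi (Dom CS f) (Dom CS g))"
proof -
  obtain M k N where f: "f = Arrow M k N" and [simp]: "normalisable V M" "normalisable V N" "k \<in> Arr V" "Dom V k = carrier M" "Cod V k = carrier N"
    using assms(1) by (rule Arr_CS_E)
  obtain M' k' N' where g: "g = Arrow M' k' N'" and [simp]: "normalisable V M'" "normalisable V N'" "k' \<in> Arr V" "Dom V k' = carrier M'" "Cod V k' = carrier N'"
    using assms(2) by (rule Arr_CS_E)
  have [simp]: "normalisable V (tensor_algebra V M M')" "normalisable V (tensor_algebra V N N')"
    by (simp_all add: normalisable_tensor)
  have "bemb N N' \<cdot> (k \<otimes> k') = tens (carrier M) (carrier N) (emb N \<cdot> k \<cdot> (emb M)\<dagger>) (carrier M') (carrier N') (emb N' \<cdot> k' \<cdot> (emb M')\<dagger>) \<cdot> bemb M M'"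
    by (simp add: tens_bemb cassoc emb_isometry) (simp add: bemb_def cassoc tensor_comp')
  from comp_reduce [OF this, of "(emb (tensor_algebra V M M'))\<dagger>"]
  show ?thesis
    by (simp add: f g Phi_def Farr_def Fobj_def phi_emb) (simp add: phi_def)
qed

text \<open>Every \<open>phi\<close> replaces an \<open>emb\<close> by a \<open>bemb\<close>, so
  both paths become three isometries followed by inverse shuffles, and associativity of the shuffle
  compares them.\<close>

lemma Phi_assoc:
  assumes [simp]: "normalisable V L" "normalisable V M" "normalisable V N"
  shows "Comp S (TensorA S (Ident S (Fobj L)) (Phi M N)) (Comp S (Phi L (tensor_algebra V M N)) (Farr (Assoc CS L M N)))
    = Comp S (Assoc S (Fobj L) (Fobj M) (Fobj N)) (Comp S (TensorA S (Phi L M) (Ident S (Fobj N))) (Phi (tensor_algebra V L M) N))"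
proof -
  have [simp]: "normalisable V (tensor_algebra V L M)" "normalisable V (tensor_algebra V M N)"
    "normalisable V (tensor_algebra V (tensor_algebra V L M) N)" "normalisable V (tensor_algebra V L (tensor_algebra V M N))"
    by (simp_all add: normalisable_tensor)
  let ?A = "carrier L" and ?B = "carrier M" and ?D = "carrier N"
  let ?\<alpha> = "\<alpha> (dbl ?A) (dbl ?B) (dbl ?D)"
  let ?e = "(emb (tensor_algebra V (tensor_algebra V L M) N))\<dagger>"
  \<comment> \<open>Associativity of the shuffle, solved for the doubled associator.\<close>
  have p: "pm (\<alpha> ?A ?B ?D) = (sh ?A (?B \<odot> ?D))\<dagger> \<cdot> (\<one> (dbl ?A) \<otimes> (sh ?B ?D)\<dagger>) \<cdot> ?\<alpha> \<cdot> (sh ?A ?B \<otimes> \<one> (dbl ?D)) \<cdot> sh (?A \<odot> ?B) ?D"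
    unfolding sh_assoc [of ?A ?B ?D, simplified] by (simp add: tensor_comp_reduce)
  have 1: "tens ?A ?A (idem L) (?B \<odot> ?D) (?B \<odot> ?D) (phi M N) \<cdot> bemb L (tensor_algebra V M N)
      = (sh ?A (?B \<odot> ?D))\<dagger> \<cdot> (emb L \<otimes> bemb M N)"
    using phi_emb [of M N "\<one> (?B \<odot> ?D)"] tens_bemb [of L "tensor_algebra V M N"] by (simp add: cassoc emb_isometry)
  have 2: "tens (?A \<odot> ?B) (?A \<odot> ?B) (phi L M) ?D ?D (idem N) \<cdot> bemb (tensor_algebra V L M) N
      = (sh (?A \<odot> ?B) ?D)\<dagger> \<cdot> (bemb L M \<otimes> emb N)"
    using phi_emb [of L M "\<one> (?A \<odot> ?B)"] tens_bemb [of "tensor_algebra V L M" N] by (simp add: cassoc emb_isometry)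
  \<comment> \<open>The projections carried by the associator of the splitting are absorbed by the
    isometries.\<close>
  have 3: "tens (?A \<odot> ?B) (?A \<odot> ?B) (tens ?A ?A (idem L) ?B ?B (idem M)) ?D ?D (idem N) \<cdot> ((sh (?A \<odot> ?B) ?D)\<dagger> \<cdot> (bemb L M \<otimes> emb N))
      = (sh (?A \<odot> ?B) ?D)\<dagger> \<cdot> (bemb L M \<otimes> emb N)"
    unfolding tens_def [of "?A \<odot> ?B"] by (simp add: cassoc tensor_comp' idem_bemb emb_isometry)
  have 4: "pm (\<alpha> ?A ?B ?D) \<cdot> ((sh (?A \<odot> ?B) ?D)\<dagger> \<cdot> (bemb L M \<otimes> emb N)) = (sh ?A (?B \<odot> ?D))\<dagger> \<cdot> (emb L \<otimes> bemb M N) \<cdot> \<alpha> ?A ?B ?D"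
  proof -
    have "pm (\<alpha> ?A ?B ?D) \<cdot> ((sh (?A \<odot> ?B) ?D)\<dagger> \<cdot> (bemb L M \<otimes> emb N))
        = (sh ?A (?B \<odot> ?D))\<dagger> \<cdot> (\<one> (dbl ?A) \<otimes> (sh ?B ?D)\<dagger>) \<cdot> (?\<alpha> \<cdot> ((emb L \<otimes> emb M) \<otimes> emb N))"
      unfolding p by (simp add: bemb_def cassoc tensor_comp_reduce tensor_comp')
    also have "?\<alpha> \<cdot> ((emb L \<otimes> emb M) \<otimes> emb N) = (emb L \<otimes> (emb M \<otimes> emb N)) \<cdot> \<alpha> ?A ?B ?D"
      by (simp add: assoc_nat)
    finally show ?thesis
      by (simp add: bemb_def cassoc tensor_comp_reduce)
  qed
  let ?T1 = "tens ?A ?A (idem L) (?B \<odot> ?D) (?B \<odot> ?D) (phi M N)"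
  let ?T2 = "tens (?A \<odot> ?B) (?A \<odot> ?B) (phi L M) ?D ?D (idem N)"
  let ?T3 = "tens (?A \<odot> ?B) (?A \<odot> ?B) (tens ?A ?A (idem L) ?B ?B (idem M)) ?D ?D (idem N)"
  have "?T1 \<cdot> (bemb L (tensor_algebra V M N) \<cdot> \<alpha> ?A ?B ?D) = (sh ?A (?B \<odot> ?D))\<dagger> \<cdot> (emb L \<otimes> bemb M N) \<cdot> \<alpha> ?A ?B ?D"
    using comp_reduce1 [OF 1, of "\<alpha> ?A ?B ?D"] by (simp add: cassoc)
  also have "\<dots> = pm (\<alpha> ?A ?B ?D) \<cdot> (?T3 \<cdot> (?T2 \<cdot> bemb (tensor_algebra V L M) N))"
    by (simp only: 2 3 4)
  finally have 5: "?T1 \<cdot> (bemb L (tensor_algebra V M N) \<cdot> \<alpha> ?A ?B ?D) = \<dots>" .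
  \<comment> \<open>The equation so far starts at the tensor algebra itself; composing with the
    adjoint of its isometry restores the doubled source.\<close>
  from arg_cong [OF 5, of "\<lambda>x. x \<cdot> ?e"]
  show ?thesis
    by (simp add: Phi_def Farr_def Fobj_def phi_emb) (simp add: phi_def [of "tensor_algebra V L M" N] cassoc)
qed

text \<open>\<open>phi0\<close> turns the isometry of the unit algebra into
  \<open>\<eta> \<I>\<close>, whose adjoint inside the doubled unitor cancels it, leaving naturality
  of the left unitor.\<close>

lemma Phi_lunit:
  assumes [simp]: "normalisable V M"
  shows "Farr (LUnit CS M) = Comp S (LUnit S (Fobj M)) (Comp S (TensorA S Phi0 (Ident S (Fobj M))) (Phi U M))"
proof -
  let ?A = "carrier M" and ?e = "(emb (tensor_algebra V U M))\<dagger>"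
  have [simp]: "normalisable V (tensor_algebra V U M)"
    by (simp add: normalisable_tensor)
  let ?T1 = "tens \<I> \<I> phi0 ?A ?A (idem M)" and ?T2 = "tens \<I> \<I> (\<one> (dbl \<I>)) ?A ?A (idem M)"
  let ?x = "(sh \<I> ?A)\<dagger> \<cdot> (\<eta> \<I> \<otimes> emb M)"
  have 1: "?T1 \<cdot> bemb U M = ?x"
    using tens_bemb [of U M \<I> ?A phi0 "idem M"] emb_isometry(1) [of U] by (simp add: phi0_def cassoc emb_isometry)
  have 2: "?T2 \<cdot> ?x = ?x"
    by (simp add: tens_def cassoc tensor_comp' emb_isometry)
  have "pm (\<Lambda> ?A) \<cdot> ?x = (\<Lambda> (dbl ?A) \<cdot> ((\<eta> \<I>)\<dagger> \<otimes> \<one> (dbl ?A)) \<cdot> sh \<I> ?A) \<cdot> ?x"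
    by (simp only: sh_lunit alg_typed' assms)
  also have "\<dots> = \<Lambda> (dbl ?A) \<cdot> (\<one> \<I> \<otimes> emb M)"
    by (simp add: cassoc tensor_comp')
  also have "\<dots> = emb M \<cdot> \<Lambda> ?A"
    by (simp add: lunit_nat)
  finally have 3: "pm (\<Lambda> ?A) \<cdot> ?x = emb M \<cdot> \<Lambda> ?A" .
  have "pm (\<Lambda> ?A) \<cdot> (?T2 \<cdot> (?T1 \<cdot> bemb U M)) = emb M \<cdot> \<Lambda> ?A"
    by (simp only: 1 2 3)
  from arg_cong [OF this, of "\<lambda>x. x \<cdot> ?e"]
  show ?thesis
    by (simp add: Phi_def Phi0_def Farr_def Fobj_def) (simp add: phi_def cassoc)
qed

lemma Phi_runit:
  assumes [simp]: "normalisable V M"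
  shows "Farr (RUnit CS M) = Comp S (RUnit S (Fobj M)) (Comp S (TensorA S (Ident S (Fobj M)) Phi0) (Phi M U))"
proof -
  let ?A = "carrier M" and ?e = "(emb (tensor_algebra V M U))\<dagger>"
  have [simp]: "normalisable V (tensor_algebra V M U)"
    by (simp add: normalisable_tensor)
  let ?T1 = "tens ?A ?A (idem M) \<I> \<I> phi0" and ?T2 = "tens ?A ?A (idem M) \<I> \<I> (\<one> (dbl \<I>))"
  let ?x = "(sh ?A \<I>)\<dagger> \<cdot> (emb M \<otimes> \<eta> \<I>)"
  have 1: "?T1 \<cdot> bemb M U = ?x"
    using tens_bemb [of M U ?A \<I> "idem M" phi0] emb_isometry(1) [of U] by (simp add: phi0_def cassoc emb_isometry)
  have 2: "?T2 \<cdot> ?x = ?x"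
    by (simp add: tens_def cassoc tensor_comp' emb_isometry)
  have "pm (\<rho> ?A) \<cdot> ?x = (\<rho> (dbl ?A) \<cdot> (\<one> (dbl ?A) \<otimes> (\<eta> \<I>)\<dagger>) \<cdot> sh ?A \<I>) \<cdot> ?x"
    by (simp only: sh_runit alg_typed' assms)
  also have "\<dots> = \<rho> (dbl ?A) \<cdot> (emb M \<otimes> \<one> \<I>)"
    by (simp add: cassoc tensor_comp')
  also have "\<dots> = emb M \<cdot> \<rho> ?A"
    by (simp add: runit_nat)
  finally have 3: "pm (\<rho> ?A) \<cdot> ?x = emb M \<cdot> \<rho> ?A" .
  have "pm (\<rho> ?A) \<cdot> (?T2 \<cdot> (?T1 \<cdot> bemb M U)) = emb M \<cdot> \<rho> ?A"
    by (simp only: 1 2 3)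
  from arg_cong [OF this, of "\<lambda>x. x \<cdot> ?e"]
  show ?thesis
    by (simp add: Phi_def Phi0_def Farr_def Fobj_def) (simp add: phi_def cassoc)
qed

text \<open>Once the projections are absorbed into \<open>bemb\<close>, this is compatibility of the
  shuffle with the symmetry followed by naturality.\<close>

lemma Phi_sym:
  assumes [simp]: "normalisable V M" "normalisable V N"
  shows "Comp S (Phi N M) (Farr (Sym CS M N)) = Comp S (Sym S (Fobj M) (Fobj N)) (Phi M N)"
proof -
  let ?A = "carrier M" and ?B = "carrier N" and ?e = "(emb (tensor_algebra V M N))\<dagger>"
  have [simp]: "normalisable V (tensor_algebra V M N)" "normalisable V (tensor_algebra V N M)"
    by (simp_all add: normalisable_tensor)
  have "pm (\<sigma> ?A ?B) \<cdot> bemb M N = (sh ?B ?A)\<dagger> \<cdot> (sh ?B ?A \<cdot> pm (\<sigma> ?A ?B)) \<cdot> bemb M N"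
    by (simp add: cassoc)
  also have "\<dots> = (sh ?B ?A)\<dagger> \<cdot> (\<sigma> (dbl ?A) (dbl ?B) \<cdot> (emb M \<otimes> emb N))"
    by (simp add: bemb_def cassoc flip: sh_sym)
  also have "\<dots> = bemb N M \<cdot> \<sigma> ?A ?B"
    by (simp add: bemb_def cassoc sym_nat)
  finally have "pm (\<sigma> ?A ?B) \<cdot> (tens ?A ?A (idem M) ?B ?B (idem N) \<cdot> bemb M N) = bemb N M \<cdot> \<sigma> ?A ?B"
    by (simp only: idem_bemb assms)
  from arg_cong [OF this, of "\<lambda>x. x \<cdot> ?e"]
  show ?thesis
    by (simp add: Phi_def Farr_def Fobj_def phi_emb) (simp add: phi_def cassoc)
qed

lemma F_monoidal: "strongly_dagger_symmetric_monoidal CS S F"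
  unfolding strongly_dagger_symmetric_monoidal_def F_sel
proof (intro conjI CS_dsm F_dagger dagger_symmetric_monoidal_category.SD_dsm CPM_dsm exI [of _ Phi] exI [of _ Phi0] ballI)
  show "unitary S (Fobj (Unit CS)) (Unit S) Phi0"
    using Phi0_unitary by simp
next
  fix M N assume "M \<in> Obj CS" "N \<in> Obj CS"
  then have "normalisable V M" "normalisable V N"
    by simp_all
  from Phi_unitary [OF this] Phi_sym [OF this]
  show "unitary S (Fobj (TensorO CS M N)) (TensorO S (Fobj M) (Fobj N)) (Phi M N)"
    and "Comp S (Phi N M) (Farr (Sym CS M N)) = Comp S (Sym S (Fobj M) (Fobj N)) (Phi M N)"
    by (simp_all only: CS_sel)
next
  fix f g assume "f \<in> Arr CS" "g \<in> Arr CS"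
  then show "Comp S (Phi (Cod CS f) (Cod CS g)) (Farr (TensorA CS f g)) = Comp S (TensorA S (Farr f) (Farr g)) (Phi (Dom CS f) (Dom CS g))"
    by (rule Phi_natural)
next
  fix L M N assume "L \<in> Obj CS" "M \<in> Obj CS" "N \<in> Obj CS"
  then have "normalisable V L" "normalisable V M" "normalisable V N"
    by simp_all
  from Phi_assoc [OF this]
  show "Comp S (TensorA S (Ident S (Fobj L)) (Phi M N)) (Comp S (Phi L (TensorO CS M N)) (Farr (Assoc CS L M N)))
    = Comp S (Assoc S (Fobj L) (Fobj M) (Fobj N)) (Comp S (TensorA S (Phi L M) (Ident S (Fobj N))) (Phi (TensorO CS L M) N))"
    by (simp only: CS_sel)
next
  fix M assume "M \<in> Obj CS"
  then have "normalisable V M"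
    by simp
  from Phi_lunit [OF this] Phi_runit [OF this]
  show "Farr (LUnit CS M) = Comp S (LUnit S (Fobj M)) (Comp S (TensorA S Phi0 (Ident S (Fobj M))) (Phi (Unit CS) M))"
    and "Farr (RUnit CS M) = Comp S (RUnit S (Fobj M)) (Comp S (TensorA S (Ident S (Fobj M)) Phi0) (Phi M (Unit CS)))"
    by (simp_all only: CS_sel)
qed

lemma Fobj_eq:
  assumes "normalisable V M"
  shows "Fobj M = (carrier M, Arrow (carrier M) (act V M \<cdot> coact V M \<cdot> (dual_map V (nrm M) \<otimes> nrm M)) (carrier M))"
  by (simp only: Fobj_def idem_eq assms)

lemma Farr_eq:
  assumes "Arrow M f N \<in> Arr CS"
  shows "Farr (Arrow M f N) = Arrow (Fobj M) (Arrow (carrier M) (act V N \<cdot> nrm N \<cdot> f \<cdot> nrm M \<cdot> coact V M) (carrier N)) (Fobj N)"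
  using assms cpstar_map_typed [of M N f] by (simp add: Farr_def emb_def dagger_comp' coact_act cassoc)

end

theorem proposition8p3:
  fixes V :: "('o, 'a) dc_cat"
    and nrm :: "('o, 'a) algebra \<Rightarrow> 'a"
  assumes "dagger_compact_category V"
    and "positive_dimensional V"
    and "algebraic_square_roots V"
    and "\<And>M. M \<in> Obj (CPstar V) \<Longrightarrow> normaliser V M (nrm M)"
  shows "\<exists>F. is_functor (CPstar V) (Split_dagger (CPM V)) F \<and>
    (\<forall>M \<in> Obj (CPstar V). on_obj F M =
      (carrier M,
       Arrow (carrier M)
         (act V M \<cdot>\<^bsub>V\<^esub> coact V M \<cdot>\<^bsub>V\<^esub> (dual_map V (nrm M) \<otimes>\<^bsub>V\<^esub> nrm M))
         (carrier M))) \<and>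
    (\<forall>M N f. Arrow M f N \<in> Arr (CPstar V) \<longrightarrow> on_arr F (Arrow M f N) =
      Arrow (on_obj F M)
        (Arrow (carrier M)
          (act V N \<cdot>\<^bsub>V\<^esub> nrm N \<cdot>\<^bsub>V\<^esub> f \<cdot>\<^bsub>V\<^esub> nrm M \<cdot>\<^bsub>V\<^esub> coact V M)
          (carrier N))
        (on_obj F N)) \<and>
    full (CPstar V) (Split_dagger (CPM V)) F \<and>
    faithful (CPstar V) (Split_dagger (CPM V)) F \<and>
    strongly_dagger_symmetric_monoidal (CPstar V) (Split_dagger (CPM V)) F"
proof -
  interpret cpstar_functor V nrm
    using assms(1,4) by (auto simp: cpstar_functor_def cpstar_functor_axioms_def CPstar_def)
  show ?thesis
  proof (intro exI [of _ F] conjI allI impI ballI F_functor F_full F_faithful F_monoidal)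
    fix M assume "M \<in> Obj CS"
    then show "on_obj F M = (carrier M, Arrow (carrier M) (act V M \<cdot>\<^bsub>V\<^esub> coact V M \<cdot>\<^bsub>V\<^esub> (dual_map V (nrm M) \<otimes>\<^bsub>V\<^esub> nrm M)) (carrier M))"
      by (simp add: Fobj_eq)
  next
    fix M N f assume "Arrow M f N \<in> Arr CS"
    then show "on_arr F (Arrow M f N) = Arrow (on_obj F M)
        (Arrow (carrier M) (act V N \<cdot>\<^bsub>V\<^esub> nrm N \<cdot>\<^bsub>V\<^esub> f \<cdot>\<^bsub>V\<^esub> nrm M \<cdot>\<^bsub>V\<^esub> coact V M) (carrier N)) (on_obj F N)"
      by (simp only: Farr_eq F_sel)
  qed
qed

end
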